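(* Let $u\in[0,1]$. The time-scaled loop-erased self-repelling walks $X_N$ on the pre-Sierpiński gaskets, $X_N(t)=Y_N(\lambda^N t)$, $t\ge 0$ (defined in the context, all on one probability space), converge uniformly in $t\in[0,\infty)$ almost surely, as $N\to\infty$, to a continuous process $X$.
   Context: Geometry. Let $O=(0,0)$, $a=(\frac12,\frac{\sqrt3}{2})$, $b=(1,0)$, and let $F'_0$ be the graph formed by the three vertices and three sides of the triangle $\triangle Oab$. Put $f_1(x)=\frac12x$, $f_2(x)=\frac12(x+a)$, $f_3(x)=\frac12(x+b)$ and $F'_{N+1}=f_1(F'_N)\cup f_2(F'_N)\cup f_3(F'_N)$. Let $F_N$ be the union of $F'_N$ and its reflection in the $y$-axis, with vertex set $G_N$ and edge set $E_N$; let $F_N^V=F_N\cup(F'_N+b)$, with vertex set $G_N^V$ and edge set $E_N^V$. A $2^{-M}$-triangle is a closed filled (upward) translate of $2^{-M}\triangle Oab$ with vertices in $G_M^V$. Paths. $W_N$ is the set of finite nearest-neighbour paths $w=(w(0),\dots,w(n))$, $n\in\mathbb N$, on $F_N$ with $w(0)=O$, $w(n)=a$ and $w(i)\notin G_0\setminus\{O\}$ for $0\le i\le n-1$; $\ell(w)=n$. For a path $w$ set $T^M_0(w)=0$, $T^M_i(w)=\inf\{j>T^M_{i-1}(w): w(j)\in G_M^V\setminus\{w(T^M_{i-1}(w))\}\}$ for $i=1,\dots,m$, where $m$ is the last index for which this is finite, and let $Q_Mw=(w(T^M_0(w)),\dots,w(T^M_m(w)))$. $V_N$ is the set of finite nearest-neighbour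 paths on $F_N^V$ from $O$, stopped at the first hit of $a$, with $Q_0w=(O,b,a)$. $\Gamma_N$ is the set of $w\in W_N\cup V_N$ (for $N=0$: $\Gamma_0=\{(O,a),(O,b,a)\}$) that visit no vertex twice. Self-repelling measures. For $w\in W_1$ let $N(w)=\#\{1\le i\le \ell(w)-1: \overrightarrow{w(i-1)w(i)}\cdot\overrightarrow{w(i)w(i+1)}<0,\ w(i)\notin G_0\}$ and $M(w)=\#\{1\le i\le\ell(w): w(i)=O\}$. For $u\in[0,1]$ let $\Phi(x,u)=\sum_{w\in W_1}u^{N(w)+M(w)}x^{\ell(w)}$ (with $0^0=1$), let $r_u$ be its radius of convergence in $x$, and let $x_u\in(0,r_u)$ be the unique positive fixed point of $\Phi(\cdot,u)$. Put $P_1^u(w)=u^{N(w)+M(w)}x_u^{\ell(w)-1}$ on $W_1$, a probability measure. For $w\in W_N$, $N\ge2$, let $\tilde w=Q_{N-1}w$ and let $w_i$, $1\le i\le\ell(\tilde w)$, be the segment of $w$ between times $T^{N-1}_{i-1}(w)$ and $T^{N-1}_i(w)$, regarded as an element of $W_1$: it lives on the two $2^{-(N-1)}$-triangles meeting at $\tilde w(i-1)$, which are mapped (each triangle by a similarity) onto the two halves of $F_1$ so that $\tilde w(i-1)\mapsto O$ and $\tilde w(i)\mapsto a$ (the remaining choice of reflection does not affect probabilities). Define $P_N^u(w)=P_{N-1}^u(\tilde w)\prod_{i=1}^{\ell(\tilde w)}P_1^u(w_i)$. For $w\in V_N$, let $w',w''\in W_N$ be the two segments of $w$ from $O$ to the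 first hit of $b$ and from then to $a$, identified with elements of $W_N$ in the same way; put $P'^u_N(w)=P_N^u(w')P_N^u(w'')$, a probability measure on $V_N$. Skeletons. For a path $w$ and $M\ge 0$ define the $2^{-M}$-skeleton $\sigma_M(w)=(\Delta_1,\dots,\Delta_k)$ and exit times $T^{ex,M}_i(w)$: $T_0^{ex,M}=0$; $\Delta_1$ is the unique $2^{-M}$-triangle containing $w(T^M_0)$ and $w(T^M_1)$; given $\Delta_i$ let $J(i)$ be the least $j$, $0\le j<m$, with $T^M_j>T^{ex,M}_{i-1}$ and $w(T^M_{j+1})\notin\Delta_i$ (if none exists, $J(i)=m$ and $k=i$); $T^{ex,M}_i=T^M_{J(i)}$; if $J(i)<m$, $\Delta_{i+1}$ is the unique $2^{-M}$-triangle containing $w(T^M_{J(i)})$ and $w(T^M_{J(i)+1})$. If $T^{ex,M}_{i-1}=T^M_n$, then $\Delta_i$ is of Type 1 if $T^{ex,M}_i=T^M_{n+1}$ and of Type 2 if $T^{ex,M}_i=T^M_{n+2}$. Erasing larger loops first. For $w\in W_N\cup V_N$ set $w^{(0)}=w$. Given $w^{(M)}$, $0\le M<N$, with $Q_Mw^{(M)}\in\Gamma_M$, treat each triangle $\Delta_i$ of $\sigma_M(w^{(M)})$ as follows. Let $z$ be the segment of $w^{(M)}$ between times $T^{ex,M}_{i-1}$ and $T^{ex,M}_i$, let $\tau_0<\tau_1<\dots<\tau_m$ be its successive hitting times of $G^V_{M+1}$ (defined as $T^{M+1}_j$ above), $\bar z(j)=z(\tau_j)$. Let $s_0=\sup\{j:\bar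 z(j)=\bar z(0)\}$, $s_l=\sup\{j:\bar z(j)=\bar z(s_{l-1}+1)\}$, until $\bar z(s_n)=\bar z(m)$ is the exit vertex; replace $z$ by the concatenation of the pieces of $z$ between times $\tau_{s_l}$ and $\tau_{s_l+1}$, $l=0,\dots,n-1$. Concatenating over $i$ gives $w^{(M+1)}\in W_N\cup V_N$ with $Q_{M+1}w^{(M+1)}\in\Gamma_{M+1}$. Put $\hat Q_Mw=Q_Mw^{(M)}\in\Gamma_M$ and $Lw=\hat Q_Nw=w^{(N)}\in\Gamma_N$. The scaling factor. For $\gamma\in\Gamma_1$ let $s_1(\gamma),s_2(\gamma)$ be the numbers of Type 1 and Type 2 triangles in $\sigma_1(\gamma)$; let $\hat\Phi(x,y)=\sum_{\gamma\in\Gamma_1}P_1^u[\{w: Lw=\gamma\}]x^{s_1(\gamma)}y^{s_2(\gamma)}$ and $\hat\Theta(x,y)=\sum_{\gamma\in\Gamma_1}P'^u_1[\{w: Lw=\gamma\}]x^{s_1(\gamma)}y^{s_2(\gamma)}$. $\lambda=\lambda(u)$ is the larger eigenvalue of the mean matrix $\begin{pmatrix}\partial_x\hat\Phi(1,1)&\partial_y\hat\Phi(1,1)\\ \partial_x\hat\Theta(1,1)&\partial_y\hat\Theta(1,1)\end{pmatrix}$. The processes. A finite path $w$ is regarded as a continuous function on $[0,\infty)$ by linear interpolation between integer times and $w(t)=a$ for $t\ge\ell(w)$. Let $P$ be the probability measure (Kolmogorov extension) on a space carrying random paths $Y_0,Y_1,Y_2,\dots$, $Y_N\in\Gamma_N$,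 such that for every $N$ the joint law of $(Y_0,\dots,Y_N)$ is the law of $(\hat Q_0v,\hat Q_1v,\dots,\hat Q_Nv)$ for $v\in W_N$ distributed according to $P_N^u$ (so $Y_0=(O,a)$). Put $X_N(t)=Y_N(\lambda^Nt)$, $t\ge0$. *)

theory Defs
  imports "HOL-Probability.Probability"
begin

section \<open>Pre-Sierpinski gaskets\<close>

text \<open>The plane is the type \<^typ>\<open>complex\<close>, with \<open>O = 0\<close>.\<close>

definition pt_a :: complex where "pt_a = Complex (1/2) (sqrt 3 / 2)"

definition pt_b :: complex where "pt_b = 1"

definition f1 :: "complex \<Rightarrow> complex" where "f1 x = (1/2) *\<^sub>R x"
definition f2 :: "complex \<Rightarrow> complex" where "f2 x = (1/2) *\<^sub>R (x + pt_a)"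
definition f3 :: "complex \<Rightarrow> complex" where "f3 x = (1/2) *\<^sub>R (x + pt_b)"

text \<open>Edges are unordered pairs, represented as two-element sets of vertices.\<close>

primrec half_vertices :: "nat \<Rightarrow> complex set" where
  "half_vertices 0 = {0, pt_a, pt_b}"
| "half_vertices (Suc N) =
     f1 ` half_vertices N \<union> f2 ` half_vertices N \<union> f3 ` half_vertices N"

primrec half_edges :: "nat \<Rightarrow> complex set set" where
  "half_edges 0 = {{0, pt_a}, {pt_a, pt_b}, {0, pt_b}}"
| "half_edges (Suc N) =
     image f1 ` half_edges N \<union> image f2 ` half_edges N \<union> image f3 ` half_edges N"

definition reflect_y :: "complex \<Rightarrow> complex" where "reflect_y z = - cnj z"

definition G :: "nat \<Rightarrow> complex set" where
  "G N = half_vertices N \<union> reflect_y ` half_vertices N"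

definition E :: "nat \<Rightarrow> complex set set" where
  "E N = half_edges N \<union> image reflect_y ` half_edges N"

definition GV :: "nat \<Rightarrow> complex set" where
  "GV N = G N \<union> (\<lambda>z. z + pt_b) ` G N"

definition EV :: "nat \<Rightarrow> complex set set" where
  "EV N = E N \<union> image (\<lambda>z. z + pt_b) ` E N"

text \<open>Membership only asks for the vertices to be in \<^term>\<open>GV M\<close>, so for \<open>M \<ge> 2\<close> some triangles
  lying in holes of the gasket are included. They contain no edge of \<^term>\<open>EV M\<close>, hence an edge
  still lies in exactly one element of \<open>triangles M\<close>.\<close>

definition triangles :: "nat \<Rightarrow> complex set set" where
  "triangles M = {convex hull {p, p + (1/2^M) *\<^sub>R pt_a, p + (1/2^M) *\<^sub>R pt_b} | p.
     {p, p + (1/2^M) *\<^sub>R pt_a, p + (1/2^M) *\<^sub>R pt_b} \<subseteq> GV M}"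


section \<open>Paths\<close>

type_synonym path = "complex list"

text \<open>A path \<open>(w(0), \<dots>, w(n))\<close> is a list of length \<open>n + 1\<close>.\<close>

definition steps :: "path \<Rightarrow> nat" where "steps w = length w - 1"

definition nn_path :: "complex set set \<Rightarrow> path \<Rightarrow> bool" where
  "nn_path H w \<longleftrightarrow> w \<noteq> [] \<and> successively (\<lambda>x y. {x, y} \<in> H) w"

definition W :: "nat \<Rightarrow> path set" where
  "W N = {w. nn_path (E N) w \<and> hd w = 0 \<and> last w = pt_a \<and>
             (\<forall>i < steps w. w ! i \<notin> G 0 - {0})}"

text \<open>The hitting times \<open>T\<^sup>M\<^sub>i(w)\<close>; the infimum of the empty set is \<open>\<infinity>\<close>.\<close>

primrec hit :: "nat \<Rightarrow> path \<Rightarrow> nat \<Rightarrow> enat" where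
  "hit M w 0 = 0"
| "hit M w (Suc i) = Inf {enat j | j. hit M w i < enat j \<and> j < length w \<and>
                            w ! j \<in> GV M - {w ! the_enat (hit M w i)}}"

definition T :: "nat \<Rightarrow> path \<Rightarrow> nat \<Rightarrow> nat" where
  "T M w i = the_enat (hit M w i)"

definition last_hit :: "nat \<Rightarrow> path \<Rightarrow> nat" where
  "last_hit M w = Max {i. hit M w i < \<infinity>}"

definition Q :: "nat \<Rightarrow> path \<Rightarrow> path" where
  "Q M w = map (\<lambda>i. w ! T M w i) [0..<Suc (last_hit M w)]"

definition V :: "nat \<Rightarrow> path set" where
  "V N = {w. nn_path (EV N) w \<and> hd w = 0 \<and> last w = pt_a \<and>
             (\<forall>i < steps w. w ! i \<noteq> pt_a) \<and> Q 0 w = [0, pt_b, pt_a]}"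

definition Gamma :: "nat \<Rightarrow> path set" where
  "Gamma N = (if N = 0 then {[0, pt_a], [0, pt_b, pt_a]}
              else {w \<in> W N \<union> V N. distinct w})"

text \<open>The part of \<open>w\<close> between times \<open>s\<close> and \<open>t\<close>, both endpoints included.\<close>

definition segment :: "path \<Rightarrow> nat \<Rightarrow> nat \<Rightarrow> path" where
  "segment w s t = take (Suc (t - s)) (drop s w)"

text \<open>Concatenation of paths, each starting where the preceding one ends.\<close>

fun path_concat :: "path list \<Rightarrow> path" where
  "path_concat [] = []"
| "path_concat (p # ps) = p @ concat (map tl ps)"


section \<open>Self-repelling measures\<close>

definition num_turns :: "path \<Rightarrow> nat" where
  "num_turns w = card {i. 1 \<le> i \<and> Suc i \<le> steps w \<and>
     inner (w ! i - w ! (i - 1)) (w ! Suc i - w ! i) < 0 \<and> w ! i \<notin> G 0}"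

definition num_returns :: "path \<Rightarrow> nat" where
  "num_returns w = card {i. 1 \<le> i \<and> i \<le> steps w \<and> w ! i = 0}"

definition Phi :: "real \<Rightarrow> real \<Rightarrow> real" where
  "Phi x u = infsum (\<lambda>w. u ^ (num_turns w + num_returns w) * x ^ steps w) (W 1)"

text \<open>Collecting equal powers of \<open>x\<close>, \<^term>\<open>Phi x u\<close> is a power series in \<open>x\<close> with
  the following radius of convergence.\<close>

definition r_rad :: "real \<Rightarrow> ereal" where
  "r_rad u = conv_radius (\<lambda>n. \<Sum>w | w \<in> W 1 \<and> steps w = n. u ^ (num_turns w + num_returns w))"

definition x_fix :: "real \<Rightarrow> real" where
  "x_fix u = (THE x. 0 < x \<and> ereal x < r_rad u \<and> Phi x u = x)"

definition P1 :: "real \<Rightarrow> path \<Rightarrow> real" where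
  "P1 u w = u ^ (num_turns w + num_returns w) * x_fix u ^ (steps w - 1)"

definition similarity :: "(complex \<Rightarrow> complex) \<Rightarrow> bool" where
  "similarity g \<longleftrightarrow> (\<exists>c>0. \<forall>x y. dist (g x) (g y) = c * dist x y)"

text \<open>\<open>is_unit_copy M z v\<close>: the path \<open>z\<close> from \<open>p = hd z\<close> to \<open>q = last z\<close> lives on two
  \<open>2\<^sup>-\<^sup>M\<close>-triangles \<open>\<Delta> \<ni> q\<close> and \<open>\<Delta>'\<close> meeting at \<open>p\<close>, and \<open>v\<close> is its image under a map that
  sends \<open>\<Delta>\<close> onto the right half and \<open>\<Delta>'\<close> onto the left half of the unit figure by
  similarities, with \<open>p \<mapsto> O\<close> and \<open>q \<mapsto> a\<close>. Only \<open>\<Delta>'\<close> leaves a choice, namely of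
  a reflection, and the measures below do not depend on it.\<close>

definition is_unit_copy :: "nat \<Rightarrow> path \<Rightarrow> path \<Rightarrow> bool" where
  "is_unit_copy M z v \<longleftrightarrow> (\<exists>\<Delta> \<Delta>' g g'.
     \<Delta> \<in> triangles M \<and> \<Delta>' \<in> triangles M \<and> \<Delta> \<noteq> \<Delta>' \<and>
     hd z \<in> \<Delta> \<inter> \<Delta>' \<and> last z \<in> \<Delta> \<and> set z \<subseteq> \<Delta> \<union> \<Delta>' \<and>
     similarity g \<and> similarity g' \<and>
     g ` \<Delta> = convex hull {0, pt_a, pt_b} \<and>
     g' ` \<Delta>' = reflect_y ` (convex hull {0, pt_a, pt_b}) \<and>
     g (hd z) = 0 \<and> g' (hd z) = 0 \<and> g (last z) = pt_a \<and>
     v = map (\<lambda>x. if x \<in> \<Delta> then g x else g' x) z)"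

definition unit_copy :: "nat \<Rightarrow> path \<Rightarrow> path" where
  "unit_copy M z = (SOME v. is_unit_copy M z v)"

text \<open>\<open>P\<^sub>N\<^sup>u(w)\<close> for \<open>w \<in> W N\<close>; for \<open>N = 0\<close> the only such path is \<open>(O, a)\<close>.\<close>

fun W_mass :: "real \<Rightarrow> nat \<Rightarrow> path \<Rightarrow> real" where
  "W_mass u 0 w = 1"
| "W_mass u (Suc 0) w = P1 u w"
| "W_mass u (Suc (Suc N)) w =
     W_mass u (Suc N) (Q (Suc N) w) *
     (\<Prod>i = 1..steps (Q (Suc N) w).
        P1 u (unit_copy (Suc N) (segment w (T (Suc N) w (i - 1)) (T (Suc N) w i))))"

definition V_mass :: "real \<Rightarrow> nat \<Rightarrow> path \<Rightarrow> real" where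
  "V_mass u N w =
     (let t = (LEAST j. w ! j = pt_b) in
      W_mass u N (unit_copy 0 (segment w 0 t)) *
      W_mass u N (unit_copy 0 (segment w t (steps w))))"

definition W_law :: "real \<Rightarrow> nat \<Rightarrow> path measure" where
  "W_law u N = point_measure (W N) (\<lambda>w. ennreal (W_mass u N w))"

definition V_law :: "real \<Rightarrow> nat \<Rightarrow> path measure" where
  "V_law u N = point_measure (V N) (\<lambda>w. ennreal (V_mass u N w))"


section \<open>Skeletons\<close>

text \<open>\<open>exit_index M w i\<close> is \<open>J(i)\<close>, with \<open>J(0) = 0\<close>, so that the exit time \<open>T\<^sup>e\<^sup>x\<^sup>,\<^sup>M\<^sub>i(w)\<close> is
  \<^term>\<open>T M w (exit_index M w i)\<close>; it equals the index of the last hit if and only if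
  the skeleton ends at \<open>i\<close>.\<close>

definition triangle_from :: "nat \<Rightarrow> path \<Rightarrow> nat \<Rightarrow> complex set" where
  "triangle_from M w n =
     (THE \<Delta>. \<Delta> \<in> triangles M \<and> w ! T M w n \<in> \<Delta> \<and> w ! T M w (Suc n) \<in> \<Delta>)"

primrec exit_index :: "nat \<Rightarrow> path \<Rightarrow> nat \<Rightarrow> nat" where
  "exit_index M w 0 = 0"
| "exit_index M w (Suc i) =
     (let n = exit_index M w i;
          exits = (\<lambda>j. j < last_hit M w \<and> T M w j > T M w n \<and>
                       w ! T M w (Suc j) \<notin> triangle_from M w n)
      in if \<exists>j. exits j then (LEAST j. exits j) else last_hit M w)"

definition exit_time :: "nat \<Rightarrow> path \<Rightarrow> nat \<Rightarrow> nat" where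
  "exit_time M w i = T M w (exit_index M w i)"

definition skeleton_length :: "nat \<Rightarrow> path \<Rightarrow> nat" where
  "skeleton_length M w = (LEAST i. 1 \<le> i \<and> exit_index M w i = last_hit M w)"

text \<open>The triangles \<open>\<Delta>\<^sub>1, \<dots>, \<Delta>\<^sub>k\<close> of the skeleton.\<close>

definition skeleton :: "nat \<Rightarrow> path \<Rightarrow> complex set list" where
  "skeleton M w =
     map (\<lambda>i. triangle_from M w (exit_index M w (i - 1))) [1..<Suc (skeleton_length M w)]"

text \<open>The number of triangles \<open>\<Delta>\<^sub>i\<close> of Type \<open>r\<close> in the skeleton, \<open>r = 1, 2\<close>.\<close>

definition type_count :: "nat \<Rightarrow> nat \<Rightarrow> path \<Rightarrow> nat" where
  "type_count r M w = card {i. 1 \<le> i \<and> i \<le> length (skeleton M w) \<and>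
     exit_index M w i = exit_index M w (i - 1) + r}"


section \<open>Erasing larger loops first\<close>

definition last_visit :: "path \<Rightarrow> nat \<Rightarrow> nat" where
  "last_visit z j = Max {k. k < length z \<and> z ! k = z ! j}"

primrec erasure_index :: "path \<Rightarrow> nat \<Rightarrow> nat" where
  "erasure_index z 0 = last_visit z 0"
| "erasure_index z (Suc l) = last_visit z (Suc (erasure_index z l))"

text \<open>\<open>erase_segment K z\<close> removes the loops of the \<open>2\<^sup>-\<^sup>K\<close>-coarse-graining of \<open>z\<close> in
  chronological order, keeping the fine structure of the surviving pieces.\<close>

definition erase_segment :: "nat \<Rightarrow> path \<Rightarrow> path" where
  "erase_segment K z =
     (let zb = Q K z; s = erasure_index zb; n = (LEAST l. zb ! s l = last zb)
      in path_concat (map (\<lambda>l. segment z (T K z (s l)) (T K z (Suc (s l)))) [0..<n]))"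

definition erase_step :: "nat \<Rightarrow> path \<Rightarrow> path" where
  "erase_step M w =
     path_concat (map (\<lambda>i. erase_segment (Suc M)
                             (segment w (exit_time M w (i - 1)) (exit_time M w i)))
                      [1..<Suc (length (skeleton M w))])"

primrec erased :: "path \<Rightarrow> nat \<Rightarrow> path" where
  "erased w 0 = w"
| "erased w (Suc M) = erase_step M (erased w M)"

definition Qhat :: "nat \<Rightarrow> path \<Rightarrow> path" where
  "Qhat M w = Q M (erased w M)"

text \<open>The map \<open>L\<close> on \<open>W N \<union> V N\<close>.\<close>

definition loop_erase :: "nat \<Rightarrow> path \<Rightarrow> path" where
  "loop_erase N w = Qhat N w"


section \<open>The scaling factor\<close>

definition Phihat :: "real \<Rightarrow> real \<Rightarrow> real \<Rightarrow> real" where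
  "Phihat u x y = (\<Sum>\<gamma>\<in>Gamma 1.
     measure (W_law u 1) {w \<in> W 1. loop_erase 1 w = \<gamma>} *
     x ^ type_count 1 1 \<gamma> * y ^ type_count 2 1 \<gamma>)"

definition Thetahat :: "real \<Rightarrow> real \<Rightarrow> real \<Rightarrow> real" where
  "Thetahat u x y = (\<Sum>\<gamma>\<in>Gamma 1.
     measure (V_law u 1) {w \<in> V 1. loop_erase 1 w = \<gamma>} *
     x ^ type_count 1 1 \<gamma> * y ^ type_count 2 1 \<gamma>)"

definition mean_matrix :: "real \<Rightarrow> real^2^2" where
  "mean_matrix u = vector
     [vector [deriv (\<lambda>x. Phihat u x 1) 1,   deriv (\<lambda>y. Phihat u 1 y) 1],
      vector [deriv (\<lambda>x. Thetahat u x 1) 1, deriv (\<lambda>y. Thetahat u 1 y) 1]]"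

definition lam :: "real \<Rightarrow> real" where
  "lam u = Max {\<mu>. \<exists>v. v \<noteq> 0 \<and> mean_matrix u *v v = \<mu> *\<^sub>R v}"


section \<open>The processes\<close>

text \<open>A finite path as a function on \<open>[0, \<infinity>)\<close>.\<close>

definition interpolate :: "path \<Rightarrow> real \<Rightarrow> complex" where
  "interpolate w t =
     (if t < real (steps w)
      then (let i = nat \<lfloor>t\<rfloor> in w ! i + (t - real i) *\<^sub>R (w ! Suc i - w ! i))
      else pt_a)"

definition loop_erased_walks :: "real \<Rightarrow> 'w measure \<Rightarrow> (nat \<Rightarrow> 'w \<Rightarrow> path) \<Rightarrow> bool" where
  "loop_erased_walks u Pr Y \<longleftrightarrow>
     prob_space Pr \<and>
     (\<forall>N. Y N \<in> Pr \<rightarrow>\<^sub>M count_space (Gamma N)) \<and>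
     (\<forall>N. distr Pr (\<Pi>\<^sub>M k\<in>{..N}. count_space UNIV) (\<lambda>\<omega>. \<lambda>k\<in>{..N}. Y k \<omega>)
        = distr (W_law u N) (\<Pi>\<^sub>M k\<in>{..N}. count_space UNIV) (\<lambda>v. \<lambda>k\<in>{..N}. Qhat k v))"

definition scaled_walk :: "real \<Rightarrow> (nat \<Rightarrow> 'w \<Rightarrow> path) \<Rightarrow> nat \<Rightarrow> real \<Rightarrow> 'w \<Rightarrow> complex" where
  "scaled_walk u Y N t \<omega> = interpolate (Y N \<omega>) (lam u ^ N * t)"

definition continuous_process :: "'w measure \<Rightarrow> (real \<Rightarrow> 'w \<Rightarrow> complex) \<Rightarrow> bool" where
  "continuous_process Pr X \<longleftrightarrow>
     (\<forall>t\<ge>0. X t \<in> borel_measurable Pr) \<and>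
     (\<forall>\<omega>\<in>space Pr. continuous_on {0..} (\<lambda>t. X t \<omega>))"

end

theory Submission
  imports Defs
begin

text \<open>
  A path obtained by erasing loops down to scale \<open>2\<^sup>-\<^sup>N\<close> is encoded by its skeleton, a list of labelled cells. Erasing
  the loops of the next scale replaces each cell by two or three cells of half the size, independently for
  different cells and with a law depending on the type of the cell only. The cells inside a fixed triangle thus form a
  two-type branching process whose mean matrix has largest eigenvalue \<open>lam u \<ge> 2\<close>. By a second moment
  bound the rescaled numbers of steps spent in a triangle converge almost surely, and a Laplace transform estimate shows
  that the limit is positive unless the skeleton misses the triangle. Hence for large \<open>N\<close> all rescaled paths are, at any given time, in
  the same or in neighbouring \<open>2\<^sup>-\<^sup>M\<close>-triangles of a common skeleton, so that they form a
  uniform Cauchy sequence.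
\<close>


text \<open>The obstacle is independence: which pieces of the random path survive down to mesh 2^-N
  depends on the path itself. It is overcome by writing every erasure as a selection of step indices
  of the coarse path. The selection is a function of the coarse path alone, while the fine path
  consists of independent local walks along the coarse steps, and samples taken at given distinct
  indices are again independent.

  Each cell has at least two subcells. This gives both \<open>lam u\<close> \<ge> 2, so that
  rescaled fluctuations are summable, and positivity of the limit, because one application of the
  offspring generating functional squares an upper bound q < 1. The number \<open>x_fix\<close>
  enters only through the total mass one of the path measures, which is read off from the given law
  of the walks.

  In the limit the times at which the triangles of a fixed skeleton are left are strictly ordered.
  Convergence of these finitely many times therefore controls the position of all finer walks at
  every time simultaneously, which turns pointwise limits into uniform ones.\<close>

section \<open>Integer coordinates for the vertices and edges of the gaskets\<close>

datatype corner = C0 | C1 | C2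

lemma all_corner: "(\<forall>i. P i) \<longleftrightarrow> P C0 \<and> P C1 \<and> P C2" by (metis corner.exhaust)

lemma ex_corner: "(\<exists>i. P i) \<longleftrightarrow> P C0 \<or> P C1 \<or> P C2" by (metis corner.exhaust)

fun delta :: "corner => int \<times> int" where
  "delta C0 = (0, 0)" | "delta C1 = (1, 0)" | "delta C2 = (0, 1)"

text \<open>The lattice of mesh 2^-N in the basis \<open>pt_a\<close>, \<open>pt_b\<close>. With
  integer pairs for vertices, subdivision becomes a matter of parities, and distances are given by
  an integral quadratic form.\<close>

definition pt :: "nat => int \<times> int => complex" where
  "pt N v = (1 / 2 ^ N) *\<^sub>R (real_of_int (fst v) *\<^sub>R pt_a + real_of_int (snd v) *\<^sub>R pt_b)"

lemma Re_pt: "Re (pt N v) = (real_of_int (fst v) / 2 + real_of_int (snd v)) / 2 ^ N"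
  and Im_pt: "Im (pt N v) = real_of_int (fst v) * (sqrt 3 / 2) / 2 ^ N" by (auto simp: pt_def pt_a_def pt_b_def field_simps)

lemma pt_inj [simp]: "pt N v = pt N w \<longleftrightarrow> v = w"
proof
  assume *: "pt N v = pt N w"
  have "fst v = fst w" using arg_cong[OF *, of Im] by (simp add: Im_pt)
  moreover have "snd v = snd w" using arg_cong[OF *, of Re] \<open>fst v = fst w\<close> by (simp add: Re_pt)
  ultimately show "v = w" by (simp add: prod_eq_iff)
qed simp

lemma pt_zero: "pt N 0 = 0" by (simp add: pt_def)

lemma pt_add_double: "pt (Suc N) (v + v) = pt N v" by (cases v) (simp add: complex_eq_iff Re_pt Im_pt field_simps)

lemma pt_eq_scale: "pt (N + k) (2 ^ k * m, 2 ^ k * n) = pt N (m, n)" by (simp add: complex_eq_iff Re_pt Im_pt field_simps power_add)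

lemma f1_pt: "f1 (pt N v) = pt (Suc N) v"
  and f2_pt: "f2 (pt N v) = pt (Suc N) (v + (2 ^ N, 0))"
  and f3_pt: "f3 (pt N v) = pt (Suc N) (v + (0, 2 ^ N))" by (simp_all add: complex_eq_iff f1_def f2_def f3_def Re_pt Im_pt field_simps)
     (simp_all add: pt_a_def pt_b_def field_simps)

lemma reflect_pt: "reflect_y (pt N v) = pt N (fst v, - fst v - snd v)" by (simp add: complex_eq_iff reflect_y_def Re_pt Im_pt field_simps)

lemma shift_pt: "pt N v + pt_b = pt N (v + (0, 2 ^ N))" by (simp add: complex_eq_iff Re_pt Im_pt field_simps) (simp add: pt_b_def)

text \<open>For the base of a cell this is the base of the cell of double size that contains it.
  Rounding towards minus infinity makes it correct also on the negative coordinates of the reflected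
  half.\<close>

definition half :: "int \<times> int => int \<times> int" where "half c = (fst c div 2, snd c div 2)"

text \<open>A set of base points of upward triangles \<open>c, c + (1,0), c + (0,1)\<close>, in coordinates of
  mesh \<open>2\<^sup>-\<^sup>N\<close>: each triangle is subdivided into the three triangles at its corners, which are those
  of the four subtriangles having no doubly odd base.\<close>

primrec cells :: "(int \<times> int) set => nat => (int \<times> int) set" where
  "cells S 0 = S"
| "cells S (Suc N) = {c. half c \<in> cells S N \<and> \<not> (odd (fst c) \<and> odd (snd c))}"

lemma cells_Suc_inner: "cells S (Suc N) = cells (cells S (Suc 0)) N" by (induction N) auto

lemma cells_Un: "cells (S \<union> S') N = cells S N \<union> cells S' N" by (induction N) auto

lemma cells_one: "cells S (Suc 0) = {c + c + delta i | c i. c \<in> S}"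
proof (intro equalityI subsetI)
  fix x assume x: "x \<in> cells S (Suc 0)"
  obtain m n where [simp]: "x = (m, n)" by (cases x)
  have "x = half x + half x + delta (if odd m then C1 else if odd n then C2 else C0)" using x by (auto simp: half_def)
  then show "x \<in> {c + c + delta i | c i. c \<in> S}" using x unfolding cells.simps by blast
next
  fix x assume "x \<in> {c + c + delta i | c i. c \<in> S}"
  then obtain c i where "x = c + c + delta i" "c \<in> S" by auto
  then show "x \<in> cells S (Suc 0)" by (cases i; cases c) (auto simp: half_def)
qed

lemma cells_Suc: "cells S (Suc N) = {c + c + delta i | c i. c \<in> cells S N}" using cells_one[of "cells S N"] by simp

text \<open>Covers translations and the reflection at once: \<open>r\<close> is the induced
  involution of the corners, and \<open>d\<close> corrects for a shift that is counted twice when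
  bases are doubled.\<close>

lemma image_sub_cells:
  assumes "!!c i. g (c + c + delta i) = g c + g c + d + delta (r i)" and "!!i. r (r i) = i"
  shows "{g c + g c + d + delta i | c i. c \<in> A} = g ` {c + c + delta i | c i. c \<in> A}"
proof (intro equalityI subsetI)
  fix x assume "x \<in> {g c + g c + d + delta i | c i. c \<in> A}"
  then obtain c i where "c \<in> A" "x = g c + g c + d + delta i" by blast
  then have "x = g (c + c + delta (r i))" by (simp add: assms)
  then show "x \<in> g ` {c + c + delta i | c i. c \<in> A}" using \<open>c \<in> A\<close> by blast
next
  fix x assume "x \<in> g ` {c + c + delta i | c i. c \<in> A}"
  then show "x \<in> {g c + g c + d + delta i | c i. c \<in> A}" using assms(1) by blast
qed

lemma cells_shift: "cells ((%c. c + d) ` S) N = (%c. c + (2 ^ N * fst d, 2 ^ N * snd d)) ` cells S N"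
proof (induction N)
  case (Suc N)
  let ?D = "(2 ^ N * fst d, 2 ^ N * snd d)"
  have "cells ((%c. c + d) ` S) (Suc N) = {c + ?D + (c + ?D) + delta i | c i. c \<in> cells S N}" unfolding cells_Suc Suc by blast
  also have "... = {c + (?D + ?D) + (c + (?D + ?D)) + (- ?D - ?D) + delta i | c i. c \<in> cells S N}" by (simp add: algebra_simps)
  also have "... = (%c. c + (?D + ?D)) ` {c + c + delta i | c i. c \<in> cells S N}" by (rule image_sub_cells[where r = id]) (simp_all add: algebra_simps)
  also have "?D + ?D = (2 ^ Suc N * fst d, 2 ^ Suc N * snd d)" by simp
  finally show ?case unfolding cells_Suc .
qed auto

text \<open>The reflection sends (m, n) to (m, - m - n) and exchanges the left and right corners of
  a triangle. The new base is thus the image of the corner \<open>C2\<close>, whence the -1.\<close>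

definition reflect_cell :: "int \<times> int => int \<times> int" where
  "reflect_cell c = (fst c, - fst c - snd c - 1)"

lemma reflect_cell_corner:
  "(fst (c + delta i), - fst (c + delta i) - snd (c + delta i)) =
   reflect_cell c + delta (case i of C0 => C2 | C1 => C1 | C2 => C0)" by (cases i; cases c) (auto simp: reflect_cell_def)

lemma reflect_cell_sub:
  "reflect_cell (c + c + delta i) =
   reflect_cell c + reflect_cell c + delta (case i of C0 => C2 | C1 => C1 | C2 => C0)" by (cases i; cases c) (auto simp: reflect_cell_def)

lemma cells_reflect: "cells (reflect_cell ` S) N = reflect_cell ` cells S N"
proof (induction N)
  case (Suc N)
  have "cells (reflect_cell ` S) (Suc N) = {reflect_cell c + reflect_cell c + 0 + delta i | c i. c \<in> cells S N}" unfolding cells_Suc Suc add_0_right by blast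
  also have "... = reflect_cell ` {c + c + delta i | c i. c \<in> cells S N}" by (rule image_sub_cells[where r = "%i. case i of C0 => C2 | C1 => C1 | C2 => C0"])
       (simp_all only: reflect_cell_sub add_0_right, simp split: corner.split)
  finally show ?case unfolding cells_Suc .
qed auto

definition vertices_of :: "nat => (int \<times> int) set => complex set" where
  "vertices_of N A = {pt N (c + delta i) | c i. c \<in> A}"

definition edges_of :: "nat => (int \<times> int) set => complex set set" where
  "edges_of N A = {{pt N (c + delta i), pt N (c + delta j)} | c i j. c \<in> A \<and> i ~= j}"

lemma vertices_of_Un: "vertices_of N (A \<union> B) = vertices_of N A \<union> vertices_of N B" unfolding vertices_of_def by blast

lemma edges_of_Un: "edges_of N (A \<union> B) = edges_of N A \<union> edges_of N B" unfolding edges_of_def by blast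

abbreviation cell_vertices :: "(int \<times> int) set => nat => complex set" where
  "cell_vertices S N \<equiv> vertices_of N (cells S N)"

abbreviation cell_edges :: "(int \<times> int) set => nat => complex set set" where
  "cell_edges S N \<equiv> edges_of N (cells S N)"

lemma image_vertices_of:
  assumes "!!c i. c \<in> A ==> f (pt N (c + delta i)) = pt M (g c + delta (r i))" and "!!i. r (r i) = i"
  shows "f ` vertices_of N A = vertices_of M (g ` A)"
proof (intro equalityI subsetI)
  fix x assume "x \<in> f ` vertices_of N A"
  then show "x \<in> vertices_of M (g ` A)" unfolding vertices_of_def using assms(1) by blast
next
  fix x assume "x \<in> vertices_of M (g ` A)"
  then obtain c i where c: "c \<in> A" "x = pt M (g c + delta i)" unfolding vertices_of_def by auto
  then have "x = f (pt N (c + delta (r i)))" by (simp add: assms)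
  then show "x \<in> f ` vertices_of N A" using c(1) unfolding vertices_of_def by blast
qed

lemma image_edges_of:
  assumes "!!c i. c \<in> A ==> f (pt N (c + delta i)) = pt M (g c + delta (r i))" and r: "!!i. r (r i) = i"
  shows "image f ` edges_of N A = edges_of M (g ` A)"
proof (intro equalityI subsetI)
  fix e assume "e \<in> image f ` edges_of N A"
  then obtain c i j where c: "c \<in> A" "i ~= j" "e = {pt M (g c + delta (r i)), pt M (g c + delta (r j))}" unfolding edges_of_def using assms(1) by auto
  moreover have "r i ~= r j" using c r by metis
  ultimately show "e \<in> edges_of M (g ` A)" unfolding edges_of_def by blast
next
  fix e assume "e \<in> edges_of M (g ` A)"
  then obtain c i j where c: "c \<in> A" "i ~= j" "e = {pt M (g c + delta i), pt M (g c + delta j)}" unfolding edges_of_def by auto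
  then have "e = f ` {pt N (c + delta (r i)), pt N (c + delta (r j))}" by (simp add: assms)
  moreover have "r i ~= r j" using c r by metis
  ultimately show "e \<in> image f ` edges_of N A" using c unfolding edges_of_def by blast
qed

text \<open>Unit triangles generating the half gasket, the gasket with vertices \<open>G\<close> and
  the extended gasket with vertices \<open>GV\<close>. Three suffice for the last one because the
  left half shifted by \<open>pt_b\<close> is the right half.\<close>

abbreviation right_cell :: "(int \<times> int) set" where "right_cell \<equiv> {(0, 0)}"
abbreviation two_cells :: "(int \<times> int) set" where "two_cells \<equiv> {(0, 0), (0, -1)}"
abbreviation three_cells :: "(int \<times> int) set" where "three_cells \<equiv> {(0, 0), (0, -1), (0, 1)}"

text \<open>The gaskets are built by applying the contractions last, whereas \<open>cells\<close>
  subdivides at the smallest scale. Moving the first subdivision to the front reconciles the two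
  recursions.\<close>

lemma cells_right_Suc:
  "cells right_cell (Suc N) = cells right_cell N \<union> (%c. c + (2 ^ N, 0)) ` cells right_cell N
     \<union> (%c. c + (0, 2 ^ N)) ` cells right_cell N"
proof -
  have e: "cells right_cell (Suc 0) = right_cell \<union> ((%c. c + (1, 0)) ` right_cell \<union> (%c. c + (0, 1)) ` right_cell)" unfolding cells_one by (auto simp: ex_corner)
  show ?thesis unfolding cells_Suc_inner[of right_cell N] e cells_Un cells_shift by auto
qed

lemma f1_corner: "f1 (pt N (c + delta i)) = pt (Suc N) (c + delta (id i))"
  and f2_corner: "f2 (pt N (c + delta i)) = pt (Suc N) (c + (2 ^ N, 0) + delta (id i))"
  and f3_corner: "f3 (pt N (c + delta i)) = pt (Suc N) (c + (0, 2 ^ N) + delta (id i))"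
  and shift_corner: "pt N (c + delta i) + pt_b = pt N (c + (0, 2 ^ N) + delta (id i))" unfolding f1_pt f2_pt f3_pt shift_pt by (simp_all only: id_apply ac_simps)

lemma half_vertices_eq: "half_vertices N = cell_vertices right_cell N"
proof (induction N)
  case 0
  have "pt 0 (0,0) = 0" "pt 0 (1,0) = pt_a" "pt 0 (0,1) = pt_b" by (auto simp: pt_def)
  then show ?case by (auto simp: vertices_of_def ex_corner)
next
  case (Suc N)
  show ?case unfolding half_vertices.simps Suc cells_right_Suc vertices_of_Un
      image_vertices_of[of _ f1 N "Suc N" "%c. c" id, OF f1_corner, simplified]
      image_vertices_of[of _ f2 N "Suc N" "%c. c + (2 ^ N, 0)" id, OF f2_corner, simplified]
      image_vertices_of[of _ f3 N "Suc N" "%c. c + (0, 2 ^ N)" id, OF f3_corner, simplified] ..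
qed

lemma edges_of_single:
  "edges_of N {c} = {{pt N (c + delta C0), pt N (c + delta C1)}, {pt N (c + delta C1), pt N (c + delta C2)},
     {pt N (c + delta C0), pt N (c + delta C2)}}"
proof (intro equalityI subsetI)
  fix e assume "e \<in> edges_of N {c}"
  then obtain i j where ij: "i ~= j" and e: "e = {pt N (c + delta i), pt N (c + delta j)}" by (auto simp: edges_of_def)
  show "e \<in> {{pt N (c + delta C0), pt N (c + delta C1)}, {pt N (c + delta C1), pt N (c + delta C2)},
     {pt N (c + delta C0), pt N (c + delta C2)}}" unfolding e using ij by (cases i; cases j) (simp_all only: insert_iff insert_commute simp_thms)
next
  have *: "{pt N (c + delta i), pt N (c + delta j)} \<in> edges_of N {c}" if "i ~= j" for i j using that unfolding edges_of_def by blast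
  fix e assume "e \<in> {{pt N (c + delta C0), pt N (c + delta C1)}, {pt N (c + delta C1), pt N (c + delta C2)},
     {pt N (c + delta C0), pt N (c + delta C2)}}"
  then show "e \<in> edges_of N {c}" by (elim insertE emptyE; hypsubst) (rule *; simp)+
qed

lemma half_edges_eq: "half_edges N = cell_edges right_cell N"
proof (induction N)
  case 0
  have "pt 0 (0,0) = 0" "pt 0 (1,0) = pt_a" "pt 0 (0,1) = pt_b" by (auto simp: pt_def)
  then show ?case by (simp add: edges_of_single)
next
  case (Suc N)
  show ?case unfolding half_edges.simps Suc cells_right_Suc edges_of_Un
      image_edges_of[of _ f1 N "Suc N" "%c. c" id, OF f1_corner, simplified]
      image_edges_of[of _ f2 N "Suc N" "%c. c + (2 ^ N, 0)" id, OF f2_corner, simplified]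
      image_edges_of[of _ f3 N "Suc N" "%c. c + (0, 2 ^ N)" id, OF f3_corner, simplified] ..
qed

lemma reflect_corner:
  "reflect_y (pt N (c + delta i)) = pt N (reflect_cell c + delta (case i of C0 => C2 | C1 => C1 | C2 => C0))" by (simp only: reflect_pt reflect_cell_corner)

lemma reflect_corner_invol:
  "(case (case i of C0 => C2 | C1 => C1 | C2 => C0) of C0 => C2 | C1 => C1 | C2 => C0) = i" by (cases i) auto

lemma reflect_vertices: "reflect_y ` cell_vertices S N = cell_vertices (reflect_cell ` S) N" unfolding cells_reflect by (rule image_vertices_of[where r = "%i. case i of C0 => C2 | C1 => C1 | C2 => C0"])
     (rule reflect_corner reflect_corner_invol)+

lemma reflect_edges: "image reflect_y ` cell_edges S N = cell_edges (reflect_cell ` S) N" unfolding cells_reflect by (rule image_edges_of[where r = "%i. case i of C0 => C2 | C1 => C1 | C2 => C0"])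
     (rule reflect_corner reflect_corner_invol)+

lemma shift_vertices: "(%z. z + pt_b) ` cell_vertices S N = cell_vertices ((%c. c + (0, 1)) ` S) N" unfolding cells_shift using image_vertices_of[of _ "%z. z + pt_b" N N "%c. c + (0, 2 ^ N)" id, OF shift_corner] by simp

lemma shift_edges: "image (%z. z + pt_b) ` cell_edges S N = cell_edges ((%c. c + (0, 1)) ` S) N" unfolding cells_shift using image_edges_of[of _ "%z. z + pt_b" N N "%c. c + (0, 2 ^ N)" id, OF shift_corner] by simp

lemma G_eq: "G N = cell_vertices two_cells N"
proof -
  have e: "two_cells = right_cell \<union> reflect_cell ` right_cell" by (auto simp: reflect_cell_def)
  show ?thesis unfolding e cells_Un vertices_of_Un G_def half_vertices_eq reflect_vertices ..
qed

lemma E_eq: "E N = cell_edges two_cells N"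
proof -
  have e: "two_cells = right_cell \<union> reflect_cell ` right_cell" by (auto simp: reflect_cell_def)
  show ?thesis unfolding e cells_Un edges_of_Un E_def half_edges_eq reflect_edges ..
qed

lemma GV_eq: "GV N = cell_vertices three_cells N"
proof -
  have e: "three_cells = two_cells \<union> (%c. c + (0, 1)) ` two_cells" by auto
  show ?thesis unfolding e cells_Un vertices_of_Un GV_def G_eq shift_vertices ..
qed

lemma EV_eq: "EV N = cell_edges three_cells N"
proof -
  have e: "three_cells = two_cells \<union> (%c. c + (0, 1)) ` two_cells" by auto
  show ?thesis unfolding e cells_Un edges_of_Un EV_def E_eq shift_edges ..
qed


section \<open>Cells meeting at a vertex\<close>

definition incident :: "(int \<times> int) set => nat => int \<times> int => corner set" where
  "incident S N y = {i. y - delta i \<in> cells S N}"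

text \<open>The midpoint, in coordinates of the next mesh, of the side opposite to corner
  \<open>k\<close>: the three corner offsets add up to (1, 1), so leaving out that of
  \<open>k\<close> gives the sum of the other two.\<close>

definition midpoint_of :: "int \<times> int => corner => int \<times> int" where
  "midpoint_of c k = c + c + (1, 1) - delta k"

lemma incident_double: "incident S (Suc N) (y + y) = incident S N y"
proof -
  have "half (y + y - delta i) = y - delta i \<and> \<not> (odd (fst (y + y - delta i)) \<and> odd (snd (y + y - delta i)))" for i by (cases i; cases y) (auto simp: half_def)
  then show ?thesis unfolding incident_def cells.simps by simp
qed

lemma midpoint_of_add:
  assumes "i ~= k" "i ~= l" "k ~= l"
  shows "midpoint_of c k = c + c + delta i + delta l"
proof -
  have "(1, 1) = delta i + delta l + delta k" using assms by (cases i; cases k; cases l) simp_all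
  then show ?thesis unfolding midpoint_of_def by (metis add.assoc add_diff_cancel_right')
qed

lemma third_corner: "\<exists>l :: corner. i ~= l \<and> k ~= l" by (cases i; cases k) (auto simp: ex_corner)

lemma half_sub_cell: "half (c + c + delta l) = c \<and> \<not> (odd (fst (c + c + delta l)) \<and> odd (snd (c + c + delta l)))" by (cases l; cases c) (auto simp: half_def)

text \<open>A new vertex on a side of a cell belongs to the two subcells at the ends of that side.
  The third upward triangle touching it has a doubly odd base and is therefore no cell.\<close>

lemma incident_midpoint: "incident S (Suc N) (midpoint_of c k) = (if c \<in> cells S N then - {k} else {})"
proof -
  have 1: "half (midpoint_of c k - delta i) = c \<and> \<not> (odd (fst (midpoint_of c k - delta i)) \<and> odd (snd (midpoint_of c k - delta i)))"
    if "i ~= k" for i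
  proof -
    obtain l where "i ~= l" "k ~= l" using third_corner by metis
    then have "midpoint_of c k - delta i = c + c + delta l" by (simp add: midpoint_of_add[OF that])
    then show ?thesis using half_sub_cell by simp
  qed
  obtain m n where mn: "c = (m, n)" by (cases c)
  have "midpoint_of c k - delta k = (1 + 2 * (m - fst (delta k)), 1 + 2 * (n - snd (delta k)))" unfolding midpoint_of_def mn by (simp add: prod_eq_iff)
  then have "odd (fst (midpoint_of c k - delta k)) \<and> odd (snd (midpoint_of c k - delta k))" by simp
  then have 2: "midpoint_of c k - delta k \<notin> cells S (Suc N)" by simp
  have "midpoint_of c k - delta i \<in> cells S (Suc N) \<longleftrightarrow> i ~= k \<and> c \<in> cells S N" for i using 1[of i] 2 by (cases "i = k") simp_all
  then show ?thesis unfolding incident_def by auto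
qed

lemma double_or_midpoint: obtains x where "y = x + x" | c k where "y = midpoint_of c k"
proof (cases "even (fst y)")
  case True
  show ?thesis
  proof (cases "even (snd y)")
    case True
    with \<open>even (fst y)\<close> have "y = (fst y div 2, snd y div 2) + (fst y div 2, snd y div 2)" by (simp add: prod_eq_iff)
    then show ?thesis using that by blast
  next
    case False
    with \<open>even (fst y)\<close> have "y = midpoint_of (fst y div 2, snd y div 2) C1" by (simp add: prod_eq_iff midpoint_of_def)
    then show ?thesis using that by blast
  qed
next
  case False
  then have "y = midpoint_of (fst y div 2, snd y div 2) (if even (snd y) then C2 else C0)" by (simp add: prod_eq_iff midpoint_of_def)
  then show ?thesis using that by blast
qed

lemma midpoint_of_inj: "midpoint_of c k = midpoint_of c' k' \<longleftrightarrow> c = c' \<and> k = k'"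
proof
  assume *: "midpoint_of c k = midpoint_of c' k'"
  obtain a b a' b' where [simp]: "c = (a, b)" "c' = (a', b')" by (cases c; cases c') auto
  show "c = c' \<and> k = k'" using * by (cases k; cases k'; simp add: midpoint_of_def; presburger)
qed simp

lemma midpoint_of_not_double: "midpoint_of c k ~= x + x"
proof
  assume *: "midpoint_of c k = x + x"
  obtain a b a' b' where [simp]: "c = (a, b)" "x = (a', b')" by (cases c; cases x) auto
  show False using * by (cases k; simp add: midpoint_of_def; presburger)
qed

lemma double_inj: "x + x = y + y \<longleftrightarrow> x = (y :: int \<times> int)" by (cases x; cases y) auto

text \<open>Exactly two cells meet at the point, as they do at \<open>O\<close> in the figure
  underlying \<open>W 1\<close>.\<close>

definition regular :: "nat => int \<times> int => bool" where
  "regular N y \<longleftrightarrow> (\<exists>i k. i ~= k \<and> incident three_cells N y = {i, k})"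

lemma compl_corner: "- {C0} = {C1, C2}" "- {C1} = {C0, C2}" "- {C2} = {C0, C1}" using corner.exhaust by auto

text \<open>Refinement does not change which corners a vertex occupies in the cells around it. Every
  vertex therefore looks as it did when it was created, as the midpoint of a side or as a vertex of
  level 0.\<close>

lemma incident_cases:
  assumes "incident S N y ~= {}"
  obtains k where "incident S N y = - {k}"
  | y0 where "y = (2 ^ N * fst y0, 2 ^ N * snd y0)" "incident S N y = incident S 0 y0" using assms
proof (induction N arbitrary: y thesis)
  case 0
  show ?case using "0.prems"(2)[of y] by simp
next
  case (Suc N)
  show ?case
  proof (cases y rule: double_or_midpoint)
    case (1 x)
    show ?thesis
    proof (rule Suc.IH[of x])
      fix k assume "incident S N x = - {k}"
      then show thesis using Suc.prems(1) 1 by (simp add: incident_double)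
    next
      fix y0 assume y0: "x = (2 ^ N * fst y0, 2 ^ N * snd y0)" "incident S N x = incident S 0 y0"
      have "y = (2 ^ Suc N * fst y0, 2 ^ Suc N * snd y0)" unfolding 1 y0(1) by simp
      moreover have "incident S (Suc N) y = incident S 0 y0" using y0(2) by (simp only: 1 incident_double)
      ultimately show thesis using Suc.prems(2) by blast
    qed (use Suc.prems(3) 1 in \<open>simp add: incident_double\<close>)
  next
    case (2 c k)
    then show ?thesis using Suc.prems(1)[of k] Suc.prems(3) by (simp add: incident_midpoint split: if_splits)
  qed
qed

text \<open>The unit cells lie in one row, so a vertex of level 0 cannot be the lower left corner of
  one and the top of another. Later vertices belong to two cells only.\<close>

lemma incident_three_not_all: "incident three_cells N y ~= UNIV"
proof
  assume *: "incident three_cells N y = UNIV"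
  show False
  proof (rule incident_cases[of three_cells N y])
    show "incident three_cells N y ~= {}" using * by simp
    fix k assume "incident three_cells N y = - {k}"
    then show False using * by blast
  next
    fix y0 assume "incident three_cells N y = incident three_cells 0 y0"
    then have "i \<in> incident three_cells 0 y0" for i using * by simp
    then have "y0 - delta C0 \<in> cells three_cells 0" "y0 - delta C1 \<in> cells three_cells 0" unfolding incident_def by blast+
    moreover have "c \<in> cells three_cells 0 ==> fst c = 0" for c by auto
    ultimately have "fst (y0 - delta C0) = 0" "fst (y0 - delta C1) = 0" by blast+
    then show False by simp
  qed
qed

lemma cells_mono: "S \<subseteq> S' ==> cells S N \<subseteq> cells S' N" by (induction N) auto

lemma incident_mono: "S \<subseteq> S' ==> incident S N y \<subseteq> incident S' N y" using cells_mono unfolding incident_def by blast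

lemma pt_scale: "pt N (2 ^ N * fst y, 2 ^ N * snd y) = pt 0 y" using pt_eq_scale[of 0 N "fst y" "snd y"] by simp

lemma pt_vertices_of: "pt N y \<in> cell_vertices S N \<longleftrightarrow> incident S N y ~= {}"
proof
  assume "pt N y \<in> cell_vertices S N"
  then obtain c i where "c \<in> cells S N" "y = c + delta i" unfolding vertices_of_def by auto
  then have "i \<in> incident S N y" by (simp add: incident_def)
  then show "incident S N y ~= {}" by auto
next
  assume "incident S N y ~= {}"
  then obtain i where "y - delta i \<in> cells S N" by (auto simp: incident_def)
  then show "pt N y \<in> cell_vertices S N" unfolding vertices_of_def by (intro CollectI exI[of _ "y - delta i"] exI[of _ i]) simp
qed

lemma vertices_of_pt: "x \<in> vertices_of N A ==> \<exists>y. x = pt N y" unfolding vertices_of_def by blast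

lemma GV_pt: "pt N y \<in> GV N \<longleftrightarrow> incident three_cells N y ~= {}" unfolding GV_eq pt_vertices_of ..

lemma GV_midpoint: "pt (Suc N) (midpoint_of c k) \<notin> GV N"
proof
  assume "pt (Suc N) (midpoint_of c k) \<in> GV N"
  then obtain y where "pt (Suc N) (midpoint_of c k) = pt (Suc N) (y + y)" unfolding GV_eq using vertices_of_pt pt_add_double by metis
  then show False by (simp add: midpoint_of_not_double)
qed

lemma GV_Suc: "GV N \<subseteq> GV (Suc N)"
proof
  fix x assume x: "x \<in> GV N"
  then obtain y where y: "x = pt N y" unfolding GV_eq using vertices_of_pt by blast
  have "incident three_cells N y ~= {}" using x unfolding y GV_pt .
  then have "pt (Suc N) (y + y) \<in> GV (Suc N)" unfolding GV_pt incident_double .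
  then show "x \<in> GV (Suc N)" unfolding y pt_add_double .
qed

lemma GV_mono: "M \<le> N ==> GV M \<subseteq> GV N" using GV_Suc by (rule lift_Suc_mono_le)

lemma edge_pt:
  assumes "{pt N y, z} \<in> cell_edges S N"
  obtains i j where "i \<in> incident S N y" "i ~= j" "z = pt N (y - delta i + delta j)"
proof -
  obtain c i j where c: "c \<in> cells S N" "i ~= j" "{pt N y, z} = {pt N (c + delta i), pt N (c + delta j)}" using assms unfolding edges_of_def by blast
  from c(3) consider "y = c + delta i" "z = pt N (c + delta j)" | "y = c + delta j" "z = pt N (c + delta i)" unfolding doubleton_eq_iff by auto
  then show ?thesis
  proof cases
    case 1
    then show ?thesis using that[of i j] c by (simp add: incident_def)
  next
    case 2
    then show ?thesis using that[of j i] c by (simp add: incident_def)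
  qed
qed

lemma pt_edge:
  assumes "c \<in> cells S N" "i ~= j"
  shows "{pt N (c + delta i), pt N (c + delta j)} \<in> cell_edges S N" using assms unfolding edges_of_def by blast

lemma edge_vertices: "{x, y} \<in> edges_of N A ==> x \<in> vertices_of N A \<and> y \<in> vertices_of N A \<and> x ~= y"
  unfolding edges_of_def vertices_of_def by (auto simp: doubleton_eq_iff) (metis delta.simps add_left_cancel corner.exhaust prod.inject zero_neq_one)+

subsection \<open>Local coordinates\<close>

text \<open>Vertices near a cell: its corners, its side midpoints \<open>Mi k\<close> (opposite to corner \<open>k\<close>), and
  the three side midpoints \<open>Ou i j\<close> of the second cell at corner \<open>i\<close>, where \<open>Ou i C0\<close> is the one
  not adjacent to that corner.\<close>

datatype node = Co corner | Mi corner | Ou corner corner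

fun adj :: "node => node => bool" where
  "adj (Co i) (Mi j) = (i ~= j)"
| "adj (Mi i) (Co j) = (i ~= j)"
| "adj (Mi i) (Mi j) = (i ~= j)"
| "adj (Co i) (Ou k j) = (i = k \<and> j ~= C0)"
| "adj (Ou k j) (Co i) = (i = k \<and> j ~= C0)"
| "adj (Ou i j) (Ou k l) = (i = k \<and> j ~= l)"
| "adj _ _ = False"

fun relabel :: "(corner => corner) => node => node" where
  "relabel \<rho> (Co i) = Co (\<rho> i)"
| "relabel \<rho> (Mi i) = Mi (\<rho> i)"
| "relabel \<rho> (Ou i j) = Ou (\<rho> i) j"

lemma adj_relabel: "inj \<rho> ==> adj (relabel \<rho> m) (relabel \<rho> n) = adj m n" by (cases m; cases n) (auto simp: inj_eq)

lemma relabel_inj: "inj \<rho> ==> relabel \<rho> m = relabel \<rho> n \<longleftrightarrow> m = n" by (cases m; cases n) (auto simp: inj_eq)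

definition other_incident :: "nat => int \<times> int => corner => corner" where
  "other_incident N y i = (SOME k. k ~= i \<and> k \<in> incident three_cells N y)"

text \<open>The transposition of \<open>C0\<close> and \<open>k\<close>. It renames the corners of a
  second cell so that the corner shared with the first one becomes \<open>C0\<close>.\<close>

definition swap_first :: "corner => corner => corner" where
  "swap_first k j = (if j = C0 then k else if j = k then C0 else j)"

lemma swap_first_C0 [simp]: "swap_first k C0 = k" by (simp add: swap_first_def)

lemma swap_first_inj [simp]: "swap_first k i = swap_first k j \<longleftrightarrow> i = j" by (auto simp: swap_first_def)

lemma swap_first_eq [simp]: "swap_first k j = k \<longleftrightarrow> j = C0" "k = swap_first k j \<longleftrightarrow> j = C0" by (auto simp: swap_first_def)

definition outer_cell :: "nat => int \<times> int => corner => int \<times> int" where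
  "outer_cell N c i = c + delta i - delta (other_incident N (c + delta i) i)"

text \<open>Coordinates refer to the next mesh, hence the doubled corners.\<close>

fun node_pos :: "nat => int \<times> int => node => int \<times> int" where
  "node_pos N c (Co i) = (c + delta i) + (c + delta i)"
| "node_pos N c (Mi k) = midpoint_of c k"
| "node_pos N c (Ou i j) = midpoint_of (outer_cell N c i) (swap_first (other_incident N (c + delta i) i) j)"

lemma other_incident:
  assumes "c \<in> cells three_cells N" "regular N (c + delta i)"
  shows "other_incident N (c + delta i) i ~= i"
    and "incident three_cells N (c + delta i) = {i, other_incident N (c + delta i) i}"
    and "outer_cell N c i \<in> cells three_cells N"
    and "outer_cell N c i ~= c"
proof -
  have "i \<in> incident three_cells N (c + delta i)" using assms(1) by (simp add: incident_def)
  with assms(2) obtain k where k: "k ~= i" "incident three_cells N (c + delta i) = {i, k}" unfolding regular_def by (metis insertE insert_commute singletonD)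
  then have "other_incident N (c + delta i) i = k" unfolding other_incident_def by (intro some_equality) auto
  then show 1: "other_incident N (c + delta i) i ~= i"
    and 2: "incident three_cells N (c + delta i) = {i, other_incident N (c + delta i) i}" using k by auto
  show "outer_cell N c i \<in> cells three_cells N" unfolding outer_cell_def using 2 by (auto simp: incident_def)
  show "outer_cell N c i ~= c" unfolding outer_cell_def using 1 by (cases c; cases i; cases "other_incident N (c + delta i) i") auto
qed

lemma delta_inj: "delta i = delta j \<longleftrightarrow> i = j" by (cases i; cases j) auto

text \<open>Two distinct upward triangles share at most one vertex, so the second cells at two
  corners of a cell cannot coincide.\<close>

lemma outer_cell_inj:
  assumes "c \<in> cells three_cells N" "regular N (c + delta i)" "regular N (c + delta j)"
    and "outer_cell N c i = outer_cell N c j"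
  shows "i = j"
proof -
  have *: "delta i - delta k = delta j - delta l ==> k ~= i ==> l ~= j ==> i = j" for k l by (cases i; cases j; cases k; cases l) auto
  have "delta i - delta (other_incident N (c + delta i) i) = delta j - delta (other_incident N (c + delta j) j)" using assms(4) unfolding outer_cell_def by (simp add: algebra_simps)
  then show ?thesis using * other_incident(1) assms by blast
qed

definition nodes_at :: "corner set => node set" where
  "nodes_at I = range Co \<union> range Mi \<union> {Ou i j | i j. i \<in> I}"

text \<open>Parity separates corners from midpoints, a midpoint determines its cell and side, and
  the cells involved are pairwise distinct.\<close>

lemma node_pos_inj:
  assumes "c \<in> cells three_cells N" "!!i. i \<in> I ==> regular N (c + delta i)"
  shows "inj_on (node_pos N c) (nodes_at I)"
proof (rule inj_onI)
  fix m n assume mn: "m \<in> nodes_at I" "n \<in> nodes_at I" and eq: "node_pos N c m = node_pos N c n"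
  have out: "outer_cell N c i ~= c" "c ~= outer_cell N c i" if "i \<in> I" for i using other_incident(4)[OF assms(1) assms(2)[OF that]] by auto
  have oi: "outer_cell N c i = outer_cell N c j ==> i = j" if "i \<in> I" "j \<in> I" for i j using outer_cell_inj[OF assms(1) assms(2)[OF that(1)] assms(2)[OF that(2)]] .
  show "m = n"
  proof (cases m)
    case (Co i)
    then show ?thesis using eq mn by (cases n) (auto simp: double_inj delta_inj midpoint_of_not_double midpoint_of_not_double[symmetric])
  next
    case (Mi i)
    then show ?thesis using eq mn out by (cases n) (auto simp: midpoint_of_not_double midpoint_of_inj nodes_at_def)
  next
    case (Ou i k)
    then have "i \<in> I" using mn by (auto simp: nodes_at_def)
    show ?thesis
    proof (cases n)
      case (Co j)
      then show ?thesis using eq Ou by (simp add: midpoint_of_not_double)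
    next
      case (Mi j)
      then show ?thesis using eq Ou out[OF \<open>i \<in> I\<close>] by (simp add: midpoint_of_inj)
    next
      case (Ou j l)
      then have "j \<in> I" using mn by (auto simp: nodes_at_def)
      have "outer_cell N c i = outer_cell N c j" using eq Ou \<open>m = Ou i k\<close> by (simp add: midpoint_of_inj)
      then have "i = j" using oi \<open>i \<in> I\<close> \<open>j \<in> I\<close> by blast
      then show ?thesis using eq Ou \<open>m = Ou i k\<close> by (simp add: midpoint_of_inj)
    qed
  qed
qed

lemma edges_sub_corner:
  assumes "b \<in> cells S N" "i ~= k"
  shows "{pt (Suc N) ((b + delta i) + (b + delta i)), pt (Suc N) (midpoint_of b k)} \<in> cell_edges S (Suc N)"
proof -
  have sub: "b + b + delta i \<in> cells S (Suc N)" unfolding cells_Suc using assms by blast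
  obtain j where j: "i ~= j" "k ~= j" using third_corner by metis
  have "midpoint_of b k = b + b + delta i + delta j" using midpoint_of_add[OF assms(2)] j by metis
  moreover have "(b + delta i) + (b + delta i) = b + b + delta i + delta i" by (simp add: algebra_simps)
  moreover have "{pt (Suc N) (b + b + delta i + delta i), pt (Suc N) (b + b + delta i + delta j)} \<in> cell_edges S (Suc N)" using pt_edge[OF sub] j by blast
  ultimately show ?thesis by (simp only:)
qed

lemma edges_sub_mid:
  assumes "b \<in> cells S N" "j ~= k"
  shows "{pt (Suc N) (midpoint_of b j), pt (Suc N) (midpoint_of b k)} \<in> cell_edges S (Suc N)"
proof -
  obtain i where i: "i ~= j" "i ~= k" using third_corner by metis
  have sub: "b + b + delta i \<in> cells S (Suc N)" unfolding cells_Suc using assms by blast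
  have "midpoint_of b k = b + b + delta i + delta j" "midpoint_of b j = b + b + delta i + delta k" using assms(2) i midpoint_of_add by metis+
  then show ?thesis using pt_edge[OF sub, of k j] assms by simp
qed

lemma node_pos_edge:
  assumes "c \<in> cells three_cells N" "!!i. i \<in> I ==> regular N (c + delta i)"
    and "m \<in> nodes_at I" "n \<in> nodes_at I" "adj m n"
  shows "{pt (Suc N) (node_pos N c m), pt (Suc N) (node_pos N c n)} \<in> EV (Suc N)"
proof -
  have out: "outer_cell N c i + delta (other_incident N (c + delta i) i) = c + delta i" for i by (simp add: outer_cell_def)
  have *: "{pt (Suc N) (node_pos N c (Co i)), pt (Suc N) (node_pos N c (Ou i j))} \<in> EV (Suc N)" if "i \<in> I" "j ~= C0" for i j using edges_sub_corner[OF other_incident(3)[OF assms(1) assms(2)[OF that(1)]],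
        of "other_incident N (c + delta i) i" "swap_first (other_incident N (c + delta i) i) j"] that(2) unfolding out EV_eq by simp
  have I: "Ou i j \<in> nodes_at I ==> i \<in> I" for i j by (auto simp: nodes_at_def)
  show ?thesis
  proof (cases m)
    case (Co i)
    show ?thesis
    proof (cases n)
      case (Mi j) then show ?thesis using Co assms edges_sub_corner[OF assms(1)] by (simp add: EV_eq)
    next
      case (Ou k j) then show ?thesis using Co assms I * by auto
    qed (use Co assms in auto)
  next
    case (Mi i)
    show ?thesis
    proof (cases n)
      case (Co j) then show ?thesis using Mi assms edges_sub_corner[OF assms(1), of j i] by (simp add: EV_eq insert_commute)
    next
      case (Mi j) then show ?thesis using \<open>m = Mi i\<close> assms edges_sub_mid[OF assms(1)] by (simp add: EV_eq)
    qed (use Mi assms in auto)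
  next
    case (Ou i k)
    show ?thesis
    proof (cases n)
      case (Co j) then show ?thesis using Ou assms I *[of i k] by (auto simp: insert_commute)
    next
      case (Ou j l) then show ?thesis using \<open>m = Ou i k\<close> assms I edges_sub_mid[OF other_incident(3)[OF assms(1) assms(2)]] by (simp add: EV_eq)
    qed (use Ou assms in auto)
  qed
qed

text \<open>Squared lengths in units of the mesh.\<close>

definition qlen :: "int \<times> int => int" where
  "qlen v = (fst v)\<^sup>2 + fst v * snd v + (snd v)\<^sup>2"

lemma norm_pt: "(norm (pt N v))\<^sup>2 = real_of_int (qlen v) / 4 ^ N"
proof -
  have "(norm (pt N v))\<^sup>2 = (Re (pt N v))\<^sup>2 + (Im (pt N v))\<^sup>2" by (simp add: cmod_power2)
  also have "... = real_of_int (qlen v) / (2 ^ N)\<^sup>2" by (simp add: Re_pt Im_pt power_divide power_mult_distrib qlen_def power2_eq_square field_simps)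
  also have "(2 ^ N :: real)\<^sup>2 = 4 ^ N" by (simp add: power2_eq_square flip: power_mult_distrib)
  finally show ?thesis .
qed

lemma pt_diff: "pt N v - pt N w = pt N (v - w)" by (simp add: complex_eq_iff Re_pt Im_pt field_simps)

lemma dist_pt: "(dist (pt N v) (pt N w))\<^sup>2 = real_of_int (qlen (v - w)) / 4 ^ N" unfolding dist_norm pt_diff norm_pt ..

lemma qlen_corners: "qlen ((b + delta i) - (b + delta j)) = (if i = j then 0 else 1)" by (cases i; cases j; cases b) (auto simp: qlen_def)

lemma qlen_corner_mid: "qlen ((b + delta i) + (b + delta i) - midpoint_of b j) = (if i = j then 3 else 1)"
  "qlen (midpoint_of b j - ((b + delta i) + (b + delta i))) = (if i = j then 3 else 1)" by (cases i; cases j; cases b; simp add: qlen_def midpoint_of_def)+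

lemma qlen_mids: "qlen (midpoint_of b i - midpoint_of b j) = (if i = j then 0 else 1)" by (cases i; cases j; cases b) (auto simp: qlen_def midpoint_of_def)


lemma successively_nth:
  "successively P xs \<longleftrightarrow> (\<forall>i. Suc i < length xs --> P (xs ! i) (xs ! Suc i))"
proof (induction xs rule: induct_list012)
  case (3 x y zs)
  have "(\<forall>i. Suc i < length (x # y # zs) --> P ((x # y # zs) ! i) ((x # y # zs) ! Suc i)) \<longleftrightarrow>
    P x y \<and> (\<forall>i. Suc i < length (y # zs) --> P ((y # zs) ! i) ((y # zs) ! Suc i))" by (auto simp: nth_Cons split: nat.splits)
  then show ?case using 3 by simp
qed auto

subsection \<open>Filled triangles\<close>

definition tri :: "nat => int \<times> int => complex set" where
  "tri N c = convex hull {pt N (c + delta C0), pt N (c + delta C1), pt N (c + delta C2)}"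

lemma tri_corner: "pt N (c + delta i) \<in> tri N c" unfolding tri_def by (cases i) (auto intro: hull_inc)

lemma triangles_eq: "triangles N = {tri N c | c. \<forall>i. pt N (c + delta i) \<in> GV N}"
proof -
  have *: "pt N y + (1 / 2 ^ N) *\<^sub>R pt_a = pt N (y + delta C1)" "pt N y + (1 / 2 ^ N) *\<^sub>R pt_b = pt N (y + delta C2)" for y
    by (simp_all add: complex_eq_iff Re_pt Im_pt field_simps) (simp_all add: pt_a_def pt_b_def field_simps)
  have c0: "y + delta C0 = y" for y by (simp add: prod_eq_iff)
  show ?thesis unfolding triangles_def tri_def
  proof (intro equalityI subsetI)
    fix t assume "t \<in> {convex hull {p, p + (1 / 2 ^ N) *\<^sub>R pt_a, p + (1 / 2 ^ N) *\<^sub>R pt_b} |p.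
           {p, p + (1 / 2 ^ N) *\<^sub>R pt_a, p + (1 / 2 ^ N) *\<^sub>R pt_b} \<subseteq> GV N}"
    then obtain p where p: "t = convex hull {p, p + (1 / 2 ^ N) *\<^sub>R pt_a, p + (1 / 2 ^ N) *\<^sub>R pt_b}"
      "{p, p + (1 / 2 ^ N) *\<^sub>R pt_a, p + (1 / 2 ^ N) *\<^sub>R pt_b} \<subseteq> GV N" by blast
    then have "p \<in> GV N" by blast
    then obtain y where y: "p = pt N y" unfolding GV_eq using vertices_of_pt by blast
    show "t \<in> {convex hull {pt N (c + delta C0), pt N (c + delta C1), pt N (c + delta C2)} |c. \<forall>i. pt N (c + delta i) \<in> GV N}"
      using p unfolding y * all_corner c0 by (intro CollectI exI[of _ y]) (simp del: delta.simps add: c0)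
  next
    fix t assume "t \<in> {convex hull {pt N (c + delta C0), pt N (c + delta C1), pt N (c + delta C2)} |c. \<forall>i. pt N (c + delta i) \<in> GV N}"
    then obtain c where c: "t = convex hull {pt N (c + delta C0), pt N (c + delta C1), pt N (c + delta C2)}"
      "\<forall>i. pt N (c + delta i) \<in> GV N" by blast
    show "t \<in> {convex hull {p, p + (1 / 2 ^ N) *\<^sub>R pt_a, p + (1 / 2 ^ N) *\<^sub>R pt_b} |p.
           {p, p + (1 / 2 ^ N) *\<^sub>R pt_a, p + (1 / 2 ^ N) *\<^sub>R pt_b} \<subseteq> GV N}" using c unfolding *(1,2)[symmetric] all_corner c0 by (intro CollectI exI[of _ "pt N c"]) simp
  qed
qed

lemma cell_triangles:
  assumes "c \<in> cells three_cells N"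
  shows "tri N c \<in> triangles N"
proof -
  have "pt N (c + delta i) \<in> GV N" for i unfolding GV_eq vertices_of_def using assms by blast
  then show ?thesis unfolding triangles_eq by blast
qed

text \<open>Together with \<open>coord_b\<close>, the coefficients in the basis \<open>pt_a\<close>,
  \<open>pt_b\<close>. A filled triangle satisfies three linear inequalities in them with integer
  bounds, which settles by integer arithmetic which lattice points it contains.\<close>

definition coord_a :: "complex => real" where "coord_a z = 2 * Im z / sqrt 3"
definition coord_b :: "complex => real" where "coord_b z = Re z - Im z / sqrt 3"

lemma coord_pt: "coord_a (pt N v) = real_of_int (fst v) / 2 ^ N" "coord_b (pt N v) = real_of_int (snd v) / 2 ^ N" by (simp_all add: coord_a_def coord_b_def Re_pt Im_pt field_simps)

lemma coord_linear:
  "coord_a (x + y) = coord_a x + coord_a y" "coord_b (x + y) = coord_b x + coord_b y"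
  "coord_a (r *\<^sub>R x) = r * coord_a x" "coord_b (r *\<^sub>R x) = r * coord_b x" by (simp_all add: coord_a_def coord_b_def algebra_simps add_divide_distrib)

lemma tri_coord:
  assumes "z \<in> tri N c"
  shows "real_of_int (fst c) \<le> 2 ^ N * coord_a z" "real_of_int (snd c) \<le> 2 ^ N * coord_b z"
    "2 ^ N * coord_a z + 2 ^ N * coord_b z \<le> real_of_int (fst c + snd c + 1)"
proof -
  obtain u v w where uvw: "0 \<le> u" "0 \<le> v" "0 \<le> w" "u + v + w = 1"
    "z = u *\<^sub>R pt N (c + delta C0) + v *\<^sub>R pt N (c + delta C1) + w *\<^sub>R pt N (c + delta C2)" using assms unfolding tri_def convex_hull_3 by blast
  have a: "2 ^ N * coord_a z = u * fst c + v * (fst c + 1) + w * fst c"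
    and b: "2 ^ N * coord_b z = u * snd c + v * snd c + w * (snd c + 1)" unfolding uvw(5) coord_linear coord_pt by (simp_all add: field_simps)
  have u: "u = 1 - v - w" using uvw by simp
  have a': "2 ^ N * coord_a z = fst c + v" and b': "2 ^ N * coord_b z = snd c + w" unfolding a b u by (simp_all add: field_simps)
  show "real_of_int (fst c) \<le> 2 ^ N * coord_a z" "real_of_int (snd c) \<le> 2 ^ N * coord_b z"
    "2 ^ N * coord_a z + 2 ^ N * coord_b z \<le> real_of_int (fst c + snd c + 1)" unfolding a' b' using uvw by simp_all
qed

lemma pt_tri:
  assumes "pt N y \<in> tri N c"
  shows "\<exists>i. y = c + delta i"
proof -
  have "real_of_int (fst c) \<le> real_of_int (fst y)" "real_of_int (snd c) \<le> real_of_int (snd y)"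
    "real_of_int (fst y) + real_of_int (snd y) \<le> real_of_int (fst c + snd c + 1)" using tri_coord[OF assms] by (simp_all add: coord_pt)
  then have "fst c \<le> fst y" "snd c \<le> snd y" "fst y + snd y \<le> fst c + snd c + 1" by linarith+
  then show ?thesis unfolding ex_corner prod_eq_iff by auto
qed

text \<open>Unlike a corner, the midpoint of a side lies in a single upward triangle. This decides
  which of the two similarities of a unit copy acts on a given point of a walk.\<close>

lemma midpoint_tri:
  assumes "pt (Suc N) (midpoint_of b k) \<in> tri N c"
  shows "b = c"
proof -
  have "real_of_int (fst c) * 2 \<le> real_of_int (fst (midpoint_of b k))"
    "real_of_int (snd c) * 2 \<le> real_of_int (snd (midpoint_of b k))"
    "real_of_int (fst (midpoint_of b k)) + real_of_int (snd (midpoint_of b k)) \<le> 2 * real_of_int (fst c + snd c + 1)" using tri_coord[OF assms] by (simp_all add: coord_pt field_simps)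
  then have "fst c * 2 \<le> fst (midpoint_of b k)" "snd c * 2 \<le> snd (midpoint_of b k)"
    "fst (midpoint_of b k) + snd (midpoint_of b k) \<le> 2 * (fst c + snd c + 1)" by linarith+
  then show ?thesis unfolding prod_eq_iff by (cases k; simp add: midpoint_of_def; presburger)
qed

lemma midpoint_in_tri: "pt (Suc N) (midpoint_of c k) \<in> tri N c"
proof -
  obtain i where i: "i ~= k" using third_corner by metis
  obtain l where l: "i ~= l" "k ~= l" using third_corner by metis
  have "pt (Suc N) (midpoint_of c k) = (1/2) *\<^sub>R pt N (c + delta i) + (1/2) *\<^sub>R pt N (c + delta l)" unfolding midpoint_of_add[OF i l] by (simp add: complex_eq_iff Re_pt Im_pt field_simps)
  moreover have "convex (tri N c)" by (simp add: tri_def convex_convex_hull)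
  ultimately show ?thesis using tri_corner by (simp only:) (rule convexD; simp)
qed

lemma tri_diameter:
  assumes "x \<in> tri N c" "y \<in> tri N c"
  shows "dist x y \<le> 1 / 2 ^ N"
proof -
  define S where "S = {pt N (c + delta C0), pt N (c + delta C1), pt N (c + delta C2)}"
  have hull: "tri N c = convex hull S" unfolding tri_def S_def ..
  have "\<exists>u\<in>S. \<exists>v\<in>S. \<forall>x\<in>convex hull S. \<forall>y\<in>convex hull S. norm (x - y) \<le> norm (u - v)" by (rule simplex_extremal_le) (simp_all add: S_def)
  then obtain u v where uv: "u \<in> S" "v \<in> S" "norm (x - y) \<le> norm (u - v)" using assms unfolding hull by blast
  have ex: "\<exists>i. w = pt N (c + delta i)" if "w \<in> S" for w using that unfolding S_def by (elim insertE emptyE) (rule exI, assumption)+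
  obtain i j where ij: "u = pt N (c + delta i)" "v = pt N (c + delta j)" using ex[OF uv(1)] ex[OF uv(2)] by (elim exE)
  have "(dist u v)\<^sup>2 \<le> 1 / 4 ^ N" unfolding ij dist_pt qlen_corners by simp
  also have "(1::real) / 4 ^ N = (1 / 2 ^ N)\<^sup>2" by (simp add: power2_eq_square flip: power_mult_distrib)
  finally have "dist u v \<le> 1 / 2 ^ N" by (rule power2_le_imp_le) simp
  then show ?thesis using uv by (simp add: dist_norm)
qed

lemma dist_corners: "i ~= j ==> dist (pt N (c + delta i)) (pt N (c + delta j)) = 1 / 2 ^ N"
proof -
  assume "i ~= j"
  then have "(dist (pt N (c + delta i)) (pt N (c + delta j)))\<^sup>2 = (1 / 2 ^ N)\<^sup>2" unfolding dist_pt qlen_corners by (simp add: power2_eq_square flip: power_mult_distrib)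
  then show ?thesis by (rule power2_eq_imp_eq) simp_all
qed

text \<open>The six differences of distinct corner offsets are pairwise different. Hence an oriented
  edge determines its triangle among all upward lattice triangles, including those lying in
  holes.\<close>

lemma edge_cell_unique:
  assumes "c + delta i = c' + delta i'" "c + delta j = c' + delta j'" "i ~= j"
  shows "c = c' \<and> i = i' \<and> j = j'"
proof -
  have "delta i - delta j = delta i' - delta j'" using assms by (metis add_diff_cancel_left)
  then have "i = i'" using assms(3) by (cases i; cases i'; cases j; cases j') (auto simp: zero_prod_def)
  then show ?thesis using assms delta_inj by auto
qed

lemma triangle_from_eq:
  assumes "c \<in> cells three_cells N" "i ~= j"
  shows "(THE \<Delta>. \<Delta> \<in> triangles N \<and> pt N (c + delta i) \<in> \<Delta> \<and> pt N (c + delta j) \<in> \<Delta>) = tri N c"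
proof (rule the_equality)
  show "tri N c \<in> triangles N \<and> pt N (c + delta i) \<in> tri N c \<and> pt N (c + delta j) \<in> tri N c" using assms cell_triangles tri_corner by blast
next
  fix \<Delta> assume \<Delta>: "\<Delta> \<in> triangles N \<and> pt N (c + delta i) \<in> \<Delta> \<and> pt N (c + delta j) \<in> \<Delta>"
  then obtain c' where c': "\<Delta> = tri N c'" unfolding triangles_eq by blast
  obtain i' j' where "c + delta i = c' + delta i'" "c + delta j = c' + delta j'" using \<Delta> pt_tri unfolding c' by meson
  then show "\<Delta> = tri N c" using edge_cell_unique assms(2) c' by blast
qed

subsection \<open>Similarities\<close>

lemma similarity_cell:
  assumes "inj \<rho>"
  obtains g where "similarity g" "g (pt N (c + delta (\<rho> C0))) = 0" "g (pt N (c + delta (\<rho> C1))) = pt_a"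
    "g ` tri N c = convex hull {0, pt_a, pt_b}"
proof -
  define p where "p = pt N (c + delta (\<rho> C0))"
  define e where "e = pt N (c + delta (\<rho> C1)) - p"
  define f where "f = pt N (c + delta (\<rho> C2)) - p"
  have ne: "\<rho> C0 ~= \<rho> C1" "\<rho> C0 ~= \<rho> C2" "\<rho> C1 ~= \<rho> C2" using assms by (auto simp: inj_eq)
  have ef: "e = pt N (delta (\<rho> C1) - delta (\<rho> C0))" "f = pt N (delta (\<rho> C2) - delta (\<rho> C0))" unfolding e_def f_def p_def pt_diff by simp_all
  have f0: "f ~= 0" using ne dist_corners[of "\<rho> C0" "\<rho> C2" N c] unfolding f_def p_def by auto
  have aa: "pt_a * cnj pt_a = 1" by (simp add: complex_eq_iff pt_a_def)
  \<comment> \<open>The vectors from one corner to the other two differ by a rotation through 60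
    degrees in one of two directions. Conjugation turns the second case into the first.\<close>
  have or: "e = f * pt_a \<or> e = f * cnj pt_a" unfolding ef using ne by (cases "\<rho> C0"; cases "\<rho> C1"; cases "\<rho> C2") (simp_all add: complex_eq_iff Re_pt Im_pt pt_a_def field_simps)
  define L where "L = (if e = f * pt_a then (%z. z / f) else (%z. cnj z / cnj f))"
  have L1: "linear L" unfolding L_def by (auto intro!: linearI simp: add_divide_distrib scaleR_conv_of_real)
  have L2: "L e = pt_a" "L f = 1" using or f0 unfolding L_def by auto
  have L3: "norm (L z) = norm z / norm f" for z unfolding L_def by (auto simp: norm_divide)
  define g where "g = (%z. - L p + L z)"
  have gdist: "dist (g x) (g y) = (1 / norm f) * dist x y" for x y unfolding g_def by (simp add: dist_norm flip: linear_diff[OF L1]) (simp add: L3)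
  have "similarity g" unfolding similarity_def using gdist f0 by (intro exI[of _ "1 / norm f"]) auto
  moreover have g0: "g p = 0" by (simp add: g_def)
  moreover have g1: "g (pt N (c + delta (\<rho> C1))) = pt_a" using L2(1) by (simp add: g_def e_def linear_diff[OF L1])
  moreover have g2: "g (pt N (c + delta (\<rho> C2))) = pt_b" using L2(2) by (simp add: g_def f_def linear_diff[OF L1] pt_b_def)
  moreover have "g ` tri N c = convex hull {0, pt_a, pt_b}"
  proof -
    have "{C0, C1, C2} = \<rho> ` {C0, C1, C2}" using ne by (cases "\<rho> C0"; cases "\<rho> C1"; cases "\<rho> C2") auto
    then have *: "(%i. pt N (c + delta i)) ` {C0, C1, C2} = (%i. pt N (c + delta i)) ` \<rho> ` {C0, C1, C2}" by (rule arg_cong)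
    have t: "tri N c = convex hull {p, pt N (c + delta (\<rho> C1)), pt N (c + delta (\<rho> C2))}" unfolding tri_def p_def using * by (simp only: image_insert image_empty)
    have "g ` tri N c = (%z. - L p + z) ` L ` tri N c" unfolding g_def by (simp add: image_image)
    also have "... = convex hull (g ` {p, pt N (c + delta (\<rho> C1)), pt N (c + delta (\<rho> C2))})" unfolding t convex_hull_linear_image[OF L1] convex_hull_translation[symmetric] g_def by (simp add: image_image)
    finally show ?thesis using g0 g1 g2 by simp
  qed
  ultimately show ?thesis using that unfolding p_def by blast
qed

lemma reflect_isometry: "dist (reflect_y x) (reflect_y y) = dist x y"
proof -
  have "reflect_y x - reflect_y y = - cnj (x - y)" by (simp add: reflect_y_def)
  then show ?thesis unfolding dist_norm by (metis complex_mod_cnj norm_minus_cancel)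
qed


subsection \<open>Frames and local walks\<close>

text \<open>\<open>I\<close> lists the labels of the corners where a path may pass into a second
  cell: \<open>C0\<close> for a single step, \<open>C0\<close> and \<open>C2\<close> for a crossing
  via the third corner.\<close>

definition frame :: "corner set => nat => int \<times> int => (corner => corner) => bool" where
  "frame I N c \<rho> \<longleftrightarrow> c \<in> cells three_cells N \<and> inj \<rho> \<and> (\<forall>i\<in>I. regular N (c + delta (\<rho> i)))"

definition emb :: "nat => int \<times> int => (corner => corner) => node => complex" where
  "emb N c \<rho> n = pt (Suc N) (node_pos N c (relabel \<rho> n))"

lemma emb_Co: "emb N c \<rho> (Co i) = pt N (c + delta (\<rho> i))" unfolding emb_def relabel.simps node_pos.simps pt_add_double ..

lemma relabel_nodes_at: "n \<in> nodes_at I ==> relabel \<rho> n \<in> nodes_at (\<rho> ` I)" by (auto simp: nodes_at_def)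

lemma frame_nodes:
  assumes "frame I N c \<rho>"
  shows "c \<in> cells three_cells N" "inj \<rho>" "!!i. i \<in> \<rho> ` I ==> regular N (c + delta i)" using assms unfolding frame_def by auto

lemma emb_inj:
  assumes "frame I N c \<rho>"
  shows "inj_on (emb N c \<rho>) (nodes_at I)"
proof (rule inj_onI)
  fix m n assume *: "m \<in> nodes_at I" "n \<in> nodes_at I" "emb N c \<rho> m = emb N c \<rho> n"
  then have "node_pos N c (relabel \<rho> m) = node_pos N c (relabel \<rho> n)" by (simp add: emb_def)
  then have "relabel \<rho> m = relabel \<rho> n" using inj_onD[OF node_pos_inj[OF frame_nodes(1,3)[OF assms]]] relabel_nodes_at * by blast
  then show "m = n" using relabel_inj frame_nodes(2)[OF assms] by blast
qed

lemma emb_edge: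
  assumes "frame I N c \<rho>" "m \<in> nodes_at I" "n \<in> nodes_at I" "adj m n"
  shows "{emb N c \<rho> m, emb N c \<rho> n} \<in> EV (Suc N)" unfolding emb_def by (rule node_pos_edge[OF frame_nodes(1,3)[OF assms(1)]])
     (use assms relabel_nodes_at adj_relabel frame_nodes(2) in auto)

lemma emb_GV:
  assumes "frame I N c \<rho>" "n \<in> nodes_at I"
  shows "emb N c \<rho> n \<in> GV N \<longleftrightarrow> n \<in> range Co"
proof (cases n)
  case (Co i)
  have "pt N (c + delta (\<rho> i)) \<in> GV N" unfolding GV_eq vertices_of_def using frame_nodes(1)[OF assms(1)] by blast
  then show ?thesis unfolding Co emb_Co by simp
qed (auto simp: emb_def GV_midpoint)

lemma compl_single: "- {x :: corner} ~= {}" by (cases x) (auto simp: compl_corner)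

lemma emb_GV_Suc:
  assumes "frame I N c \<rho>" "n \<in> nodes_at I"
  shows "emb N c \<rho> n \<in> GV (Suc N)"
proof (cases n)
  case (Co i)
  then show ?thesis using emb_GV[OF assms] GV_Suc by blast
next
  case (Mi k)
  then show ?thesis using frame_nodes(1)[OF assms(1)] by (simp add: emb_def GV_pt incident_midpoint compl_single)
next
  case (Ou i k)
  then have "i \<in> I" using assms(2) by (auto simp: nodes_at_def)
  then have "outer_cell N c (\<rho> i) \<in> cells three_cells N" using other_incident(3)[OF frame_nodes(1)[OF assms(1)]] frame_nodes(3)[OF assms(1)] by blast
  then show ?thesis using Ou by (simp add: emb_def GV_pt incident_midpoint compl_single)
qed

lemma dist_emb:
  "(dist (emb N c \<rho> m) (emb N c \<rho> n))\<^sup>2 =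
    real_of_int (qlen (node_pos N c (relabel \<rho> m) - node_pos N c (relabel \<rho> n))) / 4 ^ Suc N" unfolding emb_def dist_pt ..

lemma outer_corner: "c + delta i = outer_cell N c i + delta (other_incident N (c + delta i) i)" by (simp add: outer_cell_def)

lemma qlen_outer:
  "qlen ((c + delta i) + (c + delta i) - midpoint_of (outer_cell N c i) (swap_first (other_incident N (c + delta i) i) j)) = (if j = C0 then 3 else 1)"
  "qlen (midpoint_of (outer_cell N c i) (swap_first (other_incident N (c + delta i) i) j) - ((c + delta i) + (c + delta i))) = (if j = C0 then 3 else 1)"
  using qlen_corner_mid[where b = "outer_cell N c i" and i = "other_incident N (c + delta i) i"
      and j = "swap_first (other_incident N (c + delta i) i) j"] unfolding outer_corner[symmetric] by simp_all

lemma qlen_double_delta: "qlen (delta i + delta i - (delta j + delta j)) = (if i = j then 0 else 4)" by (cases i; cases j) (auto simp: qlen_def)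

lemma dist_emb_adj:
  assumes "inj \<rho>" "adj m n"
  shows "(dist (emb N c \<rho> m) (emb N c \<rho> n))\<^sup>2 = 1 / 4 ^ Suc N" using assms unfolding dist_emb by (cases m; cases n) (auto simp: qlen_corner_mid qlen_mids qlen_outer inj_eq)

text \<open>By the law of cosines, the inner product of two consecutive steps of mesh length is
  negative iff their outer ends have squared distance below 2 in mesh units. Around a midpoint the
  possible values are 0, 1, 3 and 4.\<close>

lemma dist_emb_turn:
  assumes "inj \<rho>" "adj m l" "adj l n" "l \<notin> range Co"
  shows "(dist (emb N c \<rho> m) (emb N c \<rho> n))\<^sup>2 < 2 / 4 ^ Suc N \<longleftrightarrow> m = n \<or> adj m n"
proof -
  have "qlen (node_pos N c (relabel \<rho> m) - node_pos N c (relabel \<rho> n)) < 2 \<longleftrightarrow> m = n \<or> adj m n" using assms by (cases l; cases m; cases n)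
      (auto simp: qlen_corner_mid qlen_mids qlen_outer qlen_double_delta qlen_def[of 0] inj_eq split: if_splits)
  moreover have "real_of_int q / 4 ^ Suc N < 2 / 4 ^ Suc N \<longleftrightarrow> q < 2" for q
  proof -
    have "real_of_int q / 4 ^ Suc N < 2 / 4 ^ Suc N \<longleftrightarrow> real_of_int q < 2" by (simp only: divide_less_cancel) simp
    then show ?thesis by linarith
  qed
  ultimately show ?thesis unfolding dist_emb by simp
qed

text \<open>\<open>W 1\<close> in local coordinates, see \<open>W_1_eq\<close>. The far corners of
  the second cell have no node, because a path of \<open>W 1\<close> never visits them.\<close>

definition local_walks :: "node list set" where
  "local_walks = {n. n ~= [] \<and> successively adj n \<and> hd n = Co C0 \<and> last n = Co C1 \<and>
     (\<forall>i < length n - 1. n ! i \<in> {Co C0} \<union> range Mi \<union> range (Ou C0))}"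

definition local_turns :: "node list => nat" where
  "local_turns n = card {i. 1 \<le> i \<and> Suc i \<le> length n - 1 \<and> (n ! (i - 1) = n ! Suc i \<or> adj (n ! (i - 1)) (n ! Suc i))
     \<and> n ! i \<notin> range Co}"

definition local_returns :: "node list => nat" where
  "local_returns n = card {i. 1 \<le> i \<and> i \<le> length n - 1 \<and> n ! i = Co C0}"

text \<open>The exponent is the number of steps minus one; a list has one entry more than
  steps.\<close>

definition local_weight :: "real => node list => real" where
  "local_weight u n = u ^ (local_turns n + local_returns n) * x_fix u ^ (length n - 2)"

lemma local_walk_props:
  assumes "n \<in> local_walks"
  shows "n ~= []" "successively adj n" "hd n = Co C0" "last n = Co C1" "n ! 0 = Co C0" "n ! (length n - 1) = Co C1"
    "!!i. i < length n - 1 ==> n ! i \<in> {Co C0} \<union> range Mi \<union> range (Ou C0)"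
    "!!i. i < length n ==> n ! i \<in> nodes_at {C0}" "set n \<subseteq> nodes_at {C0}" "2 \<le> length n"
    "!!i. Suc i < length n ==> adj (n ! i) (n ! Suc i)"
proof -
  show 1: "n ~= []" "successively adj n" "hd n = Co C0" "last n = Co C1"
    and 2: "!!i. i < length n - 1 ==> n ! i \<in> {Co C0} \<union> range Mi \<union> range (Ou C0)" using assms unfolding local_walks_def by blast+
  show 3: "n ! 0 = Co C0" "n ! (length n - 1) = Co C1" using 1 by (simp_all add: hd_conv_nth last_conv_nth)
  show 4: "n ! i \<in> nodes_at {C0}" if "i < length n" for i
  proof (cases "i < length n - 1")
    case True
    then show ?thesis using 2[OF True] by (auto simp: nodes_at_def)
  next
    case False
    then have "i = length n - 1" using that by simp
    then show ?thesis using 3 by (simp add: nodes_at_def)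
  qed
  then show "set n \<subseteq> nodes_at {C0}" by (auto simp: in_set_conv_nth)
  show "2 \<le> length n"
  proof (rule ccontr)
    assume "\<not> 2 \<le> length n"
    then have "length n - 1 = 0" by simp
    then show False using 3 by simp
  qed
  show "!!i. Suc i < length n ==> adj (n ! i) (n ! Suc i)" using 1(2) by (simp add: successively_nth)
qed

lemma inner_turn: "inner (y - x) (z - y) = ((dist x z)\<^sup>2 - (dist x y)\<^sup>2 - (dist y z)\<^sup>2) / 2"
  for x y z :: "'a::real_inner"
proof -
  have "z - x = (y - x) + (z - y)" by simp
  then have "(norm (z - x))\<^sup>2 = (norm (y - x))\<^sup>2 + (norm (z - y))\<^sup>2 + 2 * inner (y - x) (z - y)" by (simp only: power2_norm_eq_inner inner_add_left inner_add_right) (simp add: inner_commute)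
  then show ?thesis by (simp add: dist_norm norm_minus_commute)
qed

text \<open>Turns only involve three consecutive points around a midpoint. A common scaling factor
  is demanded for each such triple separately, because a unit copy applies different similarities to
  the two triangles.\<close>

lemma P1_eq_local_weight:
  assumes n: "n \<in> local_walks" and fr: "frame {C0} N c \<rho>" and len: "length v = length n"
    and local_sim: "!!i. 1 \<le> i ==> Suc i < length n ==> n ! i \<notin> range Co ==>
       \<exists>k. k > 0 \<and> (\<forall>j l. j \<in> {i - 1, i, Suc i} \<and> l \<in> {i - 1, i, Suc i} -->
           dist (v ! j) (v ! l) = k * dist (emb N c \<rho> (n ! j)) (emb N c \<rho> (n ! l)))"
    and corner: "!!i. 1 \<le> i ==> Suc i < length n ==> v ! i \<in> G 0 \<longleftrightarrow> n ! i \<in> range Co"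
    and zero: "!!i. 1 \<le> i ==> i < length n ==> v ! i = 0 \<longleftrightarrow> n ! i = Co C0"
  shows "P1 u v = local_weight u n"
proof -
  note lw = local_walk_props[OF n]
  have inj: "inj \<rho>" using frame_nodes(2)[OF fr] .
  have turn: "inner (v ! i - v ! (i - 1)) (v ! Suc i - v ! i) < 0 \<longleftrightarrow> n ! (i - 1) = n ! Suc i \<or> adj (n ! (i - 1)) (n ! Suc i)"
    if i: "1 \<le> i" "Suc i < length n" "n ! i \<notin> range Co" for i
  proof -
    obtain k where k: "k > 0" "!!j l. j \<in> {i - 1, i, Suc i} ==> l \<in> {i - 1, i, Suc i} ==>
           dist (v ! j) (v ! l) = k * dist (emb N c \<rho> (n ! j)) (emb N c \<rho> (n ! l))" using local_sim[OF i] by blast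
    have a: "adj (n ! (i - 1)) (n ! i)" "adj (n ! i) (n ! Suc i)" using lw(11)[of "i - 1"] lw(11)[of i] i by auto
    have "inner (v ! i - v ! (i - 1)) (v ! Suc i - v ! i) < 0 \<longleftrightarrow>
      (dist (v ! (i - 1)) (v ! Suc i))\<^sup>2 < (dist (v ! (i - 1)) (v ! i))\<^sup>2 + (dist (v ! i) (v ! Suc i))\<^sup>2" unfolding inner_turn by auto
    also have "... \<longleftrightarrow> k\<^sup>2 * (dist (emb N c \<rho> (n ! (i - 1))) (emb N c \<rho> (n ! Suc i)))\<^sup>2 < k\<^sup>2 * (2 / 4 ^ Suc N)" using k(2)[of "i - 1" "Suc i"] k(2)[of "i - 1" i] k(2)[of i "Suc i"]
      by (simp add: power_mult_distrib dist_emb_adj[OF inj a(1)] dist_emb_adj[OF inj a(2)] del: One_nat_def)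
    also have "... \<longleftrightarrow> (dist (emb N c \<rho> (n ! (i - 1))) (emb N c \<rho> (n ! Suc i)))\<^sup>2 < 2 / 4 ^ Suc N" using k(1) by (intro mult_less_cancel_left_pos) simp
    also have "... \<longleftrightarrow> n ! (i - 1) = n ! Suc i \<or> adj (n ! (i - 1)) (n ! Suc i)" by (rule dist_emb_turn[OF inj a i(3)])
    finally show ?thesis .
  qed
  have "{i. 1 \<le> i \<and> Suc i \<le> steps v \<and> inner (v ! i - v ! (i - 1)) (v ! Suc i - v ! i) < 0 \<and> v ! i \<notin> G 0}
    = {i. 1 \<le> i \<and> Suc i \<le> length n - 1 \<and> (n ! (i - 1) = n ! Suc i \<or> adj (n ! (i - 1)) (n ! Suc i)) \<and> n ! i \<notin> range Co}" using turn corner by (auto simp: steps_def len)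
  then have 1: "num_turns v = local_turns n" unfolding num_turns_def local_turns_def by simp
  have "{i. 1 \<le> i \<and> i \<le> steps v \<and> v ! i = 0} = {i. 1 \<le> i \<and> i \<le> length n - 1 \<and> n ! i = Co C0}" using zero lw(10) by (auto simp: steps_def len)
  then have 2: "num_returns v = local_returns n" unfolding num_returns_def local_returns_def by simp
  show ?thesis unfolding P1_def local_weight_def 1 2 by (simp add: steps_def len numeral_2_eq_2)
qed

text \<open>Points of level 0 have integral squared norm, whereas the midpoints in question lie at
  squared distance 1/4 or 3/4 from \<open>O\<close> after scaling. This tells them apart in every
  unit copy.\<close>

lemma G0_norm: "x \<in> G 0 ==> \<exists>k. (norm x)\<^sup>2 = real_of_int k"
proof -
  assume "x \<in> G 0"
  then obtain y where "x = pt 0 y" unfolding G_eq using vertices_of_pt by blast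
  then show ?thesis using norm_pt[of 0 y] by auto
qed

lemma emb_mid_dist:
  assumes "inj \<rho>" "n \<in> range Mi \<union> range (Ou C0)"
  shows "4 ^ N * (dist (emb N c \<rho> n) (emb N c \<rho> (Co C0)))\<^sup>2 \<in> {1/4, 3/4}"
proof -
  have "qlen (node_pos N c (relabel \<rho> n) - node_pos N c (relabel \<rho> (Co C0))) \<in> {1, 3}" using assms by (auto simp: qlen_corner_mid qlen_outer)
  then show ?thesis unfolding dist_emb by auto
qed

lemma quarter_not_int: "x \<in> {1/4, 3/4 :: real} ==> x ~= real_of_int k"
proof
  assume "x \<in> {1/4, 3/4 :: real}" "x = real_of_int k"
  then have "0 < real_of_int k" "real_of_int k < 1" by auto
  then show False by simp
qed

lemma reflect_hull_diameter:
  assumes "x \<in> reflect_y ` (convex hull {0, pt_a, pt_b})" "y \<in> reflect_y ` (convex hull {0, pt_a, pt_b})"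
  shows "dist x y \<le> 1"
proof -
  have "convex hull {0, pt_a, pt_b} = tri 0 0" by (simp add: tri_def pt_def zero_prod_def)
  then show ?thesis using assms tri_diameter[of _ 0 0] by (auto simp: reflect_isometry)
qed

lemma unit_copy_weight:
  assumes n: "n \<in> local_walks" and fr: "frame {C0} N c \<rho>"
    and copy: "is_unit_copy N (map (emb N c \<rho>) n) v"
  shows "P1 u v = local_weight u n"
proof -
  note lw = local_walk_props[OF n]
  have inj: "inj \<rho>" and c: "c \<in> cells three_cells N" using frame_nodes[OF fr] by blast+
  define z where "z = map (emb N c \<rho>) n"
  have z: "hd z = pt N (c + delta (\<rho> C0))" "last z = pt N (c + delta (\<rho> C1))" using lw(1,3,4) by (simp_all add: z_def hd_map last_map emb_Co)
  obtain \<Delta> \<Delta>' g g' where d: "\<Delta> \<in> triangles N" "\<Delta>' \<in> triangles N" "\<Delta> ~= \<Delta>'" "hd z \<in> \<Delta>" "hd z \<in> \<Delta>'" "last z \<in> \<Delta>"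
     "set z \<subseteq> \<Delta> \<union> \<Delta>'" "similarity g" "similarity g'"
     "g' ` \<Delta>' = reflect_y ` (convex hull {0, pt_a, pt_b})" "g (hd z) = 0" "g' (hd z) = 0" "g (last z) = pt_a"
     "v = map (%x. if x \<in> \<Delta> then g x else g' x) z" using copy unfolding is_unit_copy_def z_def[symmetric] by blast
  obtain s where s: "s > 0" "!!x y. dist (g x) (g y) = s * dist x y" using d(8) unfolding similarity_def by blast
  obtain s' where s': "s' > 0" "!!x y. dist (g' x) (g' y) = s' * dist x y" using d(9) unfolding similarity_def by blast
  have ne: "\<rho> C0 ~= \<rho> C1" using inj by (simp add: inj_eq)
  have na: "norm pt_a = 1" by (simp add: cmod_def pt_a_def power2_eq_square)
  have "dist (g (hd z)) (g (last z)) = 1" unfolding d(11,13) by (simp add: dist_norm na)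
  then have "s * (1 / 2 ^ N) = 1" unfolding s(2) unfolding z dist_corners[OF ne] .
  then have "s = 2 ^ N" by (simp add: field_simps)
  have D: "\<Delta> = tri N c"
  proof -
    obtain b where b: "\<Delta> = tri N b" using d(1) unfolding triangles_eq by blast
    obtain i j where "c + delta (\<rho> C0) = b + delta i" "c + delta (\<rho> C1) = b + delta j" using d(4,6) pt_tri unfolding z b by meson
    then show ?thesis using edge_cell_unique[OF _ _ ne] b by blast
  qed
  obtain c' where c': "\<Delta>' = tri N c'" using d(2) unfolding triangles_eq by blast
  \<comment> \<open>Unlike \<open>g\<close>, the map \<open>g'\<close> is prescribed at one point
    only. Its scale follows by comparing the diameters of the triangle and of its image in both
    directions.\<close>
  have "s' = 2 ^ N"
  proof (rule antisym)
    have "dist (g' (pt N (c' + delta C0))) (g' (pt N (c' + delta C1))) \<le> 1" using reflect_hull_diameter[folded d(10)] tri_corner unfolding c' by blast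
    then have "s' * (1 / 2 ^ N) \<le> 1" unfolding s'(2) by (simp only: dist_corners corner.distinct not_False_eq_True)
    then show "s' \<le> 2 ^ N" by (simp add: field_simps)
  next
    have "reflect_y 0 \<in> g' ` \<Delta>'" "reflect_y pt_a \<in> g' ` \<Delta>'" unfolding d(10) by (auto intro!: imageI hull_inc)
    then obtain x y where xy: "x \<in> \<Delta>'" "y \<in> \<Delta>'" "g' x = reflect_y 0" "g' y = reflect_y pt_a" by (metis imageE)
    have "1 = dist (g' x) (g' y)" unfolding xy reflect_isometry using na by (simp add: dist_norm)
    also have "... = s' * dist x y" using s'(2) by blast
    also have "... \<le> s' * (1 / 2 ^ N)" using tri_diameter xy s'(1) unfolding c' by (intro mult_left_mono) auto
    finally show "2 ^ N \<le> s'" by (simp add: field_simps)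
  qed
  have zi: "z ! i = emb N c \<rho> (n ! i)" if "i < length n" for i using that by (simp add: z_def)
  have vi: "v ! i = (if z ! i \<in> \<Delta> then g (z ! i) else g' (z ! i))" if "i < length n" for i using that unfolding d(14) by (simp add: z_def)
  have hdz: "hd z = emb N c \<rho> (Co C0)" unfolding z emb_Co ..
  have mi: "emb N c \<rho> (Mi k) \<in> \<Delta>" for k unfolding D by (simp add: emb_def midpoint_in_tri)
  have ou: "emb N c \<rho> (Ou C0 k) \<notin> \<Delta>" for k

  proof
    assume "emb N c \<rho> (Ou C0 k) \<in> \<Delta>"
    then have "outer_cell N c (\<rho> C0) = c" unfolding D emb_def relabel.simps node_pos.simps by (rule midpoint_tri)
    then show False using other_incident(4)[OF c, of "\<rho> C0"] fr unfolding frame_def by auto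
  qed
  have co: "emb N c \<rho> (Co k) \<in> \<Delta>" for k unfolding D emb_Co by (rule tri_corner)
  have gC: "g (emb N c \<rho> (Co C0)) = g' (emb N c \<rho> (Co C0))" using d(11,12) unfolding hdz by simp
  have dv: "dist (v ! i) 0 = 2 ^ N * dist (z ! i) (hd z)" if "i < length n" for i using vi[OF that] s(2)[of "z ! i" "hd z"] s'(2)[of "z ! i" "hd z"] unfolding d(11,12) \<open>s = 2 ^ N\<close> \<open>s' = 2 ^ N\<close>
    by auto
  show ?thesis
  proof (rule P1_eq_local_weight[OF n fr])
    show "length v = length n" unfolding d(14) z_def by simp
  next
    fix i assume i: "1 \<le> i" "Suc i < length n" "n ! i \<notin> range Co"
    have a: "adj (n ! (i - 1)) (n ! i)" "adj (n ! i) (n ! Suc i)" using lw(11)[of "i - 1"] lw(11)[of i] i by auto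
    have "n ! i \<in> range Mi \<union> range (Ou C0)" using lw(7)[of i] i by auto
    then consider k where "n ! i = Mi k" | k where "n ! i = Ou C0 k" by blast
    then show "\<exists>k. k > 0 \<and> (\<forall>j l. j \<in> {i - 1, i, Suc i} \<and> l \<in> {i - 1, i, Suc i} -->
           dist (v ! j) (v ! l) = k * dist (emb N c \<rho> (n ! j)) (emb N c \<rho> (n ! l)))"
    proof cases
      case 1
      have "n ! j \<in> range Co \<union> range Mi" if "j \<in> {i - 1, i, Suc i}" for j
      proof -
        have "m \<in> range Co \<union> range Mi" if "adj m (Mi k)" for m using that by (cases m) auto
        moreover have "m \<in> range Co \<union> range Mi" if "adj (Mi k) m" for m using that by (cases m) auto
        ultimately show ?thesis using that a 1 by auto
      qed
      then have "v ! j = g (emb N c \<rho> (n ! j))" if "j \<in> {i - 1, i, Suc i}" for j using that vi[of j] zi[of j] i co mi by fastforce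
      then show ?thesis using s by (intro exI[of _ s]) auto
    next
      case 2
      have "n ! j \<in> {Co C0} \<union> range (Ou C0)" if "j \<in> {i - 1, i, Suc i}" for j
      proof -
        have "m \<in> {Co C0} \<union> range (Ou C0)" if "adj m (Ou C0 k)" for m using that by (cases m) auto
        moreover have "m \<in> {Co C0} \<union> range (Ou C0)" if "adj (Ou C0 k) m" for m using that by (cases m) auto
        ultimately show ?thesis using that a 2 by auto
      qed
      then have "v ! j = g' (emb N c \<rho> (n ! j))" if "j \<in> {i - 1, i, Suc i}" for j using that vi[of j] zi[of j] i co ou gC by fastforce
      then show ?thesis using s' by (intro exI[of _ s']) auto
    qed
  next
    fix i assume i: "1 \<le> i" "Suc i < length n"
    then have il: "i < length n" by simp
    have "n ! i \<in> {Co C0} \<union> range Mi \<union> range (Ou C0)" using lw(7)[of i] i by auto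
    then consider "n ! i = Co C0" | "n ! i \<in> range Mi \<union> range (Ou C0)" by blast
    then show "v ! i \<in> G 0 \<longleftrightarrow> n ! i \<in> range Co"
    proof cases
      case 1
      then have "v ! i = 0" using vi[OF il] zi[OF il] d(11,12) hdz by simp
      moreover have "0 \<in> G 0" by (auto simp: G_def)
      ultimately show ?thesis using 1 by simp
    next
      case 2
      have "(norm (v ! i))\<^sup>2 = 4 ^ N * (dist (emb N c \<rho> (n ! i)) (emb N c \<rho> (Co C0)))\<^sup>2" using dv[OF il] zi[OF il] hdz by (simp add: power_mult_distrib power2_eq_square flip: power_mult_distrib)
      then have "v ! i \<notin> G 0" using emb_mid_dist[OF inj 2] quarter_not_int G0_norm by metis
      then show ?thesis using 2 by auto
    qed
  next
    fix i assume i: "1 \<le> i" "i < length n"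
    have "v ! i = 0 \<longleftrightarrow> z ! i = hd z" using dv[OF i(2)] by (metis dist_eq_0_iff mult_eq_0_iff power_not_zero zero_neq_numeral)
    also have "... \<longleftrightarrow> n ! i = Co C0" unfolding zi[OF i(2)] hdz using inj_on_eq_iff[OF emb_inj[OF fr] lw(8)[OF i(2)], of "Co C0"] by (simp add: nodes_at_def)
    finally show "v ! i = 0 \<longleftrightarrow> n ! i = Co C0" .
  qed
qed

text \<open>Justifies the choice in \<open>unit_copy\<close>. On the second triangle a similarity
  onto the right half is followed by the reflection.\<close>

lemma unit_copy_exists:
  assumes n: "n \<in> local_walks" and fr: "frame {C0} N c \<rho>"
  shows "\<exists>v. is_unit_copy N (map (emb N c \<rho>) n) v"
proof -
  note lw = local_walk_props[OF n]
  have inj: "inj \<rho>" and c: "c \<in> cells three_cells N" and reg: "regular N (c + delta (\<rho> C0))" using fr unfolding frame_def by auto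
  note oi = other_incident[OF c reg]
  define k where "k = other_incident N (c + delta (\<rho> C0)) (\<rho> C0)"
  define z where "z = map (emb N c \<rho>) n"
  have z: "hd z = pt N (c + delta (\<rho> C0))" "last z = pt N (c + delta (\<rho> C1))" using lw(1,3,4) by (simp_all add: z_def hd_map last_map emb_Co)
  have oc: "outer_cell N c (\<rho> C0) + delta k = c + delta (\<rho> C0)" using outer_corner k_def by metis
  obtain g where g: "similarity g" "g (pt N (c + delta (\<rho> C0))) = 0" "g (pt N (c + delta (\<rho> C1))) = pt_a"
    "g ` tri N c = convex hull {0, pt_a, pt_b}" using similarity_cell[OF inj] by blast
  have "inj (swap_first k)" by (simp add: inj_def)
  then obtain h where h: "similarity h" "h (pt N (outer_cell N c (\<rho> C0) + delta (swap_first k C0))) = 0"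
    "h ` tri N (outer_cell N c (\<rho> C0)) = convex hull {0, pt_a, pt_b}" using similarity_cell by blast
  have h0: "h (pt N (c + delta (\<rho> C0))) = 0" using h(2) unfolding swap_first_C0 oc .
  have hs: "similarity (%x. reflect_y (h x))" using h(1) unfolding similarity_def reflect_isometry .
  have "tri N c ~= tri N (outer_cell N c (\<rho> C0))" using midpoint_tri midpoint_in_tri oi(4) by metis
  moreover have "set z \<subseteq> tri N c \<union> tri N (outer_cell N c (\<rho> C0))"
  proof
    fix x assume "x \<in> set z"
    then obtain m where m: "m \<in> nodes_at {C0}" "x = emb N c \<rho> m" using lw(9) unfolding z_def by auto
    show "x \<in> tri N c \<union> tri N (outer_cell N c (\<rho> C0))"
    proof (cases m)
      case (Co i)
      then show ?thesis using m by (simp add: emb_Co tri_corner)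
    qed (use m in \<open>auto simp: nodes_at_def emb_def midpoint_in_tri\<close>)
  qed
  moreover have "pt N (c + delta (\<rho> C0)) \<in> tri N (outer_cell N c (\<rho> C0))" using tri_corner[of N "outer_cell N c (\<rho> C0)" k] unfolding oc .
  moreover have "(%x. reflect_y (h x)) ` tri N (outer_cell N c (\<rho> C0)) = reflect_y ` (convex hull {0, pt_a, pt_b})" unfolding h(3)[symmetric] by (rule image_image[symmetric])
  moreover have "reflect_y (h (pt N (c + delta (\<rho> C0)))) = 0" using h0 by (simp add: reflect_y_def)
  moreover note g hs cell_triangles[OF c] cell_triangles[OF oi(3)] tri_corner[of N c "\<rho> C0"] tri_corner[of N c "\<rho> C1"]
  ultimately have "is_unit_copy N z (map (%x. if x \<in> tri N c then g x else reflect_y (h x)) z)" unfolding is_unit_copy_def z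
    by (intro exI[of _ "tri N c"] exI[of _ "tri N (outer_cell N c (\<rho> C0))"] exI[of _ g] exI[of _ "%x. reflect_y (h x)"]
          conjI IntI) (assumption | rule refl)+
  then show ?thesis unfolding z_def by blast
qed

lemma P1_unit_copy:
  assumes "n \<in> local_walks" "frame {C0} N c \<rho>"
  shows "P1 u (unit_copy N (map (emb N c \<rho>) n)) = local_weight u n" unfolding unit_copy_def using someI_ex[OF unit_copy_exists[OF assms]] unit_copy_weight[OF assms] by blast


section \<open>Neighbours in local coordinates\<close>

lemma midpoint_neighbour:
  assumes "{pt (Suc N) (midpoint_of b k), z} \<in> EV (Suc N)"
  shows "(\<exists>l. l ~= k \<and> z = pt (Suc N) ((b + delta l) + (b + delta l))) \<or> (\<exists>i. i ~= k \<and> z = pt (Suc N) (midpoint_of b i))"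
proof -
  obtain i j where i: "i \<in> incident three_cells (Suc N) (midpoint_of b k)" "i ~= j" "z = pt (Suc N) (midpoint_of b k - delta i + delta j)" using edge_pt[OF assms[unfolded EV_eq]] by blast
  have ik: "i ~= k" using i(1) by (auto simp: incident_midpoint split: if_splits)
  obtain l where l: "i ~= l" "k ~= l" using third_corner by metis
  have e: "midpoint_of b k - delta i + delta j = b + b + delta l + delta j" using midpoint_of_add[OF ik l(1,2)] by simp
  show ?thesis
  proof (cases "j = l")
    case True
    then have "midpoint_of b k - delta i + delta j = (b + delta l) + (b + delta l)" unfolding e by (simp add: algebra_simps)
    then show ?thesis using i(3) l(2) by metis
  next
    case False
    then have "j = k" using i(2) ik l by (cases i; cases j; cases k; cases l) auto
    moreover have "midpoint_of b i = b + b + delta l + delta k" using midpoint_of_add[of l i k] ik l by metis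
    ultimately have "midpoint_of b k - delta i + delta j = midpoint_of b i" unfolding e by simp
    then show ?thesis using i(3) ik by metis
  qed
qed

lemma corner_neighbour:
  assumes "{pt (Suc N) (y + y), z} \<in> EV (Suc N)"
  shows "\<exists>i\<in>incident three_cells N y. \<exists>k. k ~= i \<and> z = pt (Suc N) (midpoint_of (y - delta i) k)"
proof -
  obtain i j where i: "i \<in> incident three_cells (Suc N) (y + y)" "i ~= j" "z = pt (Suc N) (y + y - delta i + delta j)" using edge_pt[OF assms[unfolded EV_eq]] by blast
  obtain l where l: "i ~= l" "j ~= l" using third_corner by metis
  have "midpoint_of (y - delta i) l = (y - delta i) + (y - delta i) + delta i + delta j" using midpoint_of_add[of i l j] i(2) l by metis
  also have "... = y + y - delta i + delta j" by (simp add: algebra_simps)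
  finally show ?thesis using i l by (metis incident_double)
qed

lemma swap_first_surj: "\<exists>j. swap_first k j = l" by (metis swap_first_def)

text \<open>All neighbours of a midpoint lie in its own cell, and at a regular corner just two cells
  contribute neighbours. What remains outside the nodes are the far corners of the outer
  cells.\<close>

lemma node_neighbour:
  assumes c: "c \<in> cells three_cells N" and reg: "!!i. i \<in> I ==> regular N (c + delta i)"
    and n: "n \<in> range Mi \<union> Co ` I \<union> {Ou i j | i j. i \<in> I}"
    and e: "{pt (Suc N) (node_pos N c n), z} \<in> EV (Suc N)"
  shows "(\<exists>m\<in>nodes_at I. adj n m \<and> z = pt (Suc N) (node_pos N c m)) \<or>
    (\<exists>i\<in>I. \<exists>l. l ~= other_incident N (c + delta i) i \<and> z = pt N (outer_cell N c i + delta l))"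
proof -
  consider i where "i \<in> I" "n = Co i" | k where "n = Mi k" | i j where "i \<in> I" "n = Ou i j" using n by blast
  then show ?thesis
  proof cases
    case (1 i)
    note oi = other_incident[OF c reg[OF 1(1)]]
    have "{pt (Suc N) ((c + delta i) + (c + delta i)), z} \<in> EV (Suc N)" using e 1 by simp
    then obtain j k where jk: "j \<in> incident three_cells N (c + delta i)" "k ~= j" "z = pt (Suc N) (midpoint_of (c + delta i - delta j) k)" using corner_neighbour by blast
    then consider "j = i" | "j = other_incident N (c + delta i) i" using oi(2) by auto
    then show ?thesis
    proof cases
      case 1
      then have "z = pt (Suc N) (node_pos N c (Mi k))" using jk(3) by simp
      moreover have "adj n (Mi k)" "Mi k \<in> nodes_at I" using 1 jk \<open>n = Co i\<close> by (auto simp: nodes_at_def)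
      ultimately show ?thesis by blast
    next
      case 2
      obtain l where l: "swap_first j l = k" using swap_first_surj by blast
      then have "l ~= C0" using jk(2) by auto
      have "z = pt (Suc N) (node_pos N c (Ou i l))" using jk(3) l 2 by (simp add: outer_cell_def)
      moreover have "adj n (Ou i l)" "Ou i l \<in> nodes_at I" using \<open>l ~= C0\<close> \<open>i \<in> I\<close> \<open>n = Co i\<close> by (auto simp: nodes_at_def)
      ultimately show ?thesis by blast
    qed
  next
    case (2 k)
    have "{pt (Suc N) (midpoint_of c k), z} \<in> EV (Suc N)" using e 2 by simp
    from midpoint_neighbour[OF this] consider l where "l ~= k" "z = pt (Suc N) (node_pos N c (Co l))"
      | i where "i ~= k" "z = pt (Suc N) (node_pos N c (Mi i))" by auto
    then show ?thesis
    proof cases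
      case (1 l)
      then have "adj n (Co l)" "Co l \<in> nodes_at I" using 2 by (auto simp: nodes_at_def)
      then show ?thesis using 1(2) by blast
    next
      case (2 i)
      then have "adj n (Mi i)" "Mi i \<in> nodes_at I" using \<open>n = Mi k\<close> by (auto simp: nodes_at_def)
      then show ?thesis using 2(2) by blast
    qed
  next
    case (3 i j)
    define b where "b = outer_cell N c i"
    define o' where "o' = other_incident N (c + delta i) i"
    have bo: "b + delta o' = c + delta i" unfolding b_def o'_def by (rule outer_corner[symmetric])
    have "{pt (Suc N) (midpoint_of b (swap_first o' j)), z} \<in> EV (Suc N)" using e 3 by (simp add: b_def o'_def)
    from midpoint_neighbour[OF this] consider l where "l ~= swap_first o' j" "z = pt (Suc N) ((b + delta l) + (b + delta l))"
      | k where "k ~= swap_first o' j" "z = pt (Suc N) (midpoint_of b k)" by auto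
    then show ?thesis
    proof cases
      case (1 l)
      show ?thesis
      proof (cases "l = o'")
        case True
        then have "j ~= C0" using 1(1) by auto
        then have "adj n (Co i)" "Co i \<in> nodes_at I" using 3 by (auto simp: nodes_at_def)
        moreover have "z = pt (Suc N) (node_pos N c (Co i))" using 1(2) unfolding True bo by simp
        ultimately show ?thesis by blast
      next
        case False
        then show ?thesis using 1(2) 3(1) unfolding pt_add_double b_def o'_def by blast
      qed
    next
      case (2 k)
      obtain l where l: "swap_first o' l = k" using swap_first_surj by blast
      then have "l ~= j" using 2 by auto
      then have "adj n (Ou i l)" "Ou i l \<in> nodes_at I" using 3 by (auto simp: nodes_at_def)
      moreover have "z = pt (Suc N) (node_pos N c (Ou i l))" using 2(2) l by (simp add: b_def o'_def)
      ultimately show ?thesis by blast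
    qed
  qed
qed

lemma relabel_surj: "inj \<rho> ==> \<exists>m. relabel \<rho> m = n"
proof -
  assume "inj \<rho>"
  have "finite (UNIV :: corner set)" by (rule finite_subset[of _ "{C0, C1, C2}"]) (use corner.exhaust in auto)
  then have "surj \<rho>" using \<open>inj \<rho>\<close> finite_UNIV_inj_surj by blast
  then have s: "\<exists>j. \<rho> j = i" for i by (metis surjD)
  show ?thesis
  proof (cases n)
    case (Co i)
    then show ?thesis using s[of i] relabel.simps(1) by metis
  next
    case (Mi i)
    then show ?thesis using s[of i] relabel.simps(2) by metis
  next
    case (Ou i j)
    then show ?thesis using s[of i] relabel.simps(3) by metis
  qed
qed

lemma nodes_at_relabel: "inj \<rho> ==> relabel \<rho> m \<in> nodes_at (\<rho> ` I) ==> m \<in> nodes_at I" by (cases m) (auto simp: nodes_at_def inj_eq)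

text \<open>The nodes are left only through a far corner of the second cell. That is a coarse vertex
  different from both ends of the step, so a piece of a path cannot go there.\<close>

lemma emb_neighbour:
  assumes fr: "frame {C0} N c \<rho>" and n: "n \<in> {Co C0} \<union> range Mi \<union> range (Ou C0)"
    and e: "{emb N c \<rho> n, z} \<in> EV (Suc N)"
  shows "(\<exists>m\<in>nodes_at {C0}. adj n m \<and> z = emb N c \<rho> m) \<or>
     (z \<in> GV N \<and> z ~= emb N c \<rho> (Co C0) \<and> z ~= emb N c \<rho> (Co C1))"
proof -
  note frn = frame_nodes[OF fr]
  have n': "relabel \<rho> n \<in> range Mi \<union> Co ` (\<rho> ` {C0}) \<union> {Ou i j | i j. i \<in> \<rho> ` {C0}}" using n by auto
  have "(\<exists>m\<in>nodes_at (\<rho> ` {C0}). adj (relabel \<rho> n) m \<and> z = pt (Suc N) (node_pos N c m)) \<or>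
    (\<exists>i\<in>\<rho> ` {C0}. \<exists>l. l ~= other_incident N (c + delta i) i \<and> z = pt N (outer_cell N c i + delta l))" by (rule node_neighbour[OF frn(1,3) n' e[unfolded emb_def]])
  then show ?thesis
  proof
    assume "\<exists>m\<in>nodes_at (\<rho> ` {C0}). adj (relabel \<rho> n) m \<and> z = pt (Suc N) (node_pos N c m)"
    then obtain m where m: "relabel \<rho> m \<in> nodes_at (\<rho> ` {C0})" "adj (relabel \<rho> n) (relabel \<rho> m)" "z = emb N c \<rho> m" using relabel_surj[OF frn(2)] unfolding emb_def by metis
    then show ?thesis using nodes_at_relabel[OF frn(2)] adj_relabel[OF frn(2)] by blast
  next
    assume "\<exists>i\<in>\<rho> ` {C0}. \<exists>l. l ~= other_incident N (c + delta i) i \<and> z = pt N (outer_cell N c i + delta l)"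
    then obtain l where l: "l ~= other_incident N (c + delta (\<rho> C0)) (\<rho> C0)" "z = pt N (outer_cell N c (\<rho> C0) + delta l)" by blast
    have reg: "regular N (c + delta (\<rho> C0))" using fr unfolding frame_def by blast
    note oi = other_incident[OF frn(1) reg]
    have "z \<in> GV N" unfolding l(2) GV_eq vertices_of_def using oi(3) by blast
    moreover have "z ~= emb N c \<rho> (Co C0)" using l outer_corner[of c "\<rho> C0" N] unfolding emb_Co by (metis add_left_cancel delta_inj pt_inj)
    moreover have "z ~= emb N c \<rho> (Co C1)"
    proof
      assume "z = emb N c \<rho> (Co C1)"
      then have "outer_cell N c (\<rho> C0) + delta l = c + delta (\<rho> C1)" using l(2) unfolding emb_Co by simp
      then have "outer_cell N c (\<rho> C0) = c" using edge_cell_unique[of "outer_cell N c (\<rho> C0)" "other_incident N (c + delta (\<rho> C0)) (\<rho> C0)" c "\<rho> C0" l "\<rho> C1"]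
          outer_corner[of c "\<rho> C0" N] l(1) by metis
      then show False using oi(4) by blast
    qed
    ultimately show ?thesis by blast
  qed
qed

text \<open>By induction along the path: a coarse vertex other than the start is allowed only at the
  last time, which excludes the far corners in \<open>emb_neighbour\<close>.\<close>

lemma piece_is_local:
  assumes fr: "frame {C0} N c \<rho>" and path: "nn_path (EV (Suc N)) z" and hd: "hd z = emb N c \<rho> (Co C0)"
    and last: "last z = emb N c \<rho> (Co C1)" and inner: "!!i. i < steps z ==> z ! i \<in> GV N ==> z ! i = hd z"
  shows "\<exists>n\<in>local_walks. z = map (emb N c \<rho>) n"
proof -
  define f where "f = inv_into (nodes_at {C0}) (emb N c \<rho>)"
  have f: "f (emb N c \<rho> m) = m" if "m \<in> nodes_at {C0}" for m unfolding f_def using inv_into_f_f[OF emb_inj[OF fr] that] .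
  have z: "z ~= []" "!!i. Suc i < length z ==> {z ! i, z ! Suc i} \<in> EV (Suc N)" using path unfolding nn_path_def successively_nth by auto
  let ?A = "{Co C0} \<union> range Mi \<union> range (Ou C0)"
  have A: "?A \<subseteq> nodes_at {C0}" by (auto simp: nodes_at_def)
  have step: "f (z ! Suc i) \<in> nodes_at {C0} \<and> z ! Suc i = emb N c \<rho> (f (z ! Suc i)) \<and> adj (f (z ! i)) (f (z ! Suc i)) \<and>
     (Suc i < steps z --> f (z ! Suc i) \<in> ?A)"
    if i: "Suc i < length z" "f (z ! i) \<in> ?A" "z ! i = emb N c \<rho> (f (z ! i))" for i
  proof -
    have "{emb N c \<rho> (f (z ! i)), z ! Suc i} \<in> EV (Suc N)" using z(2)[OF i(1)] i(3) by simp
    from emb_neighbour[OF fr i(2) this] show ?thesis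
    proof
      assume "\<exists>m\<in>nodes_at {C0}. adj (f (z ! i)) m \<and> z ! Suc i = emb N c \<rho> m"
      then obtain m where m: "m \<in> nodes_at {C0}" "adj (f (z ! i)) m" "z ! Suc i = emb N c \<rho> m" by blast
      have "m \<in> ?A" if "Suc i < steps z"
      proof (cases "m \<in> range Co")
        case True
        have "z ! Suc i \<in> GV N" unfolding m(3) emb_GV[OF fr m(1)] by (rule True)
        then have "z ! Suc i = hd z" by (rule inner[OF that])
        then have "emb N c \<rho> m = emb N c \<rho> (Co C0)" unfolding m(3) hd .
        then have "m = Co C0" by (rule inj_onD[OF emb_inj[OF fr]]) (use m(1) in \<open>simp_all add: nodes_at_def\<close>)
        then show ?thesis by simp
      next
        case False
        then show ?thesis using m(1) by (auto simp: nodes_at_def)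
      qed
      then show ?thesis using m f[OF m(1)] by simp
    next
      assume *: "z ! Suc i \<in> GV N \<and> z ! Suc i ~= emb N c \<rho> (Co C0) \<and> z ! Suc i ~= emb N c \<rho> (Co C1)"
      show ?thesis
      proof (cases "Suc i < steps z")
        case True
        then show ?thesis using inner[OF True] * hd by simp
      next
        case False
        then have "Suc i = length z - 1" using i(1) by (simp add: steps_def)
        then have "z ! Suc i = last z" using z(1) last_conv_nth by metis
        then show ?thesis using * last by simp
      qed
    qed
  qed
  have inv: "i < length z ==> f (z ! i) \<in> nodes_at {C0} \<and> z ! i = emb N c \<rho> (f (z ! i)) \<and> (i < steps z --> f (z ! i) \<in> ?A)" for i
  proof (induction i)
    case 0
    have "z ! 0 = emb N c \<rho> (Co C0)" using hd z(1) by (simp add: hd_conv_nth)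
    then show ?case using f[of "Co C0"] by (simp add: nodes_at_def)
  next
    case (Suc i)
    then have "i < steps z" by (simp add: steps_def)
    then show ?case using step[of i] Suc by simp
  qed
  have "map f z \<in> local_walks" unfolding local_walks_def
  proof (intro CollectI conjI allI impI)
    show "map f z ~= []" using z by simp
    show "successively adj (map f z)" unfolding successively_nth
    proof (intro allI impI)
      fix i assume "Suc i < length (map f z)"
      then have i: "Suc i < length z" by simp
      then have "i < steps z" "i < length z" by (simp_all add: steps_def)
      then show "adj (map f z ! i) (map f z ! Suc i)" using step[OF i] inv[of i] i by simp
    qed
    show "hd (map f z) = Co C0" using z(1) hd f[of "Co C0"] by (simp add: hd_map nodes_at_def)
    show "last (map f z) = Co C1" using z(1) last f[of "Co C1"] by (simp add: last_map nodes_at_def)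
    fix i assume "i < length (map f z) - 1"
    then have "i < steps z" "i < length z" by (simp_all add: steps_def)
    then show "map f z ! i \<in> ?A" using inv[of i] by simp
  qed
  moreover have "z = map (emb N c \<rho>) (map f z)" by (rule nth_equalityI) (use inv in auto)
  ultimately show ?thesis by blast
qed

subsection \<open>Two cells against three cells\<close>

lemma incident_zero: "incident two_cells 0 (0, 0) = {C0, C2}" "incident three_cells 0 (0, 0) = {C0, C2}"
  "incident three_cells 0 (0, 1) = {C0, C2}" unfolding incident_def cells.simps(1) set_eq_iff all_corner mem_Collect_eq delta.simps diff_Pair by simp_all

text \<open>Away from the boundary the vertex already belongs to two cells of the smaller gasket.
  The larger one could only add the third corner index, which \<open>incident_three_not_all\<close>
  excludes.\<close>

lemma incident_two_three:
  assumes "incident two_cells N y ~= {}" "pt N y \<notin> G 0 - {0}"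
  shows "incident two_cells N y = incident three_cells N y" "regular N y"
proof -
  have "\<exists>k. incident two_cells N y = - {k}" using assms(1)
  proof (cases rule: incident_cases)
    case (2 y0)
    have "pt 0 y0 \<in> G 0" unfolding G_eq pt_vertices_of using 2(2) assms(1) by simp
    then have "pt 0 y0 = 0" using assms(2) unfolding 2(1) pt_scale by blast
    then have "y0 = (0, 0)" using pt_zero[of 0] pt_inj[of 0 y0 0] by (simp add: zero_prod_def)
    then have "incident two_cells N y = - {C1}" using 2(2) incident_zero(1) by (simp add: compl_corner)
    then show ?thesis by blast
  qed blast
  then obtain k where k: "incident two_cells N y = - {k}" by blast
  moreover have "incident two_cells N y \<subseteq> incident three_cells N y" by (rule incident_mono) auto
  moreover have "incident three_cells N y ~= UNIV" by (rule incident_three_not_all)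
  ultimately show e: "incident two_cells N y = incident three_cells N y" by auto
  show "regular N y" unfolding regular_def e[symmetric] k by (cases k) (auto simp: compl_corner)
qed

lemma G_GV: "G N \<subseteq> GV N" by (auto simp: GV_def)

lemma E_EV: "E N \<subseteq> EV N" by (auto simp: EV_def)

lemma EV_E:
  assumes "{pt N y, z} \<in> EV N" "incident two_cells N y = incident three_cells N y"
  shows "{pt N y, z} \<in> E N"
proof -
  obtain i j where i: "i \<in> incident three_cells N y" "i ~= j" "z = pt N (y - delta i + delta j)" using edge_pt[OF assms(1)[unfolded EV_eq]] by blast
  then have "y - delta i \<in> cells two_cells N" using assms(2) by (auto simp: incident_def)
  then have "{pt N (y - delta i + delta i), pt N (y - delta i + delta j)} \<in> cell_edges two_cells N" using i(2) by (rule pt_edge)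
  then show ?thesis using i(3) unfolding E_eq by simp
qed

lemma GV_G:
  assumes "x \<in> GV M" "x \<in> G N" "M \<le> N"
  shows "x \<in> G M" using assms(3,2)
proof (induction N rule: dec_induct)
  case (step N)
  have "x \<in> GV N" using assms(1) GV_mono[OF step(1)] by blast
  then obtain y where y: "x = pt N y" unfolding GV_eq using vertices_of_pt by blast
  have "incident two_cells (Suc N) (y + y) ~= {}" using step(4) unfolding y G_eq pt_add_double[of N y, symmetric] pt_vertices_of .
  then show ?case using step(3) unfolding y G_eq pt_vertices_of incident_double by blast
qed

definition frame_W :: "nat => int \<times> int => (corner => corner) => bool" where
  "frame_W N c \<rho> \<longleftrightarrow> frame {C0} N c \<rho> \<and> c \<in> cells two_cells N \<and> outer_cell N c (\<rho> C0) \<in> cells two_cells N"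

text \<open>At a start away from the boundary both incident cells belong to the smaller gasket by
  \<open>incident_two_three\<close>, and the edge fixes the labels of entry and exit.\<close>

lemma frame_W_edge:
  assumes e: "{x, y} \<in> E N" and x: "x \<notin> G 0 - {0}"
  obtains c \<rho> where "frame_W N c \<rho>" "x = pt N (c + delta (\<rho> C0))" "y = pt N (c + delta (\<rho> C1))"
proof -
  have "x \<in> G N" using edge_vertices e unfolding E_eq G_eq by blast
  then obtain v where v: "x = pt N v" unfolding G_eq using vertices_of_pt by blast
  then have ne: "incident two_cells N v ~= {}" using \<open>x \<in> G N\<close> unfolding G_eq by (simp add: pt_vertices_of)
  note it = incident_two_three[OF ne x[unfolded v]]
  obtain i j where ij: "i \<in> incident two_cells N v" "i ~= j" "y = pt N (v - delta i + delta j)" using edge_pt[of N v y two_cells] e unfolding v E_eq by blast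
  define c where "c = v - delta i"
  have c: "c \<in> cells two_cells N" using ij(1) by (simp add: c_def incident_def)
  then have c3: "c \<in> cells three_cells N" using cells_mono[of two_cells three_cells N] by auto
  obtain l where l: "i ~= l" "j ~= l" using third_corner by metis
  define \<rho> where "\<rho> = (%k. case k of C0 => i | C1 => j | C2 => l)"
  have "inj \<rho>" unfolding inj_def all_corner \<rho>_def using ij(2) l by simp
  moreover have "regular N (c + delta (\<rho> C0))" using it(2) by (simp add: \<rho>_def c_def)
  ultimately have fr: "frame {C0} N c \<rho>" using c3 by (simp add: frame_def)
  have "other_incident N (c + delta i) i \<in> incident three_cells N v" using other_incident(2)[OF c3, of i] it(2) by (simp add: c_def)
  then have "outer_cell N c (\<rho> C0) \<in> cells two_cells N" unfolding it(1)[symmetric] by (simp add: \<rho>_def outer_cell_def incident_def c_def)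
  then show ?thesis using that[of c \<rho>] fr c v ij(3) by (simp add: frame_W_def \<rho>_def c_def)
qed

lemma frame_W_incident:
  assumes fr: "frame_W N c \<rho>" and n: "n \<in> {Co C0} \<union> range Mi \<union> range (Ou C0)" and x: "pt N (c + delta (\<rho> C0)) \<notin> G 0 - {0}"
  shows "incident two_cells (Suc N) (node_pos N c (relabel \<rho> n)) = incident three_cells (Suc N) (node_pos N c (relabel \<rho> n))"
    and "emb N c \<rho> n \<in> G (Suc N)"
proof -
  have c: "c \<in> cells two_cells N" "outer_cell N c (\<rho> C0) \<in> cells two_cells N" using fr by (auto simp: frame_W_def)
  have "\<rho> C0 \<in> incident two_cells N (c + delta (\<rho> C0))" using c by (simp add: incident_def)
  then have ne: "incident two_cells N (c + delta (\<rho> C0)) ~= {}" by blast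
  have c3: "c \<in> cells three_cells N" "outer_cell N c (\<rho> C0) \<in> cells three_cells N" using cells_mono[of two_cells three_cells N] c by auto
  show "incident two_cells (Suc N) (node_pos N c (relabel \<rho> n)) = incident three_cells (Suc N) (node_pos N c (relabel \<rho> n))" using n incident_two_three(1)[OF ne x] c c3 by (auto simp: incident_double incident_midpoint)
  show "emb N c \<rho> n \<in> G (Suc N)" unfolding G_eq emb_def pt_vertices_of using n ne c by (auto simp: incident_double incident_midpoint compl_single)
qed

lemma frame_W_path:
  assumes fr: "frame_W N c \<rho>" and n: "n \<in> local_walks" and x: "pt N (c + delta (\<rho> C0)) \<notin> G 0 - {0}"
  shows "nn_path (E (Suc N)) (map (emb N c \<rho>) n)" unfolding nn_path_def successively_nth
proof (intro conjI allI impI)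
  note lw = local_walk_props[OF n]
  show "map (emb N c \<rho>) n ~= []" using lw(1) by simp
  fix i assume "Suc i < length (map (emb N c \<rho>) n)"
  then have i: "i < length n - 1" "Suc i < length n" "i < length n" by auto
  have "{emb N c \<rho> (n ! i), emb N c \<rho> (n ! Suc i)} \<in> EV (Suc N)" using emb_edge fr lw(8,11) i unfolding frame_W_def by blast
  then have "{emb N c \<rho> (n ! i), emb N c \<rho> (n ! Suc i)} \<in> E (Suc N)" unfolding emb_def by (rule EV_E) (rule frame_W_incident(1)[OF fr lw(7)[OF i(1)] x])
  then show "{map (emb N c \<rho>) n ! i, map (emb N c \<rho>) n ! Suc i} \<in> E (Suc N)" using i by simp
qed

subsection \<open>The unit figure\<close>

definition emb0 :: "node => complex" where "emb0 = emb 0 (0, 0) id"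

lemma pt_corners: "pt 0 (0, 0) = 0" "pt 0 (1, 0) = pt_a" "pt 0 (0, 1) = pt_b" by (auto simp: pt_def)

lemma emb0_Co: "emb0 (Co C0) = 0" "emb0 (Co C1) = pt_a" "emb0 (Co C2) = pt_b" by (simp_all add: emb0_def emb_Co pt_corners)

lemma frame0: "frame {C0, C2} 0 (0, 0) id" "frame {C0} 0 (0, 0) id" by (auto simp: frame_def regular_def incident_zero)

lemma frame0_W: "frame_W 0 (0, 0) id"
proof -
  have z: "(0, 0) + delta C0 = (0, 0)" by simp
  have "other_incident 0 (0, 0) C0 \<in> incident three_cells 0 (0, 0)" using other_incident(2)[of "(0,0)" 0 C0] frame0(2) unfolding z by (auto simp: frame_def zero_prod_def)
  then have "(0, 0) - delta (other_incident 0 (0, 0) C0) \<in> cells two_cells 0" unfolding incident_zero(2) unfolding incident_zero(1)[symmetric] incident_def mem_Collect_eq .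
  then have "outer_cell 0 (0, 0) (id C0) \<in> cells two_cells 0" unfolding outer_cell_def id_apply z .
  then show ?thesis using frame0(2) unfolding frame_W_def by simp
qed

text \<open>Before its end a path of \<open>W 1\<close> meets level 0 only in returns to
  \<open>O\<close>, so it is a single piece and \<open>piece_is_local\<close> applies.\<close>

lemma W_1_eq: "W 1 = map emb0 ` local_walks"
proof (intro equalityI subsetI)
  fix w assume w: "w \<in> W 1"
  have path: "nn_path (E (Suc 0)) w" and hd: "hd w = 0" and last: "last w = pt_a"
    and av: "!!i. i < steps w ==> w ! i \<notin> G 0 - {0}" using w by (auto simp: W_def)
  have "w ! i = hd w" if i: "i < steps w" "w ! i \<in> GV 0" for i
  proof -
    have "{w ! i, w ! Suc i} \<in> E (Suc 0)" using path i by (simp add: nn_path_def successively_nth steps_def)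
    then have "w ! i \<in> G (Suc 0)" using edge_vertices unfolding E_eq G_eq by blast
    then have "w ! i \<in> G 0" using GV_G[OF i(2)] by simp
    then have "w ! i = 0" using av[OF i(1)] by blast
    then show ?thesis using hd by simp
  qed
  moreover have "nn_path (EV (Suc 0)) w" using path E_EV[of "Suc 0"] unfolding nn_path_def successively_nth by blast
  ultimately show "w \<in> map emb0 ` local_walks" using piece_is_local[OF frame0(2), of w] hd last emb0_Co unfolding emb0_def by (simp add: image_iff)
next
  fix w assume "w \<in> map emb0 ` local_walks"
  then obtain n where n: "n \<in> local_walks" "w = map (emb 0 (0, 0) id) n" by (auto simp: emb0_def)
  note lw = local_walk_props[OF n(1)]
  have x: "pt 0 ((0, 0) + delta (id C0)) \<notin> G 0 - {0}" by (simp add: pt_corners)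
  have "nn_path (E (Suc 0)) w" unfolding n(2) by (rule frame_W_path[OF frame0_W n(1) x])
  moreover have "hd w = 0" "last w = pt_a" using lw(1,3,4) emb0_Co unfolding n(2) emb0_def by (simp_all add: hd_map last_map)
  moreover have "w ! i \<notin> G 0 - {0}" if "i < steps w" for i
  proof
    assume *: "w ! i \<in> G 0 - {0}"
    have i: "i < length n - 1" "i < length n" using that unfolding n(2) steps_def by auto
    have "emb 0 (0, 0) id (n ! i) \<in> GV 0" using * G_GV[of 0] i n(2) by auto
    then have "n ! i \<in> range Co" using emb_GV[OF frame0(2) lw(8)[OF i(2)]] by simp
    then have "n ! i = Co C0" using lw(7)[OF i(1)] by auto
    then have "w ! i = 0" using emb0_Co(1) i n(2) by (simp add: emb0_def)
    then show False using * by simp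
  qed
  ultimately show "w \<in> W 1" by (simp add: W_def)
qed

lemma emb0_inj: "inj_on emb0 (nodes_at {C0, C2})" unfolding emb0_def by (rule emb_inj[OF frame0(1)])

lemma map_emb0_inj: "inj_on (map emb0) local_walks"
proof -
  have "inj_on emb0 (nodes_at {C0})" using emb0_inj by (rule inj_on_subset) (auto simp: nodes_at_def)
  then have "inj_on (map emb0) (lists (nodes_at {C0}))" by (rule inj_on_mapI[OF inj_on_subset]) auto
  then show ?thesis by (rule inj_on_subset) (use local_walk_props(9) in auto)
qed

lemma P1_emb0:
  assumes n: "n \<in> local_walks"
  shows "P1 u (map emb0 n) = local_weight u n"
proof (rule P1_eq_local_weight[OF n frame0(2)])
  note lw = local_walk_props[OF n]
  fix i assume i: "1 \<le> i" "Suc i < length n"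
  then have i': "i < length n" "i < length n - 1" by auto
  show "\<exists>k>0. \<forall>j l. j \<in> {i - 1, i, Suc i} \<and> l \<in> {i - 1, i, Suc i} -->
          dist (map emb0 n ! j) (map emb0 n ! l) = k * dist (emb 0 (0, 0) id (n ! j)) (emb 0 (0, 0) id (n ! l))" using i by (intro exI[of _ 1]) (auto simp: emb0_def)
  show "map emb0 n ! i \<in> G 0 \<longleftrightarrow> n ! i \<in> range Co"
  proof
    assume "map emb0 n ! i \<in> G 0"
    then show "n ! i \<in> range Co" using emb_GV[OF frame0(2) lw(8)[OF i'(1)]] G_GV[of 0] i' by (auto simp: emb0_def)
  next
    assume "n ! i \<in> range Co"
    then have "n ! i = Co C0" using lw(7)[OF i'(2)] by auto
    then show "map emb0 n ! i \<in> G 0" using i' emb0_Co(1) by (simp add: G_def)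
  qed
next
  fix i assume i: "1 \<le> i" "i < length n"
  then show "map emb0 n ! i = 0 \<longleftrightarrow> n ! i = Co C0" using inj_on_eq_iff[OF emb0_inj, of "n ! i" "Co C0"] local_walk_props(8)[OF n i(2)] emb0_Co(1) by (auto simp: nodes_at_def)
qed simp

subsection \<open>Embedding along an edge\<close>

text \<open>An oriented edge determines its cell and two of the labels, hence the third as well. The
  choice is thus unique, see \<open>edge_emb_eq\<close>.\<close>

definition edge_emb :: "nat => complex => complex => node => complex" where
  "edge_emb N x y = (SOME f. \<exists>c \<rho>. inj \<rho> \<and> x = pt N (c + delta (\<rho> C0)) \<and> y = pt N (c + delta (\<rho> C1)) \<and> f = emb N c \<rho>)"

lemma third_corner_unique:
  fixes k l :: corner
  assumes "k ~= i" "k ~= j" "l ~= i" "l ~= j" "i ~= j"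
  shows "k = l" using assms by (cases k; cases l; cases i; cases j) simp_all

lemma frame_determined:
  fixes \<rho> \<rho>' :: "corner => corner"
  assumes "inj \<rho>" "inj \<rho>'" "\<rho> C0 = \<rho>' C0" "\<rho> C1 = \<rho>' C1"
  shows "\<rho> = \<rho>'"
proof
  fix k
  have "\<rho> C2 ~= \<rho> C0" "\<rho> C2 ~= \<rho> C1" "\<rho>' C2 ~= \<rho> C0" "\<rho>' C2 ~= \<rho> C1" "\<rho> C0 ~= \<rho> C1" using assms by (metis corner.distinct injD)+
  then have "\<rho> C2 = \<rho>' C2" by (rule third_corner_unique)
  then show "\<rho> k = \<rho>' k" using assms by (cases k) auto
qed

lemma edge_emb_eq:
  assumes "inj \<rho>"
  shows "edge_emb N (pt N (c + delta (\<rho> C0))) (pt N (c + delta (\<rho> C1))) = emb N c \<rho>" unfolding edge_emb_def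
proof (rule some_equality)
  show "\<exists>c' \<rho>'. inj \<rho>' \<and> pt N (c + delta (\<rho> C0)) = pt N (c' + delta (\<rho>' C0)) \<and>
      pt N (c + delta (\<rho> C1)) = pt N (c' + delta (\<rho>' C1)) \<and> emb N c \<rho> = emb N c' \<rho>'" using assms by blast
next
  fix f assume "\<exists>c' \<rho>'. inj \<rho>' \<and> pt N (c + delta (\<rho> C0)) = pt N (c' + delta (\<rho>' C0)) \<and>
      pt N (c + delta (\<rho> C1)) = pt N (c' + delta (\<rho>' C1)) \<and> f = emb N c' \<rho>'"
  then obtain c' \<rho>' where *: "inj \<rho>'" "c + delta (\<rho> C0) = c' + delta (\<rho>' C0)" "c + delta (\<rho> C1) = c' + delta (\<rho>' C1)"
    "f = emb N c' \<rho>'" by auto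
  have "\<rho> C0 ~= \<rho> C1" using assms by (simp add: inj_eq)
  then have "c = c'" "\<rho> C0 = \<rho>' C0" "\<rho> C1 = \<rho>' C1" using edge_cell_unique[OF *(2,3)] by auto
  then show "f = emb N c \<rho>" using frame_determined[OF assms *(1)] *(4) by simp
qed


subsection \<open>Hitting times\<close>

definition next_hits :: "nat => path => nat => nat set" where
  "next_hits M w t = {j. t < j \<and> j < length w \<and> w ! j \<in> GV M - {w ! t}}"

lemma hit_Suc_enat:
  assumes "hit M w i = enat t"
  shows "hit M w (Suc i) = (if next_hits M w t = {} then \<infinity> else enat (LEAST j. j \<in> next_hits M w t))"
proof -
  have e: "hit M w (Suc i) = Inf (enat ` next_hits M w t)" using assms by (auto simp: next_hits_def intro!: arg_cong[of _ _ Inf])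
  show ?thesis
  proof (cases "next_hits M w t = {}")
    case True
    then show ?thesis using e by (simp add: top_enat_def)
  next
    case False
    then obtain j0 where j0: "j0 \<in> next_hits M w t" by blast
    have "Inf (enat ` next_hits M w t) = enat (LEAST j. j \<in> next_hits M w t)"
    proof (rule antisym)
      show "Inf (enat ` next_hits M w t) \<le> enat (LEAST j. j \<in> next_hits M w t)" by (rule Inf_lower) (use LeastI[of "%j. j \<in> next_hits M w t", OF j0] in blast)
      show "enat (LEAST j. j \<in> next_hits M w t) \<le> Inf (enat ` next_hits M w t)" by (rule Inf_greatest) (auto intro: Least_le)
    qed
    then show ?thesis using e False by simp
  qed
qed

lemma hit_Suc_infinity: "hit M w i = \<infinity> ==> hit M w (Suc i) = \<infinity>" by (simp add: top_enat_def)

lemma hit_finite_mono: "hit M w j < \<infinity> ==> i \<le> j ==> hit M w i < \<infinity>"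
proof (induction j)
  case (Suc j)
  have "hit M w j ~= \<infinity>" using hit_Suc_infinity[of M w j] Suc.prems(1) by fastforce
  then show ?case using Suc by (cases "i = Suc j") (auto simp: le_Suc_eq simp del: hit.simps(2))
qed auto

lemma hit_step:
  assumes "hit M w (Suc i) < \<infinity>"
  obtains t t' where "hit M w i = enat t" "hit M w (Suc i) = enat t'" "t' \<in> next_hits M w t"
    "!!j. j \<in> next_hits M w t ==> t' \<le> j"
proof -
  obtain t where t: "hit M w i = enat t" using assms hit_Suc_infinity[of M w i] by (cases "hit M w i") (auto simp del: hit.simps(2))
  have ne: "next_hits M w t ~= {}" using hit_Suc_enat[OF t] assms by (auto split: if_splits simp del: hit.simps(2))
  then show ?thesis using that[OF t] hit_Suc_enat[OF t] LeastI_ex[of "%j. j \<in> next_hits M w t"]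
      Least_le[of "%j. j \<in> next_hits M w t"] by auto
qed

lemma hit_ge: "hit M w i = enat t ==> i \<le> t"
proof (induction i arbitrary: t)
  case (Suc i)
  obtain s t' where "hit M w i = enat s" "hit M w (Suc i) = enat t'" "t' \<in> next_hits M w s" using hit_step[of M w i] Suc.prems by (metis enat_ord_simps(4) enat.distinct(2))
  then show ?case using Suc.IH[of s] Suc.prems by (auto simp: next_hits_def simp del: hit.simps(2))
qed simp

lemma hit_length: "w ~= [] ==> hit M w i = enat t ==> t < length w"
proof (cases i)
  case (Suc k)
  assume "hit M w i = enat t"
  then show ?thesis using hit_step[of M w k] Suc by (metis (no_types, lifting) enat.inject enat_ord_simps(4) mem_Collect_eq next_hits_def enat.distinct(2))
qed (auto simp: zero_enat_def)

text \<open>The hitting time with index \<open>i\<close> is at least \<open>i\<close>, so only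
  finitely many are finite and the maximum in \<open>last_hit\<close> is attained.\<close>

lemma hits_finite:
  assumes "w ~= []"
  shows "hit M w i < \<infinity> \<longleftrightarrow> i \<le> last_hit M w"
proof -
  let ?A = "{i. hit M w i < \<infinity>}"
  have fin: "finite ?A"
  proof (rule finite_subset[of _ "{..length w}"])
    show "?A \<subseteq> {..length w}"
    proof
      fix i assume "i \<in> ?A"
      then obtain t where t: "hit M w i = enat t" by auto
      show "i \<in> {..length w}" using hit_ge[OF t] hit_length[OF assms t] by simp
    qed
  qed simp
  have "0 \<in> ?A" by (simp add: zero_enat_def)
  then have "last_hit M w \<in> ?A" unfolding last_hit_def using fin by (intro Max_in) blast+
  then show ?thesis using hit_finite_mono[of M w "last_hit M w" i] Max_ge[OF fin, of i] unfolding last_hit_def[symmetric] by auto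
qed

lemma hit_T: "w ~= [] ==> i \<le> last_hit M w ==> hit M w i = enat (T M w i)" using hits_finite[of w M i] by (auto simp: T_def)

lemma T_0 [simp]: "T M w 0 = 0" by (simp add: T_def zero_enat_def)

lemma T_length: "w ~= [] ==> i \<le> last_hit M w ==> T M w i < length w" using hit_T hit_length by metis

lemma T_Suc:
  assumes "w ~= []" "Suc i \<le> last_hit M w"
  shows "T M w i < T M w (Suc i)" "w ! T M w (Suc i) \<in> GV M" "w ! T M w (Suc i) ~= w ! T M w i"
    "!!j. T M w i < j ==> j < T M w (Suc i) ==> w ! j \<in> GV M ==> w ! j = w ! T M w i"
proof -
  have f: "hit M w (Suc i) < \<infinity>" using hits_finite assms by blast
  obtain t t' where t: "hit M w i = enat t" "hit M w (Suc i) = enat t'" "t' \<in> next_hits M w t"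
    "!!j. j \<in> next_hits M w t ==> t' \<le> j" using hit_step[OF f] by blast
  have T: "T M w i = t" "T M w (Suc i) = t'" using t unfolding T_def by (simp_all del: hit.simps(2))
  show "T M w i < T M w (Suc i)" "w ! T M w (Suc i) \<in> GV M" "w ! T M w (Suc i) ~= w ! T M w i" unfolding T using t(3) by (auto simp: next_hits_def)
  fix j assume j: "T M w i < j" "j < T M w (Suc i)" "w ! j \<in> GV M"
  have "j \<notin> next_hits M w t" using t(4)[of j] j unfolding T by auto
  moreover have "j < length w" using j t(3) unfolding T by (auto simp: next_hits_def)
  ultimately show "w ! j = w ! T M w i" using j unfolding T by (auto simp: next_hits_def)
qed

lemma no_hit_after:
  assumes "w ~= []" "T M w (last_hit M w) < j" "j < length w" "w ! j \<in> GV M"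
  shows "w ! j = w ! T M w (last_hit M w)"
proof (rule ccontr)
  assume "w ! j ~= w ! T M w (last_hit M w)"
  then have "j \<in> next_hits M w (T M w (last_hit M w))" using assms by (auto simp: next_hits_def)
  then have "hit M w (Suc (last_hit M w)) < \<infinity>" using hit_Suc_enat[OF hit_T[OF assms(1) order_refl]] by (auto simp del: hit.simps(2))
  then show False unfolding hits_finite[OF assms(1)] by simp
qed

lemma T_mono:
  assumes "w ~= []" "i < j" "j \<le> last_hit M w"
  shows "T M w i < T M w j" using assms(2,3)
proof (induction j)
  case (Suc j)
  then have "T M w j < T M w (Suc j)" using T_Suc(1)[OF assms(1)] by blast
  then show ?case using Suc by (cases "i = j") (auto intro: less_trans)
qed simp

lemma Q_nth: "i \<le> last_hit M w ==> Q M w ! i = w ! T M w i" unfolding Q_def by (simp del: upt_Suc)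

lemma Q_length: "length (Q M w) = Suc (last_hit M w)" unfolding Q_def by simp

lemma steps_Q: "steps (Q M w) = last_hit M w" by (simp add: steps_def Q_length)

lemma last_Q:
  assumes "w ~= []" "last w \<in> GV M"
  shows "last (Q M w) = last w"
proof -
  have "last (Q M w) = Q M w ! last_hit M w" using Q_length[of M w] by (metis diff_Suc_1 last_conv_nth length_0_conv nat.distinct(1))
  also have "... = w ! T M w (last_hit M w)" by (rule Q_nth) simp
  also have "... = last w"
  proof (cases "T M w (last_hit M w) < length w - 1")
    case True
    then show ?thesis using no_hit_after[OF assms(1) True] assms by (simp add: last_conv_nth)
  next
    case False
    then have "T M w (last_hit M w) = length w - 1" using T_length[OF assms(1) order_refl, of M] by simp
    then show ?thesis using assms(1) by (simp add: last_conv_nth)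
  qed
  finally show ?thesis .
qed

text \<open>Paths whose vertices all lie in \<open>GV N\<close> and which move in each step.\<close>

definition lattice_path :: "nat => path => bool" where
  "lattice_path N v \<longleftrightarrow> v ~= [] \<and> set v \<subseteq> GV N \<and> successively (~=) v"

lemma hit_lattice_path:
  assumes "lattice_path N v"
  shows "i < length v ==> hit N v i = enat i" "hit N v (length v) = \<infinity>"
proof -
  have v: "v ~= []" "!!i. i < length v ==> v ! i \<in> GV N" "!!i. Suc i < length v ==> v ! i ~= v ! Suc i" using assms unfolding lattice_path_def successively_nth by auto
  show 1: "i < length v ==> hit N v i = enat i" for i
  proof (induction i)
    case (Suc i)
    then have h: "hit N v i = enat i" by simp
    have i: "Suc i \<in> next_hits N v i" using v(2)[of "Suc i"] v(3)[of i] Suc.prems by (auto simp: next_hits_def)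
    have "(LEAST j. j \<in> next_hits N v i) = Suc i" by (rule Least_equality) (use i in \<open>auto simp: next_hits_def\<close>)
    then show ?case using hit_Suc_enat[OF h] i by auto
  qed (simp add: zero_enat_def)
  have "next_hits N v (length v - 1) = {}" by (auto simp: next_hits_def)
  then have "hit N v (Suc (length v - 1)) = \<infinity>" using hit_Suc_enat[OF 1, of "length v - 1"] v(1) by simp
  then show "hit N v (length v) = \<infinity>" using v(1) by simp
qed

lemma last_hit_lattice_path: "lattice_path N v ==> last_hit N v = steps v"
proof -
  assume f: "lattice_path N v"
  then have v: "v ~= []" by (simp add: lattice_path_def)
  have "hit N v (length v) = \<infinity>" "hit N v (length v - 1) < \<infinity>" using hit_lattice_path[OF f] v by simp_all
  then have "length v - 1 \<le> last_hit N v" "\<not> length v \<le> last_hit N v" unfolding hits_finite[OF v, symmetric] by simp_all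
  then show ?thesis unfolding steps_def by simp
qed

lemma T_lattice_path: "lattice_path N v ==> i < length v ==> T N v i = i" by (simp add: T_def hit_lattice_path)

lemma Q_lattice_path: "lattice_path N v ==> Q N v = v"
proof -
  assume f: "lattice_path N v"
  then have "length v > 0" by (simp add: lattice_path_def)
  then show ?thesis using last_hit_lattice_path[OF f] T_lattice_path[OF f] by (intro nth_equalityI) (auto simp: Q_length Q_nth steps_def)
qed

subsection \<open>Concatenations of pieces\<close>

definition piece :: "nat => path => bool" where
  "piece N p \<longleftrightarrow> 2 \<le> length p \<and> hd p \<in> GV N \<and> last p \<in> GV N \<and> hd p ~= last p \<and>
     (\<forall>k < steps p. p ! k \<in> GV N --> p ! k = hd p)"

definition pieces :: "nat => path list => bool" where
  "pieces N ps \<longleftrightarrow> ps ~= [] \<and> (\<forall>p\<in>set ps. piece N p) \<and> successively (%p q. last p = hd q) ps"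

text \<open>Mere concatenability. It is kept apart from \<open>pieces\<close> because it also holds
  for the paths through cells, which for Type 2 visit a coarse vertex on the way.\<close>

definition linked :: "path list => bool" where
  "linked ps \<longleftrightarrow> ps ~= [] \<and> (\<forall>p\<in>set ps. 2 \<le> length p) \<and> successively (%p q. last p = hd q) ps"

lemma pieces_linked: "pieces N ps ==> linked ps" by (auto simp: pieces_def linked_def piece_def)

text \<open>The coarse path: for pieces of level \<open>N\<close> it is \<open>Q N\<close> of their
  concatenation, see \<open>last_hit_pieces\<close>.\<close>

definition ends :: "path list => path" where
  "ends ps = map hd ps @ [last (last ps)]"

text \<open>Starting times of the pieces within their concatenation.\<close>

primrec pos :: "path list => nat => nat" where
  "pos ps 0 = 0" | "pos ps (Suc i) = pos ps i + steps (ps ! i)"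

lemma length_ends: "length (ends ps) = Suc (length ps)" by (simp add: ends_def)

lemma pieces_nth: "pieces N ps ==> i < length ps ==> piece N (ps ! i)" by (simp add: pieces_def)

lemma linked_link: "linked ps ==> Suc i < length ps ==> last (ps ! i) = hd (ps ! Suc i)" by (simp add: linked_def successively_nth)

lemma linked_nth: "linked ps ==> i < length ps ==> 2 \<le> length (ps ! i)" by (simp add: linked_def)

lemma linked_steps: "2 \<le> length p ==> 0 < steps p \<and> length p = Suc (steps p)" by (auto simp: steps_def)

lemmas pieces_link = linked_link[OF pieces_linked]

lemma ends_nth: "i < length ps ==> ends ps ! i = hd (ps ! i)" by (simp add: ends_def nth_append)

lemma linked_ends_Suc: "linked ps ==> i < length ps ==> ends ps ! Suc i = last (ps ! i)"
proof -
  assume *: "linked ps" "i < length ps"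
  show ?thesis
  proof (cases "Suc i < length ps")
    case True
    then show ?thesis using linked_link[OF *(1) True] by (simp add: ends_nth)
  next
    case False
    then have i: "Suc i = length ps" using * by simp
    have "ps ! i = last ps" using i by (metis diff_Suc_1 last_conv_nth length_0_conv nat.distinct(1))
    then show ?thesis by (simp add: ends_def nth_append i)
  qed
qed

lemmas ends_Suc = linked_ends_Suc[OF pieces_linked]

lemma lattice_path_ends: "pieces N ps ==> lattice_path N (ends ps)"
proof -
  assume p: "pieces N ps"
  then have ne: "ps ~= []" by (simp add: pieces_def)
  have "ends ps ! i ~= ends ps ! Suc i" if "Suc i < length (ends ps)" for i using pieces_nth[OF p, of i] that ends_nth[of i ps] ends_Suc[OF p, of i] by (simp add: length_ends piece_def)
  moreover have "set (ends ps) \<subseteq> GV N" using p ne by (auto simp: ends_def pieces_def piece_def)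
  moreover have "ends ps ~= []" by (simp add: ends_def)
  ultimately show ?thesis unfolding lattice_path_def successively_nth by blast
qed

lemma path_concat_snoc: "ps ~= [] ==> path_concat (ps @ [p]) = path_concat ps @ tl p" by (cases ps) auto

lemma linked_length_path_concat:
  assumes "linked ps"
  shows "n \<le> length ps ==> n > 0 ==> length (path_concat (take n ps)) = Suc (pos ps n)"
proof (induction n)
  case (Suc n)
  have st: "length (ps ! n) = Suc (steps (ps ! n))" using linked_nth[OF assms, of n] linked_steps Suc by auto
  show ?case
  proof (cases "n = 0")
    case True
    then show ?thesis using st Suc.prems by (cases ps) auto
  next
    case False
    have "take (Suc n) ps = take n ps @ [ps ! n]" using Suc.prems by (simp add: take_Suc_conv_app_nth)
    moreover have "take n ps ~= []" using Suc.prems False by auto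
    ultimately show ?thesis using Suc False st by (simp add: path_concat_snoc)
  qed
qed simp

lemmas length_path_concat = linked_length_path_concat[OF pieces_linked]

lemma path_concat_prefix: "n \<le> length ps ==> n > 0 ==> \<exists>r. path_concat ps = path_concat (take n ps) @ r"
proof -
  assume "n \<le> length ps" "n > 0"
  then obtain p qs where "take n ps = p # qs" by (cases "take n ps") auto
  then have "ps = (p # qs) @ drop n ps" by (metis append_take_drop_id)
  then have "path_concat ps = path_concat (p # qs) @ concat (map tl (drop n ps))" by (metis append_Cons append_assoc concat_append map_append path_concat.simps(2))
  then show ?thesis using \<open>take n ps = p # qs\<close> by auto
qed

lemma linked_path_concat_nth:
  assumes "linked ps" "i < length ps" "k \<le> steps (ps ! i)"
  shows "path_concat ps ! (pos ps i + k) = ps ! i ! k"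
proof -
  have p: "2 \<le> length (ps ! i)" using linked_nth assms by blast
  note st = linked_steps[OF p]
  have tk: "take (Suc i) ps = take i ps @ [ps ! i]" using assms by (simp add: take_Suc_conv_app_nth)
  have "path_concat (take (Suc i) ps) ! (pos ps i + k) = ps ! i ! k"
  proof (cases "i = 0")
    case True
    then show ?thesis using assms by (cases ps) auto
  next
    case False
    then have ti: "take i ps ~= []" "i > 0" using assms by auto
    have len: "length (path_concat (take i ps)) = Suc (pos ps i)" using linked_length_path_concat[OF assms(1)] assms(2) ti by simp
    show ?thesis
    proof (cases k)
      \<comment> \<open>The first point of a later piece is dropped by \<open>tl\<close>; it is
        represented by the last point of the preceding piece.\<close>
      case 0
      have "path_concat (take i ps) ! pos ps i = last (path_concat (take i ps))" using len by (metis diff_Suc_1 last_conv_nth length_0_conv nat.distinct(1))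
      also have "... = last (ps ! (i - 1))"
      proof -
        have tk': "take i ps = take (i - 1) ps @ [ps ! (i - 1)]" using take_Suc_conv_app_nth[of "i - 1" ps] assms(2) ti(2) by simp
        have q: "2 \<le> length (ps ! (i - 1))" using linked_nth[OF assms(1)] assms(2) by simp
        then have q2: "tl (ps ! (i - 1)) ~= []" by (cases "ps ! (i - 1)") auto
        show ?thesis
        proof (cases "take (i - 1) ps = []")
          case True
          then show ?thesis unfolding tk' True by simp
        next
          case False
          then show ?thesis unfolding tk' path_concat_snoc[OF False] using q2 by (simp add: last_tl)
        qed
      qed
      also have "... = hd (ps ! i)" using linked_link[OF assms(1), of "i - 1"] assms(2) ti(2) by simp
      also have "... = ps ! i ! 0" using st by (cases "ps ! i") auto
      finally show ?thesis using 0 len unfolding tk path_concat_snoc[OF ti(1)] by (simp add: nth_append)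
    next
      case (Suc k')
      have "(path_concat (take i ps) @ tl (ps ! i)) ! (pos ps i + k) = tl (ps ! i) ! k'" using len Suc by (simp add: nth_append)
      also have "... = ps ! i ! k" using st assms(3) Suc by (simp add: nth_tl)
      finally show ?thesis unfolding tk path_concat_snoc[OF ti(1)] .
    qed
  qed
  moreover obtain r where "path_concat ps = path_concat (take (Suc i) ps) @ r" using path_concat_prefix[of "Suc i" ps] assms(2) by auto
  moreover have "length (path_concat (take (Suc i) ps)) = Suc (pos ps i + steps (ps ! i))" using linked_length_path_concat[OF assms(1), of "Suc i"] assms(2) by simp
  ultimately show ?thesis using assms(3) by (simp add: nth_append)
qed

lemmas path_concat_nth = linked_path_concat_nth[OF pieces_linked]

lemma linked_pos_strict:
  assumes "linked ps" "i < j" "j \<le> length ps"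
  shows "pos ps i < pos ps j" using assms(2,3)
proof (induction j)
  case (Suc j)
  then have "pos ps j < pos ps (Suc j)" using linked_steps[OF linked_nth[OF assms(1), of j]] by simp
  then show ?case using Suc by (cases "i = j") (auto intro: less_trans)
qed simp

lemmas pos_strict = linked_pos_strict[OF pieces_linked]

lemma linked_pos_less_iff:
  assumes "linked ps" "i \<le> length ps" "j \<le> length ps"
  shows "pos ps i < pos ps j \<longleftrightarrow> i < j" using linked_pos_strict[OF assms(1)] assms(2,3) by (metis linorder_neqE_nat order_less_asym)

lemmas pos_less_iff = linked_pos_less_iff[OF pieces_linked]

lemma linked_pos_nth_ends:
  assumes "linked ps" "i \<le> length ps"
  shows "path_concat ps ! pos ps i = ends ps ! i"
proof (cases "i < length ps")
  case True
  then have "ps ! i ~= []" using linked_nth[OF assms(1) True] by auto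
  then show ?thesis using linked_path_concat_nth[OF assms(1) True, of 0] by (simp add: ends_nth[OF True] hd_conv_nth)
next
  case False
  then have i: "i = length ps" "ps ~= []" using assms by (auto simp: linked_def)
  then have "i ~= 0" by simp
  then obtain k where k: "i = Suc k" using not0_implies_Suc by blast
  have "ps ! k ~= []" using linked_nth[OF assms(1), of k] i k by auto
  then show ?thesis using linked_path_concat_nth[OF assms(1), of k "steps (ps ! k)"] linked_ends_Suc[OF assms(1), of k] i(2) i(1)[symmetric] unfolding k by (simp add: last_conv_nth steps_def)
qed

lemmas pos_nth_ends = linked_pos_nth_ends[OF pieces_linked]

lemma linked_path_concat_length: "linked ps ==> length (path_concat ps) = Suc (pos ps (length ps))" using linked_length_path_concat[of ps "length ps"] by (auto simp: linked_def)

lemmas path_concat_length = linked_path_concat_length[OF pieces_linked]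

lemma linked_pos_cover:
  assumes "linked ps" "j < length (path_concat ps)"
  shows "(\<exists>i < length ps. pos ps i \<le> j \<and> j < pos ps (Suc i)) \<or> j = pos ps (length ps)"
proof -
  have "j < pos ps n ==> \<exists>i < n. pos ps i \<le> j \<and> j < pos ps (Suc i)" for n
  proof (induction n)
    case (Suc n)
    then show ?case by (cases "j < pos ps n") (auto simp: not_less less_Suc_eq)
  qed simp
  then show ?thesis using assms(2) linked_path_concat_length[OF assms(1)] by (auto simp: less_Suc_eq)
qed

lemmas pos_cover = linked_pos_cover[OF pieces_linked]

text \<open>Before its end a piece of level \<open>N\<close> meets \<open>GV N\<close> only at its
  starting vertex, so a new vertex of a coarser level can appear only at the boundary of a
  piece.\<close>

lemma next_hits_pos:
  assumes ps: "pieces N ps" and M: "M \<le> N" and t: "t \<le> length ps"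
  shows "pos ps ` next_hits M (ends ps) t \<subseteq> next_hits M (path_concat ps) (pos ps t)"
    and "j \<in> next_hits M (path_concat ps) (pos ps t) ==> \<exists>i\<in>next_hits M (ends ps) t. pos ps i \<le> j"
proof -
  show "pos ps ` next_hits M (ends ps) t \<subseteq> next_hits M (path_concat ps) (pos ps t)"
  proof
    fix x assume "x \<in> pos ps ` next_hits M (ends ps) t"
    then obtain i where i: "x = pos ps i" "t < i" "i \<le> length ps" "ends ps ! i \<in> GV M - {ends ps ! t}" by (auto simp: next_hits_def length_ends)
    then have "pos ps i \<le> pos ps (length ps)" using pos_less_iff[OF ps] by (metis leI order_refl order_less_asym linorder_not_less)
    then show "x \<in> next_hits M (path_concat ps) (pos ps t)" using i pos_strict[OF ps, of t i] pos_nth_ends[OF ps] t path_concat_length[OF ps] by (auto simp: next_hits_def)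
  qed
  assume j: "j \<in> next_hits M (path_concat ps) (pos ps t)"
  then have j': "pos ps t < j" "j < length (path_concat ps)" "path_concat ps ! j \<in> GV M - {ends ps ! t}" using pos_nth_ends[OF ps t] by (auto simp: next_hits_def)
  then have GN: "path_concat ps ! j \<in> GV N" using GV_mono[OF M] by blast
  from pos_cover[OF ps j'(2)] show "\<exists>i\<in>next_hits M (ends ps) t. pos ps i \<le> j"
  proof
    assume "\<exists>i < length ps. pos ps i \<le> j \<and> j < pos ps (Suc i)"
    then obtain i where i: "i < length ps" "pos ps i \<le> j" "j < pos ps (Suc i)" by blast
    define k where "k = j - pos ps i"
    have k: "j = pos ps i + k" "k < steps (ps ! i)" using i by (auto simp: k_def)
    have "path_concat ps ! j = ps ! i ! k" using path_concat_nth[OF ps i(1)] k by simp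
    then have e: "path_concat ps ! j = ends ps ! i" using pieces_nth[OF ps i(1)] GN k(2) by (simp add: piece_def ends_nth[OF i(1)])
    then have "i ~= t" using j'(3) by auto
    moreover have "t < Suc i" using j'(1) i pos_less_iff[OF ps t, of "Suc i"] by simp
    ultimately have "t < i" by simp
    then have "i \<in> next_hits M (ends ps) t" using e j'(3) i(1) by (simp add: next_hits_def length_ends)
    then show ?thesis using i(2) by blast
  next
    assume j2: "j = pos ps (length ps)"
    then have "path_concat ps ! j = ends ps ! length ps" using pos_nth_ends[OF ps] by simp
    moreover have "t < length ps" using j'(1) j2 pos_less_iff[OF ps t, of "length ps"] by simp
    ultimately have "length ps \<in> next_hits M (ends ps) t" using j'(3) by (simp add: next_hits_def length_ends)
    then show ?thesis using j2 by auto
  qed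
qed

text \<open>Makes the hitting times of every coarser level functions of the coarse path, up to the
  change of clock \<open>pos\<close>.\<close>

lemma hit_path_concat:
  assumes ps: "pieces N ps" and M: "M \<le> N"
  shows "hit M (path_concat ps) i = (if hit M (ends ps) i = \<infinity> then \<infinity> else enat (pos ps (the_enat (hit M (ends ps) i))))"
proof (induction i)
  case 0
  show ?case by (simp add: zero_enat_def)
next
  case (Suc i)
  show ?case
  proof (cases "hit M (ends ps) i")
    case infinity
    then show ?thesis using Suc hit_Suc_infinity by (simp del: hit.simps(2))
  next
    case (enat t)
    have ne: "ends ps ~= []" by (simp add: ends_def)
    have t: "t \<le> length ps" using hit_length[OF ne enat] by (simp add: length_ends)
    have h: "hit M (path_concat ps) i = enat (pos ps t)" using Suc enat by simp
    let ?A = "next_hits M (ends ps) t" and ?B = "next_hits M (path_concat ps) (pos ps t)"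
    note nh = next_hits_pos[OF ps M t]
    show ?thesis
    proof (cases "?A = {}")
      case True
      then have "?B = {}" using nh(2) by blast
      then show ?thesis using True hit_Suc_enat[OF enat] hit_Suc_enat[OF h] by (simp del: hit.simps(2))
    next
      case False
      then have ne: "?B ~= {}" using nh(1) by blast
      define a where "a = (LEAST j. j \<in> ?A)"
      have a: "a \<in> ?A" "!!j. j \<in> ?A ==> a \<le> j" using False LeastI_ex[of "%j. j \<in> ?A"] Least_le[of "%j. j \<in> ?A"] by (auto simp: a_def)
      have "(LEAST j. j \<in> ?B) = pos ps a"
      proof (rule Least_equality)
        show "pos ps a \<in> ?B" using nh(1) a(1) by blast
        fix j assume "j \<in> ?B"
        then obtain i where i: "i \<in> ?A" "pos ps i \<le> j" using nh(2) by blast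
        then have "a \<le> i" "i \<le> length ps" using a(2) by (auto simp: next_hits_def length_ends)
        then have "pos ps a \<le> pos ps i" using pos_less_iff[OF ps, of i a] by simp
        then show "pos ps a \<le> j" using i(2) by simp
      qed
      then show ?thesis using False ne hit_Suc_enat[OF enat] hit_Suc_enat[OF h] by (simp add: a_def del: hit.simps(2))
    qed
  qed
qed

lemma path_concat_ne: "pieces N ps ==> path_concat ps ~= []" using path_concat_length[of N ps] by force

lemma last_hit_path_concat:
  assumes "pieces N ps" "M \<le> N"
  shows "last_hit M (path_concat ps) = last_hit M (ends ps)" unfolding last_hit_def hit_path_concat[OF assms] by (rule arg_cong[of _ _ Max]) auto

lemma T_path_concat:
  assumes "pieces N ps" "M \<le> N" "i \<le> last_hit M (ends ps)"
  shows "T M (path_concat ps) i = pos ps (T M (ends ps) i)" using hits_finite[of "ends ps" M i] assms(3) hit_path_concat[OF assms(1,2), of i] by (simp add: T_def length_ends[of ps] flip: length_0_conv split: if_splits)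

lemma Q_path_concat:
  assumes "pieces N ps" "M \<le> N"
  shows "Q M (path_concat ps) = Q M (ends ps)"
proof (rule nth_equalityI)
  show "length (Q M (path_concat ps)) = length (Q M (ends ps))" by (simp add: Q_length last_hit_path_concat[OF assms])
  fix i assume "i < length (Q M (path_concat ps))"
  then have i: "i \<le> last_hit M (ends ps)" by (simp add: Q_length last_hit_path_concat[OF assms])
  have ne: "ends ps ~= []" by (simp add: ends_def)
  have "T M (ends ps) i \<le> length ps" using T_length[OF ne i] by (simp add: length_ends)
  then show "Q M (path_concat ps) ! i = Q M (ends ps) ! i" using i T_path_concat[OF assms i] pos_nth_ends[OF assms(1)] by (simp add: Q_nth last_hit_path_concat[OF assms])
qed

lemma path_concat_map_path_concat:
  assumes "!!xs. xs \<in> set xss ==> xs ~= []" "!!xs p. xs \<in> set xss ==> p \<in> set xs ==> p ~= []"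
  shows "path_concat (map path_concat xss) = path_concat (concat xss)"
proof (cases xss)
  case (Cons xs yss)
  have *: "tl (path_concat ys) = concat (map tl ys)" if ys: "ys \<in> set xss" for ys
  proof -
    obtain p qs where "ys = p # qs" using assms(1)[OF ys] by (cases ys) auto
    then show ?thesis using assms(2)[OF ys, of p] by simp
  qed
  obtain p qs where "xs = p # qs" using assms(1)[of xs] Cons by (cases xs) auto
  moreover have "concat (map tl (map path_concat yss)) = concat (map tl (concat yss))"
  proof -
    have "concat (map tl (map path_concat yss)) = concat (map (%ys. concat (map tl ys)) yss)" using * Cons by (auto intro!: arg_cong[of _ _ concat])
    also have "... = concat (map tl (concat yss))" by (induction yss) auto
    finally show ?thesis .
  qed
  ultimately show ?thesis using Cons by simp
qed simp

lemma linked_slice: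
  assumes "linked ps" "a < b" "b \<le> length ps"
  shows "linked (map (nth ps) [a..<b])" "ends (map (nth ps) [a..<b]) = segment (ends ps) a b"
    "segment (path_concat ps) (pos ps a) (pos ps b) = path_concat (map (nth ps) [a..<b])"
proof -
  let ?qs = "map (nth ps) [a..<b]"
  have q: "?qs ! i = ps ! (a + i)" if "i < b - a" for i using that by simp
  show pq: "linked ?qs" unfolding linked_def successively_nth using assms linked_nth[OF assms(1)] linked_link[OF assms(1)] by (auto simp: q)
  have endq: "ends ?qs ! i = ends ps ! (a + i)" if le: "i \<le> b - a" for i
  proof (cases "i < b - a")
    case True
    then show ?thesis using assms by (simp add: ends_nth)
  next
    case False
    then have "i = Suc (i - 1)" "i - 1 < b - a" using le assms(2) by auto
    then obtain k where k: "i = Suc k" "k < b - a" by blast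
    then show ?thesis using linked_ends_Suc[OF pq, of k] linked_ends_Suc[OF assms(1), of "a + k"] assms by simp
  qed
  show "ends ?qs = segment (ends ps) a b" by (rule nth_equalityI) (use assms endq in \<open>auto simp: length_ends segment_def\<close>)
  have posq: "pos ?qs i = pos ps (a + i) - pos ps a \<and> pos ps a \<le> pos ps (a + i)" if "i \<le> b - a" for i using that by (induction i) (auto simp: q)
  have lt: "pos ps a < pos ps b" "pos ps b \<le> pos ps (length ps)" using linked_pos_strict[OF assms] linked_pos_less_iff[OF assms(1), of "length ps" b] assms by auto
  have len: "length (path_concat ?qs) = Suc (pos ps b - pos ps a)" using linked_path_concat_length[OF pq] posq[of "b - a"] assms by simp
  show "segment (path_concat ps) (pos ps a) (pos ps b) = path_concat ?qs"
  proof (rule nth_equalityI)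
    show "length (segment (path_concat ps) (pos ps a) (pos ps b)) = length (path_concat ?qs)" using len lt linked_path_concat_length[OF assms(1)] by (simp add: segment_def)
    fix j assume "j < length (segment (path_concat ps) (pos ps a) (pos ps b))"
    then have j: "j \<le> pos ps b - pos ps a" "pos ps a + j < length (path_concat ps)" by (auto simp: segment_def)
    have l: "segment (path_concat ps) (pos ps a) (pos ps b) ! j = path_concat ps ! (pos ps a + j)" using j by (simp add: segment_def)
    have "j < length (path_concat ?qs)" using len j by simp
    from linked_pos_cover[OF pq this] show "segment (path_concat ps) (pos ps a) (pos ps b) ! j = path_concat ?qs ! j"
    proof
      assume "\<exists>i < length ?qs. pos ?qs i \<le> j \<and> j < pos ?qs (Suc i)"
      then obtain i where i: "i < b - a" "pos ?qs i \<le> j" "j < pos ?qs (Suc i)" by auto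
      define k where "k = j - pos ?qs i"
      have k: "j = pos ?qs i + k" "k \<le> steps (?qs ! i)" "k \<le> steps (ps ! (a + i))" using i by (auto simp: k_def)
      have "pos ps a + j = pos ps (a + i) + k" using posq[of i] i k(1) by simp
      then have pp: "path_concat ps ! (pos ps a + j) = path_concat ps ! (pos ps (a + i) + k)" by (rule arg_cong)
      then have "path_concat ps ! (pos ps a + j) = ps ! (a + i) ! k" unfolding pp using i(1) k(3) assms(3) by (intro linked_path_concat_nth[OF assms(1)]) auto
      moreover have "path_concat ?qs ! j = ?qs ! i ! k" using linked_path_concat_nth[OF pq, of i k] i k by simp
      ultimately show ?thesis using l i q by simp
    next
      assume j2: "j = pos ?qs (length ?qs)"
      then have "pos ps a + j = pos ps b" using posq[of "b - a"] assms by simp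
      then have "path_concat ps ! (pos ps a + j) = ends ps ! b" using linked_pos_nth_ends[OF assms(1,3)] by simp
      moreover have "path_concat ?qs ! j = ends ?qs ! (b - a)" using linked_pos_nth_ends[OF pq, of "b - a"] j2 by simp
      ultimately show ?thesis using l endq[of "b - a"] assms by simp
    qed
  qed
qed

lemma pieces_slice:
  assumes "pieces N ps" "a < b" "b \<le> length ps"
  shows "pieces N (map (nth ps) [a..<b])" "ends (map (nth ps) [a..<b]) = segment (ends ps) a b"
    "segment (path_concat ps) (pos ps a) (pos ps b) = path_concat (map (nth ps) [a..<b])"
proof -
  have "linked (map (nth ps) [a..<b])" using linked_slice(1)[OF pieces_linked[OF assms(1)] assms(2,3)] .
  then show "pieces N (map (nth ps) [a..<b])" using assms unfolding pieces_def linked_def by auto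
qed (use linked_slice[OF pieces_linked[OF assms(1)] assms(2,3)] in auto)


subsection \<open>Skeletons depend on the coarse path only\<close>

definition edge_tri :: "nat => path => nat => complex set" where
  "edge_tri M q n = (THE \<Delta>. \<Delta> \<in> triangles M \<and> q ! n \<in> \<Delta> \<and> q ! Suc n \<in> \<Delta>)"

primrec exit_idx :: "nat => path => nat => nat" where
  "exit_idx M q 0 = 0"
| "exit_idx M q (Suc i) =
     (let n = exit_idx M q i; exits = (%j. j < steps q \<and> n < j \<and> q ! Suc j \<notin> edge_tri M q n)
      in if \<exists>j. exits j then (LEAST j. exits j) else steps q)"

lemma if_Least_le:
  fixes L :: nat
  assumes "!!j. P j ==> j < L"
  shows "(if \<exists>j. P j then (LEAST j. P j) else L) \<le> L" using assms LeastI_ex[of P] less_imp_le by auto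

text \<open>Hitting times increase strictly, so comparing times amounts to comparing indices, and
  the remaining conditions only mention the vertices hit.\<close>

lemma exit_index_Q:
  assumes "w ~= []"
  shows "exit_index M w i = exit_idx M (Q M w) i \<and> exit_index M w i \<le> last_hit M w"
proof (induction i)
  case (Suc i)
  define n where "n = exit_idx M (Q M w) i"
  have n: "exit_index M w i = n" "n \<le> last_hit M w" using Suc by (simp_all add: n_def)
  have TT: "T M w j > T M w n \<longleftrightarrow> j > n" if "j < last_hit M w" for j using T_mono[OF assms, of n j M] T_mono[OF assms, of j n M] n(2) that
    by (metis linorder_neqE_nat not_less_iff_gr_or_eq order.strict_implies_order)
  have ex: "(j < last_hit M w \<and> T M w j > T M w n \<and> w ! T M w (Suc j) \<notin> triangle_from M w n) \<longleftrightarrow>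
      (j < steps (Q M w) \<and> n < j \<and> Q M w ! Suc j \<notin> edge_tri M (Q M w) n)" for j
  proof (cases "j < last_hit M w \<and> n < j")
    case True
    then have "triangle_from M w n = edge_tri M (Q M w) n" unfolding triangle_from_def edge_tri_def by (simp add: Q_nth)
    then show ?thesis using True TT by (simp add: steps_Q Q_nth)
  next
    case False
    then show ?thesis using TT[of j] by (auto simp: steps_Q)
  qed
  have "exit_index M w (Suc i) = exit_idx M (Q M w) (Suc i)" unfolding exit_index.simps exit_idx.simps n(1) n_def[symmetric] Let_def ex steps_Q ..
  moreover have "exit_index M w (Suc i) \<le> last_hit M w" unfolding exit_index.simps Let_def by (rule if_Least_le) simp
  ultimately show ?case by blast
qed simp

subsection \<open>Chains of cells\<close>

text \<open>A cell is given by its base, a labelling of its corners (\<open>C0\<close> is the entry and \<open>C1\<close> the exit), and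
  whether the path through it visits the third corner (Type 2).\<close>

type_synonym cell = "(int \<times> int) \<times> (corner => corner) \<times> bool"

definition cell_pt :: "nat => cell => corner => complex" where
  "cell_pt N C i = pt N (fst C + delta (fst (snd C) i))"

definition cell_path :: "nat => cell => path" where
  "cell_path N C = (if snd (snd C) then [cell_pt N C C0, cell_pt N C C2, cell_pt N C C1] else [cell_pt N C C0, cell_pt N C C1])"

definition path_of :: "nat => cell list => path" where
  "path_of N cs = path_concat (map (cell_path N) cs)"

text \<open>Consecutive cells have to differ, since the skeleton would otherwise merge them into one
  triangle.\<close>

definition chain :: "nat => cell list => bool" where
  "chain N cs \<longleftrightarrow> cs ~= [] \<and> (\<forall>C\<in>set cs. fst C \<in> cells three_cells N \<and> inj (fst (snd C))) \<and>
     successively (%C D. fst C ~= fst D \<and> cell_pt N C C1 = cell_pt N D C0) cs"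

definition cell_len :: "cell => nat" where "cell_len C = (if snd (snd C) then 2 else 1)"

text \<open>The index in \<open>path_of\<close> at which the cell with number \<open>i\<close> is
  entered.\<close>

primrec cum :: "cell list => nat => nat" where
  "cum cs 0 = 0" | "cum cs (Suc i) = cum cs i + cell_len (cs ! i)"

lemma steps_cell_path: "steps (cell_path N C) = cell_len C" by (simp add: steps_def cell_path_def cell_len_def)

lemma cell_path_ends: "hd (cell_path N C) = cell_pt N C C0" "last (cell_path N C) = cell_pt N C C1" by (simp_all add: cell_path_def)

lemma pos_cells: "i \<le> length cs ==> pos (map (cell_path N) cs) i = cum cs i" by (induction i) (auto simp: steps_cell_path)

lemma linked_cells: "chain N cs ==> linked (map (cell_path N) cs)" unfolding linked_def chain_def successively_map cell_path_ends by (auto elim!: successively_mono) (auto simp: cell_path_def)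

lemma chain_nth: "chain N cs ==> i < length cs ==> fst (cs ! i) \<in> cells three_cells N \<and> inj (fst (snd (cs ! i)))" by (simp add: chain_def)

lemma chain_link: "chain N cs ==> Suc i < length cs ==>
    fst (cs ! i) ~= fst (cs ! Suc i) \<and> cell_pt N (cs ! i) C1 = cell_pt N (cs ! Suc i) C0" by (simp add: chain_def successively_nth)

lemma path_of_nth:
  assumes "chain N cs" "i < length cs" "k \<le> cell_len (cs ! i)"
  shows "path_of N cs ! (cum cs i + k) = cell_path N (cs ! i) ! k" using linked_path_concat_nth[OF linked_cells[OF assms(1)], of i k] assms(2,3) by (simp add: path_of_def pos_cells steps_cell_path)

lemma steps_path_of: "chain N cs ==> steps (path_of N cs) = cum cs (length cs)" using linked_path_concat_length[OF linked_cells, of N cs] by (simp add: path_of_def pos_cells steps_def)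

lemma cum_strict: "i < j ==> cum cs i < cum cs j"
proof (induction j)
  case (Suc j)
  then show ?case by (cases "i = j") (auto simp: cell_len_def)
qed simp

lemma cum_eq_iff: "cum cs i = cum cs j \<longleftrightarrow> i = j" using cum_strict[of i j cs] cum_strict[of j i cs] by (metis linorder_neqE_nat less_irrefl)

lemma cell_pt_tri: "cell_pt N C i \<in> tri N (fst C)" by (simp add: cell_pt_def tri_corner)

text \<open>From the last point of a cell the path moves along an edge of a different cell. The
  triangles share only the common corner, so the exit is detected there. Earlier only the third
  corner of a Type 2 cell could qualify, and its successor still lies in the triangle.\<close>

lemma exit_idx_path_of:
  assumes ch: "chain N cs"
  shows "i \<le> length cs ==> exit_idx N (path_of N cs) i = cum cs i"
proof (induction i)
  case (Suc i)
  let ?q = "path_of N cs"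
  let ?C = "cs ! i"
  have i: "i < length cs" using Suc by simp
  have n: "exit_idx N ?q i = cum cs i" using Suc by simp
  note C = chain_nth[OF ch i]
  have 0: "?q ! cum cs i = cell_pt N ?C C0" using path_of_nth[OF ch i, of 0] by (simp add: cell_path_def)
  have 1: "?q ! Suc (cum cs i) = cell_pt N ?C (if snd (snd ?C) then C2 else C1)" using path_of_nth[OF ch i, of 1] by (simp add: cell_path_def cell_len_def)
  have 2: "?q ! cum cs (Suc i) = cell_pt N ?C C1" using path_of_nth[OF ch i, of "cell_len ?C"] by (simp add: cell_path_def cell_len_def)
  have tri: "edge_tri N ?q (cum cs i) = tri N (fst ?C)" unfolding edge_tri_def 0 1 cell_pt_def by (rule triangle_from_eq) (use C in \<open>auto simp: inj_eq\<close>)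
  define ex where "ex = (%j. j < steps ?q \<and> cum cs i < j \<and> ?q ! Suc j \<notin> tri N (fst ?C))"
  have step: "exit_idx N ?q (Suc i) = (if \<exists>j. ex j then (LEAST j. ex j) else steps ?q)" unfolding exit_idx.simps n tri Let_def ex_def ..
  have early: "\<not> ex j" if "j < cum cs (Suc i)" for j
  proof
    assume j: "ex j"
    then have "j = Suc (cum cs i)" "cell_len ?C = 2" using that by (auto simp: ex_def cell_len_def split: if_splits)
    then have "Suc j = cum cs (Suc i)" by simp
    then show False using j 2 cell_pt_tri[of N ?C C1] by (simp add: ex_def)
  qed
  show ?case
  proof (cases "Suc i < length cs")
    case True
    let ?D = "cs ! Suc i"
    note D = chain_nth[OF ch True] and l = chain_link[OF ch True]
    have 3: "?q ! Suc (cum cs (Suc i)) = cell_pt N ?D (if snd (snd ?D) then C2 else C1)" using path_of_nth[OF ch True, of 1] by (simp add: cell_path_def cell_len_def)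
    have "?q ! Suc (cum cs (Suc i)) \<notin> tri N (fst ?C)"
    proof
      assume "?q ! Suc (cum cs (Suc i)) \<in> tri N (fst ?C)"
      then obtain a where a: "fst ?D + delta (fst (snd ?D) (if snd (snd ?D) then C2 else C1)) = fst ?C + delta a" unfolding 3 cell_pt_def using pt_tri by blast
      have b: "fst ?D + delta (fst (snd ?D) C0) = fst ?C + delta (fst (snd ?C) C1)" using l unfolding cell_pt_def by simp
      have "fst (snd ?D) (if snd (snd ?D) then C2 else C1) ~= fst (snd ?D) C0" using D by (simp add: inj_eq)
      then show False using edge_cell_unique[OF a b] l by auto
    qed
    moreover have "cum cs (Suc i) < steps ?q" unfolding steps_path_of[OF ch] by (rule cum_strict[OF True])
    ultimately have e: "ex (cum cs (Suc i))" using cum_strict[of i "Suc i" cs] by (simp add: ex_def)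
    have "(LEAST j. ex j) = cum cs (Suc i)"
    proof (rule Least_equality)
      show "ex (cum cs (Suc i))" by (rule e)
      show "cum cs (Suc i) \<le> j" if "ex j" for j using early[of j] that not_less by blast
    qed
    then show ?thesis using step e by auto
  next
    case False
    then have k: "Suc i = length cs" using i by simp
    have "\<not> ex j" for j using early[of j] k steps_path_of[OF ch] by (auto simp: ex_def)
    then show ?thesis using step steps_path_of[OF ch] k by simp
  qed
qed simp

lemma exit_index_chain:
  assumes "w ~= []" "chain M cs" "Q M w = path_of M cs"
  shows "i \<le> length cs ==> exit_index M w i = cum cs i" "last_hit M w = cum cs (length cs)"
    "length (skeleton M w) = length cs"
proof -
  show 1: "exit_index M w i = cum cs i" if "i \<le> length cs" for i using exit_index_Q[OF assms(1), of M i] exit_idx_path_of[OF assms(2) that] assms(3) by simp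
  show 2: "last_hit M w = cum cs (length cs)" using steps_Q[of M w] steps_path_of[OF assms(2)] assms(3) by simp
  have ne: "1 \<le> length cs" using assms(2) by (cases cs) (auto simp: chain_def)
  have "skeleton_length M w = length cs" unfolding skeleton_length_def
  proof (rule Least_equality)
    show "1 \<le> length cs \<and> exit_index M w (length cs) = last_hit M w" using ne 1 2 by simp
    fix i assume i: "1 \<le> i \<and> exit_index M w i = last_hit M w"
    show "length cs \<le> i"
    proof (rule ccontr)
      assume "\<not> length cs \<le> i"
      then have "cum cs i = cum cs (length cs)" using 1[of i] 2 i by simp
      then show False using \<open>\<not> length cs \<le> i\<close> by (simp add: cum_eq_iff)
    qed
  qed
  then show "length (skeleton M w) = length cs" unfolding skeleton_def using ne by auto
qed

lemma type_count_chain: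
  assumes "w ~= []" "chain M cs" "Q M w = path_of M cs"
  shows "type_count r M w = length (filter (%C. cell_len C = r) cs)"
proof -
  note ec = exit_index_chain[OF assms]
  have "{i. 1 \<le> i \<and> i \<le> length (skeleton M w) \<and> exit_index M w i = exit_index M w (i - 1) + r} =
    Suc ` {i. i < length cs \<and> cell_len (cs ! i) = r}"
  proof (intro equalityI subsetI)
    fix i assume i: "i \<in> {i. 1 \<le> i \<and> i \<le> length (skeleton M w) \<and> exit_index M w i = exit_index M w (i - 1) + r}"
    then obtain k where k: "i = Suc k" by (cases i) auto
    then show "i \<in> Suc ` {i. i < length cs \<and> cell_len (cs ! i) = r}" using i ec by (auto simp del: exit_index.simps(2))
  next
    fix i assume "i \<in> Suc ` {i. i < length cs \<and> cell_len (cs ! i) = r}"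
    then show "i \<in> {i. 1 \<le> i \<and> i \<le> length (skeleton M w) \<and> exit_index M w i = exit_index M w (i - 1) + r}" using ec by (auto simp del: exit_index.simps(2))
  qed
  then show ?thesis unfolding type_count_def length_filter_conv_card by (simp add: card_image)
qed

subsection \<open>Routes: selections of steps of a path\<close>

text \<open>Indices of steps of \<open>v\<close>, in increasing order, whose steps fit together to a
  path from \<open>v ! a\<close> to \<open>v ! b\<close>. Loop erasure is expressed by such indices
  so that it can be carried over from a coarse path to every refinement of it.\<close>

definition route :: "path => nat => nat => nat list => bool" where
  "route v a b is \<longleftrightarrow> is ~= [] \<and> sorted_wrt (<) is \<and> (\<forall>i\<in>set is. a \<le> i \<and> i < b) \<and>
     v ! hd is = v ! a \<and> v ! Suc (last is) = v ! b \<and> successively (%i j. v ! Suc i = v ! j) is"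

lemma route_interval: "a < b ==> route v a b [a..<b]" unfolding route_def successively_nth by (simp add: hd_upt last_upt)

lemma route_append:
  assumes "route v a b xs" "route v b' c ys" "b \<le> b'" "v ! b = v ! b'"
  shows "route v a c (xs @ ys)"
proof -
  have xs: "xs ~= []" "sorted_wrt (<) xs" "!!i. i \<in> set xs ==> a \<le> i \<and> i < b" "v ! hd xs = v ! a" "v ! Suc (last xs) = v ! b"
    "successively (%i j. v ! Suc i = v ! j) xs" using assms(1) by (auto simp: route_def)
  have ys: "ys ~= []" "sorted_wrt (<) ys" "!!i. i \<in> set ys ==> b' \<le> i \<and> i < c" "v ! hd ys = v ! b'" "v ! Suc (last ys) = v ! c"
    "successively (%i j. v ! Suc i = v ! j) ys" using assms(2) by (auto simp: route_def)
  have lt: "i < j" if "i \<in> set xs" "j \<in> set ys" for i j using xs(3)[OF that(1)] ys(3)[OF that(2)] assms(3) by linarith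
  have ab: "a < b" using xs(3)[of "hd xs"] xs(1) by auto
  have bc: "b' < c" using ys(3)[of "hd ys"] ys(1) by auto
  have "a \<le> i \<and> i < c" if "i \<in> set (xs @ ys)" for i using that xs(3)[of i] ys(3)[of i] assms(3) ab bc by fastforce
  then show ?thesis using xs ys lt assms(4) unfolding route_def by (simp add: sorted_wrt_append successively_append_iff)
qed

lemma route_shift_start: "route v a' b xs ==> a \<le> a' ==> v ! a = v ! a' ==> route v a b xs" unfolding route_def by auto

lemma route_shift_end: "route v a b xs ==> b \<le> b' ==> v ! b = v ! b' ==> route v a b' xs" unfolding route_def by auto

lemma route_segment:
  assumes "route (segment v a b) 0 (b - a) xs" "a < b" "b < length v"
  shows "route v a b (map ((+) a) xs)"
proof -
  have s: "segment v a b ! i = v ! (a + i)" if "i \<le> b - a" for i using that assms(2,3) by (simp add: segment_def)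
  have xs: "xs ~= []" "!!i. i \<in> set xs ==> i < b - a" using assms(1) by (auto simp: route_def)
  have h: "hd xs < b - a" "last xs < b - a" using xs by auto
  have lt: "a + i < b" if "i \<in> set xs" for i using xs(2)[OF that] by linarith
  have "successively (%i j. v ! Suc (a + i) = v ! (a + j)) xs"
  proof (rule successively_mono)
    show "successively (%i j. segment v a b ! Suc i = segment v a b ! j) xs" using assms(1) by (simp add: route_def)
    fix i j assume "i \<in> set xs" "j \<in> set xs" "segment v a b ! Suc i = segment v a b ! j"
    then show "v ! Suc (a + i) = v ! (a + j)" using xs(2)[of i] xs(2)[of j] s[of "Suc i"] s[of j] by simp
  qed
  then show ?thesis using assms h xs lt s[of "hd xs"] s[of 0] s[of "Suc (last xs)"] s[of "b - a"] unfolding route_def by (auto simp: hd_map last_map sorted_wrt_map successively_map)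
qed

lemma pieces_route:
  assumes "pieces N ps" "route (ends ps) 0 (length ps) is"
  shows "pieces N (map (nth ps) is)"
    "ends (map (nth ps) is) = map (nth (ends ps)) is @ [ends ps ! Suc (last is)]"
proof -
  have i: "is ~= []" "!!i. i \<in> set is ==> i < length ps" "successively (%i j. ends ps ! Suc i = ends ps ! j) is" using assms(2) by (auto simp: route_def)
  have "successively (%i j. last (ps ! i) = hd (ps ! j)) is" using i(3) by (rule successively_mono) (use i(2) ends_nth ends_Suc[OF assms(1)] in auto)
  then show "pieces N (map (nth ps) is)" using assms(1) i unfolding pieces_def successively_map by auto
  have "last (map (nth ps) is) = ps ! last is" "last is \<in> set is" using i(1) by (auto simp: last_map)
  then show "ends (map (nth ps) is) = map (nth (ends ps)) is @ [ends ps ! Suc (last is)]" using i ends_Suc[OF assms(1)] unfolding ends_def[of "map (nth ps) is"] by (auto simp: ends_nth)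
qed

text \<open>The trivial refinement of \<open>v\<close>, with single steps as pieces. Through it,
  statements about all refinements specialise to \<open>v\<close> itself.\<close>

definition edges_list :: "path => path list" where
  "edges_list v = map (%i. [v ! i, v ! Suc i]) [0..<steps v]"

lemma pieces_edges:
  assumes "lattice_path N v" "2 \<le> length v"
  shows "pieces N (edges_list v)" "ends (edges_list v) = v"
proof -
  have v: "v ~= []" "!!i. i < length v ==> v ! i \<in> GV N" "!!i. Suc i < length v ==> v ! i ~= v ! Suc i" using assms unfolding lattice_path_def successively_nth by auto
  show p: "pieces N (edges_list v)" unfolding pieces_def edges_list_def successively_map using assms(2) v by (auto simp: piece_def steps_def successively_nth)
  show "ends (edges_list v) = v"
  proof (rule nth_equalityI)
    show "length (ends (edges_list v)) = length v" using assms(2) by (simp add: length_ends edges_list_def steps_def)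
    fix i assume i: "i < length (ends (edges_list v))"
    then have i: "i \<le> steps v" by (simp add: length_ends edges_list_def)
    show "ends (edges_list v) ! i = v ! i"
    proof (cases "i < steps v")
      case True
      then show ?thesis by (simp add: ends_nth edges_list_def)
    next
      case False
      then have "i = Suc (steps v - 1)" "steps v - 1 < length (edges_list v)" using i assms(2) by (auto simp: steps_def edges_list_def)
      then show ?thesis using ends_Suc[OF p, of "steps v - 1"] by (simp add: edges_list_def)
    qed
  qed
qed

lemma path_concat_short:
  assumes "pieces N qs" "!!q. q \<in> set qs ==> length q = 2"
  shows "path_concat qs = ends qs"
proof (rule nth_equalityI)
  have p: "i \<le> length qs ==> pos qs i = i" for i by (induction i) (auto simp: steps_def assms(2))
  show "length (path_concat qs) = length (ends qs)" using path_concat_length[OF assms(1)] p by (simp add: length_ends)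
  fix i assume "i < length (path_concat qs)"
  then have i: "i \<le> length qs" using path_concat_length[OF assms(1)] p by simp
  show "path_concat qs ! i = ends qs ! i" using pos_nth_ends[OF assms(1) i] p[OF i] by simp
qed

lemma path_concat_edges: "lattice_path N v ==> 2 \<le> length v ==> path_concat (edges_list v) = v" using path_concat_short[OF pieces_edges(1)] pieces_edges(2) by (fastforce simp: edges_list_def)

subsection \<open>Chronological erasure\<close>

lemma last_visit:
  assumes "j < length z"
  shows "j \<le> last_visit z j" "last_visit z j < length z" "z ! last_visit z j = z ! j"
    "!!k. last_visit z j < k ==> k < length z ==> z ! k ~= z ! j"
proof -
  let ?A = "{k. k < length z \<and> z ! k = z ! j}"
  have A: "finite ?A" "j \<in> ?A" using assms by auto
  have "last_visit z j \<in> ?A" unfolding last_visit_def using A by (intro Max_in) auto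
  then show "last_visit z j < length z" "z ! last_visit z j = z ! j" by auto
  show "j \<le> last_visit z j" unfolding last_visit_def using A by (intro Max_ge) auto
  fix k assume "last_visit z j < k" "k < length z"
  show "z ! k ~= z ! j"
  proof
    assume "z ! k = z ! j"
    then have "k \<in> ?A" using \<open>k < length z\<close> by simp
    then have "k \<le> last_visit z j" unfolding last_visit_def by (rule Max_ge[OF A(1)])
    then show False using \<open>last_visit z j < k\<close> by simp
  qed
qed

definition erasure_len :: "path => nat" where
  "erasure_len z = (LEAST l. z ! erasure_index z l = last z)"

lemma erasure_index_props:
  assumes "z ~= []"
  shows "z ! erasure_index z (erasure_len z) = last z"
    "l \<le> erasure_len z ==> erasure_index z l < length z"
    "l < erasure_len z ==> Suc (erasure_index z l) < length z"
    "l < erasure_len z ==> erasure_index z l < erasure_index z (Suc l)"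
    "l < erasure_len z ==> z ! erasure_index z (Suc l) = z ! Suc (erasure_index z l)"
    "l < erasure_len z ==> z ! erasure_index z l ~= last z"
    "l \<le> erasure_len z ==> erasure_index z l < k ==> k < length z ==> z ! k ~= z ! erasure_index z l"
proof -
  let ?s = "erasure_index z"
  have nl: "z ! ?s l ~= last z ==> ?s l < length z ==> Suc (?s l) < length z" for l using assms by (metis Suc_lessI diff_Suc_1 last_conv_nth)
  \<comment> \<open>As long as the end vertex is not reached the indices increase strictly, so the
    erasure stops within \<open>length z\<close> rounds.\<close>
  have range: "(!!m. m < l ==> z ! ?s m ~= last z) ==> ?s l < length z \<and> l \<le> ?s l" for l
  proof (induction l)
    case 0
    then show ?case using last_visit(2)[of 0 z] assms by simp
  next
    case (Suc l)
    then have "Suc (?s l) < length z" using nl[of l] by auto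
    then show ?case using last_visit(1,2)[of "Suc (?s l)" z] Suc by force
  qed
  have "\<exists>l. z ! ?s l = last z"
  proof (rule ccontr)
    assume "\<nexists>l. z ! ?s l = last z"
    then show False using range[of "length z"] by auto
  qed
  then show 1: "z ! ?s (erasure_len z) = last z" unfolding erasure_len_def by (rule LeastI_ex)
  show 2: "l < erasure_len z ==> z ! ?s l ~= last z" for l unfolding erasure_len_def by (rule not_less_Least)
  show 3: "l \<le> erasure_len z ==> ?s l < length z" for l using range[of l] 2 by auto
  show 4: "l < erasure_len z ==> Suc (?s l) < length z" for l using nl 2 3 by simp
  show "l < erasure_len z ==> ?s l < ?s (Suc l)" using last_visit(1)[OF 4, of l] by simp
  show "l < erasure_len z ==> z ! ?s (Suc l) = z ! Suc (?s l)" using last_visit(3)[OF 4, of l] by simp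
  have "\<exists>j < length z. ?s l = last_visit z j" if "l \<le> erasure_len z"
  proof (cases l)
    case 0
    then show ?thesis using assms by (intro exI[of _ 0]) auto
  next
    case (Suc m)
    then show ?thesis using 4[of m] that by (intro exI[of _ "Suc (?s m)"]) auto
  qed
  then show "l \<le> erasure_len z ==> ?s l < k ==> k < length z ==> z ! k ~= z ! ?s l" using last_visit(3,4) by metis
qed

lemma erasure_len_pos: "z ~= [] ==> hd z ~= last z ==> 0 < erasure_len z" using erasure_index_props(1)[of z] last_visit(3)[of 0 z] by (cases "erasure_len z") (auto simp: hd_conv_nth)

text \<open>The steps of \<open>v\<close> surviving the erasure at scale \<open>K\<close>; all steps
  between a last visit and the next hit are kept as one block.\<close>

definition erase_idx :: "nat => path => nat list" where
  "erase_idx K v = concat (map (%l. [T K v (erasure_index (Q K v) l)..<T K v (Suc (erasure_index (Q K v) l))])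
     [0..<erasure_len (Q K v)])"

lemma Q_ne: "Q K v ~= []" using Q_length[of K v] by auto

lemma hd_Q: "hd (Q K v) = v ! 0" using Q_nth[of 0 K v] Q_ne[of K v] by (simp add: hd_conv_nth)

lemma erase_idx_route:
  assumes v: "v ~= []" "last v \<in> GV K" "hd v ~= last v"
  shows "route v 0 (length v - 1) (erase_idx K v)"
proof -
  let ?z = "Q K v" and ?s = "erasure_index (Q K v)" and ?n = "erasure_len (Q K v)"
  note e = erasure_index_props[OF Q_ne[of K v]]
  have last: "last ?z = last v" by (rule last_Q[OF v(1,2)])
  have n: "0 < ?n" using erasure_len_pos[OF Q_ne[of K v]] v last hd_Q[of K v] by (simp add: hd_conv_nth)
  have sl: "l < ?n ==> Suc (?s l) \<le> last_hit K v" for l using e(3)[of l] by (simp add: Q_length)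
  have zT: "i \<le> last_hit K v ==> v ! T K v i = ?z ! i" for i by (simp add: Q_nth)
  have TT: "i \<le> j ==> j \<le> last_hit K v ==> T K v i \<le> T K v j" for i j using T_mono[OF v(1), of i j K] by (cases "i = j") auto
  have int: "route v (T K v (?s l)) (T K v (Suc (?s l))) [T K v (?s l)..<T K v (Suc (?s l))]" if "l < ?n" for l using route_interval[OF T_mono[OF v(1)]] sl[OF that] by simp
  \<comment> \<open>Each block ends at the vertex where the next one begins, at a possibly later
    time; the gap is the erased loop.\<close>
  have "m < ?n ==> route v (T K v (?s 0)) (T K v (Suc (?s m)))
      (concat (map (%l. [T K v (?s l)..<T K v (Suc (?s l))]) [0..<Suc m]))" for m
  proof (induction m)
    case 0
    then show ?case using int[of 0] by simp
  next
    case (Suc m)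
    have "Suc (?s m) \<le> ?s (Suc m)" "?s (Suc m) \<le> last_hit K v" using e(4)[of m] e(2)[of "Suc m"] Suc.prems by (simp_all add: Q_length)
    then have "T K v (Suc (?s m)) \<le> T K v (?s (Suc m))" "v ! T K v (Suc (?s m)) = v ! T K v (?s (Suc m))" using TT zT e(5)[of m] Suc.prems by auto
    then have "route v (T K v (?s 0)) (T K v (Suc (?s (Suc m))))
      (concat (map (%l. [T K v (?s l)..<T K v (Suc (?s l))]) [0..<Suc m]) @ [T K v (?s (Suc m))..<T K v (Suc (?s (Suc m)))])" using route_append[OF Suc.IH int[OF Suc.prems]] Suc.prems by auto
    then show ?case by simp
  qed
  from this[of "?n - 1"] have r: "route v (T K v (?s 0)) (T K v (Suc (?s (?n - 1)))) (erase_idx K v)" using n by (simp add: erase_idx_def)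
  have s0: "?s 0 \<le> last_hit K v" "?z ! ?s 0 = ?z ! 0" using last_visit[of 0 ?z] Q_ne[of K v] by (auto simp: Q_length)
  have a: "v ! 0 = v ! T K v (?s 0)" using zT[OF s0(1)] s0(2) zT[of 0] by simp
  have "T K v (Suc (?s (?n - 1))) \<le> length v - 1" using T_length[OF v(1) sl[of "?n - 1"]] n by simp
  moreover have "v ! T K v (Suc (?s (?n - 1))) = v ! (length v - 1)" using zT[OF sl[of "?n - 1"]] e(5)[of "?n - 1"] e(1) n last v(1) by (simp add: last_conv_nth)
  ultimately show ?thesis using route_shift_end[OF route_shift_start[OF r _ a]] by simp
qed

text \<open>The hitting times of a concatenation are those of its coarse path on another clock, so
  the coarse path alone decides which pieces survive.\<close>

lemma erase_segment_pieces:
  assumes qs: "pieces N qs" and K: "K \<le> N"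
  shows "erase_segment K (path_concat qs) = path_concat (map (nth qs) (erase_idx K (ends qs)))"
proof -
  let ?v = "ends qs"
  let ?z = "Q K ?v" and ?s = "erasure_index (Q K ?v)" and ?n = "erasure_len (Q K ?v)"
  have ne: "?v ~= []" by (simp add: ends_def)
  note e = erasure_index_props[OF Q_ne[of K ?v]]
  have sl: "l < ?n ==> Suc (?s l) \<le> last_hit K ?v" for l using e(3)[of l] by (simp add: Q_length)
  have seg: "segment (path_concat qs) (T K (path_concat qs) (?s l)) (T K (path_concat qs) (Suc (?s l))) =
      path_concat (map (nth qs) [T K ?v (?s l)..<T K ?v (Suc (?s l))])" if l: "l < ?n" for l
  proof -
    have "T K ?v (Suc (?s l)) \<le> length qs" using T_length[OF ne sl[OF l]] by (simp add: length_ends)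
    moreover have "T K ?v (?s l) < T K ?v (Suc (?s l))" using T_mono[OF ne] sl[OF l] by simp
    ultimately show ?thesis using pieces_slice(3)[OF qs] T_path_concat[OF qs K] sl[OF l] by simp
  qed
  have "erase_segment K (path_concat qs) = path_concat (map (%l. segment (path_concat qs) (T K (path_concat qs) (?s l))
      (T K (path_concat qs) (Suc (?s l)))) [0..<?n])" unfolding erase_segment_def Q_path_concat[OF qs K] Let_def erasure_len_def ..
  also have "... = path_concat (map path_concat (map (%l. map (nth qs) [T K ?v (?s l)..<T K ?v (Suc (?s l))]) [0..<?n]))" using seg by (intro arg_cong[of _ _ path_concat]) simp
  also have "... = path_concat (concat (map (%l. map (nth qs) [T K ?v (?s l)..<T K ?v (Suc (?s l))]) [0..<?n]))"
  proof (rule path_concat_map_path_concat)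
    fix xs assume "xs \<in> set (map (%l. map (nth qs) [T K ?v (?s l)..<T K ?v (Suc (?s l))]) [0..<?n])"
    then obtain l where l: "l < ?n" "xs = map (nth qs) [T K ?v (?s l)..<T K ?v (Suc (?s l))]" by auto
    then show "xs ~= []" using T_mono[OF ne, of "?s l" "Suc (?s l)" K] sl[OF l(1)] by simp
    have "T K ?v (Suc (?s l)) \<le> length qs" using T_length[OF ne sl[OF l(1)]] by (simp add: length_ends)
    then have "piece N p" if "p \<in> set xs" for p using that l(2) pieces_nth[OF qs] by auto
    then show "p ~= []" if "p \<in> set xs" for p using that by (force simp: piece_def)
  qed
  also have "concat (map (%l. map (nth qs) [T K ?v (?s l)..<T K ?v (Suc (?s l))]) [0..<?n]) = map (nth qs) (erase_idx K ?v)" unfolding erase_idx_def map_concat by (simp add: comp_def)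
  finally show ?thesis .
qed

lemma chain_cell_ends:
  assumes "v ~= []" "chain M cs" "Q M v = path_of M cs" "i < length cs"
  shows "v ! T M v (cum cs i) = cell_pt M (cs ! i) C0" "v ! T M v (cum cs (Suc i)) = cell_pt M (cs ! i) C1"
    "v ! T M v (cum cs i) ~= v ! T M v (cum cs (Suc i))" "T M v (cum cs i) < T M v (cum cs (Suc i))"
    "T M v (cum cs (Suc i)) < length v"
proof -
  have lh: "last_hit M v = cum cs (length cs)" by (rule exit_index_chain(2)[OF assms(1-3)])
  have le: "cum cs (Suc i) \<le> last_hit M v" unfolding lh using assms(4) cum_strict[of "Suc i" "length cs" cs] by (cases "Suc i = length cs") auto
  have lt: "cum cs i < cum cs (Suc i)" by (rule cum_strict) simp
  show 1: "v ! T M v (cum cs i) = cell_pt M (cs ! i) C0" using Q_nth[of "cum cs i" M v] le lt assms(3) path_of_nth[OF assms(2,4), of 0] by (simp add: cell_path_def)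
  show 2: "v ! T M v (cum cs (Suc i)) = cell_pt M (cs ! i) C1" using Q_nth[OF le] assms(3) path_of_nth[OF assms(2,4), of "cell_len (cs ! i)"] by (simp add: cell_path_def cell_len_def)
  show "v ! T M v (cum cs i) ~= v ! T M v (cum cs (Suc i))" unfolding 1 2 cell_pt_def using chain_nth[OF assms(2,4)] by (simp add: delta_inj inj_eq)
  show "T M v (cum cs i) < T M v (cum cs (Suc i))" by (rule T_mono[OF assms(1) lt le])
  show "T M v (cum cs (Suc i)) < length v" by (rule T_length[OF assms(1) le])
qed

lemma erase_step_chain:
  assumes "w ~= []" "chain M cs" "Q M w = path_of M cs"
  shows "erase_step M w = path_concat (map (%i. erase_segment (Suc M) (segment w (T M w (cum cs i)) (T M w (cum cs (Suc i)))))
    [0..<length cs])"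
proof -
  note ec = exit_index_chain[OF assms]
  have "erase_step M w = path_concat (map (%i. erase_segment (Suc M) (segment w (exit_time M w (i - 1)) (exit_time M w i)))
    (map Suc [0..<length cs]))" unfolding erase_step_def ec(3) by (simp only: map_Suc_upt One_nat_def)
  also have "... = path_concat (map (%i. erase_segment (Suc M) (segment w (T M w (cum cs i)) (T M w (cum cs (Suc i)))))
    [0..<length cs])" unfolding map_map comp_def exit_time_def by (intro arg_cong[of _ _ path_concat] map_cong refl) (simp add: ec(1) del: exit_index.simps(2) cum.simps(2))
  finally show ?thesis .
qed

text \<open>The order of quantifiers matters: one list of indices serves all refinements
  \<open>qs\<close> of \<open>v\<close>.\<close>

lemma erase_step_pieces:
  assumes v: "lattice_path N v" and M: "M < N" and ch: "chain M cs" and Qv: "Q M v = path_of M cs"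
    and lastv: "last v \<in> GV M"
  shows "\<exists>is. route v 0 (length v - 1) is \<and>
    (\<forall>qs. pieces N qs \<and> ends qs = v --> erase_step M (path_concat qs) = path_concat (map (nth qs) is))"
proof -
  have ne: "v ~= []" using v by (simp add: lattice_path_def)
  note cc = chain_cell_ends[OF ne ch Qv]
  define e where "e = (%i. T M v (cum cs i))"
  define f where "f = (%i. map ((+) (e i)) (erase_idx (Suc M) (segment v (e i) (e (Suc i)))))"
  have GM: "!!i. i < length cs ==> v ! e (Suc i) \<in> GV (Suc M)"
  proof -
    fix i assume i: "i < length cs"
    have "fst (cs ! i) \<in> cells three_cells M" using chain_nth[OF ch i] by blast
    then have "cell_pt M (cs ! i) C1 \<in> GV M" unfolding cell_pt_def GV_eq vertices_of_def by blast
    then show "v ! e (Suc i) \<in> GV (Suc M)" using cc(2)[OF i] GV_Suc unfolding e_def by auto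
  qed
  have r: "route v (e i) (e (Suc i)) (f i)" if i: "i < length cs" for i
  proof -
    have lt: "e i < e (Suc i)" "e (Suc i) < length v" using cc(4,5)[OF i] by (simp_all add: e_def)
    let ?z = "segment v (e i) (e (Suc i))"
    have len: "length ?z = Suc (e (Suc i) - e i)" using lt by (simp add: segment_def)
    then have z: "?z ~= []" "hd ?z = v ! e i" "last ?z = v ! e (Suc i)" using lt by (auto simp: segment_def hd_conv_nth last_conv_nth)
    have "route ?z 0 (length ?z - 1) (erase_idx (Suc M) ?z)" using GM[OF i] cc(3)[OF i] z by (intro erase_idx_route) (auto simp: e_def)
    then show ?thesis unfolding f_def using lt len by (intro route_segment) auto
  qed
  have rr: "m < length cs ==> route v (e 0) (e (Suc m)) (concat (map f [0..<Suc m]))" for m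
  proof (induction m)
    case (Suc m)
    then show ?case using route_append[OF Suc.IH r[of "Suc m"]] by simp
  qed (use r in simp)
  have csne: "length cs > 0" using ch by (simp add: chain_def)
  define "is" where "is = concat (map f [0..<length cs])"
  have r1: "route v (e 0) (e (length cs)) is" using rr[of "length cs - 1"] csne by (simp add: is_def del: upt_Suc)
  have e0: "e 0 = 0" by (simp add: e_def)
  have lh: "last_hit M v = cum cs (length cs)" by (rule exit_index_chain(2)[OF ne ch Qv])
  have "v ! e (length cs) = v ! (length v - 1)"
  proof -
    have "v ! e (length cs) = last (Q M v)" unfolding e_def lh[symmetric] using Q_nth[of "last_hit M v" M v] Q_ne[of M v] Q_length[of M v] by (simp add: last_conv_nth)
    then show ?thesis using last_Q[OF ne lastv] ne by (simp add: last_conv_nth)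
  qed
  moreover have "e (length cs) \<le> length v - 1" using cc(5)[of "length cs - 1"] csne by (simp add: e_def del: cum.simps(2))
  ultimately have r2: "route v 0 (length v - 1) is" using route_shift_end[OF r1] e0 by simp
  have "erase_step M (path_concat qs) = path_concat (map (nth qs) is)" if qs: "pieces N qs" "ends qs = v" for qs
  proof -
    let ?w = "path_concat qs"
    have MN: "M \<le> N" "Suc M \<le> N" using M by auto
    have Qw: "Q M ?w = path_of M cs" using Q_path_concat[OF qs(1) MN(1)] qs(2) Qv by simp
    have lq: "length v = Suc (length qs)" using qs(2) length_ends by auto
    have Tw: "T M ?w (cum cs i) = pos qs (e i)" if "i \<le> length cs" for i
    proof -
      have "cum cs i \<le> last_hit M (ends qs)" unfolding qs(2) lh using that cum_strict[of i "length cs" cs] by (cases "i = length cs") auto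
      then show ?thesis using T_path_concat[OF qs(1) MN(1)] qs(2) by (simp add: e_def)
    qed
    have seg: "erase_segment (Suc M) (segment ?w (T M ?w (cum cs i)) (T M ?w (cum cs (Suc i)))) = path_concat (map (nth qs) (f i))"
      if i: "i < length cs" for i
    proof -
      have lt: "e i < e (Suc i)" "e (Suc i) \<le> length qs" using cc(4,5)[OF i] lq by (simp_all add: e_def)
      note ps = pieces_slice[OF qs(1) lt]
      have "erase_segment (Suc M) (segment ?w (T M ?w (cum cs i)) (T M ?w (cum cs (Suc i)))) =
         path_concat (map (nth (map (nth qs) [e i..<e (Suc i)])) (erase_idx (Suc M) (segment v (e i) (e (Suc i)))))" using erase_segment_pieces[OF ps(1) MN(2)] ps(2,3) Tw[of i] Tw[of "Suc i"] i qs(2) by simp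
      also have "map (nth (map (nth qs) [e i..<e (Suc i)])) (erase_idx (Suc M) (segment v (e i) (e (Suc i)))) = map (nth qs) (f i)" unfolding f_def map_map
      proof (rule map_cong[OF refl])
        fix k assume k: "k \<in> set (erase_idx (Suc M) (segment v (e i) (e (Suc i))))"
        then have "e i + k \<in> set (f i)" by (auto simp: f_def)
        then have "e i + k < e (Suc i)" using r[OF i] by (auto simp: route_def)
        then show "map (nth qs) [e i..<e (Suc i)] ! k = ((!) qs \<circ> (+) (e i)) k" by simp
      qed
      finally show ?thesis .
    qed
    have "erase_step M ?w = path_concat (map path_concat (map (%i. map (nth qs) (f i)) [0..<length cs]))" unfolding erase_step_chain[OF path_concat_ne[OF qs(1)] ch Qw] using seg by (intro arg_cong[of _ _ path_concat]) simp
    also have "... = path_concat (concat (map (%i. map (nth qs) (f i)) [0..<length cs]))"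
    proof (rule path_concat_map_path_concat)
      fix xs assume "xs \<in> set (map (%i. map (nth qs) (f i)) [0..<length cs])"
      then obtain i where i: "i < length cs" "xs = map (nth qs) (f i)" by auto
      then show "xs ~= []" using r[OF i(1)] by (auto simp: route_def)
      have "k < length qs" if "k \<in> set (f i)" for k using r[OF i(1)] that cc(5)[OF i(1)] lq by (force simp: route_def e_def)
      then have "piece N p" if "p \<in> set xs" for p using that i(2) pieces_nth[OF qs(1)] by auto
      then show "p ~= []" if "p \<in> set xs" for p using that by (force simp: piece_def)
    qed
    also have "concat (map (%i. map (nth qs) (f i)) [0..<length cs]) = map (nth qs) is" unfolding is_def map_concat by (simp add: comp_def)
    finally show ?thesis .
  qed
  then show ?thesis using r2 by blast
qed

text \<open>Successive selections compose to a single one, again determined by \<open>v\<close>.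
  Hence, given \<open>v\<close>, the choice of the surviving pieces reveals nothing about their
  inner structure.\<close>

lemma erased_pieces:
  assumes v: "lattice_path N v" "2 \<le> length v" "last v \<in> GV 0"
  shows "K \<le> N ==> (!!M. M < K ==> \<exists>cs. chain M cs \<and> Q M (erased v M) = path_of M cs) ==>
    \<exists>is. sorted_wrt (<) is \<and> (\<forall>i\<in>set is. i < steps v) \<and> last (erased v K) = last v \<and>
      (\<forall>qs. pieces N qs \<and> ends qs = v --> pieces N (map (nth qs) is) \<and> ends (map (nth qs) is) = erased v K
         \<and> erased (path_concat qs) K = path_concat (map (nth qs) is))"
proof (induction K)
  case 0
  have "map (nth qs) [0..<steps v] = qs" if "ends qs = v" for qs :: "path list" using that length_ends[of qs] by (intro nth_equalityI) (auto simp: steps_def)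
  then show ?case by (intro exI[of _ "[0..<steps v]"]) auto
next
  case (Suc K)
  then obtain "is" where I: "sorted_wrt (<) is" "!!i. i \<in> set is ==> i < steps v" "last (erased v K) = last v"
    "!!qs. pieces N qs ==> ends qs = v ==> pieces N (map (nth qs) is) \<and> ends (map (nth qs) is) = erased v K
         \<and> erased (path_concat qs) K = path_concat (map (nth qs) is)" by force
  obtain cs where cs: "chain K cs" "Q K (erased v K) = path_of K cs" using Suc.prems(2)[of K] by blast
  note pe = pieces_edges[OF v(1,2)]
  have vK: "lattice_path N (erased v K)" using I(4)[OF pe] lattice_path_ends by metis
  have "last (erased v K) \<in> GV K" using I(3) v(3) GV_mono[of 0 K] by auto
  then obtain js where js: "route (erased v K) 0 (length (erased v K) - 1) js"
    "!!qs. pieces N qs ==> ends qs = erased v K ==> erase_step K (path_concat qs) = path_concat (map (nth qs) js)" using erase_step_pieces[OF vK _ cs] Suc.prems(1) by force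
  have len: "length (erased v K) = Suc (length is)" using I(4)[OF pe] length_ends by (metis length_map)
  have jlt: "j < length is" if "j \<in> set js" for j using js(1) that len by (auto simp: route_def)
  \<comment> \<open>Indices into the pieces kept so far are translated into indices of the pieces of
    \<open>v\<close>.\<close>
  define ks where "ks = map (nth is) js"
  have k1: "sorted_wrt (<) ks" unfolding ks_def sorted_wrt_map
  proof (rule sorted_wrt_mono_rel)
    show "sorted_wrt (<) js" using js(1) by (simp add: route_def)
    fix x y assume "x \<in> set js" "y \<in> set js" "x < y"
    then show "is ! x < is ! y" using sorted_wrt_nth_less[OF I(1)] jlt by blast
  qed
  have k2: "!!i. i \<in> set ks ==> i < steps v" using I(2) jlt by (auto simp: ks_def)
  have main: "pieces N (map (nth qs) ks) \<and> ends (map (nth qs) ks) = map (nth (erased v K)) js @ [erased v K ! Suc (last js)] \<and>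
      erased (path_concat qs) (Suc K) = path_concat (map (nth qs) ks)" if qs: "pieces N qs" "ends qs = v" for qs
  proof -
    note Iq = I(4)[OF qs]
    have e: "map (nth (map (nth qs) is)) js = map (nth qs) ks" using jlt by (simp add: ks_def)
    have rt: "route (ends (map (nth qs) is)) 0 (length (map (nth qs) is)) js" using js(1) Iq len by simp
    have "pieces N (map (nth qs) is)" using Iq by blast
    from pieces_route[OF this rt] show ?thesis using Iq js(2)[of "map (nth qs) is"] unfolding e by simp
  qed
  note me = main[OF pe]
  have short: "!!q. q \<in> set (map (nth (edges_list v)) ks) ==> length q = 2" using k2 by (auto simp: edges_list_def)
  \<comment> \<open>Applied to the trivial refinement, whose concatenation is \<open>v\<close>, the
    general statement computes the erasure of \<open>v\<close> itself.\<close>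
  have "path_concat (edges_list v) = v" by (rule path_concat_edges[OF v(1,2)])
  then have ev: "erased v (Suc K) = map (nth (erased v K)) js @ [erased v K ! Suc (last js)]" using me path_concat_short[OF _ short] by metis
  have lv: "erased v K ! length is = last v" using I(3) len by (metis diff_Suc_1 last_conv_nth length_0_conv nat.distinct(1))
  have "last (erased v (Suc K)) = last v" unfolding ev using js(1) lv len by (simp add: route_def)
  then show ?case using k1 k2 main ev by (intro exI[of _ ks]) metis
qed


subsection \<open>Loop erasure by recursion\<close>

text \<open>The list is cut at the next occurrence of its head rather than at the last one; the
  recursion repeats this until no further occurrence is left.\<close>

function lerase :: "'a list => 'a list" where
  "lerase [] = []"
| "lerase (x # xs) = (if x \<in> set xs then lerase (dropWhile (%y. y ~= x) xs) else x # lerase xs)" by pat_completeness auto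
termination by (relation "Wellfounded.measure length") (auto simp: le_imp_less_Suc length_dropWhile_le)

definition loop_erasure :: "path => path" where
  "loop_erasure z = map (%l. z ! erasure_index z l) [0..<Suc (erasure_len z)]"

lemma last_visit_append:
  assumes "j < length y"
  shows "last_visit (xs @ y) (length xs + j) = length xs + last_visit y j"
proof -
  let ?z = "xs @ y"
  have j: "length xs + j < length ?z" using assms by simp
  note a = last_visit[OF j] and b = last_visit[OF assms]
  have "length xs + last_visit y j \<le> last_visit ?z (length xs + j)" using a(4)[of "length xs + last_visit y j"] b(2,3) by (fastforce simp: nth_append)
  moreover have "last_visit ?z (length xs + j) \<le> length xs + last_visit y j"
  proof (rule ccontr)
    assume *: "\<not> last_visit ?z (length xs + j) \<le> length xs + last_visit y j"
    define m where "m = last_visit ?z (length xs + j) - length xs"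
    have m: "last_visit ?z (length xs + j) = length xs + m" "last_visit y j < m" "m < length y" using * a(1,2) by (auto simp: m_def)
    then show False using b(4)[of m] a(3) by (simp add: nth_append)
  qed
  ultimately show ?thesis by simp
qed

text \<open>Once the erasure has reached the last visit to the first vertex of the suffix
  \<open>y\<close>, it proceeds exactly as the erasure of \<open>y\<close>.\<close>

lemma loop_erasure_shift:
  assumes y: "y ~= []" and st: "erasure_index z k = length xs + last_visit y 0" and z: "z = xs @ y"
    and early: "!!l. l < k ==> z ! erasure_index z l ~= last z"
  shows "erasure_len z = k + erasure_len y"
    "l \<le> erasure_len y ==> erasure_index z (k + l) = length xs + erasure_index y l"
proof -
  note e = erasure_index_props[OF y]
  show 1: "l \<le> erasure_len y ==> erasure_index z (k + l) = length xs + erasure_index y l" for l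
  proof (induction l)
    case 0
    then show ?case using st by simp
  next
    case (Suc l)
    then have "Suc (erasure_index y l) < length y" using e(3) by simp
    then show ?case using last_visit_append[of "Suc (erasure_index y l)" y xs] Suc unfolding z by simp
  qed
  have lz: "last z = last y" using y z by simp
  have v: "l \<le> erasure_len y ==> z ! erasure_index z (k + l) = y ! erasure_index y l" for l using 1[of l] by (simp add: z nth_append)
  show "erasure_len z = k + erasure_len y" unfolding erasure_len_def[of z]
  proof (rule Least_equality)
    show "z ! erasure_index z (k + erasure_len y) = last z" using v[of "erasure_len y"] e(1) lz by simp
    fix m assume m: "z ! erasure_index z m = last z"
    show "k + erasure_len y \<le> m"
    proof (rule ccontr)
      assume *: "\<not> k + erasure_len y \<le> m"
      have "k \<le> m" using early[of m] m not_less by blast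
      then obtain l where "m = k + l" using le_Suc_ex by blast
      then show False using v[of l] e(6)[of l] m lz * by simp
    qed
  qed
qed

lemma loop_erasure_eq: "z ~= [] ==> loop_erasure z = lerase z"
proof (induction z rule: lerase.induct)
  case (2 x xs)
  let ?z = "x # xs"
  show ?case
  proof (cases "x \<in> set xs")
    case True
    define y where "y = dropWhile (%y. y ~= x) xs"
    define p where "p = x # takeWhile (%y. y ~= x) xs"
    have z: "?z = p @ y" by (simp add: p_def y_def)
    have y: "y ~= []" "y ! 0 = x" using True hd_dropWhile[of "%y. y ~= x" xs] by (auto simp: y_def dropWhile_eq_Nil_conv hd_conv_nth)
    have "erasure_index ?z 0 = last_visit ?z (length p + 0)"
    proof -
      have "?z ! (length p + 0) = y ! 0" unfolding z by (rule nth_append_length_plus)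
      then have "?z ! 0 = ?z ! (length p + 0)" using y by simp
      then show ?thesis unfolding erasure_index.simps last_visit_def by simp
    qed
    also have "... = length p + last_visit y 0" unfolding z by (rule last_visit_append) (use y in simp)
    finally have st: "erasure_index ?z 0 = length p + last_visit y 0" .
    note s = loop_erasure_shift[OF y(1) st z]
    have "loop_erasure ?z = loop_erasure y"
    proof -
      have "?z ! erasure_index ?z l = y ! erasure_index y l" if "l \<le> erasure_len y" for l
      proof -
        have "?z ! erasure_index ?z l = (p @ y) ! (length p + erasure_index y l)" using s(2)[of l] that unfolding z by simp
        then show ?thesis unfolding nth_append_length_plus .
      qed
      then show ?thesis unfolding loop_erasure_def using s(1) by (intro map_cong) (auto simp del: upt_Suc)
    qed
    then show ?thesis using 2(1)[OF True y(1)[unfolded y_def]] True by (simp add: y_def)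
  next
    case False
    have l0: "last_visit ?z 0 = 0"

    proof (rule ccontr)
      assume "last_visit ?z 0 ~= 0"
      then obtain m where m: "last_visit ?z 0 = Suc m" using not0_implies_Suc by blast
      then have "m < length xs" "xs ! m = x" using last_visit(2,3)[of 0 ?z] by auto
      then show False using False nth_mem by blast
    qed
    show ?thesis
    proof (cases "xs = []")
      case True
      have "erasure_len ?z = 0" unfolding erasure_len_def using True l0 by (intro Least_equality) auto
      then show ?thesis using True l0 by (simp add: loop_erasure_def)
    next
      case ne: False
      have st: "erasure_index ?z 1 = length [x] + last_visit xs 0" using last_visit_append[of 0 xs "[x]"] ne l0 by simp
      have early: "!!l. l < 1 ==> ?z ! erasure_index ?z l ~= last ?z" using l0 ne False by auto
      have z: "?z = [x] @ xs" by simp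
      note s0 = loop_erasure_shift[OF ne st z early]
      have s1: "erasure_len ?z = Suc (erasure_len xs)" using s0(1) by simp
      have s2: "?z ! erasure_index ?z (Suc l) = xs ! erasure_index xs l" if le: "l \<le> erasure_len xs" for l
      proof -
        have "erasure_index ?z (1 + l) = length [x] + erasure_index xs l" by (rule s0(2)) (use le in simp_all)
        then have "erasure_index ?z (Suc l) = Suc (erasure_index xs l)" by (simp del: erasure_index.simps)
        then show ?thesis by (simp only: nth_Cons_Suc)
      qed
      have "loop_erasure ?z = x # loop_erasure xs"
      proof (rule nth_equalityI)
        show "length (loop_erasure ?z) = length (x # loop_erasure xs)" using s1 by (simp add: loop_erasure_def)
        fix i assume i: "i < length (loop_erasure ?z)"
        show "loop_erasure ?z ! i = (x # loop_erasure xs) ! i"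
        proof (cases i)
          case 0
          then show ?thesis using l0 by (simp add: loop_erasure_def del: upt_Suc)
        next
          case (Suc l)
          then have "l \<le> erasure_len xs" using i s1 by (simp add: loop_erasure_def)
          then show ?thesis using Suc i s1 s2[of l] by (simp add: loop_erasure_def del: upt_Suc erasure_index.simps)
        qed
      qed
      then show ?thesis using 2(2)[OF False ne] False by simp
    qed
  qed
qed simp

lemma lerase_map:
  "inj_on f (set z) ==> lerase (map f z) = map f (lerase z)"
proof (induction z rule: lerase.induct)
  case (2 x xs)
  have mem: "f x \<in> f ` set xs \<longleftrightarrow> x \<in> set xs" using 2(3) by (auto simp: inj_on_def)
  have "dropWhile (%y. y ~= f x) (map f xs) = map f (dropWhile (%y. y ~= x) xs)" unfolding dropWhile_map by (intro arg_cong[of _ _ "map f"] dropWhile_cong) (use 2(3) in \<open>auto simp: inj_on_def\<close>)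
  moreover have "inj_on f (set (dropWhile (%y. y ~= x) xs))" "inj_on f (set xs)" by (rule inj_on_subset[OF 2(3)]; auto dest: set_dropWhileD)+
  ultimately show ?case using 2(1,2) mem by simp
qed simp

lemma set_lerase: "set (lerase z) \<subseteq> set z"
proof (induction z rule: lerase.induct)
  case (2 x xs)
  then show ?case using set_dropWhileD[of _ "%y. y ~= x" xs] by auto
qed simp

lemma distinct_lerase: "distinct (lerase z)"
proof (induction z rule: lerase.induct)
  case (2 x xs)
  then show ?case using set_lerase[of xs] by auto
qed simp

lemma lerase_props:
  "z ~= [] ==> lerase z ~= [] \<and> hd (lerase z) = hd z \<and> last (lerase z) = last z"
proof (induction z rule: lerase.induct)
  case (2 x xs)
  show ?case
  proof (cases "x \<in> set xs")
    case True
    then have ne: "dropWhile (%y. y ~= x) xs ~= []" by (auto simp: dropWhile_eq_Nil_conv)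
    moreover have "hd (dropWhile (%y. y ~= x) xs) = x" using hd_dropWhile[OF ne] by simp
    moreover have "last (dropWhile (%y. y ~= x) xs) = last xs" using ne by (metis last_appendR takeWhile_dropWhile_id)
    moreover have "xs ~= []" using True by auto
    ultimately show ?thesis using 2(1)[OF True] True by simp
  next
    case False
    then show ?thesis using 2(2)[OF False] by auto
  qed
qed simp

lemma successively_lerase: "successively P z ==> successively P (lerase z)"
proof (induction z rule: lerase.induct)
  case (2 x xs)
  show ?case
  proof (cases "x \<in> set xs")
    case True
    have "successively P (takeWhile (%y. y ~= x) xs @ dropWhile (%y. y ~= x) xs)" using 2(3) by (auto simp: successively_Cons)
    then have "successively P (dropWhile (%y. y ~= x) xs)" unfolding successively_append_iff by blast
    then show ?thesis using 2(1)[OF True] True by simp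
  next
    case False
    then show ?thesis using 2(2)[OF False] 2(3) lerase_props[of xs] by (cases "xs = []") (auto simp: successively_Cons)
  qed
qed simp

subsection \<open>Self-avoiding paths in the unit figure\<close>

definition all_nodes :: "node list" where
  "all_nodes = map Co [C0, C1, C2] @ map Mi [C0, C1, C2] @ map (Ou C0) [C0, C1, C2] @ map (Ou C2) [C0, C1, C2]"

fun saws :: "nat => node list => node => node list list" where
  "saws 0 vis x = []"
| "saws (Suc k) vis x = (if x = Co C1 then [[x]] else
     map ((#) x) (concat (map (saws k (x # vis)) (filter (%y. adj x y \<and> y \<notin> set (x # vis)) all_nodes))))"

lemma set_all_nodes: "set all_nodes = nodes_at {C0, C2}"
proof -
  have "x \<in> set all_nodes \<longleftrightarrow> x \<in> nodes_at {C0, C2}" for x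
  proof (cases x)
    case (Co i) then show ?thesis by (cases i) (auto simp: all_nodes_def nodes_at_def)
  next
    case (Mi i) then show ?thesis by (cases i) (auto simp: all_nodes_def nodes_at_def)
  next
    case (Ou i j) then show ?thesis by (cases i; cases j) (auto simp: all_nodes_def nodes_at_def)
  qed
  then show ?thesis by blast
qed

lemma saws_complete:
  "distinct (x # xs) ==> set (x # xs) \<inter> set vis = {} ==> successively adj (x # xs) ==> last (x # xs) = Co C1 ==>
   set (x # xs) \<subseteq> nodes_at {C0, C2} ==> length (x # xs) \<le> k ==> x # xs \<in> set (saws k vis x)"
proof (induction k arbitrary: x xs vis)
  case (Suc k)
  show ?case
  proof (cases xs)
    case Nil
    then show ?thesis using Suc.prems by simp
  next
    case (Cons y ys)
    then have "x ~= Co C1" using Suc.prems(1,4) last_in_set[of xs] by auto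
    moreover have "xs \<in> set (saws k (x # vis) y)" unfolding Cons by (rule Suc.IH) (use Suc.prems Cons in auto)
    moreover have "y \<in> set (filter (%y. adj x y \<and> y \<notin> set (x # vis)) all_nodes)" using Suc.prems Cons by (auto simp: set_all_nodes)
    ultimately show ?thesis by auto
  qed
qed simp

text \<open>Self-avoiding paths in the unit figure and, for each of them, the types of the half-size triangles
  it crosses. Two triangles are crossed if the path goes from the corner triangle at \<open>C0\<close> directly
  to that at \<open>C1\<close>, and three otherwise.\<close>

definition saw_table :: "(node list \<times> bool list) list" where
  "saw_table = [
    ([Co C0, Mi C2, Co C1], [False, False]),
    ([Co C0, Mi C2, Mi C0, Co C1], [False, True]),
    ([Co C0, Mi C1, Mi C2, Co C1], [True, False]),
    ([Co C0, Mi C1, Mi C2, Mi C0, Co C1], [True, True]),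
    ([Co C0, Mi C1, Mi C0, Co C1], [False, False, False]),
    ([Co C0, Mi C1, Mi C0, Mi C2, Co C1], [False, False, True]),
    ([Co C0, Mi C1, Co C2, Mi C0, Co C1], [False, True, False]),
    ([Co C0, Mi C1, Co C2, Mi C0, Mi C2, Co C1], [False, True, True]),
    ([Co C0, Mi C2, Mi C1, Mi C0, Co C1], [True, False, False]),
    ([Co C0, Mi C2, Mi C1, Co C2, Mi C0, Co C1], [True, True, False])]"

definition code_of :: "node list => bool list" where
  "code_of l = the (map_of saw_table l)"

text \<open>There are twelve nodes and none is visited twice, so depth 12 exhausts the self-avoiding
  paths. The finitely many cases are evaluated.\<close>

lemma saws_table: "list_all (%l. l \<in> set (map fst saw_table)) (saws 12 [] (Co C0))" by code_simp

lemma saw_in_table: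
  assumes "distinct l" "l ~= []" "hd l = Co C0" "last l = Co C1" "successively adj l" "set l \<subseteq> nodes_at {C0, C2}"
  shows "(l, code_of l) \<in> set saw_table"
proof -
  obtain xs where l: "l = Co C0 # xs" using assms(2,3) by (cases l) auto
  have "length l = card (set l)" using assms(1) by (simp add: distinct_card)
  also have "... \<le> card (set all_nodes)" using assms(6) unfolding set_all_nodes[symmetric] by (intro card_mono) simp_all
  also have "... \<le> 12" by (rule order_trans[OF card_length]) (simp add: all_nodes_def)
  finally have "l \<in> set (saws 12 [] (Co C0))" unfolding l by (intro saws_complete) (use assms l in auto)
  then have "l \<in> set (map fst saw_table)" using saws_table by (auto simp: list_all_iff)
  then obtain bs where "map_of saw_table l = Some bs" by (metis (no_types, opaque_lifting) imageE image_set map_of_eq_None_iff not_None_eq)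
  then show ?thesis unfolding code_of_def using map_of_SomeD by force
qed

subsection \<open>Refinement of cells\<close>

text \<open>A walk from \<open>C0\<close> to \<open>C1\<close> relabelled by \<open>swap12\<close>
  runs from \<open>C0\<close> to \<open>C2\<close>, and relabelled by \<open>swap02\<close> from
  \<open>C2\<close> to \<open>C1\<close>. These are the two halves of a Type 2 crossing.\<close>

definition swap12 :: "corner => corner" where
  "swap12 k = (case k of C0 => C0 | C1 => C2 | C2 => C1)"

definition swap02 :: "corner => corner" where
  "swap02 k = (case k of C0 => C2 | C1 => C1 | C2 => C0)"

lemma inj_swap: "inj swap12" "inj swap02" unfolding inj_def all_corner by (auto simp: swap12_def swap02_def)

definition sub_cell :: "int \<times> int => corner => int \<times> int" where
  "sub_cell c i = c + c + delta i"

text \<open>The entries of the list are the types of the subcells in the order of crossing. If the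
  subcell at \<open>C2\<close> is crossed as well, the first subcell is left towards
  \<open>C2\<close> and the last one entered from there, which is the effect of the two
  swaps.\<close>

fun refine :: "cell => bool list => cell list" where
  "refine (c, \<rho>, t) [t0, t1] = [(sub_cell c (\<rho> C0), \<rho>, t0), (sub_cell c (\<rho> C1), \<rho>, t1)]"
| "refine (c, \<rho>, t) [t0, t2, t1] =
     [(sub_cell c (\<rho> C0), \<rho> \<circ> swap12, t0), (sub_cell c (\<rho> C2), \<rho>, t2), (sub_cell c (\<rho> C1), \<rho> \<circ> swap02, t1)]"
| "refine _ _ = []"

definition codes :: "bool list set" where "codes = snd ` set saw_table"

lemma codes_cases:
  assumes "bs \<in> codes"
  obtains t0 t1 where "bs = [t0, t1]" | t0 t2 t1 where "bs = [t0, t2, t1]"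
proof -
  have "\<forall>p\<in>set saw_table. length (snd p) = 2 \<or> length (snd p) = 3" unfolding saw_table_def by simp
  then have "length bs = 2 \<or> length bs = 3" using assms unfolding codes_def by blast
  then show thesis
  proof
    assume "length bs = 2"
    then obtain t0 t1 where "bs = [t0, t1]" by (auto simp: length_Suc_conv numeral_2_eq_2)
    then show thesis by (rule that(1))
  next
    assume "length bs = 3"
    then obtain t0 t2 t1 where "bs = [t0, t2, t1]" by (auto simp: length_Suc_conv numeral_3_eq_3)
    then show thesis by (rule that(2))
  qed
qed

lemma cell_pt_sub_same:
  "inj \<rho> ==> cell_pt (Suc N) (sub_cell c (\<rho> i), \<rho> \<circ> \<sigma>, t) j = emb N c \<rho> (if \<sigma> j = i then Co i else Mi (SOME k. k ~= i \<and> k ~= \<sigma> j))"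
proof -
  assume inj: "inj \<rho>"
  show ?thesis
  proof (cases "\<sigma> j = i")
    case True
    then have "sub_cell c (\<rho> i) + delta (\<rho> (\<sigma> j)) = (c + delta (\<rho> i)) + (c + delta (\<rho> i))" by (simp add: sub_cell_def algebra_simps)
    then show ?thesis using True by (simp add: cell_pt_def emb_def)
  next
    case False
    define k where "k = (SOME k. k ~= i \<and> k ~= \<sigma> j)"
    have "\<exists>k. k ~= i \<and> k ~= \<sigma> j" using third_corner[of i "\<sigma> j"] by metis
    then have k: "k ~= i" "k ~= \<sigma> j" unfolding k_def by (metis (mono_tags, lifting) someI_ex)+
    have "midpoint_of c (\<rho> k) = c + c + delta (\<rho> i) + delta (\<rho> (\<sigma> j))" by (rule midpoint_of_add) (use k False inj in \<open>auto simp: inj_eq\<close>)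
    then show ?thesis using False k_def by (simp add: cell_pt_def emb_def sub_cell_def)
  qed
qed

lemma some_third:
  "(SOME k. k ~= C0 \<and> k ~= C1) = C2" "(SOME k. k ~= C0 \<and> k ~= C2) = C1" "(SOME k. k ~= C1 \<and> k ~= C0) = C2"
  "(SOME k. k ~= C1 \<and> k ~= C2) = C0" "(SOME k. k ~= C2 \<and> k ~= C0) = C1" "(SOME k. k ~= C2 \<and> k ~= C1) = C0" by (rule some_equality, simp, rename_tac k, (case_tac k; simp))+

lemma refine_path:
  assumes "(l, bs) \<in> set saw_table" "inj \<rho>"
  shows "path_of (Suc N) (refine (c, \<rho>, t) bs) = map (emb N c \<rho>) l"
proof -
  have id: "cell_pt (Suc N) (sub_cell c (\<rho> i), \<rho>, t') j = emb N c \<rho> (if j = i then Co i else Mi (SOME k. k ~= i \<and> k ~= j))" for i j t' using cell_pt_sub_same[OF assms(2), of N c i id t' j] by simp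
  show ?thesis using assms(1) unfolding saw_table_def by (auto simp: path_of_def cell_path_def id cell_pt_sub_same[OF assms(2)] some_third swap12_def swap02_def)
qed

lemma half_sub_cell_eq: "half (sub_cell c i) = c" using half_sub_cell unfolding sub_cell_def by blast

lemma sub_cell_inj: "sub_cell c i = sub_cell d j \<longleftrightarrow> c = d \<and> i = j" by (metis half_sub_cell_eq sub_cell_def add_left_cancel delta_inj)

lemma sub_cell_cells: "c \<in> cells S N ==> sub_cell c i \<in> cells S (Suc N)" unfolding cells_Suc sub_cell_def by blast

lemma refine_props:
  assumes "bs \<in> codes" "inj (fst (snd C))" "fst C \<in> cells three_cells N"
  shows "chain (Suc N) (refine C bs)" "cell_pt (Suc N) (hd (refine C bs)) C0 = cell_pt N C C0"
    "cell_pt (Suc N) (last (refine C bs)) C1 = cell_pt N C C1"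
    "!!D. D \<in> set (refine C bs) ==> half (fst D) = fst C"
    "distinct (map fst (refine C bs))" "map (%D. snd (snd D)) (refine C bs) = bs"
proof -
  obtain c \<rho> t where C: "C = (c, \<rho>, t)" by (cases C)
  have inj: "inj \<rho>" and c: "c \<in> cells three_cells N" using assms C by auto
  have id: "cell_pt (Suc N) (sub_cell c (\<rho> i), \<rho>, t') j = emb N c \<rho> (if j = i then Co i else Mi (SOME k. k ~= i \<and> k ~= j))" for i j t' using cell_pt_sub_same[OF inj, of N c i id t' j] by simp
  have e: "cell_pt N C i = emb N c \<rho> (Co i)" for i unfolding emb_Co by (simp add: cell_pt_def C)
  have ic: "inj (\<rho> \<circ> swap12)" "inj (\<rho> \<circ> swap02)" using inj inj_swap by (auto intro: inj_compose)
  note facts = chain_def C id cell_pt_sub_same[OF inj] some_third swap12_def swap02_def inj ic sub_cell_cells[OF c]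
    sub_cell_inj inj_eq[OF inj] half_sub_cell_eq
  show "chain (Suc N) (refine C bs)" by (rule codes_cases[OF assms(1)]) (simp_all add: facts del: cells.simps)
  show "cell_pt (Suc N) (hd (refine C bs)) C0 = cell_pt N C C0" unfolding e by (rule codes_cases[OF assms(1)]) (simp_all add: facts)
  show "cell_pt (Suc N) (last (refine C bs)) C1 = cell_pt N C C1" unfolding e by (rule codes_cases[OF assms(1)]) (simp_all add: facts)
  show "!!D. D \<in> set (refine C bs) ==> half (fst D) = fst C" by (rule codes_cases[OF assms(1)]) (auto simp: facts)
  show "distinct (map fst (refine C bs))" by (rule codes_cases[OF assms(1)]) (simp_all add: facts)
  show "map (%D. snd (snd D)) (refine C bs) = bs" by (rule codes_cases[OF assms(1)]) (simp_all add: facts)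
qed

definition refine_all :: "cell list => bool list list => cell list" where
  "refine_all cs bss = concat (map2 refine cs bss)"

text \<open>At a seam the last child of one cell and the first child of the next have different
  parents and hence differ. The claims about the first child are there to close the
  induction.\<close>

lemma chain_refine_all:
  "chain N cs ==> length bss = length cs ==> set bss \<subseteq> codes ==>
    chain (Suc N) (refine_all cs bss) \<and> cell_pt (Suc N) (hd (refine_all cs bss)) C0 = cell_pt N (hd cs) C0 \<and>
    half (fst (hd (refine_all cs bss))) = fst (hd cs)"
proof (induction cs arbitrary: bss)
  case (Cons C cs)
  obtain bs bss' where b: "bss = bs # bss'" "bs \<in> codes" "set bss' \<subseteq> codes" "length bss' = length cs" using Cons.prems(2,3) by (cases bss) auto
  have C: "inj (fst (snd C))" "fst C \<in> cells three_cells N" using Cons.prems(1) by (auto simp: chain_def)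
  note r = refine_props[OF b(2) C]
  have ne: "refine C bs ~= []" using r(1) by (simp add: chain_def)
  have ra: "refine_all (C # cs) bss = refine C bs @ refine_all cs bss'" by (simp add: refine_all_def b(1))
  show ?case
  proof (cases "cs = []")
    case True
    then have "refine_all cs bss' = []" by (simp add: refine_all_def)
    then show ?thesis using r ne unfolding ra by simp
  next
    case False
    then have ch: "chain N cs" and l: "fst C ~= fst (hd cs)" "cell_pt N C C1 = cell_pt N (hd cs) C0" using Cons.prems(1) by (auto simp: chain_def successively_Cons)
    note IH = Cons.IH[OF ch b(4,3)]
    have "half (fst (last (refine C bs))) = fst C" using r(4) ne by simp
    then have "fst (last (refine C bs)) ~= fst (hd (refine_all cs bss'))" using IH l(1) by metis
    then show ?thesis using IH r ne l unfolding ra chain_def by (auto simp: successively_append_iff)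
  qed
qed (simp add: chain_def)

subsection \<open>Erasure within a cell\<close>

text \<open>The two local walks of a Type 2 crossing in the coordinates of one cell, joined at
  \<open>Co C2\<close>.\<close>

definition join_walks :: "node list => node list => node list" where
  "join_walks n n' = map (relabel swap12) n @ tl (map (relabel swap02) n')"

definition cell_walk :: "bool => node list list => node list" where
  "cell_walk t ns = (if t then join_walks (ns ! 0) (ns ! 1) else ns ! 0)"

lemma swap_simps: "swap12 C0 = C0" "swap12 C1 = C2" "swap12 C2 = C1" "swap02 C0 = C2" "swap02 C1 = C1" "swap02 C2 = C0" by (simp_all add: swap12_def swap02_def)

lemma join_walks_props:
  assumes n: "n \<in> local_walks" and n': "n' \<in> local_walks"
  shows "join_walks n n' ~= []" "hd (join_walks n n') = Co C0" "last (join_walks n n') = Co C1"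
    "successively adj (join_walks n n')" "set (join_walks n n') \<subseteq> nodes_at {C0, C2}"
proof -
  note a = local_walk_props[OF n] and b = local_walk_props[OF n']
  obtain y ys where y: "n' = Co C0 # y # ys" using b(1,3,10) by (cases n'; cases "tl n'") auto
  show "join_walks n n' ~= []" "hd (join_walks n n') = Co C0" "last (join_walks n n') = Co C1" using a(1,3) b(4) y by (auto simp: join_walks_def hd_map last_map swap_simps)
  have "last (map (relabel swap12) n) = Co C2" using a(1,4) by (simp add: last_map swap_simps)
  moreover have "successively adj (map (relabel swap02) n')" using b(2) by (simp add: successively_map adj_relabel inj_swap)
  moreover have "successively adj (map (relabel swap12) n)" using a(2) by (simp add: successively_map adj_relabel inj_swap)
  ultimately show "successively adj (join_walks n n')" unfolding join_walks_def y by (simp add: successively_append_iff swap_simps)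
  have "relabel swap12 x \<in> nodes_at {C0, C2}" if "x \<in> nodes_at {C0}" for x using that by (cases x) (auto simp: nodes_at_def swap_simps)
  moreover have "relabel swap02 x \<in> nodes_at {C0, C2}" if "x \<in> nodes_at {C0}" for x using that by (cases x) (auto simp: nodes_at_def swap_simps)
  moreover have "set (tl xs) \<subseteq> set xs" for xs :: "node list" by (cases xs) auto
  ultimately show "set (join_walks n n') \<subseteq> nodes_at {C0, C2}" using a(9) b(9) by (fastforce simp: join_walks_def)
qed

lemma emb_comp: "emb N c (\<rho> \<circ> \<sigma>) n = emb N c \<rho> (relabel \<sigma> n)" unfolding emb_def by (cases n) simp_all

definition cell_code :: "bool => node list list => bool list" where
  "cell_code t ns = code_of (lerase (cell_walk t ns))"

lemma cell_walk_props:
  assumes "set ns \<subseteq> local_walks" "length ns = (if t then 2 else 1)"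
  shows "cell_walk t ns ~= []" "hd (cell_walk t ns) = Co C0" "last (cell_walk t ns) = Co C1"
    "successively adj (cell_walk t ns)" "set (cell_walk t ns) \<subseteq> nodes_at {C0, C2}"
proof -
  have n: "ns ! 0 \<in> local_walks" "t ==> ns ! 1 \<in> local_walks" using assms by (auto split: if_splits)
  note a = local_walk_props[OF n(1)]
  have s: "nodes_at {C0} \<subseteq> nodes_at {C0, C2}" by (auto simp: nodes_at_def)
  show "cell_walk t ns ~= []" "hd (cell_walk t ns) = Co C0" "last (cell_walk t ns) = Co C1"
    "successively adj (cell_walk t ns)" "set (cell_walk t ns) \<subseteq> nodes_at {C0, C2}" using a(1-4,9) s join_walks_props[OF n(1)] n(2) by (auto simp: cell_walk_def)
qed

lemma cell_code_table:
  assumes "set ns \<subseteq> local_walks" "length ns = (if t then 2 else 1)"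
  shows "(lerase (cell_walk t ns), cell_code t ns) \<in> set saw_table" unfolding cell_code_def
proof (rule saw_in_table)
  note c = cell_walk_props[OF assms]
  show "distinct (lerase (cell_walk t ns))" by (rule distinct_lerase)
  have p: "lerase (cell_walk t ns) ~= [] \<and> hd (lerase (cell_walk t ns)) = Co C0 \<and> last (lerase (cell_walk t ns)) = Co C1" using lerase_props[OF c(1)] unfolding c(2,3) .
  show "lerase (cell_walk t ns) ~= []" by (rule p[THEN conjunct1])
  show "hd (lerase (cell_walk t ns)) = Co C0" by (rule p[THEN conjunct2, THEN conjunct1])
  show "last (lerase (cell_walk t ns)) = Co C1" by (rule p[THEN conjunct2, THEN conjunct2])
  show "successively adj (lerase (cell_walk t ns))" using c(4) by (rule successively_lerase)
  show "set (lerase (cell_walk t ns)) \<subseteq> nodes_at {C0, C2}" by (rule subset_trans[OF set_lerase c(5)])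
qed

lemma cell_code_codes:
  assumes "set ns \<subseteq> local_walks" "length ns = (if t then 2 else 1)"
  shows "cell_code t ns \<in> codes" using cell_code_table[OF assms] unfolding codes_def by force


subsection \<open>Assembling a path from its coarse path and local walks\<close>

definition embed_pieces :: "nat => path => node list list => path list" where
  "embed_pieces N v ns = map (%i. map (edge_emb N (v ! i) (v ! Suc i)) (ns ! i)) [0..<length ns]"

definition assemble :: "nat => path => node list list => path" where
  "assemble N v ns = path_concat (embed_pieces N v ns)"

text \<open>Starting points of steps avoid the boundary vertices, so that two cells meet at each of
  them and a local walk can be attached to every step.\<close>

definition inner_path :: "nat => path => bool" where
  "inner_path N v \<longleftrightarrow> 2 \<le> length v \<and> (\<forall>i < steps v. {v ! i, v ! Suc i} \<in> E N \<and> v ! i \<notin> G 0 - {0})"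

lemma edge_piece:
  assumes e: "{x, y} \<in> E N" "x \<notin> G 0 - {0}" and n: "n \<in> local_walks"
  shows "piece N (map (edge_emb N x y) n)" "hd (map (edge_emb N x y) n) = x" "last (map (edge_emb N x y) n) = y"
    "nn_path (E (Suc N)) (map (edge_emb N x y) n)"
    "P1 u (unit_copy N (map (edge_emb N x y) n)) = local_weight u n"
    "!!i. i < length n - 1 ==> map (edge_emb N x y) n ! i \<notin> G 0 - {0}"
    "inj_on (edge_emb N x y) (nodes_at {C0})"
proof -
  obtain c \<rho> where f: "frame_W N c \<rho>" "x = pt N (c + delta (\<rho> C0))" "y = pt N (c + delta (\<rho> C1))" using frame_W_edge[OF e] by blast
  have fr: "frame {C0} N c \<rho>" using f(1) by (simp add: frame_W_def)
  have inj: "inj \<rho>" using frame_nodes(2)[OF fr] .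
  have em: "edge_emb N x y = emb N c \<rho>" unfolding f(2,3) by (rule edge_emb_eq[OF inj])
  note lw = local_walk_props[OF n]
  have hl: "hd (map (emb N c \<rho>) n) = x" "last (map (emb N c \<rho>) n) = y" using lw(1,3,4) f(2,3) by (simp_all add: hd_map last_map emb_Co)
  then show "hd (map (edge_emb N x y) n) = x" "last (map (edge_emb N x y) n) = y" unfolding em .
  have xy: "x \<in> GV N" "y \<in> GV N" "x ~= y" using edge_vertices e(1) G_GV unfolding E_eq G_eq by blast+
  have k: "map (emb N c \<rho>) n ! k = x" if "k < length n - 1" "map (emb N c \<rho>) n ! k \<in> GV N" for k
  proof -
    have k': "k < length n" using that by simp
    then have "n ! k \<in> range Co" using that(2) emb_GV[OF fr lw(8)[OF k']] by simp
    then have "n ! k = Co C0" using lw(7)[OF that(1)] by auto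
    then show ?thesis using k' f(2) by (simp add: emb_Co)
  qed
  show "piece N (map (edge_emb N x y) n)" unfolding em piece_def using xy hl lw(10) k by (auto simp: steps_def)
  show "nn_path (E (Suc N)) (map (edge_emb N x y) n)" unfolding em by (rule frame_W_path[OF f(1) n]) (use e(2) f(2) in simp)
  show "P1 u (unit_copy N (map (edge_emb N x y) n)) = local_weight u n" unfolding em by (rule P1_unit_copy[OF n fr])
  show "map (edge_emb N x y) n ! i \<notin> G 0 - {0}" if "i < length n - 1" for i
  proof
    assume *: "map (edge_emb N x y) n ! i \<in> G 0 - {0}"
    then have "map (emb N c \<rho>) n ! i \<in> GV N" using G_GV GV_mono[of 0 N] unfolding em by blast
    then have "map (emb N c \<rho>) n ! i = x" using k[OF that] by blast
    then show False using * e(2) unfolding em by simp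
  qed
  show "inj_on (edge_emb N x y) (nodes_at {C0})" unfolding em by (rule emb_inj[OF fr])
qed

lemma embed_pieces_nth:
  "i < length ns ==> embed_pieces N v ns ! i = map (edge_emb N (v ! i) (v ! Suc i)) (ns ! i)" by (simp add: embed_pieces_def)

lemma length_embed_pieces [simp]: "length (embed_pieces N v ns) = length ns" by (simp add: embed_pieces_def)

lemma step_premises:
  assumes "inner_path N v" "set ns \<subseteq> local_walks" "length ns = steps v" "i < steps v"
  shows "{v ! i, v ! Suc i} \<in> E N" "v ! i \<notin> G 0 - {0}" "ns ! i \<in> local_walks"
proof -
  show "{v ! i, v ! Suc i} \<in> E N" "v ! i \<notin> G 0 - {0}" using assms unfolding inner_path_def by blast+
  have "ns ! i \<in> set ns" using assms by (intro nth_mem) simp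
  then show "ns ! i \<in> local_walks" using assms(2) by blast
qed

lemma embed_pieces:
  assumes v: "inner_path N v" and ns: "set ns \<subseteq> local_walks" "length ns = steps v"
  shows "pieces N (embed_pieces N v ns)" "ends (embed_pieces N v ns) = v"
proof -
  let ?ps = "embed_pieces N v ns"
  have ep: "piece N (?ps ! i)" "hd (?ps ! i) = v ! i" "last (?ps ! i) = v ! Suc i" if "i < steps v" for i using edge_piece(1-3)[OF step_premises[OF v ns that]] ns that by (simp_all add: embed_pieces_nth)
  have ne: "ns ~= []" using v ns by (auto simp: inner_path_def steps_def)
  show p: "pieces N ?ps" unfolding pieces_def successively_nth
  proof (intro conjI ballI allI impI)
    show "?ps ~= []" using ne by (metis length_embed_pieces length_0_conv)
    fix p assume "p \<in> set ?ps"
    then show "piece N p" using ep(1) ns(2) by (auto simp: in_set_conv_nth)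
  next
    fix i assume "Suc i < length ?ps"
    then show "last (?ps ! i) = hd (?ps ! Suc i)" using ep ns(2) by simp
  qed
  show "ends ?ps = v"
  proof (rule nth_equalityI)
    show "length (ends ?ps) = length v" using ns(2) v by (auto simp: length_ends steps_def inner_path_def)
    fix i assume "i < length (ends ?ps)"
    then have "i \<le> steps v" using ns(2) by (simp add: length_ends)
    then show "ends ?ps ! i = v ! i"
    proof (cases "i < steps v")
      case True
      then show ?thesis using ep(2)[OF True] ns(2) by (simp add: ends_nth)
    next
      case False
      then have "i = Suc (steps v - 1)" "steps v - 1 < steps v" using \<open>i \<le> steps v\<close> v by (auto simp: inner_path_def steps_def)
      then show ?thesis using ends_Suc[OF p, of "steps v - 1"] ep(3)[of "steps v - 1"] ns(2) by simp
    qed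
  qed
qed

lemma W_inner_path: "v \<in> W N ==> inner_path N v"
proof -
  assume v: "v \<in> W N"
  then have "v ~= []" "hd v = 0" "last v = pt_a" by (auto simp: W_def nn_path_def)
  moreover have "pt_a ~= 0" by (simp add: pt_a_def complex_eq_iff)
  ultimately have "2 \<le> length v" by (cases v; cases "tl v") auto
  then show ?thesis using v by (auto simp: W_def nn_path_def inner_path_def successively_nth steps_def)
qed

lemma path_concat_adjacent:
  assumes "linked ps" "Suc j < length (path_concat ps)"
  obtains i k where "i < length ps" "k < steps (ps ! i)" "path_concat ps ! j = ps ! i ! k" "path_concat ps ! Suc j = ps ! i ! Suc k"
proof -
  have "j ~= pos ps (length ps)" using assms linked_path_concat_length[OF assms(1)] by simp
  then obtain i where i: "i < length ps" "pos ps i \<le> j" "j < pos ps (Suc i)" using linked_pos_cover[OF assms(1), of j] assms(2) by auto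
  define k where "k = j - pos ps i"
  have k: "j = pos ps i + k" "k < steps (ps ! i)" using i by (auto simp: k_def)
  show ?thesis using that[OF i(1) k(2)] linked_path_concat_nth[OF assms(1) i(1), of k]
      linked_path_concat_nth[OF assms(1) i(1), of "Suc k"] k by simp
qed

lemma assemble_W:
  assumes v: "v \<in> W N" and ns: "set ns \<subseteq> local_walks" "length ns = steps v"
  shows "assemble N v ns \<in> W (Suc N)"
proof -
  note ip = W_inner_path[OF v]
  note ep = embed_pieces[OF ip ns]
  let ?ps = "embed_pieces N v ns"
  let ?w = "path_concat ?ps"
  have piece: "nn_path (E (Suc N)) (?ps ! i)" "!!k. k < steps (?ps ! i) ==> ?ps ! i ! k \<notin> G 0 - {0}" if "i < length ?ps" for i
  proof -
    have i: "i < steps v" using that ns by simp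
    note e = edge_piece(4,6)[OF step_premises[OF ip ns i]]
    show "nn_path (E (Suc N)) (?ps ! i)" using e(1) that by (simp add: embed_pieces_nth)
    show "?ps ! i ! k \<notin> G 0 - {0}" if "k < steps (?ps ! i)" for k using e(2)[of k] that i ns(2) by (simp add: embed_pieces_nth steps_def)
  qed
  have ne: "?w ~= []" by (rule path_concat_ne[OF ep(1)])
  have len: "length ?w = Suc (pos ?ps (length ?ps))" by (rule path_concat_length[OF ep(1)])
  have "nn_path (E (Suc N)) ?w" unfolding nn_path_def successively_nth
  proof (intro conjI ne allI impI)
    fix j assume "Suc j < length ?w"
    then obtain i k where ik: "i < length ?ps" "k < steps (?ps ! i)" "?w ! j = ?ps ! i ! k" "?w ! Suc j = ?ps ! i ! Suc k" by (rule path_concat_adjacent[OF pieces_linked[OF ep(1)]])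
    then show "{?w ! j, ?w ! Suc j} \<in> E (Suc N)" using piece(1)[OF ik(1)] by (simp add: nn_path_def successively_nth steps_def)
  qed
  moreover have "hd ?w = 0" using pos_nth_ends[OF ep(1), of 0] ne ep(2) v by (auto simp: hd_conv_nth W_def nn_path_def)
  moreover have "last ?w = pt_a"
  proof -
    have "last ?w = ?w ! pos ?ps (length ?ps)" using ne len by (simp add: last_conv_nth)
    also have "... = v ! steps v" using pos_nth_ends[OF ep(1), of "length ?ps"] ep(2) ns(2) by simp
    also have "... = pt_a" using v ip by (auto simp: W_def steps_def nn_path_def last_conv_nth)
    finally show ?thesis .
  qed
  moreover have "?w ! j \<notin> G 0 - {0}" if "j < steps ?w" for j
  proof -
    have "Suc j < length ?w" using that by (simp add: steps_def)
    then obtain i k where ik: "i < length ?ps" "k < steps (?ps ! i)" "?w ! j = ?ps ! i ! k" by (rule path_concat_adjacent[OF pieces_linked[OF ep(1)]])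
    then show ?thesis using piece(2) by simp
  qed
  ultimately show ?thesis unfolding assemble_def W_def by blast
qed

lemma last_hit_pieces:
  assumes "pieces N ps"
  shows "last_hit N (path_concat ps) = length ps" "i \<le> length ps ==> T N (path_concat ps) i = pos ps i"
    "Q N (path_concat ps) = ends ps"
proof -
  note f = lattice_path_ends[OF assms]
  show 1: "last_hit N (path_concat ps) = length ps" using last_hit_path_concat[OF assms order_refl] last_hit_lattice_path[OF f] by (simp add: steps_def length_ends)
  show "i \<le> length ps ==> T N (path_concat ps) i = pos ps i" using T_path_concat[OF assms order_refl, of i] T_lattice_path[OF f, of i] last_hit_lattice_path[OF f] by (simp add: steps_def length_ends)
  show "Q N (path_concat ps) = ends ps" using Q_path_concat[OF assms order_refl] Q_lattice_path[OF f] by simp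
qed

lemma segment_pieces:
  assumes "pieces N ps" "i < length ps"
  shows "segment (path_concat ps) (T N (path_concat ps) i) (T N (path_concat ps) (Suc i)) = ps ! i" using pieces_slice(3)[OF assms(1), of i "Suc i"] last_hit_pieces(2)[OF assms(1)] assms(2) by simp

lemma edge_emb0: "edge_emb 0 0 pt_a = emb0" using edge_emb_eq[of id 0 "(0, 0)"] unfolding emb0_def by (simp add: pt_corners)

lemma W_0: "v \<in> W 0 \<longleftrightarrow> v = [0, pt_a]"
proof
  assume v: "v \<in> W 0"
  note ip = W_inner_path[OF v]
  have "v ! Suc i \<in> G 0 - {0}" if "i < steps v" "v ! i = 0" for i
  proof -
    have "{v ! i, v ! Suc i} \<in> E 0" using ip that(1) unfolding inner_path_def by blast
    then have "v ! Suc i \<in> G 0 \<and> v ! i ~= v ! Suc i" using edge_vertices unfolding E_eq G_eq by blast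
    then show ?thesis using that(2) by simp
  qed
  moreover have "v ! 0 = 0" "v ~= []" using v by (auto simp: W_def nn_path_def hd_conv_nth)
  ultimately have "v ! 1 \<in> G 0 - {0}" using ip by (simp add: inner_path_def steps_def)
  then have "steps v = 1" using ip by (metis One_nat_def inner_path_def steps_def less_one linorder_neqE_nat not_numeral_le_zero
        numeral_2_eq_2 Suc_le_eq zero_less_diff less_Suc_eq_0_disj less_numeral_extra(3))
  then have "length v = 2" using ip by (simp add: inner_path_def steps_def)
  then show "v = [0, pt_a]" using v by (auto simp: W_def length_Suc_conv numeral_2_eq_2)
next
  assume v: "v = [0, pt_a]"
  have "{0, pt_a} \<in> E 0" by (auto simp: E_def)
  then show "v \<in> W 0" by (auto simp: v W_def nn_path_def steps_def)
qed

text \<open>Segmenting the assembled path returns the embedded local walks, whose unit copies have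
  the local weights. Level 0 is separate because \<open>W_mass u (Suc 0)\<close> is
  \<open>P1\<close> itself, without passing to a unit copy.\<close>

lemma W_mass_assemble:
  assumes v: "v \<in> W N" and ns: "set ns \<subseteq> local_walks" "length ns = steps v"
  shows "W_mass u (Suc N) (assemble N v ns) = W_mass u N v * (\<Prod>i<steps v. local_weight u (ns ! i))"
proof -
  note ip = W_inner_path[OF v]
  note ep = embed_pieces[OF ip ns]
  let ?ps = "embed_pieces N v ns"
  have P: "P1 u (unit_copy N (?ps ! i)) = local_weight u (ns ! i)" if "i < steps v" for i using edge_piece(5)[OF step_premises[OF ip ns that]] ns that by (simp add: embed_pieces_nth)
  show ?thesis
  proof (cases N)
    case 0
    then have v0: "v = [0, pt_a]" using v W_0 by simp
    obtain n where n: "ns = [n]" "n \<in> local_walks" using ns v0 by (cases ns) (auto simp: steps_def)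
    have "assemble N v ns = map emb0 n" unfolding assemble_def embed_pieces_def n v0 0 by (simp add: edge_emb0)
    then show ?thesis using 0 n P1_emb0[OF n(2)] by (simp add: v0 steps_def)
  next
    case (Suc K)
    have Qw: "Q N (assemble N v ns) = v" unfolding assemble_def last_hit_pieces(3)[OF ep(1)] ep(2) ..
    have "(\<Prod>i = 1..steps v. P1 u (unit_copy N (segment (assemble N v ns) (T N (assemble N v ns) (i - 1)) (T N (assemble N v ns) i))))
      = (\<Prod>i<steps v. P1 u (unit_copy N (segment (assemble N v ns) (T N (assemble N v ns) i) (T N (assemble N v ns) (Suc i)))))" by (rule prod.reindex_bij_witness[of _ Suc "%i. i - 1"]) auto
    also have "... = (\<Prod>i<steps v. local_weight u (ns ! i))" using P segment_pieces[OF ep(1)] ns(2) by (intro prod.cong) (auto simp: assemble_def)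
    finally show ?thesis using Qw Suc by simp
  qed
qed

text \<open>The coarse path is recovered as \<open>Q N\<close>, the pieces as segments between its
  hitting times, and the local walks by injectivity of the embeddings.\<close>

lemma assemble_inj:
  assumes v: "v \<in> W N" "v' \<in> W N" and ns: "set ns \<subseteq> local_walks" "length ns = steps v"
    and ns': "set ns' \<subseteq> local_walks" "length ns' = steps v'" and eq: "assemble N v ns = assemble N v' ns'"
  shows "v = v' \<and> ns = ns'"
proof -
  note ip = W_inner_path[OF v(1)] W_inner_path[OF v(2)]
  note ep = embed_pieces[OF ip(1) ns] and ep' = embed_pieces[OF ip(2) ns']
  have vv: "v = v'" using last_hit_pieces(3)[OF ep(1)] last_hit_pieces(3)[OF ep'(1)] ep(2) ep'(2) eq unfolding assemble_def by simp
  have "ns ! i = ns' ! i" if i: "i < length ns" for i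
  proof -
    have "embed_pieces N v ns ! i = embed_pieces N v' ns' ! i" using segment_pieces[OF ep(1), of i] segment_pieces[OF ep'(1), of i] eq i ns(2) ns'(2) vv unfolding assemble_def by simp
    then have eq: "map (edge_emb N (v ! i) (v ! Suc i)) (ns ! i) = map (edge_emb N (v ! i) (v ! Suc i)) (ns' ! i)" using i ns(2) ns'(2) vv by (simp add: embed_pieces_nth)
    have iv: "i < steps v" "i < steps v'" using i ns ns' vv by auto
    have inj: "inj_on (edge_emb N (v ! i) (v ! Suc i)) (nodes_at {C0})" by (rule edge_piece(7)[OF step_premises[OF ip(1) ns iv(1)]])
    have "set (ns ! i) \<union> set (ns' ! i) \<subseteq> nodes_at {C0}" by (rule Un_least) (rule local_walk_props(9), rule step_premises(3)[OF ip(1) ns iv(1)],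
          rule local_walk_props(9), rule step_premises(3)[OF ip(2) ns' iv(2)])
    from map_inj_on[OF eq inj_on_subset[OF inj this]] show ?thesis .
  qed
  then show ?thesis using vv ns(2) ns'(2) by (auto intro: nth_equalityI)
qed

subsection \<open>One step of the erasure\<close>

lemma path_concat_pairs:
  "n > 0 ==> path_concat (map (%l. [f l, f (Suc l)]) [0..<n]) = map f [0..<Suc n]"
proof (induction n)
  case (Suc n)
  then show ?case by (cases "n = 0") (simp_all add: path_concat_snoc)
qed simp

text \<open>When the segment already has resolution \<open>K\<close>, the surviving pieces are
  single steps and plain loop erasure remains.\<close>

lemma erase_segment_lattice:
  assumes z: "lattice_path K z" "hd z ~= last z"
  shows "erase_segment K z = lerase z"
proof -
  have ne: "z ~= []" using z by (simp add: lattice_path_def)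
  note e = erasure_index_props[OF ne]
  have n: "0 < erasure_len z" using erasure_len_pos[OF ne z(2)] .
  have seg: "segment z (T K z (erasure_index z l)) (T K z (Suc (erasure_index z l))) =
    [z ! erasure_index z l, z ! erasure_index z (Suc l)]" if "l < erasure_len z" for l
  proof -
    have lt: "Suc (erasure_index z l) < length z" using e(3)[OF that] .
    have "segment z i (Suc i) = [z ! i, z ! Suc i]" if "Suc i < length z" for i using that unfolding segment_def by (simp add: Cons_nth_drop_Suc[symmetric] numeral_2_eq_2)
    then show ?thesis using lt T_lattice_path[OF z(1)] e(5)[OF that] by (simp del: erasure_index.simps)
  qed
  have "erase_segment K z = path_concat (map (%l. segment z (T K z (erasure_index z l)) (T K z (Suc (erasure_index z l)))) [0..<erasure_len z])" unfolding erase_segment_def Q_lattice_path[OF z(1)] Let_def erasure_len_def ..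
  also have "... = path_concat (map (%l. [z ! erasure_index z l, z ! erasure_index z (Suc l)]) [0..<erasure_len z])" using seg by (intro arg_cong[of _ _ path_concat]) simp
  also have "... = loop_erasure z" unfolding loop_erasure_def by (rule path_concat_pairs[OF n])
  finally show ?thesis using loop_erasure_eq[OF ne] by simp
qed

lemma adj_irrefl: "\<not> adj n n" by (cases n) auto

lemma erase_segment_emb:
  assumes fr: "frame I N c \<rho>" and m: "m ~= []" "set m \<subseteq> nodes_at I" "successively adj m" "hd m = Co C0" "last m = Co C1"
  shows "erase_segment (Suc N) (map (emb N c \<rho>) m) = map (emb N c \<rho>) (lerase m)"
proof -
  have inj: "inj_on (emb N c \<rho>) (set m)" using emb_inj[OF fr] m(2) by (rule inj_on_subset)
  have nth: "m ! i \<in> nodes_at I" if "i < length m" for i using m(2) that by (auto simp: set_conv_nth)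
  have "successively (~=) (map (emb N c \<rho>) m)" unfolding successively_nth
  proof (intro allI impI)
    fix i assume "Suc i < length (map (emb N c \<rho>) m)"
    then have i: "Suc i < length m" "i < length m" by auto
    have "adj (m ! i) (m ! Suc i)" using m(3) i by (simp add: successively_nth)
    then have "m ! i ~= m ! Suc i" using adj_irrefl by metis
    then show "map (emb N c \<rho>) m ! i ~= map (emb N c \<rho>) m ! Suc i" using inj_onD[OF inj, of "m ! i" "m ! Suc i"] i by auto
  qed
  moreover have "set (map (emb N c \<rho>) m) \<subseteq> GV (Suc N)" using emb_GV_Suc[OF fr] m(2) by auto
  ultimately have lp: "lattice_path (Suc N) (map (emb N c \<rho>) m)" using m(1) by (simp add: lattice_path_def)
  have "Co C0 \<in> set m" "Co C1 \<in> set m" using m(1,4,5) by (metis hd_in_set, metis last_in_set)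
  then have "emb N c \<rho> (Co C0) ~= emb N c \<rho> (Co C1)" using inj_onD[OF inj, of "Co C0" "Co C1"] by auto
  then have "hd (map (emb N c \<rho>) m) ~= last (map (emb N c \<rho>) m)" using m(1,4,5) by (simp add: hd_map last_map)
  from erase_segment_lattice[OF lp this] show ?thesis unfolding lerase_map[OF inj] .
qed

fun cell_codes :: "cell list => node list list => bool list list" where
  "cell_codes [] ms = []"
| "cell_codes (C # cs) ms = cell_code (snd (snd C)) (take (cell_len C) ms) # cell_codes cs (drop (cell_len C) ms)"

lemma cum_Cons: "cum (C # cs) (Suc i) = cell_len C + cum cs i" by (induction i) auto

lemma length_cell_codes [simp]: "length (cell_codes cs ms) = length cs" by (induction cs ms rule: cell_codes.induct) auto

lemma cell_codes_nth:
  "i < length cs ==> cell_codes cs ms ! i = cell_code (snd (snd (cs ! i))) (take (cell_len (cs ! i)) (drop (cum cs i) ms))"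
proof (induction cs ms arbitrary: i rule: cell_codes.induct)
  case (2 C cs ms)
  show ?case
  proof (cases i)
    case (Suc j)
    then show ?thesis using 2(1)[of j] 2(2) by (simp add: cum_Cons add.commute del: cum.simps(2))
  qed simp
qed simp

lemma length_chain_path: "chain N cs ==> length (path_of N cs) = Suc (cum cs (length cs))" using linked_path_concat_length[OF linked_cells, of N cs] by (simp add: path_of_def pos_cells)

lemma lattice_path_of:
  assumes "chain N cs"
  shows "lattice_path N (path_of N cs)"
proof -
  let ?ps = "map (cell_path N) cs"
  have l: "linked ?ps" by (rule linked_cells[OF assms])
  have ne: "path_of N cs ~= []" using length_chain_path[OF assms] by force
  have C: "fst C \<in> cells three_cells N" "inj (fst (snd C))" if "C \<in> set cs" for C using assms that by (auto simp: chain_def)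
  have GV: "cell_pt N C i \<in> GV N" if "C \<in> set cs" for C i unfolding cell_pt_def GV_eq vertices_of_def using C(1)[OF that] by blast
  have ptne: "cell_pt N C i ~= cell_pt N C j" if "C \<in> set cs" "i ~= j" for C i j using C(2)[OF that(1)] that(2) by (simp add: cell_pt_def delta_inj inj_eq)
  have "set (path_of N cs) \<subseteq> GV N"
  proof -
    have sub: "set (path_concat qs) \<subseteq> (\<Union>p\<in>set qs. set p)" for qs
    proof (cases qs)
      case (Cons p ps)
      have "set (tl xs) \<subseteq> set xs" for xs :: path by (cases xs) auto
      then show ?thesis using Cons by fastforce
    qed simp
    have "set (cell_path N C) \<subseteq> GV N" if "C \<in> set cs" for C using GV[OF that] by (simp add: cell_path_def)
    then show ?thesis using sub[of ?ps] unfolding path_of_def by fastforce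
  qed
  moreover have "path_of N cs ! j ~= path_of N cs ! Suc j" if "Suc j < length (path_of N cs)" for j
  proof -
    have "Suc j < length (path_concat ?ps)" using that by (simp add: path_of_def)
    then obtain i k where a: "i < length ?ps" "k < steps (?ps ! i)" "path_concat ?ps ! j = ?ps ! i ! k"
      "path_concat ?ps ! Suc j = ?ps ! i ! Suc k" by (rule path_concat_adjacent[OF l])
    then have ik: "i < length cs" "k < steps (cell_path N (cs ! i))" "path_of N cs ! j = cell_path N (cs ! i) ! k"
      "path_of N cs ! Suc j = cell_path N (cs ! i) ! Suc k" by (simp_all add: path_of_def)
    have "k = 0 \<or> k = 1 \<and> snd (snd (cs ! i))" using ik(2) by (auto simp: steps_cell_path cell_len_def split: if_splits)
    then show ?thesis unfolding ik(3,4) using ptne[of "cs ! i"] ik(1) by (auto simp: cell_path_def)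
  qed
  ultimately show ?thesis using ne unfolding lattice_path_def successively_nth by blast
qed

lemma frame_of_edge:
  assumes e: "{pt N (c + delta i), pt N (c + delta j)} \<in> E N" "pt N (c + delta i) \<notin> G 0 - {0}" "i ~= j"
  shows "regular N (c + delta i)"
proof -
  obtain c' \<rho> where f: "frame_W N c' \<rho>" "pt N (c + delta i) = pt N (c' + delta (\<rho> C0))" using frame_W_edge[OF e(1,2)] by metis
  then show ?thesis by (simp add: frame_W_def frame_def)
qed

text \<open>In local coordinates the erased walk is a path of \<open>saw_table\<close>, whose code
  describes the refinement. Regularity is needed where steps start: at the entry, and for Type 2
  also at the third corner.\<close>

lemma cell_erasure:
  assumes C: "c \<in> cells three_cells N" "inj \<rho>" and ms: "set ms \<subseteq> local_walks" "length ms = cell_len (c, \<rho>, t)"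
    and inner: "!!i. i < cell_len (c, \<rho>, t) ==>
      {cell_path N (c, \<rho>, t) ! i, cell_path N (c, \<rho>, t) ! Suc i} \<in> E N \<and> cell_path N (c, \<rho>, t) ! i \<notin> G 0 - {0}"
  shows "erase_segment (Suc N) (path_concat (embed_pieces N (cell_path N (c, \<rho>, t)) ms)) =
    path_of (Suc N) (refine (c, \<rho>, t) (cell_code t ms))"
proof -
  have ne: "\<rho> C0 ~= \<rho> C1" "\<rho> C0 ~= \<rho> C2" "\<rho> C2 ~= \<rho> C1" using C(2) by (auto simp: inj_eq)
  let ?m = "cell_walk t ms"
  have len: "length ms = (if t then 2 else 1)" using ms(2) by (simp add: cell_len_def)
  note cw = cell_walk_props[OF ms(1) len]
  have "\<exists>I. frame I N c \<rho> \<and> set ?m \<subseteq> nodes_at I \<and>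
    path_concat (embed_pieces N (cell_path N (c, \<rho>, t)) ms) = map (emb N c \<rho>) ?m"
  proof (cases t)
    case False
    obtain n where n: "ms = [n]" using len False by (auto simp: length_Suc_conv)
    have "regular N (c + delta (\<rho> C0))" by (rule frame_of_edge[OF _ _ ne(1)]) (use inner[of 0] False in \<open>simp_all add: cell_len_def cell_path_def cell_pt_def\<close>)
    then have "frame {C0} N c \<rho>" using C by (simp add: frame_def)
    moreover have "set ?m \<subseteq> nodes_at {C0}" using local_walk_props(9)[of n] ms n False by (simp add: cell_walk_def)
    moreover have "path_concat (embed_pieces N (cell_path N (c, \<rho>, t)) ms) = map (emb N c \<rho>) ?m" unfolding embed_pieces_def n using edge_emb_eq[OF C(2), of N c]
      by (simp add: False cell_path_def cell_pt_def cell_walk_def)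
    ultimately show ?thesis by blast
  next
    case True
    obtain n n' where n: "ms = [n, n']" using len True by (auto simp: length_Suc_conv numeral_2_eq_2)
    have r0: "regular N (c + delta (\<rho> C0))" by (rule frame_of_edge[OF _ _ ne(2)]) (use inner[of 0] True in \<open>simp_all add: cell_len_def cell_path_def cell_pt_def\<close>)
    have r2: "regular N (c + delta (\<rho> C2))" by (rule frame_of_edge[OF _ _ ne(3)]) (use inner[of 1] True in \<open>simp_all add: cell_len_def cell_path_def cell_pt_def\<close>)
    have "frame {C0, C2} N c \<rho>" using C r0 r2 by (simp add: frame_def)
    moreover have ic: "inj (\<rho> \<circ> swap12)" "inj (\<rho> \<circ> swap02)" using C(2) inj_swap by (auto intro: inj_compose)
    have comp: "emb N c (\<rho> \<circ> \<sigma>) = emb N c \<rho> \<circ> relabel \<sigma>" for \<sigma> by (rule ext) (simp add: emb_comp)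
    have e12: "edge_emb N (pt N (c + delta (\<rho> C0))) (pt N (c + delta (\<rho> C2))) = emb N c (\<rho> \<circ> swap12)" using edge_emb_eq[OF ic(1), of N c] by (simp add: swap_simps)
    have e02: "edge_emb N (pt N (c + delta (\<rho> C2))) (pt N (c + delta (\<rho> C1))) = emb N c (\<rho> \<circ> swap02)" using edge_emb_eq[OF ic(2), of N c] by (simp add: swap_simps)
    have "embed_pieces N (cell_path N (c, \<rho>, t)) ms = [map (emb N c (\<rho> \<circ> swap12)) n, map (emb N c (\<rho> \<circ> swap02)) n']"
      unfolding embed_pieces_def n using True e12 e02 by (simp add: cell_path_def cell_pt_def upt_rec)
    then have "path_concat (embed_pieces N (cell_path N (c, \<rho>, t)) ms) = map (emb N c \<rho>) ?m" using comp by (simp add: cell_walk_def True n join_walks_def map_tl)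
    ultimately show ?thesis using cw(5) by blast
  qed
  then obtain I where I: "frame I N c \<rho>" "set ?m \<subseteq> nodes_at I"
    "path_concat (embed_pieces N (cell_path N (c, \<rho>, t)) ms) = map (emb N c \<rho>) ?m" by blast
  show ?thesis unfolding I(3) erase_segment_emb[OF I(1) cw(1) I(2) cw(4,2,3)] using refine_path[OF cell_code_table[OF ms(1) len] C(2)] by simp
qed

text \<open>Erasure acts in each cell separately and uses only the one or two local walks attached
  to the steps of that cell. This locality is the source of the independence of the
  refinements.\<close>

lemma erase_step_refine:
  assumes ch: "chain N cs" and ip: "inner_path N (path_of N cs)" and ms: "set ms \<subseteq> local_walks" "length ms = cum cs (length cs)"
  shows "erase_step N (path_concat (embed_pieces N (path_of N cs) ms)) = path_of (Suc N) (refine_all cs (cell_codes cs ms))"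
    "set (cell_codes cs ms) \<subseteq> codes"
proof -
  let ?v = "path_of N cs"
  let ?qs = "embed_pieces N ?v ms"
  have lm: "length ms = steps ?v" using ms(2) steps_path_of[OF ch] by simp
  note ep = embed_pieces[OF ip ms(1) lm]
  have Qw: "Q N (path_concat ?qs) = ?v" unfolding last_hit_pieces(3)[OF ep(1)] ep(2) ..
  have le: "i \<le> length cs ==> cum cs i \<le> length ms" for i unfolding ms(2) using cum_strict[of i "length cs" cs] by (cases "i = length cs") auto
  have sub: "set (take (cell_len (cs ! i)) (drop (cum cs i) ms)) \<subseteq> local_walks" for i using ms(1) set_take_subset set_drop_subset by fast
  have lsub: "length (take (cell_len (cs ! i)) (drop (cum cs i) ms)) = cell_len (cs ! i)" if "i < length cs" for i using le[of "Suc i"] that by simp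
  have cell: "erase_segment (Suc N) (segment (path_concat ?qs) (T N (path_concat ?qs) (cum cs i)) (T N (path_concat ?qs) (cum cs (Suc i)))) =
      path_of (Suc N) (refine (cs ! i) (cell_codes cs ms ! i))" if i: "i < length cs" for i
  proof -
    obtain c \<rho> t where C: "cs ! i = (c, \<rho>, t)" by (cases "cs ! i")
    let ?ms = "take (cell_len (cs ! i)) (drop (cum cs i) ms)"
    have lt: "cum cs i < cum cs (Suc i)" by (rule cum_strict) simp
    have le': "cum cs (Suc i) \<le> length ?qs" "cum cs i \<le> length ?qs" using le[of "Suc i"] le[of i] i by simp_all
    have "segment (path_concat ?qs) (T N (path_concat ?qs) (cum cs i)) (T N (path_concat ?qs) (cum cs (Suc i))) =
      path_concat (map (nth ?qs) [cum cs i..<cum cs (Suc i)])" unfolding last_hit_pieces(2)[OF ep(1) le'(1)] last_hit_pieces(2)[OF ep(1) le'(2)] by (rule pieces_slice(3)[OF ep(1) lt le'(1)])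
    also have "map (nth ?qs) [cum cs i..<cum cs (Suc i)] = embed_pieces N (cell_path N (cs ! i)) ?ms"
    proof (rule nth_equalityI)
      show "length (map (nth ?qs) [cum cs i..<cum cs (Suc i)]) = length (embed_pieces N (cell_path N (cs ! i)) ?ms)" using lsub[OF i] by simp
      fix k assume "k < length (map (nth ?qs) [cum cs i..<cum cs (Suc i)])"
      then have k: "k < cell_len (cs ! i)" by simp
      have kk: "cum cs i + k < length ms" using k le[of "Suc i"] i by simp
      have "map (nth ?qs) [cum cs i..<cum cs (Suc i)] ! k = ?qs ! (cum cs i + k)" using k by simp
      also have "... = map (edge_emb N (?v ! (cum cs i + k)) (?v ! (cum cs i + Suc k))) (ms ! (cum cs i + k))" using kk by (simp add: embed_pieces_nth)
      also have "... = map (edge_emb N (cell_path N (cs ! i) ! k) (cell_path N (cs ! i) ! Suc k)) (ms ! (cum cs i + k))" using path_of_nth[OF ch i, of k] path_of_nth[OF ch i, of "Suc k"] k by (simp only: less_imp_le Suc_leI)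
      also have "... = embed_pieces N (cell_path N (cs ! i)) ?ms ! k" using k kk lsub[OF i] by (simp add: embed_pieces_nth)
      finally show "map (nth ?qs) [cum cs i..<cum cs (Suc i)] ! k = embed_pieces N (cell_path N (cs ! i)) ?ms ! k" .
    qed
    also have "erase_segment (Suc N) (path_concat (embed_pieces N (cell_path N (cs ! i)) ?ms)) =
      path_of (Suc N) (refine (cs ! i) (cell_code t ?ms))" unfolding C
    proof (rule cell_erasure)
      show "c \<in> cells three_cells N" "inj \<rho>" using chain_nth[OF ch i] C by auto
      show "set (take (cell_len (c, \<rho>, t)) (drop (cum cs i) ms)) \<subseteq> local_walks" using sub[of i] C by simp
      show "length (take (cell_len (c, \<rho>, t)) (drop (cum cs i) ms)) = cell_len (c, \<rho>, t)" using lsub[OF i] C by simp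
      fix k assume "k < cell_len (c, \<rho>, t)"
      then have k: "k < cell_len (cs ! i)" using C by simp
      have kk: "cum cs i + k < steps ?v" using k le[of "Suc i"] i lm by simp
      have "?v ! (cum cs i + k) = cell_path N (cs ! i) ! k" "?v ! (cum cs i + Suc k) = cell_path N (cs ! i) ! Suc k" using path_of_nth[OF ch i, of k] path_of_nth[OF ch i, of "Suc k"] k by (simp_all only: less_imp_le Suc_leI)
      then show "{cell_path N (c, \<rho>, t) ! k, cell_path N (c, \<rho>, t) ! Suc k} \<in> E N \<and> cell_path N (c, \<rho>, t) ! k \<notin> G 0 - {0}" using ip kk C by (auto simp: inner_path_def)
    qed
    also have "cell_code t ?ms = cell_codes cs ms ! i" using cell_codes_nth[OF i, of ms] C by simp
    finally show ?thesis .
  qed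
  have code: "cell_codes cs ms ! i \<in> codes" if "i < length cs" for i unfolding cell_codes_nth[OF that] by (rule cell_code_codes[OF sub]) (use lsub[OF that] in \<open>simp add: cell_len_def\<close>)
  then show sc: "set (cell_codes cs ms) \<subseteq> codes" by (auto simp: set_conv_nth)
  have "erase_step N (path_concat ?qs) = path_concat (map (%i. path_of (Suc N) (refine (cs ! i) (cell_codes cs ms ! i))) [0..<length cs])"
    unfolding erase_step_chain[OF path_concat_ne[OF ep(1)] ch Qw] using cell by (intro arg_cong[of _ _ path_concat]) simp
  also have "... = path_concat (map path_concat (map (%i. map (cell_path (Suc N)) (refine (cs ! i) (cell_codes cs ms ! i))) [0..<length cs]))" by (simp add: path_of_def comp_def)
  also have "... = path_concat (concat (map (%i. map (cell_path (Suc N)) (refine (cs ! i) (cell_codes cs ms ! i))) [0..<length cs]))"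
  proof (rule path_concat_map_path_concat)
    fix xs assume "xs \<in> set (map (%i. map (cell_path (Suc N)) (refine (cs ! i) (cell_codes cs ms ! i))) [0..<length cs])"
    then obtain i where i: "i < length cs" "xs = map (cell_path (Suc N)) (refine (cs ! i) (cell_codes cs ms ! i))" by auto
    show "xs ~= []" using refine_props(1)[OF code[OF i(1)], of "cs ! i"] chain_nth[OF ch i(1)] i(2) by (auto simp: chain_def)
    show "p ~= []" if "p \<in> set xs" for p using that i(2) by (auto simp: cell_path_def)
  qed
  also have "concat (map (%i. map (cell_path (Suc N)) (refine (cs ! i) (cell_codes cs ms ! i))) [0..<length cs]) =
      map (cell_path (Suc N)) (refine_all cs (cell_codes cs ms))"
  proof -
    have "map2 refine cs (cell_codes cs ms) = map (%i. refine (cs ! i) (cell_codes cs ms ! i)) [0..<length cs]" by (rule nth_equalityI) auto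
    then show ?thesis unfolding refine_all_def map_concat by (simp add: comp_def)
  qed
  finally show "erase_step N (path_concat ?qs) = path_of (Suc N) (refine_all cs (cell_codes cs ms))" unfolding path_of_def .
qed

text \<open>The erasures of an assembled path up to level \<open>N\<close> only see its coarse path \<open>v\<close>, and the next one only
  sees the local walks along the steps of \<open>v\<close> that survive, whose indices \<open>is\<close> depend on \<open>v\<close> only.\<close>

lemma Qhat_assemble:
  assumes v: "v \<in> W N" and below: "!!M. M < N ==> \<exists>cs. chain M cs \<and> Qhat M v = path_of M cs"
    and ch: "chain N cs" and top: "Qhat N v = path_of N cs"
  shows "\<exists>is. sorted_wrt (<) is \<and> (\<forall>i\<in>set is. i < steps v) \<and> length is = cum cs (length cs) \<and>
    (\<forall>ns. set ns \<subseteq> local_walks \<and> length ns = steps v -->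
       (\<forall>M\<le>N. Qhat M (assemble N v ns) = Qhat M v) \<and>
       Qhat (Suc N) (assemble N v ns) = path_of (Suc N) (refine_all cs (cell_codes cs (map (nth ns) is))) \<and>
       chain (Suc N) (refine_all cs (cell_codes cs (map (nth ns) is))))"
proof -
  note ip = W_inner_path[OF v]
  have v2: "2 \<le> length v" using ip by (simp add: inner_path_def)
  have "{v ! i, v ! Suc i} \<in> E N" if "Suc i < length v" for i using ip that by (simp add: inner_path_def steps_def)
  then have vx: "v ! i \<in> GV N \<and> v ! Suc i \<in> GV N \<and> v ! i ~= v ! Suc i" if "Suc i < length v" for i using that edge_vertices G_GV unfolding E_eq G_eq by blast
  have "v ! i \<in> GV N" if "i < length v" for i using vx[of i] vx[of "i - 1"] that v2 by (cases "Suc i < length v") (auto simp: Suc_diff_1 not_less dest!: le_antisym)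
  then have lat: "lattice_path N v" using vx v2 unfolding lattice_path_def successively_nth by (auto simp: set_conv_nth)
  have lastv: "last v \<in> GV 0" using v by (auto simp: W_def GV_def G_def)
  have erM: "\<exists>cs. chain M cs \<and> Q M (erased v M) = path_of M cs" if "M < K" "K \<le> N" for M K using below[of M] that by (simp add: Qhat_def)
  have E: "K \<le> N ==> \<exists>is. sorted_wrt (<) is \<and> (\<forall>i\<in>set is. i < steps v) \<and> last (erased v K) = last v \<and>
      (\<forall>qs. pieces N qs \<and> ends qs = v --> pieces N (map (nth qs) is) \<and> ends (map (nth qs) is) = erased v K
         \<and> erased (path_concat qs) K = path_concat (map (nth qs) is))" for K using erased_pieces[OF lat v2 lastv, of K] erM by blast
  obtain "is" where I: "sorted_wrt (<) is" "!!i. i \<in> set is ==> i < steps v"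
      "!!qs. pieces N qs ==> ends qs = v ==> pieces N (map (nth qs) is) \<and> ends (map (nth qs) is) = erased v N
         \<and> erased (path_concat qs) N = path_concat (map (nth qs) is)" using E[of N] by blast
  note pe = pieces_edges[OF lat v2]
  have lN: "lattice_path N (erased v N)" using I(3)[OF pe] lattice_path_ends by metis
  have er: "erased v N = path_of N cs" using top Q_lattice_path[OF lN] by (simp add: Qhat_def)
  let ?g = "path_of N cs"
  have len: "length is = steps ?g" using I(3)[OF pe] length_ends er by (metis diff_Suc_1 length_map steps_def)
  \<comment> \<open>The surviving steps of \<open>v\<close> are, in order, the steps of its
    erasure.\<close>
  have vis: "v ! (is ! k) = ?g ! k \<and> v ! Suc (is ! k) = ?g ! Suc k" if k: "k < length is" for k
  proof -
    have p: "pieces N (map (nth (edges_list v)) is)" "ends (map (nth (edges_list v)) is) = ?g" using I(3)[OF pe] er by auto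
    have ik: "is ! k < steps v" using I(2) k by simp
    then have "edges_list v ! (is ! k) = [v ! (is ! k), v ! Suc (is ! k)]" by (simp add: edges_list_def)
    then show ?thesis using ends_nth[of k "map (nth (edges_list v)) is"] ends_Suc[OF p(1), of k] p(2) k by simp
  qed
  have sg: "0 < steps ?g" using steps_path_of[OF ch] cum_strict[of 0 "length cs" cs] ch by (simp add: chain_def)
  have ig: "inner_path N ?g" unfolding inner_path_def
  proof (intro conjI allI impI)
    show "2 \<le> length ?g" using sg by (simp add: steps_def)
    fix k assume "k < steps ?g"
    then have k: "k < length is" using len by simp
    then have "is ! k < steps v" using I(2) by simp
    then show "{?g ! k, ?g ! Suc k} \<in> E N" "?g ! k \<notin> G 0 - {0}" using ip vis[OF k] by (auto simp: inner_path_def)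
  qed
  have main: "(\<forall>M\<le>N. Qhat M (assemble N v ns) = Qhat M v) \<and>
       Qhat (Suc N) (assemble N v ns) = path_of (Suc N) (refine_all cs (cell_codes cs (map (nth ns) is))) \<and>
       chain (Suc N) (refine_all cs (cell_codes cs (map (nth ns) is)))"
    if ns: "set ns \<subseteq> local_walks" "length ns = steps v" for ns
  proof -
    note ep = embed_pieces[OF ip ns]
    have "Qhat M (assemble N v ns) = Qhat M v" if M: "M \<le> N" for M
    proof -
      obtain js where "!!qs. pieces N qs ==> ends qs = v ==> pieces N (map (nth qs) js) \<and> ends (map (nth qs) js) = erased v M
         \<and> erased (path_concat qs) M = path_concat (map (nth qs) js)" using E[OF M] by blast
      then have "pieces N (map (nth (embed_pieces N v ns)) js)" "ends (map (nth (embed_pieces N v ns)) js) = erased v M"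
        "erased (assemble N v ns) M = path_concat (map (nth (embed_pieces N v ns)) js)" using ep unfolding assemble_def by blast+
      then show ?thesis unfolding Qhat_def using Q_path_concat M by metis
    qed
    moreover have "map (nth (embed_pieces N v ns)) is = embed_pieces N ?g (map (nth ns) is)"
    proof (rule nth_equalityI)
      fix k assume "k < length (map (nth (embed_pieces N v ns)) is)"
      then have k: "k < length is" by simp
      then have "is ! k < steps v" using I(2) by simp
      then show "map (nth (embed_pieces N v ns)) is ! k = embed_pieces N ?g (map (nth ns) is) ! k" using k ns(2) vis[OF k] by (simp add: embed_pieces_nth)
    qed simp
    then have "erased (assemble N v ns) N = path_concat (embed_pieces N ?g (map (nth ns) is))" using I(3)[OF ep] unfolding assemble_def by simp
    moreover have ms: "set (map (nth ns) is) \<subseteq> local_walks" "length (map (nth ns) is) = cum cs (length cs)" using ns I(2) len steps_path_of[OF ch] by auto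
    ultimately have e: "erased (assemble N v ns) (Suc N) = path_of (Suc N) (refine_all cs (cell_codes cs (map (nth ns) is)))" using erase_step_refine(1)[OF ch ig ms] by simp
    have ch': "chain (Suc N) (refine_all cs (cell_codes cs (map (nth ns) is)))" using chain_refine_all[OF ch _ erase_step_refine(2)[OF ch ig ms]] by simp
    have "Qhat (Suc N) (assemble N v ns) = path_of (Suc N) (refine_all cs (cell_codes cs (map (nth ns) is)))" unfolding Qhat_def e by (rule Q_lattice_path[OF lattice_path_of[OF ch']])
    then show ?thesis using ch' \<open>!!M. M \<le> N ==> Qhat M (assemble N v ns) = Qhat M v\<close> by blast
  qed

  then show ?thesis using I(1,2) len steps_path_of[OF ch] by (intro exI[of _ "is"]) auto
qed


subsection \<open>The measures as probability mass functions\<close>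

text \<open>Derived in \<open>total_mass\<close> from the law of the given walks; it carries the
  information about \<open>x_fix\<close> that the construction of the measures relies on.\<close>

definition total_mass_one :: "real => bool" where
  "total_mass_one u \<longleftrightarrow> (\<forall>N. (\<integral>\<^sup>+ w. ennreal (W_mass u N w) \<partial>count_space (W N)) = 1)"

text \<open>Until \<open>x_fix\<close> is known to be positive, weights are truncated at \<open>0\<close>, as \<open>point_measure\<close> does.\<close>

definition walk_pmf :: "real => node list pmf" where
  "walk_pmf u = embed_pmf (%n. if n \<in> local_walks then max 0 (local_weight u n) else 0)"

primrec W_pmf :: "real => nat => path pmf" where
  "W_pmf u 0 = return_pmf [0, pt_a]"
| "W_pmf u (Suc N) = bind_pmf (W_pmf u N) (%v. map_pmf (assemble N v) (replicate_pmf (steps v) (walk_pmf u)))"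

lemma walk_pmf_total:
  assumes "total_mass_one u"
  shows "(\<integral>\<^sup>+ n. ennreal (if n \<in> local_walks then max 0 (local_weight u n) else 0) \<partial>count_space UNIV) = 1"
proof -
  have bij: "bij_betw (map emb0) local_walks (W (Suc 0))" using map_emb0_inj W_1_eq by (simp add: bij_betw_def)
  have "1 = (\<integral>\<^sup>+ w. ennreal (P1 u w) \<partial>count_space (W (Suc 0)))" using assms[unfolded total_mass_one_def, THEN spec, of "Suc 0"] by simp
  also have "... = (\<integral>\<^sup>+ n. ennreal (P1 u (map emb0 n)) \<partial>count_space local_walks)" by (rule nn_integral_bij_count_space[OF bij, symmetric])
  also have "... = (\<integral>\<^sup>+ n. ennreal (max 0 (local_weight u n)) \<partial>count_space local_walks)"
  proof (rule nn_integral_cong)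
    fix n assume "n \<in> space (count_space local_walks)"
    then have "P1 u (map emb0 n) = local_weight u n" by (simp add: P1_emb0)
    then show "ennreal (P1 u (map emb0 n)) = ennreal (max 0 (local_weight u n))" by (cases "0 \<le> local_weight u n") (auto simp: max_def ennreal_neg)
  qed
  also have "... = (\<integral>\<^sup>+ n. ennreal (if n \<in> local_walks then max 0 (local_weight u n) else 0) \<partial>count_space UNIV)"
    by (subst nn_integral_count_space_indicator) (auto intro!: nn_integral_cong simp: indicator_def)
  finally show ?thesis by simp
qed

lemma pmf_walk_pmf:
  assumes "total_mass_one u"
  shows "pmf (walk_pmf u) n = (if n \<in> local_walks then max 0 (local_weight u n) else 0)" unfolding walk_pmf_def by (rule pmf_embed_pmf) (use walk_pmf_total[OF assms] in auto)

lemma set_walk_pmf: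
  assumes "total_mass_one u"
  shows "set_pmf (walk_pmf u) = {n \<in> local_walks. 0 < local_weight u n}" by (auto simp: set_pmf_iff pmf_walk_pmf[OF assms] max_def split: if_splits)

lemma pmf_replicate: "length xs = n ==> pmf (replicate_pmf n p) xs = (\<Prod>i<n. pmf p (xs ! i))"
proof (induction n arbitrary: xs)
  case (Suc n)
  then obtain y ys where xs: "xs = y # ys" "length ys = n" by (cases xs) auto
  have "pmf (replicate_pmf (Suc n) p) xs = (\<integral>x. pmf (map_pmf ((#) x) (replicate_pmf n p)) xs \<partial>measure_pmf p)" by (simp add: pmf_bind map_pmf_def)
  also have "... = (\<Sum>x\<in>{y}. pmf (map_pmf ((#) x) (replicate_pmf n p)) xs * pmf p x)"
  proof (rule integral_measure_pmf_real)
    fix x assume "pmf (map_pmf ((#) x) (replicate_pmf n p)) xs ~= 0"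
    then have "xs \<in> set_pmf (map_pmf ((#) x) (replicate_pmf n p))" unfolding set_pmf_iff .
    then show "x \<in> {y}" using xs by auto
  qed simp
  also have "... = pmf (replicate_pmf n p) ys * pmf p y" unfolding xs by (simp add: pmf_map_inj')
  also have "... = (\<Prod>i<Suc n. pmf p (xs ! i))" unfolding Suc.IH[OF xs(2)] xs(1) by (simp add: prod.lessThan_Suc_shift del: prod.lessThan_Suc)
  finally show ?case .
qed simp

lemma set_replicate_walks:
  assumes "total_mass_one u" "ns \<in> set_pmf (replicate_pmf n (walk_pmf u))"
  shows "set ns \<subseteq> local_walks" "length ns = n" "set ns \<subseteq> set_pmf (walk_pmf u)" using assms(2) set_walk_pmf[OF assms(1)] by (auto simp: set_replicate_pmf)

lemma set_W_pmf:
  assumes "total_mass_one u"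
  shows "set_pmf (W_pmf u N) \<subseteq> W N"
proof (induction N)
  case (Suc N)
  then show ?case using assemble_W set_replicate_walks[OF assms] by fastforce
qed (simp add: W_0)

text \<open>A path determines its coarse path and its local walks, so the mixture over coarse paths
  collapses to one term.\<close>

lemma pmf_W_pmf_assemble:
  assumes t: "total_mass_one u" and v: "v \<in> set_pmf (W_pmf u N)" and ns: "ns \<in> set_pmf (replicate_pmf (steps v) (walk_pmf u))"
  shows "pmf (W_pmf u (Suc N)) (assemble N v ns) = pmf (W_pmf u N) v * (\<Prod>i<steps v. pmf (walk_pmf u) (ns ! i))"
proof -
  let ?R = "%v. replicate_pmf (steps v) (walk_pmf u)"
  note sr = set_replicate_walks[OF t]
  have vW: "v \<in> W N" if "v \<in> set_pmf (W_pmf u N)" for v using set_W_pmf[OF t] that by blast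
  have "pmf (W_pmf u (Suc N)) (assemble N v ns) = (\<integral>v'. pmf (map_pmf (assemble N v') (?R v')) (assemble N v ns) \<partial>W_pmf u N)" by (simp add: pmf_bind)
  also have "... = (\<Sum>v'\<in>{v}. pmf (map_pmf (assemble N v') (?R v')) (assemble N v ns) * pmf (W_pmf u N) v')"
  proof (rule integral_measure_pmf_real)
    fix v' assume v': "v' \<in> set_pmf (W_pmf u N)" "pmf (map_pmf (assemble N v') (?R v')) (assemble N v ns) ~= 0"
    then obtain ns' where "ns' \<in> set_pmf (?R v')" "assemble N v' ns' = assemble N v ns" by (auto simp: set_pmf_iff[symmetric])
    then show "v' \<in> {v}" using assemble_inj[OF vW[OF v'(1)] vW[OF v]] sr ns by blast
  qed simp
  finally have A: "pmf (W_pmf u (Suc N)) (assemble N v ns) = pmf (map_pmf (assemble N v) (?R v)) (assemble N v ns) * pmf (W_pmf u N) v" by simp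
  have "pmf (map_pmf (assemble N v) (?R v)) (assemble N v ns) = pmf (?R v) ns"
  proof (rule pmf_map_inj[OF inj_onI ns])
    fix a b assume "a \<in> set_pmf (?R v)" "b \<in> set_pmf (?R v)" "assemble N v a = assemble N v b"
    then show "a = b" using assemble_inj[OF vW[OF v] vW[OF v]] sr by blast
  qed
  then have "pmf (W_pmf u (Suc N)) (assemble N v ns) = pmf (?R v) ns * pmf (W_pmf u N) v" unfolding A by simp
  then show ?thesis using pmf_replicate[OF sr(2)[OF ns]] by simp
qed

lemma W_pmf_W_mass:
  assumes t: "total_mass_one u"
  shows "w \<in> set_pmf (W_pmf u N) ==> pmf (W_pmf u N) w = W_mass u N w"
proof (induction N arbitrary: w)
  case (Suc N)
  then obtain v ns where v: "v \<in> set_pmf (W_pmf u N)" "ns \<in> set_pmf (replicate_pmf (steps v) (walk_pmf u))" "w = assemble N v ns" by auto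
  note sr = set_replicate_walks[OF t v(2)]
  have "pmf (walk_pmf u) (ns ! i) = local_weight u (ns ! i)" if "i < steps v" for i
  proof -
    have "ns ! i \<in> set_pmf (walk_pmf u)" using sr that by auto
    then show ?thesis using set_walk_pmf[OF t] pmf_walk_pmf[OF t] by simp
  qed
  moreover have "v \<in> W N" using set_W_pmf[OF t] v(1) by blast
  ultimately show ?case using pmf_W_pmf_assemble[OF t v(1,2)] W_mass_assemble[of v N ns u] sr(1,2) Suc.IH[OF v(1)] v(3) by simp
qed simp

text \<open>The mass function dominates \<open>pmf\<close> pointwise and both have total mass \<open>1\<close>, so they agree.\<close>

lemma W_mass_eq_pmf:
  assumes t: "total_mass_one u" and w: "w \<in> W N"
  shows "ennreal (W_mass u N w) = ennreal (pmf (W_pmf u N) w)"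
proof -
  let ?f = "%w. ennreal (W_mass u N w)" and ?g = "%w. ennreal (pmf (W_pmf u N) w)"
  have le: "?g w \<le> ?f w" for w

  proof (cases "w \<in> set_pmf (W_pmf u N)")
    case True
    then show ?thesis by (simp only: W_pmf_W_mass[OF t True])
  qed (simp add: set_pmf_iff)
  have f1: "(\<integral>\<^sup>+ w. ?f w \<partial>count_space (W N)) = 1" using t unfolding total_mass_one_def by blast
  have g1: "(\<integral>\<^sup>+ w. ?g w \<partial>count_space (W N)) = 1" unfolding nn_integral_pmf using set_W_pmf[OF t, of N] by (intro measure_pmf.emeasure_eq_1_AE) (auto simp: AE_measure_pmf_iff)
  have "(\<integral>\<^sup>+ w. ?f w - ?g w \<partial>count_space (W N)) = (\<integral>\<^sup>+ w. ?f w \<partial>count_space (W N)) - (\<integral>\<^sup>+ w. ?g w \<partial>count_space (W N))"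
    by (rule nn_integral_diff) (use le g1 in auto)
  also have "... = 0" unfolding f1 g1 by simp
  finally have "AE w in count_space (W N). ?f w - ?g w = 0" by (subst (asm) nn_integral_0_iff_AE) auto
  then have "?f w - ?g w = 0" using w by (simp add: AE_count_space)
  then have "?f w \<le> ?g w" unfolding diff_eq_0_iff_ennreal by blast
  then show ?thesis using le[of w] by (rule antisym)
qed

lemma W_law_pmf:
  assumes "total_mass_one u"
  shows "emeasure (W_law u N) {w \<in> W N. P w} = emeasure (W_pmf u N) {w. P w}"
proof -
  have "emeasure (W_law u N) {w \<in> W N. P w} = (\<integral>\<^sup>+ w. ennreal (W_mass u N w) * indicator {w \<in> W N. P w} w \<partial>count_space (W N))" unfolding W_law_def point_measure_def by (rule emeasure_density) auto
  also have "... = (\<integral>\<^sup>+ w. ennreal (pmf (W_pmf u N) w) * indicator {w. P w} w \<partial>count_space (W N))" by (rule nn_integral_cong) (auto simp: W_mass_eq_pmf[OF assms] indicator_def)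
  also have "... = (\<integral>\<^sup>+ w. ennreal (pmf (W_pmf u N) w) \<partial>count_space (W N \<inter> {w. P w}))"
  proof -
    have ind: "(\<integral>\<^sup>+ w. f w \<partial>count_space X) = (\<integral>\<^sup>+ w. f w * indicator X w \<partial>count_space UNIV)" for X :: "path set" and f by (rule nn_integral_count_space_indicator) simp
    show ?thesis unfolding ind[where X = "W N"] ind[where X = "W N \<inter> {w. P w}"] by (rule nn_integral_cong) (auto simp: indicator_def)
  qed
  also have "... = emeasure (W_pmf u N) (W N \<inter> {w. P w})" by (rule nn_integral_pmf)
  also have "... = emeasure (W_pmf u N) {w. P w}" using set_W_pmf[OF assms, of N] by (intro emeasure_eq_AE) (auto simp: AE_measure_pmf_iff)
  finally show ?thesis .
qed

section \<open>Positivity of the fixed point\<close>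

lemma local_walk_length: "n \<in> local_walks ==> 3 \<le> length n"
proof (rule ccontr)
  assume n: "n \<in> local_walks" "\<not> 3 \<le> length n"
  note lw = local_walk_props[OF n(1)]
  have l: "length n = 2" using n(2) lw(10) by simp
  then have "adj (n ! 0) (n ! 1)" using lw(11)[of 0] by simp
  then show False using lw(5,6) l by simp
qed

definition straight_walk :: "node list" where "straight_walk = [Co C0, Mi C2, Co C1]"

lemma straight_walk: "straight_walk \<in> local_walks" "local_weight u straight_walk = x_fix u"
proof -
  show "straight_walk \<in> local_walks" by (auto simp: straight_walk_def local_walks_def less_Suc_eq numeral_2_eq_2 nth_Cons' split: if_splits)
  have "local_turns straight_walk = 0" unfolding local_turns_def by (auto simp: straight_walk_def less_Suc_eq_le le_Suc_eq numeral_2_eq_2)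
  moreover have "local_returns straight_walk = 0" unfolding local_returns_def by (auto simp: straight_walk_def le_Suc_eq numeral_2_eq_2)
  ultimately show "local_weight u straight_walk = x_fix u" by (simp add: local_weight_def straight_walk_def)
qed

text \<open>There is no sharp turn and no return, so just an even power of \<open>x_fix\<close>
  remains, which is positive also for negative \<open>x_fix\<close>.\<close>

lemma bent_walk: "[Co C0, Mi C1, Mi C0, Co C1] \<in> local_walks" "local_weight u [Co C0, Mi C1, Mi C0, Co C1] = (x_fix u)\<^sup>2"
proof -
  let ?n = "[Co C0, Mi C1, Mi C0, Co C1]"
  show "?n \<in> local_walks" by (auto simp: local_walks_def less_Suc_eq numeral_3_eq_3 nth_Cons' split: if_splits)
  have "\<not> (?n ! (i - 1) = ?n ! Suc i \<or> adj (?n ! (i - 1)) (?n ! Suc i))" if "1 \<le> i" "Suc i \<le> length ?n - 1" for i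
  proof -
    have "i = 1 \<or> i = 2" using that by auto
    then show ?thesis by (elim disjE; simp)
  qed
  then have "{i. 1 \<le> i \<and> Suc i \<le> length ?n - 1 \<and> (?n ! (i - 1) = ?n ! Suc i \<or> adj (?n ! (i - 1)) (?n ! Suc i))
     \<and> ?n ! i \<notin> range Co} = {}" by blast
  then have "local_turns ?n = 0" unfolding local_turns_def by (simp only: card.empty)
  moreover have "?n ! i ~= Co C0" if "1 \<le> i" "i \<le> length ?n - 1" for i
  proof -
    have "i = 1 \<or> i = 2 \<or> i = 3" using that by auto
    then show ?thesis by (elim disjE; simp)
  qed
  then have "{i. 1 \<le> i \<and> i \<le> length ?n - 1 \<and> ?n ! i = Co C0} = {}" by blast
  then have "local_returns ?n = 0" unfolding local_returns_def by (simp only: card.empty)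
  ultimately show "local_weight u ?n = (x_fix u)\<^sup>2" by (simp add: local_weight_def power2_eq_square)
qed

text \<open>If \<open>x_fix\<close> were negative, a path of level 2 with exactly two pieces of negative weight would have positive
  mass, although both measures have total mass one on the paths with positive pieces.\<close>

lemma x_fix_pos:
  assumes t: "total_mass_one u"
  shows "0 < x_fix u"
proof (rule ccontr)
  assume "\<not> 0 < x_fix u"
  then consider "x_fix u = 0" | "x_fix u < 0" by linarith
  then show False
  proof cases
    case 1
    \<comment> \<open>For \<open>x_fix u = 0\<close> all weights vanish, because every local walk
      has at least two steps.\<close>
    obtain n where "n \<in> set_pmf (walk_pmf u)" using set_pmf_not_empty by fast
    then have "n \<in> local_walks" "0 < local_weight u n" using set_walk_pmf[OF t] by auto
    moreover from this have "length n - 2 ~= 0" using local_walk_length[of n] by simp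
    then have "(0 :: real) ^ (length n - 2) = 0" by (rule power_0_left[THEN trans, OF if_not_P])
    ultimately show False unfolding local_weight_def 1 by simp
  next
    case 2
    define b where "b = [Co C0, Mi C1, Mi C0, Co C1]"
    define v where "v = map emb0 b"
    define ns where "ns = [straight_walk, straight_walk, b]"
    have b: "b \<in> local_walks" "local_weight u b = (x_fix u)\<^sup>2" unfolding b_def by (rule bent_walk)+
    have v: "v \<in> W (Suc 0)" using W_1_eq b(1) by (simp add: v_def)
    have sv: "steps v = 3" by (simp add: v_def b_def steps_def)
    have ns: "set ns \<subseteq> local_walks" "length ns = steps v" using straight_walk(1) b(1) sv by (auto simp: ns_def)
    let ?w = "assemble (Suc 0) v ns"
    have m1: "W_mass u (Suc 0) v = (x_fix u)\<^sup>2" using P1_emb0[OF b(1)] b(2) by (simp add: v_def)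
    have "(\<Prod>i<3. local_weight u (ns ! i)) = x_fix u * x_fix u * (x_fix u)\<^sup>2" by (simp add: ns_def straight_walk(2) b(2) eval_nat_numeral)
    then have "W_mass u (Suc (Suc 0)) ?w = (x_fix u)\<^sup>2 * (x_fix u * x_fix u * (x_fix u)\<^sup>2)" using W_mass_assemble[OF v ns, of u] m1 sv by (simp del: W_mass.simps)
    then have "0 < W_mass u (Suc (Suc 0)) ?w" using 2 by (simp add: mult_neg_neg)
    then have "pmf (W_pmf u (Suc (Suc 0))) ?w ~= 0" using W_mass_eq_pmf[OF t assemble_W[OF v ns]] by (auto simp del: W_mass.simps W_pmf.simps)
    then have "?w \<in> set_pmf (W_pmf u (Suc (Suc 0)))" by (simp add: set_pmf_iff del: W_pmf.simps)
    then obtain v' ns' where v': "v' \<in> set_pmf (W_pmf u (Suc 0))" "ns' \<in> set_pmf (replicate_pmf (steps v') (walk_pmf u))"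
      "?w = assemble (Suc 0) v' ns'" unfolding W_pmf.simps(2)[of u "Suc 0"] by auto
    note sr = set_replicate_walks[OF t v'(2)]
    have "v' \<in> W (Suc 0)" using set_W_pmf[OF t] v'(1) by blast
    then have "ns = ns'" using assemble_inj[OF v _ ns sr(1,2) v'(3)] by blast
    then have "straight_walk \<in> set_pmf (walk_pmf u)" using sr(3) by (auto simp: ns_def)
    then show False using set_walk_pmf[OF t] straight_walk(2) 2 by simp
  qed
qed

subsection \<open>The Markov chain of cell lists\<close>

text \<open>The exit indices recover where the cells begin; then entry and exit corners determine
  each cell together with its labelling.\<close>

lemma path_of_inj:
  assumes a: "chain N cs" and b: "chain N ds" and eq: "path_of N cs = path_of N ds"
  shows "cs = ds"
proof -
  have cum: "cum cs i = cum ds i" if "i \<le> length cs" "i \<le> length ds" for i using exit_idx_path_of[OF a that(1)] exit_idx_path_of[OF b that(2)] eq by simp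
  have tot: "cum cs (length cs) = cum ds (length ds)" using steps_path_of[OF a] steps_path_of[OF b] eq by simp
  have len: "length cs = length ds"
  proof (rule ccontr)
    assume "length cs ~= length ds"
    then consider "length cs < length ds" | "length ds < length cs" by linarith
    then show False
    proof cases
      case 1
      then have "cum ds (length cs) = cum ds (length ds)" using cum[of "length cs"] tot by simp
      then show False using 1 by (simp add: cum_eq_iff)
    next
      case 2
      then have "cum cs (length ds) = cum cs (length cs)" using cum[of "length ds"] tot by simp
      then show False using 2 by (simp add: cum_eq_iff)
    qed
  qed
  show ?thesis
  proof (rule nth_equalityI[OF len])
    fix i assume i: "i < length cs"
    then have j: "i < length ds" using len by simp
    have "cum cs (Suc i) = cum ds (Suc i)" "cum cs i = cum ds i" using cum[of "Suc i"] cum[of i] i j by (simp_all del: cum.simps)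
    then have cl: "cell_len (cs ! i) = cell_len (ds ! i)" by simp
    then have t: "snd (snd (cs ! i)) = snd (snd (ds ! i))" by (simp add: cell_len_def split: if_splits)
    have p: "cell_path N (cs ! i) ! k = cell_path N (ds ! i) ! k" if "k \<le> cell_len (cs ! i)" for k using path_of_nth[OF a i that] path_of_nth[OF b j, of k] that cl eq \<open>cum cs i = cum ds i\<close> by simp
    have "cell_pt N (cs ! i) C0 = cell_pt N (ds ! i) C0" using p[of 0] by (simp add: cell_path_def split: if_splits)
    moreover have "cell_pt N (cs ! i) C1 = cell_pt N (ds ! i) C1" using p[of "cell_len (cs ! i)"] t by (simp add: cell_path_def cell_len_def split: if_splits)
    ultimately have e: "fst (cs ! i) + delta (fst (snd (cs ! i)) C0) = fst (ds ! i) + delta (fst (snd (ds ! i)) C0)"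
      "fst (cs ! i) + delta (fst (snd (cs ! i)) C1) = fst (ds ! i) + delta (fst (snd (ds ! i)) C1)" by (simp_all add: cell_pt_def)
    note ci = chain_nth[OF a i] and di = chain_nth[OF b j]
    have "fst (snd (cs ! i)) C0 ~= fst (snd (cs ! i)) C1" using ci by (simp add: inj_eq)
    from edge_cell_unique[OF e this] have u: "fst (cs ! i) = fst (ds ! i)" "fst (snd (cs ! i)) C0 = fst (snd (ds ! i)) C0"
      "fst (snd (cs ! i)) C1 = fst (snd (ds ! i)) C1" by auto
    then have "fst (snd (cs ! i)) = fst (snd (ds ! i))" using frame_determined ci di by blast
    then show "cs ! i = ds ! i" using u(1) t by (simp add: prod_eq_iff)
  qed
qed

definition decode :: "nat => path => cell list" where
  "decode N w = (THE cs. chain N cs \<and> path_of N cs = w)"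

lemma decode_path_of: "chain N cs ==> decode N (path_of N cs) = cs" unfolding decode_def by (rule the_equality) (auto intro: path_of_inj)

definition code_pmf :: "real => bool => bool list pmf" where
  "code_pmf u t = map_pmf (cell_code t) (replicate_pmf (if t then 2 else 1) (walk_pmf u))"

primrec codes_pmf :: "real => cell list => bool list list pmf" where
  "codes_pmf u [] = return_pmf []"
| "codes_pmf u (C # cs) = bind_pmf (code_pmf u (snd (snd C))) (%bs. map_pmf ((#) bs) (codes_pmf u cs))"

text \<open>An independent sample cut into consecutive groups, one for each cell, gives independent
  groups.\<close>

lemma cell_codes_pmf: "map_pmf (cell_codes cs) (replicate_pmf (cum cs (length cs)) (walk_pmf u)) = codes_pmf u cs"
proof (induction cs)
  case (Cons C cs)
  let ?w = "walk_pmf u"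
  have cl: "cell_len C = (if snd (snd C) then 2 else 1)" by (simp add: cell_len_def)
  have "map_pmf (cell_codes (C # cs)) (replicate_pmf (cum (C # cs) (length (C # cs))) ?w) =
    bind_pmf (replicate_pmf (cell_len C) ?w) (%xs. bind_pmf (replicate_pmf (cum cs (length cs)) ?w)
      (%ys. return_pmf (cell_codes (C # cs) (xs @ ys))))" by (simp add: cum_Cons replicate_pmf_distrib map_bind_pmf del: cum.simps(2) cell_codes.simps)
  also have "... = bind_pmf (replicate_pmf (cell_len C) ?w) (%xs. bind_pmf (replicate_pmf (cum cs (length cs)) ?w)
      (%ys. return_pmf (cell_code (snd (snd C)) xs # cell_codes cs ys)))" by (intro bind_pmf_cong refl) (auto simp: set_replicate_pmf)
  also have "... = bind_pmf (replicate_pmf (cell_len C) ?w) (%xs. map_pmf ((#) (cell_code (snd (snd C)) xs))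
      (map_pmf (cell_codes cs) (replicate_pmf (cum cs (length cs)) ?w)))" by (simp add: map_pmf_def bind_assoc_pmf bind_return_pmf)
  also have "... = codes_pmf u (C # cs)" unfolding Cons.IH codes_pmf.simps code_pmf_def cl[symmetric] bind_map_pmf ..
  finally show ?case .
qed simp

text \<open>Independent samples read off at distinct prescribed positions are again independent.
  Since the positions are sorted, either the first sample is the first one selected or it is skipped
  altogether.\<close>

lemma replicate_pmf_select:
  "sorted_wrt (<) is ==> \<forall>i\<in>set is. i < n ==> map_pmf (%xs. map (nth xs) is) (replicate_pmf n p) = replicate_pmf (length is) p"
proof (induction n arbitrary: "is")
  case 0
  then have "is = []" by (cases "is") auto
  then show ?case by simp
next
  case (Suc n)
  have red: "\<exists>js. js' = map Suc js \<and> sorted_wrt (<) js \<and> (\<forall>i\<in>set js. i < n)"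
    if "sorted_wrt (<) js'" "\<forall>i\<in>set js'. i < Suc n \<and> 0 < i" for js' :: "nat list"
  proof (intro exI conjI)
    show "js' = map Suc (map (%i. i - 1) js')" using that(2) by (induction js') auto
    show "sorted_wrt (<) (map (%i. i - 1) js')" unfolding sorted_wrt_map using that(1) by (rule sorted_wrt_mono_rel[rotated]) (use that(2) in fastforce)
    show "\<forall>i\<in>set (map (%i. i - 1) js'). i < n" using that(2) by auto
  qed
  show ?case
  proof (cases "0 \<in> set is")
    case True
    then obtain js' where js': "is = 0 # js'" using Suc.prems(1) by (cases "is") auto
    then have "sorted_wrt (<) js'" "\<forall>i\<in>set js'. i < Suc n \<and> 0 < i" using Suc.prems by auto
    then obtain js where js: "js' = map Suc js" "sorted_wrt (<) js" "\<forall>i\<in>set js. i < n" using red by blast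
    have "map_pmf (%xs. map (nth xs) is) (replicate_pmf (Suc n) p) =
      bind_pmf p (%x. map_pmf ((#) x) (map_pmf (%xs. map (nth xs) js) (replicate_pmf n p)))" unfolding js' js(1) by (simp add: map_bind_pmf map_pmf_def bind_assoc_pmf bind_return_pmf comp_def)
    also have "... = replicate_pmf (length is) p" unfolding Suc.IH[OF js(2,3)] js' js(1) by (simp add: map_pmf_def)
    finally show ?thesis .
  next
    case False
    then have "\<forall>i\<in>set is. i < Suc n \<and> 0 < i" using Suc.prems(2) by (metis gr0I)
    then obtain js where js: "is = map Suc js" "sorted_wrt (<) js" "\<forall>i\<in>set js. i < n" using red Suc.prems(1) by blast
    have "map_pmf (%xs. map (nth xs) is) (replicate_pmf (Suc n) p) =
      bind_pmf p (%x. map_pmf (%xs. map (nth xs) js) (replicate_pmf n p))" unfolding js(1) by (simp add: map_bind_pmf map_pmf_def bind_assoc_pmf bind_return_pmf comp_def)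
    also have "... = replicate_pmf (length is) p" unfolding Suc.IH[OF js(2,3)] js(1) by simp
    finally show ?thesis .
  qed
qed

definition root_cell :: cell where "root_cell = ((0, 0), id, False)"

lemma chain_root: "chain 0 [root_cell]" "path_of 0 [root_cell] = [0, pt_a]" by (simp_all add: chain_def root_cell_def path_of_def cell_path_def cell_pt_def pt_corners zero_prod_def)

lemma W_pmf_chain:
  assumes t: "total_mass_one u"
  shows "v \<in> set_pmf (W_pmf u N) ==> M \<le> N ==> \<exists>cs. chain M cs \<and> Qhat M v = path_of M cs"
proof (induction N arbitrary: v M)
  case 0
  then have "v = path_of 0 [root_cell]" "M = 0" using chain_root(2) by auto
  then show ?case using chain_root(1) Q_lattice_path[OF lattice_path_of[OF chain_root(1)]] by (intro exI[of _ "[root_cell]"]) (simp add: Qhat_def)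
next
  case (Suc N)
  then obtain v' ns where v': "v' \<in> set_pmf (W_pmf u N)" "ns \<in> set_pmf (replicate_pmf (steps v') (walk_pmf u))" "v = assemble N v' ns" by auto
  obtain cs where cs: "chain N cs" "Qhat N v' = path_of N cs" using Suc.IH[OF v'(1) order_refl] by blast
  have vW: "v' \<in> W N" using set_W_pmf[OF t] v'(1) by blast
  have "!!M. M < N ==> \<exists>cs. chain M cs \<and> Qhat M v' = path_of M cs" using Suc.IH[OF v'(1)] by simp
  from Qhat_assemble[OF vW this cs] obtain "is" where
    "!!ns. set ns \<subseteq> local_walks ==> length ns = steps v' ==>
       (\<forall>M\<le>N. Qhat M (assemble N v' ns) = Qhat M v') \<and>
       Qhat (Suc N) (assemble N v' ns) = path_of (Suc N) (refine_all cs (cell_codes cs (map (nth ns) is))) \<and>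
       chain (Suc N) (refine_all cs (cell_codes cs (map (nth ns) is)))" by blast
  from this[OF set_replicate_walks(1,2)[OF t v'(2)]] show ?case using Suc.prems(2) Suc.IH[OF v'(1), of M] v'(3) by (cases "M = Suc N") auto
qed

definition cells_pmf :: "real => nat => cell list pmf" where
  "cells_pmf u N = map_pmf (%w. decode N (Qhat N w)) (W_pmf u N)"

text \<open>The Markov property: given the coarse path \<open>v\<close> the surviving indices are
  fixed, so the local walks entering the refinement form a fresh sample of the right size.\<close>

lemma W_pmf_step:
  assumes t: "total_mass_one u"
  shows "map_pmf (%w. (decode N (Qhat N w), decode (Suc N) (Qhat (Suc N) w))) (W_pmf u (Suc N)) =
    bind_pmf (cells_pmf u N) (%cs. map_pmf (%bss. (cs, refine_all cs bss)) (codes_pmf u cs))"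
proof -
  have "map_pmf (%w. (decode N (Qhat N w), decode (Suc N) (Qhat (Suc N) w))) (W_pmf u (Suc N)) =
    bind_pmf (W_pmf u N) (%v. map_pmf (%ns. (decode N (Qhat N (assemble N v ns)), decode (Suc N) (Qhat (Suc N) (assemble N v ns))))
       (replicate_pmf (steps v) (walk_pmf u)))" by (simp add: map_bind_pmf map_pmf_comp)
  also have "... = bind_pmf (W_pmf u N) (%v. map_pmf (%bss. (decode N (Qhat N v), refine_all (decode N (Qhat N v)) bss))
       (codes_pmf u (decode N (Qhat N v))))"
  proof (rule bind_pmf_cong[OF refl])
    fix v assume v: "v \<in> set_pmf (W_pmf u N)"
    obtain cs where cs: "chain N cs" "Qhat N v = path_of N cs" using W_pmf_chain[OF t v order_refl] by blast
    have vW: "v \<in> W N" using set_W_pmf[OF t] v by blast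
    have "!!M. M < N ==> \<exists>cs. chain M cs \<and> Qhat M v = path_of M cs" using W_pmf_chain[OF t v] by simp
    from Qhat_assemble[OF vW this cs] obtain "is" where I: "sorted_wrt (<) is" "\<forall>i\<in>set is. i < steps v" "length is = cum cs (length cs)"
      "!!ns. set ns \<subseteq> local_walks ==> length ns = steps v ==>
         (\<forall>M\<le>N. Qhat M (assemble N v ns) = Qhat M v) \<and>
         Qhat (Suc N) (assemble N v ns) = path_of (Suc N) (refine_all cs (cell_codes cs (map (nth ns) is))) \<and>
         chain (Suc N) (refine_all cs (cell_codes cs (map (nth ns) is)))" by blast
    have d: "decode N (Qhat N v) = cs" using cs decode_path_of by simp
    have "map_pmf (%ns. (decode N (Qhat N (assemble N v ns)), decode (Suc N) (Qhat (Suc N) (assemble N v ns))))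
       (replicate_pmf (steps v) (walk_pmf u)) =
      map_pmf (%ns. (cs, refine_all cs (cell_codes cs (map (nth ns) is)))) (replicate_pmf (steps v) (walk_pmf u))"
    proof (rule map_pmf_cong[OF refl])
      fix ns assume "ns \<in> set_pmf (replicate_pmf (steps v) (walk_pmf u))"
      from I(4)[OF set_replicate_walks(1,2)[OF t this]]
      show "(decode N (Qhat N (assemble N v ns)), decode (Suc N) (Qhat (Suc N) (assemble N v ns))) =
          (cs, refine_all cs (cell_codes cs (map (nth ns) is)))" using d decode_path_of by simp
    qed
    also have "... = map_pmf (%bss. (cs, refine_all cs bss)) (map_pmf (cell_codes cs)
        (map_pmf (%ns. map (nth ns) is) (replicate_pmf (steps v) (walk_pmf u))))" by (simp add: map_pmf_comp)
    also have "... = map_pmf (%bss. (cs, refine_all cs bss)) (codes_pmf u cs)" unfolding replicate_pmf_select[OF I(1,2)] I(3) cell_codes_pmf ..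
    finally show "map_pmf (%ns. (decode N (Qhat N (assemble N v ns)), decode (Suc N) (Qhat (Suc N) (assemble N v ns))))
       (replicate_pmf (steps v) (walk_pmf u)) =
       map_pmf (%bss. (decode N (Qhat N v), refine_all (decode N (Qhat N v)) bss)) (codes_pmf u (decode N (Qhat N v)))" unfolding d .
  qed
  also have "... = bind_pmf (cells_pmf u N) (%cs. map_pmf (%bss. (cs, refine_all cs bss)) (codes_pmf u cs))" unfolding cells_pmf_def bind_map_pmf ..
  finally show ?thesis .
qed


subsection \<open>Paths through two unit cells\<close>

lemma frame_swap: "frame {C0} 0 (0, 0) swap12" "frame {C0} 0 (0, 0) swap02" using inj_swap by (auto simp: frame_def regular_def incident_zero swap_simps)

lemma emb0_relabel: "map (emb 0 (0, 0) \<sigma>) n = map emb0 (map (relabel \<sigma>) n)" unfolding emb0_def using emb_comp[of 0 "(0, 0)" id \<sigma>] by simp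

definition unit_pieces :: "bool => node list list => path list" where
  "unit_pieces t ns = (if t then [map (emb 0 (0, 0) swap12) (ns ! 0), map (emb 0 (0, 0) swap02) (ns ! 1)] else [map emb0 (ns ! 0)])"

lemma path_concat_unit_pieces: "path_concat (unit_pieces t ns) = map emb0 (cell_walk t ns)" by (simp add: unit_pieces_def cell_walk_def join_walks_def emb0_relabel map_tl)

lemma local_piece:
  assumes "n \<in> local_walks" "frame {C0} N c \<rho>"
  shows "piece N (map (emb N c \<rho>) n)" "hd (map (emb N c \<rho>) n) = emb N c \<rho> (Co C0)" "last (map (emb N c \<rho>) n) = emb N c \<rho> (Co C1)"
proof -
  note lw = local_walk_props[OF assms(1)]
  show hl: "hd (map (emb N c \<rho>) n) = emb N c \<rho> (Co C0)" "last (map (emb N c \<rho>) n) = emb N c \<rho> (Co C1)" using lw(1,3,4) by (simp_all add: hd_map last_map)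
  have co: "Co i \<in> nodes_at {C0}" for i by (simp add: nodes_at_def)
  have k: "map (emb N c \<rho>) n ! k = emb N c \<rho> (Co C0)" if "k < length n - 1" "map (emb N c \<rho>) n ! k \<in> GV N" for k
  proof -
    have k': "k < length n" using that by simp
    then have "n ! k \<in> range Co" using that(2) emb_GV[OF assms(2) lw(8)[OF k']] by simp
    then have "n ! k = Co C0" using lw(7)[OF that(1)] by auto
    then show ?thesis using k' by simp
  qed
  have "emb N c \<rho> (Co C0) ~= emb N c \<rho> (Co C1)" using inj_onD[OF emb_inj[OF assms(2)] _ co co, of C0 C1] by auto
  then show "piece N (map (emb N c \<rho>) n)" unfolding piece_def hl using lw(10) k emb_GV[OF assms(2) co] by (auto simp: steps_def)
qed

lemma emb0_swap: "emb 0 (0, 0) swap12 (Co C0) = 0" "emb 0 (0, 0) swap12 (Co C1) = pt_b"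
  "emb 0 (0, 0) swap02 (Co C0) = pt_b" "emb 0 (0, 0) swap02 (Co C1) = pt_a" by (simp_all add: emb_Co swap_simps pt_corners)

definition unit_cell :: "bool => cell" where "unit_cell t = ((0, 0), id, t)"

lemma chain_unit: "chain 0 [unit_cell t]" by (simp add: chain_def unit_cell_def)

lemma path_of_unit: "path_of 0 [unit_cell t] = (if t then [0, pt_b, pt_a] else [0, pt_a])" by (simp add: path_of_def unit_cell_def cell_path_def cell_pt_def pt_corners)

lemma unit_pieces:
  assumes ns: "set ns \<subseteq> local_walks" "length ns = (if t then 2 else 1)"
  shows "pieces 0 (unit_pieces t ns)" "ends (unit_pieces t ns) = path_of 0 [unit_cell t]"
proof -
  have n0: "ns ! 0 \<in> local_walks" "t ==> ns ! 1 \<in> local_walks" using ns by (auto split: if_splits)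
  note a = local_piece[OF n0(1) frame0(2), folded emb0_def] local_piece[OF n0(1) frame_swap(1)]
  have b: "piece 0 (map (emb 0 (0, 0) swap02) (ns ! 1))" "hd (map (emb 0 (0, 0) swap02) (ns ! 1)) = pt_b"
    "last (map (emb 0 (0, 0) swap02) (ns ! 1)) = pt_a" if t using local_piece[OF n0(2)[OF that] frame_swap(2)] emb0_swap by simp_all
  show "pieces 0 (unit_pieces t ns)" using a b by (auto simp: pieces_def unit_pieces_def emb0_swap)
  show "ends (unit_pieces t ns) = path_of 0 [unit_cell t]" using a b by (auto simp: ends_def unit_pieces_def emb0_swap emb0_Co path_of_unit)
qed

text \<open>At level 0 the skeleton consists of one cell, so the first erasure step is the loop
  erasure of the whole path in local coordinates.\<close>

lemma unit_loop_erase: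
  assumes ns: "set ns \<subseteq> local_walks" "length ns = (if t then 2 else 1)"
  shows "loop_erase (Suc 0) (map emb0 (cell_walk t ns)) = path_of (Suc 0) (refine (unit_cell t) (cell_code t ns))"
    "chain (Suc 0) (refine (unit_cell t) (cell_code t ns))"
    "Q 0 (map emb0 (cell_walk t ns)) = path_of 0 [unit_cell t]"
proof -
  let ?w = "map emb0 (cell_walk t ns)"
  let ?ps = "unit_pieces t ns"
  note up = unit_pieces[OF ns] and cw = cell_walk_props[OF ns]
  have w: "path_concat ?ps = ?w" by (rule path_concat_unit_pieces)
  show Q: "Q 0 ?w = path_of 0 [unit_cell t]" using last_hit_pieces(3)[OF up(1)] up(2) w by simp
  have ne: "?w ~= []" using cw(1) by simp
  have cum: "cum [unit_cell t] (Suc 0) = length ?ps" by (simp add: cell_len_def unit_cell_def unit_pieces_def)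
  have lp: "0 < length ?ps" by (simp add: unit_pieces_def)
  have seg: "segment ?w (T 0 ?w 0) (T 0 ?w (length ?ps)) = ?w"
  proof -
    have "segment (path_concat ?ps) (pos ?ps 0) (pos ?ps (length ?ps)) = path_concat (map (nth ?ps) [0..<length ?ps])" by (rule pieces_slice(3)[OF up(1) lp order_refl])
    then show ?thesis using last_hit_pieces(2)[OF up(1)] unfolding w map_nth by simp
  qed
  have "erase_step 0 ?w = path_concat [erase_segment (Suc 0) ?w]" using erase_step_chain[OF ne chain_unit Q] seg cum by (simp del: cum.simps(2) T_0)
  also have "... = map emb0 (lerase (cell_walk t ns))" using erase_segment_emb[OF frame0(1) cw(1,5,4,2,3)] unfolding emb0_def by simp
  also have "... = path_of (Suc 0) (refine (unit_cell t) (cell_code t ns))" using refine_path[OF cell_code_table[OF ns], of id 0 "(0, 0)" t] unfolding emb0_def unit_cell_def by simp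
  finally have e: "erase_step 0 ?w = path_of (Suc 0) (refine (unit_cell t) (cell_code t ns))" .
  show ch: "chain (Suc 0) (refine (unit_cell t) (cell_code t ns))" by (rule refine_props(1)[OF cell_code_codes[OF ns]]) (simp_all add: unit_cell_def)
  show "loop_erase (Suc 0) ?w = path_of (Suc 0) (refine (unit_cell t) (cell_code t ns))" unfolding loop_erase_def Qhat_def erased.simps e by (rule Q_lattice_path[OF lattice_path_of[OF ch]])
qed

text \<open>A local walk reaches \<open>Co C1\<close> at its end only, so in the joined walk the
  first part ends at the first visit to \<open>Co C2\<close>.\<close>

lemma join_walks_inj:
  assumes "n \<in> local_walks" "n' \<in> local_walks" "m \<in> local_walks" "m' \<in> local_walks" "join_walks n n' = join_walks m m'"
  shows "n = m \<and> n' = m'"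
proof -
  have tw: "map (relabel swap12) n = takeWhile (%x. x ~= Co C2) (join_walks n n') @ [Co C2]" if n: "n \<in> local_walks" for n n'
  proof -
    note lw = local_walk_props[OF n]
    have "n = butlast n @ [Co C1]" using append_butlast_last_id[OF lw(1)] lw(4) by simp
    then have "map (relabel swap12) n = map (relabel swap12) (butlast n @ [Co C1])" by (rule arg_cong)
    also have "... = map (relabel swap12) (butlast n) @ [Co C2]" by (simp add: swap_simps)
    finally have m: "map (relabel swap12) n = map (relabel swap12) (butlast n) @ [Co C2]" .
    have "x ~= Co C2" if "x \<in> set (map (relabel swap12) (butlast n))" for x
    proof -
      obtain i where i: "i < length n - 1" "x = relabel swap12 (n ! i)" using \<open>x \<in> _\<close>
        by (auto simp: in_set_conv_nth nth_butlast)
      then show ?thesis using lw(7)[OF i(1)] by (auto simp: swap_simps)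
    qed
    then have "takeWhile (%x. x ~= Co C2) (map (relabel swap12) (butlast n) @ Co C2 # ys) = map (relabel swap12) (butlast n)" for ys by (subst takeWhile_append2) auto
    then show ?thesis unfolding join_walks_def m by simp
  qed
  have e1: "map (relabel swap12) n = map (relabel swap12) m" using tw[OF assms(1), of n'] tw[OF assms(3), of m'] assms(5) by simp
  then have t: "tl (map (relabel swap02) n') = tl (map (relabel swap02) m')" using assms(5) unfolding join_walks_def by simp
  have h: "map (relabel swap02) k = Co C2 # tl (map (relabel swap02) k)" if "k \<in> local_walks" for k using local_walk_props(1,3)[OF that] by (cases k) (simp_all add: swap_simps)
  have "map (relabel swap02) n' = Co C2 # tl (map (relabel swap02) n')" by (rule h[OF assms(2)])
  also have "... = Co C2 # tl (map (relabel swap02) m')" by (simp only: t)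
  also have "... = map (relabel swap02) m'" by (rule h[OF assms(4), symmetric])
  finally have e2: "map (relabel swap02) n' = map (relabel swap02) m'" .
  have "inj (relabel swap12)" by (rule injI) (simp only: relabel_inj[OF inj_swap(1)])
  moreover have "inj (relabel swap02)" by (rule injI) (simp only: relabel_inj[OF inj_swap(2)])
  ultimately show ?thesis using e1 e2 by (simp add: inj_map_eq_map)
qed

text \<open>The condition on \<open>Q 0\<close> splits the path at the first visit to
  \<open>pt_b\<close>. Among the vertices of level 0, only \<open>O\<close> may be revisited before
  that time and only \<open>pt_b\<close> between it and the end, so both parts are pieces.\<close>

lemma V_1_eq: "V (Suc 0) = (%(n, n'). map emb0 (join_walks n n')) ` (local_walks \<times> local_walks)"
proof (intro equalityI subsetI)
  fix w assume w: "w \<in> V (Suc 0)"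
  have path: "nn_path (EV (Suc 0)) w" and hl: "hd w = 0" "last w = pt_a" and av: "!!i. i < steps w ==> w ! i ~= pt_a"
    and Q0: "Q 0 w = [0, pt_b, pt_a]" using w by (auto simp: V_def)
  have ne: "w ~= []" using path by (simp add: nn_path_def)
  have nn: "!!i. Suc i < length w ==> {w ! i, w ! Suc i} \<in> EV (Suc 0)" using path by (simp add: nn_path_def successively_nth)
  have lh: "last_hit 0 w = 2" using Q_length[of 0 w] Q0 by simp
  define t where "t = T 0 w 1"
  have t1: "0 < t" "w ! t = pt_b" using T_Suc(1)[OF ne, of 0 0] lh Q_nth[of 1 0 w] Q0 by (simp_all add: t_def)
  have t2: "t < T 0 w 2" "T 0 w 2 < length w" "w ! T 0 w 2 = pt_a" using T_Suc(1)[OF ne, of "Suc 0" 0] T_length[OF ne, of 2 0] lh Q_nth[of 2 0 w] Q0 by (simp_all add: t_def numeral_2_eq_2)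
  then have "\<not> T 0 w 2 < steps w" using av by blast
  then have t2': "T 0 w 2 = steps w" using t2(2) unfolding steps_def by linarith
  have b1: "w ! j = 0" if "j < t" "w ! j \<in> GV 0" for j using T_Suc(4)[OF ne, of 0 0 j] that lh hl(1) ne by (cases "j = 0") (auto simp: t_def hd_conv_nth)
  have b2: "w ! j = pt_b" if "t \<le> j" "j < steps w" "w ! j \<in> GV 0" for j using T_Suc(4)[OF ne, of "Suc 0" 0 j] that lh t1(2) t2' by (cases "j = t") (auto simp: t_def numeral_2_eq_2)
  have tl: "t < length w" using t2 by simp
  have "\<exists>n\<in>local_walks. take (Suc t) w = map (emb 0 (0, 0) swap12) n"
  proof (rule piece_is_local[OF frame_swap(1)])
    show "nn_path (EV (Suc 0)) (take (Suc t) w)" using ne nn unfolding nn_path_def successively_nth by auto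
    show h: "hd (take (Suc t) w) = emb 0 (0, 0) swap12 (Co C0)" using hl ne by (simp add: emb0_swap hd_take)
    show "last (take (Suc t) w) = emb 0 (0, 0) swap12 (Co C1)" using tl t1 by (simp add: emb0_swap take_Suc_conv_app_nth)
    fix i assume "i < steps (take (Suc t) w)" "take (Suc t) w ! i \<in> GV 0"
    then show "take (Suc t) w ! i = hd (take (Suc t) w)" unfolding h using b1[of i] tl by (simp add: steps_def emb0_swap)
  qed
  then obtain n where n: "n \<in> local_walks" "take (Suc t) w = map (emb 0 (0, 0) swap12) n" by blast
  have "\<exists>n\<in>local_walks. drop t w = map (emb 0 (0, 0) swap02) n"
  proof (rule piece_is_local[OF frame_swap(2)])
    show "nn_path (EV (Suc 0)) (drop t w)" using tl nn unfolding nn_path_def successively_nth by auto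
    show h: "hd (drop t w) = emb 0 (0, 0) swap02 (Co C0)" using tl t1 by (simp add: emb0_swap hd_drop_conv_nth)
    show "last (drop t w) = emb 0 (0, 0) swap02 (Co C1)" using tl hl by (simp add: emb0_swap)
    fix i assume "i < steps (drop t w)" "drop t w ! i \<in> GV 0"
    then show "drop t w ! i = hd (drop t w)" unfolding h using b2[of "t + i"] tl by (simp add: steps_def emb0_swap)
  qed
  then obtain n' where n': "n' \<in> local_walks" "drop t w = map (emb 0 (0, 0) swap02) n'" by blast
  have "w = take (Suc t) w @ tl (drop t w)" using append_take_drop_id[of "Suc t" w] by (simp only: drop_Suc tl_drop)
  then have "w = map emb0 (join_walks n n')" unfolding n(2) n'(2) emb0_relabel join_walks_def by (simp add: map_tl)
  then show "w \<in> (%(n, n'). map emb0 (join_walks n n')) ` (local_walks \<times> local_walks)" using n(1) n'(1) by force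
next
  fix w assume "w \<in> (%(n, n'). map emb0 (join_walks n n')) ` (local_walks \<times> local_walks)"
  then obtain n n' where n: "n \<in> local_walks" "n' \<in> local_walks" "w = map emb0 (join_walks n n')" by auto
  let ?m = "join_walks n n'"
  note jp = join_walks_props[OF n(1,2)]
  have m: "cell_walk True [n, n'] = ?m" by (simp add: cell_walk_def)
  have "Q 0 w = [0, pt_b, pt_a]" using unit_loop_erase(3)[of "[n, n']" True] n by (simp add: m path_of_unit)
  moreover have "nn_path (EV (Suc 0)) w" unfolding nn_path_def successively_nth n(3)
  proof (intro conjI allI impI)
    show "map emb0 ?m ~= []" using jp(1) by simp
    fix i assume "Suc i < length (map emb0 ?m)"
    then have i: "Suc i < length ?m" "i < length ?m" by auto
    then have "?m ! i \<in> nodes_at {C0, C2}" "?m ! Suc i \<in> nodes_at {C0, C2}" "adj (?m ! i) (?m ! Suc i)" using jp(4,5) by (auto simp: successively_nth)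
    then show "{map emb0 ?m ! i, map emb0 ?m ! Suc i} \<in> EV (Suc 0)" using emb_edge[OF frame0(1)] i unfolding emb0_def by simp
  qed
  moreover have "hd w = 0" "last w = pt_a" using jp(1-3) n(3) by (simp_all add: hd_map last_map emb0_Co)
  moreover have "w ! i ~= pt_a" if "i < steps w" for i
  proof
    assume *: "w ! i = pt_a"
    have i: "i < length ?m - 1" "i < length ?m" using that n(3) by (auto simp: steps_def)
    have "emb0 (?m ! i) = emb0 (Co C1)" using * n(3) i by (simp add: emb0_Co)
    moreover have "?m ! i \<in> nodes_at {C0, C2}" using jp(5) i by auto
    ultimately have c1: "?m ! i = Co C1" using inj_onD[OF emb0_inj] by (simp add: nodes_at_def)
    \<comment> \<open>In local labels \<open>pt_a\<close> would be the corner \<open>C2\<close> of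
      the first walk, which never occurs, or the corner \<open>C1\<close> of the second, which
      occurs only at its end.\<close>
    show False
    proof (cases "i < length n")
      case True
      then have "?m ! i = relabel swap12 (n ! i)" by (simp add: join_walks_def nth_append)
      then have "n ! i = Co C2" using c1 relabel_inj[OF inj_swap(1), of "n ! i" "Co C2"] by (simp add: swap_simps)
      moreover have "n ! i = Co C1 \<or> n ! i \<in> {Co C0} \<union> range Mi \<union> range (Ou C0)"
        using local_walk_props(6)[OF n(1)] local_walk_props(7)[OF n(1), of i] True by (cases "i < length n - 1") (auto simp: not_less le_antisym Suc_leI dest: le_neq_implies_less)
      ultimately show False by auto
    next
      case False
      define k where "k = Suc (i - length n)"
      have lt: "length ?m = length n + (length n' - 1)" by (simp add: join_walks_def)
      have k: "k < length n' - 1" using i False lt by (simp add: k_def)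
      have mi: "?m ! i = relabel swap02 (n' ! k)" using False k by (simp add: join_walks_def nth_append nth_tl k_def)
      have "relabel swap02 (n' ! k) = relabel swap02 (Co C1)" unfolding mi[symmetric] c1 by (simp add: swap_simps)
      then have "n' ! k = Co C1" by (rule iffD1[OF relabel_inj[OF inj_swap(2)]])
      then show False using local_walk_props(7)[OF n(2) k] by auto
    qed
  qed
  ultimately show "w \<in> V (Suc 0)" by (simp add: V_def)
qed

lemma V_mass_join:
  assumes n: "n \<in> local_walks" and n': "n' \<in> local_walks"
  shows "V_mass u (Suc 0) (map emb0 (join_walks n n')) = local_weight u n * local_weight u n'"
proof -
  let ?w = "map emb0 (join_walks n n')"
  note lw = local_walk_props[OF n] and lw' = local_walk_props[OF n']
  have w: "?w = map (emb 0 (0, 0) swap12) n @ tl (map (emb 0 (0, 0) swap02) n')" unfolding emb0_relabel join_walks_def by (simp add: map_tl)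
  have t: "(LEAST j. ?w ! j = pt_b) = length n - 1"
  proof (rule Least_equality)
    show "?w ! (length n - 1) = pt_b" unfolding w using lw(1,6) by (simp add: nth_append emb0_swap)
    fix j assume j: "?w ! j = pt_b"
    show "length n - 1 \<le> j"
    proof (rule ccontr)
      assume "\<not> length n - 1 \<le> j"
      then have jl: "j < length n - 1" "j < length n" by auto
      then have "emb 0 (0, 0) swap12 (n ! j) = emb 0 (0, 0) swap12 (Co C1)" using j unfolding w by (simp add: nth_append emb0_swap)
      then have "n ! j = Co C1" using inj_onD[OF emb_inj[OF frame_swap(1)] _ lw(8)[OF jl(2)]] by (simp add: nodes_at_def)
      then show False using lw(7)[OF jl(1)] by auto
    qed
  qed
  have s1: "segment ?w 0 (length n - 1) = map (emb 0 (0, 0) swap12) n" unfolding w segment_def using lw(1) by simp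
  have "drop (length n - 1) (map (emb 0 (0, 0) swap12) n) = [pt_b]" using Cons_nth_drop_Suc[of "length n - 1" "map (emb 0 (0, 0) swap12) n", symmetric] lw(1,6) by (simp add: emb0_swap)
  moreover have "pt_b # tl (map (emb 0 (0, 0) swap02) n') = map (emb 0 (0, 0) swap02) n'" using lw'(1,3) emb0_swap(3) by (cases n') auto
  ultimately have s2: "segment ?w (length n - 1) (steps ?w) = map (emb 0 (0, 0) swap02) n'" unfolding segment_def steps_def w using lw(1) lw'(1) by (auto simp: Suc_diff_le)
  show ?thesis unfolding V_mass_def t Let_def s1 s2 W_mass.simps using P1_unit_copy[OF n frame_swap(1)] P1_unit_copy[OF n' frame_swap(2)] by simp
qed

subsection \<open>The mean matrix\<close>

definition code_path :: "bool list => path" where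
  "code_path bs = path_of (Suc 0) (refine root_cell bs)"

lemma refine_unit_cell: "refine (unit_cell t) bs = refine root_cell bs" if "bs \<in> codes" using that by (rule codes_cases) (simp_all add: unit_cell_def root_cell_def)

lemma chain_code: "bs \<in> codes ==> chain (Suc 0) (refine root_cell bs)" by (rule refine_props(1)) (simp_all add: root_cell_def)

lemma code_path_table: "(l, bs) \<in> set saw_table ==> code_path bs = map emb0 l" unfolding code_path_def root_cell_def emb0_def by (rule refine_path) simp_all

lemma type_count_code:
  assumes "bs \<in> codes"
  shows "type_count 1 1 (code_path bs) = length (filter Not bs)" "type_count 2 1 (code_path bs) = length (filter id bs)"
proof -
  let ?cs = "refine root_cell bs"
  note ch = chain_code[OF assms]
  have lp: "lattice_path (Suc 0) (code_path bs)" unfolding code_path_def by (rule lattice_path_of[OF ch])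
  have ne: "code_path bs ~= []" using lp by (simp add: lattice_path_def)
  have tc: "type_count r 1 (code_path bs) = length (filter (%C. cell_len C = r) ?cs)" for r using type_count_chain[OF ne ch] Q_lattice_path[OF lp] by (simp add: code_path_def)
  have m: "map (%D. snd (snd D)) ?cs = bs" by (rule refine_props(6)[OF assms, where N = 0]) (simp_all add: root_cell_def)
  have "length (filter Not (map (%D. snd (snd D)) ?cs)) = length (filter (%C. cell_len C = 1) ?cs)" by (simp add: filter_map comp_def cell_len_def)
  then show "type_count 1 1 (code_path bs) = length (filter Not bs)" unfolding tc m by simp
  have "length (filter id (map (%D. snd (snd D)) ?cs)) = length (filter (%C. cell_len C = 2) ?cs)" by (simp add: filter_map comp_def cell_len_def)
  then show "type_count 2 1 (code_path bs) = length (filter id bs)" unfolding tc m by simp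
qed

lemma finite_cells: "finite S ==> finite (cells S N)"
proof (induction N)
  case (Suc N)
  have "cells S (Suc N) \<subseteq> (%(c, i). c + c + delta i) ` (cells S N \<times> {C0, C1, C2})"
  proof
    fix d assume "d \<in> cells S (Suc N)"
    then obtain c i where ci: "c \<in> cells S N" "d = c + c + delta i" unfolding cells_Suc by blast
    have "(c, i) \<in> cells S N \<times> {C0, C1, C2}" using ci(1) by (cases i) simp_all
    then show "d \<in> (%(c, i). c + c + delta i) ` (cells S N \<times> {C0, C1, C2})" using ci(2) by (intro image_eqI[where x = "(c, i)"]) simp_all
  qed
  then show ?case by (rule finite_subset) (simp add: Suc.IH[OF Suc.prems])
qed simp

lemma finite_GV: "finite (GV N)"
proof -
  have "GV N \<subseteq> (%(c, i). pt N (c + delta i)) ` (cells three_cells N \<times> {C0, C1, C2})"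
  proof
    fix x assume "x \<in> GV N"
    then obtain c i where ci: "c \<in> cells three_cells N" "x = pt N (c + delta i)" unfolding GV_eq vertices_of_def by blast
    have "(c, i) \<in> cells three_cells N \<times> {C0, C1, C2}" using ci(1) by (cases i) simp_all
    then show "x \<in> (%(c, i). pt N (c + delta i)) ` (cells three_cells N \<times> {C0, C1, C2})" using ci(2) by (intro image_eqI[where x = "(c, i)"]) simp_all
  qed
  then show ?thesis by (rule finite_subset) (simp add: finite_cells)
qed

text \<open>A path without repetitions in a finite graph is no longer than the number of
  vertices.\<close>

lemma finite_Gamma: "finite (Gamma N)"
proof (cases "N = 0")
  case False
  have sub: "set w \<subseteq> insert 0 (GV N)" if w: "w \<in> W N \<union> V N" for w
  proof
    fix x assume "x \<in> set w"
    then obtain i where i: "i < length w" "x = w ! i" by (auto simp: in_set_conv_nth)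
    have p: "w ~= []" "hd w = 0" "!!i. Suc i < length w ==> {w ! i, w ! Suc i} \<in> EV N" using w E_EV[of N] by (auto simp: W_def V_def nn_path_def successively_nth)
    show "x \<in> insert 0 (GV N)"
    proof (cases i)
      case 0
      then show ?thesis using i p by (simp add: hd_conv_nth)
    next
      case (Suc j)
      then show ?thesis using p(3)[of j] i edge_vertices unfolding EV_eq GV_eq by blast
    qed
  qed
  have "Gamma N \<subseteq> {w. set w \<subseteq> insert 0 (GV N) \<and> length w \<le> card (insert 0 (GV N))}"
  proof
    fix w assume "w \<in> Gamma N"
    then have w: "w \<in> W N \<union> V N" "distinct w" using False by (auto simp: Gamma_def)
    have "card (set w) \<le> card (insert 0 (GV N))" by (rule card_mono) (use finite_GV sub[OF w(1)] in auto)
    then show "w \<in> {w. set w \<subseteq> insert 0 (GV N) \<and> length w \<le> card (insert 0 (GV N))}" using sub[OF w(1)] distinct_card[OF w(2)] by simp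
  qed
  moreover have "finite {w. set w \<subseteq> insert 0 (GV N) \<and> length w \<le> card (insert 0 (GV N))}" by (rule finite_lists_length_le) (simp add: finite_GV)
  ultimately show ?thesis by (rule finite_subset)
qed (simp add: Gamma_def)

lemma local_walkI:
  assumes "successively adj n" "n ~= []" "hd n = Co C0" "last n = Co C1" "set (butlast n) \<subseteq> {Co C0} \<union> range Mi \<union> range (Ou C0)"
  shows "n \<in> local_walks"
proof -
  have "n ! i \<in> set (butlast n)" if "i < length n - 1" for i using that by (metis nth_butlast length_butlast nth_mem)
  then show ?thesis using assms unfolding local_walks_def by blast
qed

text \<open>Used to place all coded paths in \<open>Gamma 1\<close>, so that the sums over
  \<open>Gamma 1\<close> in \<open>Phihat\<close> and \<open>Thetahat\<close> capture the whole
  mass.\<close>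

lemma table_walks: "(l, bs) \<in> set saw_table ==> distinct l \<and> set l \<subseteq> nodes_at {C0, C2} \<and>
    (l \<in> local_walks \<or> (\<exists>n\<in>local_walks. \<exists>n'\<in>local_walks. l = join_walks n n'))"
proof -
  assume t: "(l, bs) \<in> set saw_table"
  have j: "[Co C0, Mi C2, Co C1] \<in> local_walks" "[Co C0, Mi C1, Mi C2, Co C1] \<in> local_walks" "[Co C0, Mi C2, Mi C0, Co C1] \<in> local_walks"
    "[Co C0, Mi C1, Mi C2, Mi C0, Co C1] \<in> local_walks" "[Co C0, Mi C1, Mi C0, Co C1] \<in> local_walks"
    "[Co C0, Mi C1, Mi C0, Mi C2, Co C1] \<in> local_walks" "[Co C0, Mi C2, Mi C1, Mi C0, Co C1] \<in> local_walks" by (rule local_walkI; simp)+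
  have q: "[Co C0, Mi C1, Co C2, Mi C0, Co C1] = join_walks [Co C0, Mi C2, Co C1] [Co C0, Mi C2, Co C1]"
    "[Co C0, Mi C1, Co C2, Mi C0, Mi C2, Co C1] = join_walks [Co C0, Mi C2, Co C1] [Co C0, Mi C2, Mi C0, Co C1]"
    "[Co C0, Mi C2, Mi C1, Co C2, Mi C0, Co C1] = join_walks [Co C0, Mi C1, Mi C2, Co C1] [Co C0, Mi C2, Co C1]" by (simp_all add: join_walks_def swap_simps)
  have "l \<in> local_walks \<or> (\<exists>n\<in>local_walks. \<exists>n'\<in>local_walks. l = join_walks n n')" using t unfolding saw_table_def list.set insert_iff empty_iff prod.inject
    by (elim disjE conjE FalseE; hypsubst; use j q in blast)
  moreover have "distinct l" using t unfolding saw_table_def by auto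
  moreover have "set l \<subseteq> nodes_at {C0, C2}" using t unfolding saw_table_def by (auto simp: nodes_at_def)
  ultimately show ?thesis by blast
qed

lemma code_path_Gamma: "bs \<in> codes ==> code_path bs \<in> Gamma 1"
proof -
  assume "bs \<in> codes"
  then obtain l where l: "(l, bs) \<in> set saw_table" by (auto simp: codes_def)
  note tw = table_walks[OF l]
  have d: "distinct (map emb0 l)" using tw emb0_inj by (auto simp: distinct_map intro: inj_on_subset)
  have "map emb0 l \<in> W 1 \<union> V 1" using tw unfolding W_1_eq V_1_eq[folded One_nat_def] by (auto simp: image_iff)
  then show ?thesis using d code_path_table[OF l] by (simp add: Gamma_def)
qed

lemma set_code_pmf:
  assumes "total_mass_one u"
  shows "set_pmf (code_pmf u t) \<subseteq> codes" using cell_code_codes set_replicate_walks(1,2)[OF assms] unfolding code_pmf_def by fastforce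

lemma W_law_code:
  assumes t: "total_mass_one u"
  shows "measure (W_law u 1) {w \<in> W 1. loop_erase 1 w = \<gamma>} = pmf (map_pmf code_path (code_pmf u False)) \<gamma>"
proof -
  have "map_pmf (loop_erase 1) (W_pmf u 1) = map_pmf code_path (code_pmf u False)"
  proof -
    have "map_pmf (loop_erase 1) (W_pmf u 1) = map_pmf (%ns. loop_erase 1 (assemble 0 [0, pt_a] ns)) (replicate_pmf 1 (walk_pmf u))" by (simp add: bind_return_pmf map_pmf_comp steps_def)
    also have "... = map_pmf (%ns. code_path (cell_code False ns)) (replicate_pmf 1 (walk_pmf u))"
    proof (rule map_pmf_cong[OF refl])
      fix ns assume "ns \<in> set_pmf (replicate_pmf 1 (walk_pmf u))"
      note sr = set_replicate_walks[OF t this]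
      obtain n where n: "ns = [n]" using sr(2) by (auto simp: length_Suc_conv)
      have "assemble 0 [0, pt_a] ns = map emb0 (cell_walk False ns)" unfolding assemble_def embed_pieces_def n by (simp add: edge_emb0 cell_walk_def)
      then show "loop_erase 1 (assemble 0 [0, pt_a] ns) = code_path (cell_code False ns)" using unit_loop_erase(1)[of ns False] sr(1,2) refine_unit_cell cell_code_codes[of ns False] by (simp add: code_path_def)
    qed
    finally show ?thesis unfolding code_pmf_def by (simp add: map_pmf_comp)
  qed
  then have "pmf (map_pmf code_path (code_pmf u False)) \<gamma> = measure (W_pmf u 1) (loop_erase 1 -` {\<gamma>})" by (metis pmf_map)
  also have "... = measure (W_pmf u 1) {w. loop_erase 1 w = \<gamma>}" by (simp add: vimage_def)
  also have "... = measure (W_law u 1) {w \<in> W 1. loop_erase 1 w = \<gamma>}" unfolding measure_def W_law_pmf[OF t] ..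
  finally show ?thesis ..
qed

text \<open>Paths of \<open>V 1\<close> correspond to pairs of local walks with product weights, so
  the mass becomes that of an independent pair.\<close>

lemma V_law_code:
  assumes t: "total_mass_one u" and u: "0 \<le> u"
  shows "measure (V_law u 1) {w \<in> V 1. loop_erase 1 w = \<gamma>} = pmf (map_pmf code_path (code_pmf u True)) \<gamma>"
proof -
  let ?j = "%(n, n'). map emb0 (join_walks n n')"
  let ?L = "local_walks \<times> local_walks"
  let ?p = "pair_pmf (walk_pmf u) (walk_pmf u)"
  let ?c = "%(n, n'). code_path (cell_code True [n, n'])"
  have V1: "V 1 = ?j ` ?L" using V_1_eq by simp
  have ij: "inj_on ?j ?L"
  proof (rule inj_onI, clarify)
    fix n n' m m' assume *: "n \<in> local_walks" "n' \<in> local_walks" "m \<in> local_walks" "m' \<in> local_walks"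
      "map emb0 (join_walks n n') = map emb0 (join_walks m m')"
    have "set (join_walks n n') \<union> set (join_walks m m') \<subseteq> nodes_at {C0, C2}" using join_walks_props(5)[OF *(1,2)] join_walks_props(5)[OF *(3,4)] by simp
    then have "join_walks n n' = join_walks m m'" using map_inj_on[OF *(5) inj_on_subset[OF emb0_inj]] by blast
    then show "n = m \<and> n' = m'" by (rule join_walks_inj[OF *(1-4)])
  qed
  have le: "loop_erase 1 (?j p) = ?c p" if pL: "p \<in> ?L" for p
  proof -
    obtain n n' where p: "p = (n, n')" "n \<in> local_walks" "n' \<in> local_walks" using pL by (rule SigmaE)
    have ns: "set [n, n'] \<subseteq> local_walks" "length [n, n'] = (if True then 2 else 1)" using p by auto
    have "cell_walk True [n, n'] = join_walks n n'" by (simp add: cell_walk_def)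
    then show ?thesis using unit_loop_erase(1)[OF ns] refine_unit_cell[OF cell_code_codes[OF ns]] p(1) by (simp add: code_path_def)
  qed
  \<comment> \<open>With \<open>x_fix u\<close> positive and \<open>u\<close> nonnegative the
    truncation in \<open>walk_pmf\<close> has no effect.\<close>
  have xp: "0 < x_fix u" by (rule x_fix_pos[OF t])
  have lw: "pmf (walk_pmf u) n = local_weight u n" if "n \<in> local_walks" for n using that xp u by (simp add: pmf_walk_pmf[OF t] local_weight_def)
  have mass: "ennreal (V_mass u 1 (?j p)) = ennreal (pmf ?p p)" if "p \<in> ?L" for p using that V_mass_join[of "fst p" "snd p" u] lw by (cases p) (simp add: pmf_pair)
  have sp: "set_pmf ?p \<subseteq> ?L" using set_walk_pmf[OF t] by auto
  have "emeasure (V_law u 1) {w \<in> V 1. loop_erase 1 w = \<gamma>} =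
      (\<integral>\<^sup>+ w. ennreal (V_mass u 1 w) * indicator {w \<in> V 1. loop_erase 1 w = \<gamma>} w \<partial>count_space (V 1))" unfolding V_law_def point_measure_def by (rule emeasure_density) auto
  also have "... = (\<integral>\<^sup>+ p. ennreal (V_mass u 1 (?j p)) * indicator {w \<in> V 1. loop_erase 1 w = \<gamma>} (?j p) \<partial>count_space ?L)"
    by (rule nn_integral_bij_count_space[symmetric]) (unfold bij_betw_def V1, rule conjI[OF ij refl])
  also have "... = (\<integral>\<^sup>+ p. ennreal (pmf ?p p) * indicator {p. ?c p = \<gamma>} p \<partial>count_space ?L)"
  proof (rule nn_integral_cong)
    fix p assume "p \<in> space (count_space ?L)"
    then have p: "p \<in> ?L" by simp
    then have "?j p \<in> V 1" unfolding V1 by (rule imageI)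
    then have "indicator {w \<in> V 1. loop_erase 1 w = \<gamma>} (?j p) = (indicator {p. ?c p = \<gamma>} p :: ennreal)" using le[OF p] unfolding indicator_def by simp
    then show "ennreal (V_mass u 1 (?j p)) * indicator {w \<in> V 1. loop_erase 1 w = \<gamma>} (?j p) =
        ennreal (pmf ?p p) * indicator {p. ?c p = \<gamma>} p" using mass[OF p] by simp
  qed
  also have "... = (\<integral>\<^sup>+ p. ennreal (pmf ?p p) \<partial>count_space (?L \<inter> {p. ?c p = \<gamma>}))"
  proof -
    have ind: "(\<integral>\<^sup>+ w. f w \<partial>count_space X) = (\<integral>\<^sup>+ w. f w * indicator X w \<partial>count_space UNIV)"
      for X :: "(node list \<times> node list) set" and f by (rule nn_integral_count_space_indicator) simp
    show ?thesis unfolding ind[where X = ?L] ind[where X = "?L \<inter> {p. ?c p = \<gamma>}"] by (rule nn_integral_cong) (auto simp: indicator_def)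
  qed
  also have "... = emeasure ?p (?L \<inter> {p. ?c p = \<gamma>})" by (rule nn_integral_pmf)
  also have "... = emeasure ?p (?c -` {\<gamma>})" using sp by (intro emeasure_eq_AE) (auto simp: AE_measure_pmf_iff)
  finally have "measure (V_law u 1) {w \<in> V 1. loop_erase 1 w = \<gamma>} = measure ?p (?c -` {\<gamma>})" unfolding measure_def by simp
  also have "... = pmf (map_pmf ?c ?p) \<gamma>" by (simp add: pmf_map)
  also have "map_pmf ?c ?p = map_pmf code_path (code_pmf u True)" unfolding code_pmf_def pair_pmf_def by (simp add: map_pmf_def bind_assoc_pmf bind_return_pmf numeral_2_eq_2)
  finally show ?thesis .
qed

definition mean :: "real => bool => bool => real" where
  "mean u t r = measure_pmf.expectation (code_pmf u t) (%bs. real (length (filter (%s. s = r) bs)))"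

lemma finite_codes: "finite codes" by (simp add: codes_def)

lemma code_integrable: "total_mass_one u ==> integrable (code_pmf u t) (f :: bool list => real)" by (rule integrable_measure_pmf_finite) (rule finite_subset[OF set_code_pmf finite_codes])

lemma sum_Gamma_code:
  assumes t: "total_mass_one u"
  shows "(\<Sum>\<gamma>\<in>Gamma 1. pmf (map_pmf code_path (code_pmf u t)) \<gamma> * f \<gamma>) = measure_pmf.expectation (code_pmf u t) (%bs. f (code_path bs))"
proof -
  have "set_pmf (map_pmf code_path (code_pmf u t)) \<subseteq> Gamma 1" using set_code_pmf[OF t] code_path_Gamma by auto
  then have "measure_pmf.expectation (map_pmf code_path (code_pmf u t)) f = (\<Sum>\<gamma>\<in>Gamma 1. f \<gamma> * pmf (map_pmf code_path (code_pmf u t)) \<gamma>)" by (intro integral_measure_pmf_real finite_Gamma) auto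
  then show ?thesis by (simp add: mult.commute)
qed

lemma deriv_monomials:
  fixes p :: "'a => real"
  assumes "finite A"
  shows "deriv (%x. \<Sum>\<gamma>\<in>A. p \<gamma> * x ^ m \<gamma> * 1 ^ k \<gamma>) 1 = (\<Sum>\<gamma>\<in>A. p \<gamma> * real (m \<gamma>))"
    "deriv (%y. \<Sum>\<gamma>\<in>A. p \<gamma> * 1 ^ m \<gamma> * y ^ k \<gamma>) 1 = (\<Sum>\<gamma>\<in>A. p \<gamma> * real (k \<gamma>))" by (intro DERIV_imp_deriv; auto intro!: derivative_eq_intros sum.cong)+

lemma expectation_type_count:
  assumes t: "total_mass_one u"
  shows "measure_pmf.expectation (code_pmf u t) (%bs. real (type_count 1 1 (code_path bs))) = mean u t False"
    "measure_pmf.expectation (code_pmf u t) (%bs. real (type_count 2 1 (code_path bs))) = mean u t True"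
proof -
  have "AE bs in code_pmf u t. real (type_count 1 1 (code_path bs)) = real (length (filter (%s. s = False) bs))"
    "AE bs in code_pmf u t. real (type_count 2 1 (code_path bs)) = real (length (filter (%s. s = True) bs))"
    using set_code_pmf[OF t] type_count_code by (auto simp: AE_measure_pmf_iff id_def Not_eq_iff fun_eq_iff intro!: arg_cong[of _ _ length] filter_cong)
  then show "measure_pmf.expectation (code_pmf u t) (%bs. real (type_count 1 1 (code_path bs))) = mean u t False"
    "measure_pmf.expectation (code_pmf u t) (%bs. real (type_count 2 1 (code_path bs))) = mean u t True" unfolding mean_def by (auto intro: integral_cong_AE)
qed

lemma mean_matrix_eq:
  assumes t: "total_mass_one u" and u: "0 \<le> u"
  shows "mean_matrix u = vector [vector [mean u False False, mean u False True], vector [mean u True False, mean u True True]]"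
proof -
  have P: "Phihat u = (%x y. \<Sum>\<gamma>\<in>Gamma 1. pmf (map_pmf code_path (code_pmf u False)) \<gamma> * x ^ type_count 1 1 \<gamma> * y ^ type_count 2 1 \<gamma>)" unfolding Phihat_def W_law_code[OF t] ..
  have T: "Thetahat u = (%x y. \<Sum>\<gamma>\<in>Gamma 1. pmf (map_pmf code_path (code_pmf u True)) \<gamma> * x ^ type_count 1 1 \<gamma> * y ^ type_count 2 1 \<gamma>)" unfolding Thetahat_def V_law_code[OF t u] ..
  show ?thesis unfolding mean_matrix_def P T deriv_monomials[OF finite_Gamma] sum_Gamma_code[OF t] expectation_type_count[OF t] ..
qed

lemma expectation_mono_code:
  fixes f g :: "bool list => real"
  assumes t: "total_mass_one u" and "!!bs. bs \<in> codes ==> f bs \<le> g bs"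
  shows "measure_pmf.expectation (code_pmf u r) f \<le> measure_pmf.expectation (code_pmf u r) g" by (rule integral_mono_AE[OF code_integrable[OF t] code_integrable[OF t]])
     (use assms(2) set_code_pmf[OF t] in \<open>auto simp: AE_measure_pmf_iff\<close>)

lemma code_counts:
  assumes "bs \<in> codes"
  shows "2 \<le> length (filter (%s. s = False) bs) + length (filter (%s. s = True) bs)"
    "length (filter (%s. s = True) bs) \<le> 2" "length bs \<le> 3" "2 \<le> length bs" using assms unfolding codes_def saw_table_def by auto

text \<open>Both codes arise from straight walks, whose weight \<open>x_fix u\<close> is positive
  for every \<open>u\<close>, including 0.\<close>

lemma pmf_code_pos:
  assumes t: "total_mass_one u"
  shows "0 < pmf (code_pmf u False) [False, False]" "0 < pmf (code_pmf u True) [False, True, False]"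
proof -
  have s: "straight_walk \<in> set_pmf (walk_pmf u)" using set_walk_pmf[OF t] straight_walk x_fix_pos[OF t] by simp
  have "cell_code False [straight_walk] = [False, False]" by (simp add: cell_code_def cell_walk_def straight_walk_def code_of_def saw_table_def)
  moreover have "[straight_walk] \<in> set_pmf (replicate_pmf 1 (walk_pmf u))" using s by (simp add: set_replicate_pmf)
  ultimately have "[False, False] \<in> set_pmf (code_pmf u False)" unfolding code_pmf_def by (force simp: image_iff)
  then show "0 < pmf (code_pmf u False) [False, False]" by (simp add: pmf_positive_iff)
  have "cell_code True [straight_walk, straight_walk] = [False, True, False]" by (simp add: cell_code_def cell_walk_def straight_walk_def join_walks_def swap_simps code_of_def saw_table_def)
  moreover have "[straight_walk, straight_walk] \<in> set_pmf (replicate_pmf 2 (walk_pmf u))" using s by (simp add: set_replicate_pmf)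
  ultimately have "[False, True, False] \<in> set_pmf (code_pmf u True)" unfolding code_pmf_def by (force simp: image_iff)
  then show "0 < pmf (code_pmf u True) [False, True, False]" by (simp add: pmf_positive_iff)
qed

lemma expectation_indicator:
  "measure_pmf.expectation p (%x. c * indicator {y} x) = c * pmf p y" for c :: real by (simp add: measure_pmf_single)

text \<open>Every cell has at least two subcells, and at most two of them are of Type 2. The codes
  of the straight walks make the remaining inequalities strict.\<close>

lemma mean_bounds:
  assumes t: "total_mass_one u"
  shows "2 \<le> mean u r False + mean u r True" "0 \<le> mean u r s" "0 < mean u False False" "0 < mean u True False" "mean u True True < 2"
proof -
  note I = code_integrable[OF t]
  have "mean u r False + mean u r True = measure_pmf.expectation (code_pmf u r)
     (%bs. real (length (filter (%s. s = False) bs)) + real (length (filter (%s. s = True) bs)))" unfolding mean_def by (rule Bochner_Integration.integral_add[OF I I, symmetric])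
  also have "... \<ge> measure_pmf.expectation (code_pmf u r) (%bs. 2)" by (rule expectation_mono_code[OF t]) (use code_counts(1) in fastforce)
  finally show "2 \<le> mean u r False + mean u r True" by simp
  show "0 \<le> mean u r s" unfolding mean_def by (rule integral_nonneg_AE) simp
  have "measure_pmf.expectation (code_pmf u False) (%bs. 1 * indicator {[False, False]} bs) \<le> mean u False False" unfolding mean_def by (rule expectation_mono_code[OF t]) (auto simp: indicator_def)
  then show "0 < mean u False False" unfolding expectation_indicator using pmf_code_pos(1)[OF t] by simp
  have "measure_pmf.expectation (code_pmf u True) (%bs. 1 * indicator {[False, True, False]} bs) \<le> mean u True False" unfolding mean_def by (rule expectation_mono_code[OF t]) (auto simp: indicator_def)
  then show "0 < mean u True False" unfolding expectation_indicator using pmf_code_pos(2)[OF t] by simp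
  have "mean u True True \<le> measure_pmf.expectation (code_pmf u True) (%bs. 2 - 1 * indicator {[False, True, False]} bs)"
    unfolding mean_def by (rule expectation_mono_code[OF t]) (use code_counts(2) in \<open>auto simp: indicator_def\<close>)
  also have "... = 2 - pmf (code_pmf u True) [False, True, False]" by (subst Bochner_Integration.integral_diff[OF I I]) (simp add: measure_pmf_single)
  finally show "mean u True True < 2" using pmf_code_pos(2)[OF t] by simp
qed

text \<open>For each root \<mu> of the characteristic polynomial, (\<mu> - d, c) is an eigenvector,
  and it is nonzero because c > 0.\<close>

lemma eigenvalues_2:
  fixes a b c d :: real
  assumes c: "0 < c" and disc: "0 < (a - d)\<^sup>2 + 4 * b * c"
  defines "r \<equiv> sqrt ((a - d)\<^sup>2 + 4 * b * c)"
  shows "{\<mu>. \<exists>v. v ~= 0 \<and> (vector [vector [a, b], vector [c, d]] :: real^2^2) *v v = \<mu> *\<^sub>R v} =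
    {(a + d + r) / 2, (a + d - r) / 2}"
proof -
  let ?M = "vector [vector [a, b], vector [c, d]] :: real^2^2"
  have r2: "r * r = (a - d) * (a - d) + 4 * b * c" using disc unfolding r_def by (simp add: power2_eq_square)
  have mv: "?M *v v = \<mu> *\<^sub>R v \<longleftrightarrow> a * v $ 1 + b * v $ 2 = \<mu> * v $ 1 \<and> c * v $ 1 + d * v $ 2 = \<mu> * v $ 2" for v :: "real^2" and \<mu>
    by (simp add: vec_eq_iff forall_2 matrix_vector_mult_def sum_2)
  have root: "(\<mu> - a) * (\<mu> - d) = b * c \<longleftrightarrow> \<mu> = (a + d + r) / 2 \<or> \<mu> = (a + d - r) / 2" for \<mu>
  proof -
    have "(\<mu> - a) * (\<mu> - d) - b * c = (\<mu> - (a + d + r) / 2) * (\<mu> - (a + d - r) / 2)" using r2 by (simp add: field_simps)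
    then have "(\<mu> - a) * (\<mu> - d) = b * c \<longleftrightarrow> (\<mu> - (a + d + r) / 2) * (\<mu> - (a + d - r) / 2) = 0" by linarith
    then show ?thesis by (simp only: mult_eq_0_iff right_minus_eq)
  qed
  have "(\<exists>v. v ~= 0 \<and> ?M *v v = \<mu> *\<^sub>R v) \<longleftrightarrow> (\<mu> - a) * (\<mu> - d) = b * c" for \<mu>
  proof
    assume "\<exists>v. v ~= 0 \<and> ?M *v v = \<mu> *\<^sub>R v"
    then obtain v where v0: "v ~= 0" "?M *v v = \<mu> *\<^sub>R v" by (elim exE conjE)
    note v = v0(1) conjunct1[OF iffD1[OF mv v0(2)]] conjunct2[OF iffD1[OF mv v0(2)]]
    have e: "(\<mu> - a) * v $ 1 = b * v $ 2" "c * v $ 1 = (\<mu> - d) * v $ 2" using v by (simp_all add: algebra_simps)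
    have v2: "v $ 2 ~= 0"
    proof
      assume "v $ 2 = 0"
      then have "v $ 1 = 0" using e(2) c by simp
      then show False using v(1) \<open>v $ 2 = 0\<close> by (simp add: vec_eq_iff forall_2)
    qed
    have "(\<mu> - a) * (\<mu> - d) * v $ 2 = (\<mu> - a) * (c * v $ 1)" using e(2) by simp
    also have "... = c * ((\<mu> - a) * v $ 1)" by simp
    also have "... = b * c * v $ 2" unfolding e(1) by simp
    finally show "(\<mu> - a) * (\<mu> - d) = b * c" using v2 by simp
  next
    assume p: "(\<mu> - a) * (\<mu> - d) = b * c"
    let ?v = "vector [\<mu> - d, c] :: real^2"
    have "?v ~= 0" using c by (auto simp: vec_eq_iff forall_2)
    moreover have "?M *v ?v = \<mu> *\<^sub>R ?v" unfolding mv using p by (simp add: algebra_simps)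
    ultimately show "\<exists>v. v ~= 0 \<and> ?M *v v = \<mu> *\<^sub>R v" by (intro exI conjI)
  qed
  then show ?thesis using root by auto
qed

text \<open>The eigenvector for \<open>lam u\<close> has positive entries, and it spans together with that for the smaller
  eigenvalue; hence the number of steps is a combination of two functionals with geometric mean growth.\<close>

lemma growth:
  assumes t: "total_mass_one u" and u: "0 \<le> u"
  obtains \<theta> h g \<alpha> \<beta> where "2 \<le> lam u" "\<bar>\<theta>\<bar> < lam u" "!!s. 0 < h s"
    "!!r. measure_pmf.expectation (code_pmf u r) (%bs. sum_list (map h bs)) = lam u * h r"
    "!!r. measure_pmf.expectation (code_pmf u r) (%bs. sum_list (map g bs)) = \<theta> * g r"
    "!!s. (if s then 2 else 1) = \<alpha> * h s + \<beta> * g s"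
proof -
  define a where "a = mean u False False"
  define b where "b = mean u False True"
  define c where "c = mean u True False"
  define d where "d = mean u True True"
  note mb = mean_bounds[OF t]
  have ab: "2 \<le> a + b" "2 \<le> c + d" "0 < a" "0 \<le> b" "0 < c" "0 \<le> d" "d < 2" using mb unfolding a_def b_def c_def d_def by blast+
  \<comment> \<open>If \<open>b\<close> vanishes, then a \<ge> 2 > d keeps the eigenvalues
    apart.\<close>
  have disc: "0 < (a - d)\<^sup>2 + 4 * b * c"
  proof (cases "b = 0")
    case True
    then show ?thesis using ab by simp
  next
    case False
    then have "0 < 4 * b * c" using ab by simp
    then show ?thesis by (simp add: add_nonneg_pos)
  qed
  define r where "r = sqrt ((a - d)\<^sup>2 + 4 * b * c)"
  have r: "0 < r" "r * r = (a - d) * (a - d) + 4 * b * c" using disc by (auto simp: r_def power2_eq_square)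
  define \<theta> where "\<theta> = (a + d - r) / 2"
  have lam: "lam u = (a + d + r) / 2"
  proof -
    have "{\<mu>. \<exists>v. v ~= 0 \<and> mean_matrix u *v v = \<mu> *\<^sub>R v} = {(a + d + r) / 2, (a + d - r) / 2}" unfolding mean_matrix_eq[OF t u] a_def[symmetric] b_def[symmetric] c_def[symmetric] d_def[symmetric] r_def
      by (rule eigenvalues_2[OF ab(5) disc])
    then show ?thesis unfolding lam_def using r(1) by (simp add: max_def)
  qed
  have root: "(\<mu> - a) * (\<mu> - d) = b * c" if "\<mu> = lam u \<or> \<mu> = \<theta>" for \<mu>
  proof -
    have "(\<mu> - a) * (\<mu> - d) - b * c = (\<mu> - lam u) * (\<mu> - \<theta>)" unfolding lam \<theta>_def using r(2) by (simp add: field_simps)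
    then show ?thesis using that by auto
  qed
  have l2: "2 \<le> lam u"
  proof (rule ccontr)
    assume *: "\<not> 2 \<le> lam u"
    have "\<theta> < lam u" using r(1) by (simp add: lam \<theta>_def)
    then have pos: "0 < (2 - lam u) * (2 - \<theta>)" using * by (intro mult_pos_pos) auto
    have "(2 - a) * (2 - d) - b * c = (2 - lam u) * (2 - \<theta>)" unfolding lam \<theta>_def using r(2) by (simp add: field_simps)
    \<comment> \<open>The row sums are at least 2, so the characteristic polynomial is not positive
      at 2. It would be if both roots were below 2.\<close>
    moreover have "(2 - a) * (2 - d) \<le> b * c"
    proof (cases "2 \<le> a")
      case True
      then have "(2 - a) * (2 - d) \<le> 0" using ab(7) by (intro mult_nonpos_nonneg) auto
      then show ?thesis using ab by (meson mult_nonneg_nonneg less_imp_le order_trans)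
    next
      case False
      then show ?thesis using ab by (intro mult_mono) auto
    qed
    ultimately show False using pos by simp
  qed
  \<comment> \<open>Beyond the gap \<open>r\<close>, this uses that the trace is positive.\<close>
  have th: "\<bar>\<theta>\<bar> < lam u" using r(1) ab(3,6) unfolding lam \<theta>_def by (auto simp: abs_less_iff)
  have ml: "measure_pmf.expectation (code_pmf u s) (%bs. sum_list (map f bs)) = mean u s False * f False + mean u s True * f True" for s and f :: "bool => real"
  proof -
    have "sum_list (map f bs) = real (length (filter (%s. s = False) bs)) * f False + real (length (filter (%s. s = True) bs)) * f True" for bs by (induction bs) (auto simp: algebra_simps)
    then show ?thesis unfolding mean_def by (simp add: Bochner_Integration.integral_add[OF code_integrable[OF t] code_integrable[OF t]])
  qed
  define ev where "ev = (%\<mu> s. if s then c else \<mu> - d)"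
  have ev: "measure_pmf.expectation (code_pmf u s) (%bs. sum_list (map (ev \<mu>) bs)) = \<mu> * ev \<mu> s" if "\<mu> = lam u \<or> \<mu> = \<theta>" for s \<mu>
  proof -
    have "a * (\<mu> - d) + b * c = \<mu> * (\<mu> - d)" "c * (\<mu> - d) + d * c = \<mu> * c" using root[OF that] by (simp_all add: algebra_simps)
    then show ?thesis unfolding ml ev_def a_def b_def c_def d_def by (cases s) simp_all
  qed
  have ne: "lam u - \<theta> ~= 0" using r(1) by (simp add: lam \<theta>_def)
  \<comment> \<open>Both eigenvectors have second entry \<open>c\<close>, so every \<open>k\<close>
    yields the value 2 for Type 2; the value 1 for Type 1 then determines \<open>k\<close>.\<close>
  define k where "k = (2 * (lam u - d) - c) / (c * (lam u - \<theta>))"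
  have comb: "(if s then 2 else 1) = (2 / c - k) * ev (lam u) s + k * ev \<theta> s" for s
  proof (cases s)
    case True
    then show ?thesis using ab(5) by (simp add: ev_def field_simps)
  next
    case False
    have "(2 / c - k) * (lam u - d) + k * (\<theta> - d) = 2 * (lam u - d) / c - k * (lam u - \<theta>)" by (simp add: algebra_simps)
    also have "k * (lam u - \<theta>) = (2 * (lam u - d) - c) / c" using ne ab(5) by (simp add: k_def)
    also have "2 * (lam u - d) / c - (2 * (lam u - d) - c) / c = 1" using ab(5) by (simp add: field_simps)
    finally show ?thesis using False by (simp add: ev_def)
  qed
  have pos: "0 < ev (lam u) s" for s using ab(5,7) l2 by (simp add: ev_def)
  show ?thesis by (rule that[of \<theta> "ev (lam u)" "ev \<theta>" "2 / c - k" k]) (use l2 th pos ev comb in auto)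
qed


section \<open>Two-type branching processes\<close>

primrec brood :: "('t => 't list pmf) => 't list => 't list pmf" where
  "brood \<kappa> [] = return_pmf []"
| "brood \<kappa> (t # z) = bind_pmf (\<kappa> t) (%bs. map_pmf ((@) bs) (brood \<kappa> z))"

lemma expectation_bind_finite:
  fixes f :: "'b => real"
  assumes "finite (set_pmf p)" "!!x. x \<in> set_pmf p ==> finite (set_pmf (q x))"
  shows "measure_pmf.expectation (bind_pmf p q) f = measure_pmf.expectation p (%x. measure_pmf.expectation (q x) f)"
proof -
  have "measure_pmf.expectation (bind_pmf p q) f = (\<Sum>a\<in>set_pmf p. pmf p a *\<^sub>R measure_pmf.expectation (q a) f)" by (rule pmf_expectation_bind) (use assms in auto)
  also have "... = measure_pmf.expectation p (%x. measure_pmf.expectation (q x) f)" using integral_measure_pmf_real[of "set_pmf p" p "%x. measure_pmf.expectation (q x) f"] assms(1) by (simp add: mult.commute)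
  finally show ?thesis .
qed

lemma expectation_mono_pmf:
  fixes f g :: "'a => real"
  assumes "finite (set_pmf p)" "!!x. x \<in> set_pmf p ==> f x \<le> g x"
  shows "measure_pmf.expectation p f \<le> measure_pmf.expectation p g" by (rule integral_mono_AE) (use assms in \<open>auto simp: AE_measure_pmf_iff integrable_measure_pmf_finite\<close>)

locale offspring =
  fixes \<kappa> :: "'t::finite => 't list pmf"
  assumes finite_kappa: "finite (set_pmf (\<kappa> t))"
begin

abbreviation "\<E> p \<equiv> measure_pmf.expectation p"

lemma finite_brood: "finite (set_pmf (brood \<kappa> z))" by (induction z) (simp_all add: finite_kappa)

lemma int_k: "integrable (\<kappa> t) (f :: 't list => real)" by (rule integrable_measure_pmf_finite[OF finite_kappa])

lemma int_b: "integrable (brood \<kappa> z) (f :: 't list => real)" by (rule integrable_measure_pmf_finite[OF finite_brood])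

lemma expectation_brood_Cons:
  fixes f :: "'t list => real"
  shows "\<E> (brood \<kappa> (t # z)) f = \<E> (\<kappa> t) (%bs. \<E> (brood \<kappa> z) (%y. f (bs @ y)))" by (simp add: expectation_bind_finite finite_kappa finite_brood)

lemma expectation_brood_sum:
  fixes g :: "'t => real"
  assumes "!!t. \<E> (\<kappa> t) (%bs. sum_list (map g bs)) = \<theta> * g t"
  shows "\<E> (brood \<kappa> z) (%y. sum_list (map g y)) = \<theta> * sum_list (map g z)"
proof (induction z)
  case (Cons t z)
  then show ?case unfolding expectation_brood_Cons by (simp add: Bochner_Integration.integral_add int_k int_b assms measure_pmf.prob_space algebra_simps)
qed simp

text \<open>Litters are independent and centred after subtracting their means, so the mixed term
  vanishes and variances add up.\<close>

lemma variance_brood: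
  fixes g :: "'t => real" and K :: real
  assumes m: "!!t. \<E> (\<kappa> t) (%bs. sum_list (map g bs)) = \<theta> * g t"
    and K: "!!t. \<E> (\<kappa> t) (%bs. (sum_list (map g bs) - \<theta> * g t)\<^sup>2) \<le> K"
  shows "\<E> (brood \<kappa> z) (%y. (sum_list (map g y) - \<theta> * sum_list (map g z))\<^sup>2) \<le> K * length z"
proof (induction z)
  case (Cons t z)
  define X where "X = (%bs. sum_list (map g bs) - \<theta> * g t)"
  define R where "R = (%y. sum_list (map g y) - \<theta> * sum_list (map g z))"
  have R0: "\<E> (brood \<kappa> z) R = 0" unfolding R_def by (simp add: Bochner_Integration.integral_diff int_b expectation_brood_sum[OF m] measure_pmf.prob_space)
  have sq: "(sum_list (map g (bs @ y)) - \<theta> * sum_list (map g (t # z)))\<^sup>2 = (X bs)\<^sup>2 + 2 * X bs * R y + (R y)\<^sup>2" for bs y by (simp add: X_def R_def power2_eq_square algebra_simps)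
  have "\<E> (brood \<kappa> z) (%y. (X bs)\<^sup>2 + 2 * X bs * R y + (R y)\<^sup>2) = (X bs)\<^sup>2 + \<E> (brood \<kappa> z) (%y. (R y)\<^sup>2)" for bs
    by (simp add: Bochner_Integration.integral_add int_b R0 measure_pmf.prob_space)
  then have "\<E> (brood \<kappa> (t # z)) (%y. (sum_list (map g y) - \<theta> * sum_list (map g (t # z)))\<^sup>2) =
      \<E> (\<kappa> t) (%bs. (X bs)\<^sup>2) + \<E> (brood \<kappa> z) (%y. (R y)\<^sup>2)" unfolding expectation_brood_Cons sq by (simp add: Bochner_Integration.integral_add int_k measure_pmf.prob_space)
  also have "... \<le> K + K * length z" using K[of t] Cons.IH unfolding X_def R_def by (rule add_mono)
  finally show ?case by (simp add: algebra_simps)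
qed simp

text \<open>The offspring generating functional. By \<open>expectation_brood_prod\<close> its
  iterates carry product functionals, in particular Laplace transforms, from a generation back to
  the initial one.\<close>

definition F :: "('t => real) => 't => real" where
  "F f t = \<E> (\<kappa> t) (%bs. prod_list (map f bs))"

lemma expectation_brood_prod:
  fixes f :: "'t => real"
  shows "\<E> (brood \<kappa> z) (%y. prod_list (map f y)) = prod_list (map (F f) z)"
proof (induction z)
  case (Cons t z)
  then show ?case unfolding expectation_brood_Cons F_def by simp
qed simp

lemma prod_list_mono:
  fixes f g :: "'t => real"
  shows "(!!t. 0 \<le> f t) ==> (!!t. f t \<le> g t) ==> 0 \<le> prod_list (map f z) \<and> prod_list (map f z) \<le> prod_list (map g z)"
proof (induction z)
  case (Cons t z)
  then have IH: "0 \<le> prod_list (map f z)" "prod_list (map f z) \<le> prod_list (map g z)" by blast+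
  show ?case using mult_mono[OF Cons.prems(2)[of t] IH(2)] Cons.prems(1)[of t] Cons.prems(2)[of t] IH(1) by (simp add: order_trans[OF Cons.prems(1) Cons.prems(2)])
qed simp

lemma F_mono: "(!!t. 0 \<le> f t) ==> (!!t. f t \<le> g t) ==> 0 \<le> F f t \<and> F f t \<le> F g t" unfolding F_def using prod_list_mono[of f g]
  by (auto intro!: Bochner_Integration.integral_nonneg expectation_mono_pmf finite_kappa)

lemma funpow_F_mono:
  assumes "!!t. 0 \<le> f t" "!!t. f t \<le> g t"
  shows "0 \<le> (F ^^ n) f t \<and> (F ^^ n) f t \<le> (F ^^ n) g t"
proof (induction n arbitrary: t)
  case (Suc n)
  then show ?case using F_mono[of "(F ^^ n) f" "(F ^^ n) g"] by simp
qed (use assms in simp)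

end

locale supercritical = offspring \<kappa> for \<kappa> :: "'t::finite => 't list pmf" +
  fixes \<rho> :: real and h :: "'t => real" and m :: nat
  assumes rho: "2 \<le> \<rho>" and h_pos: "0 < h t"
    and mean_h: "measure_pmf.expectation (\<kappa> t) (%bs. sum_list (map h bs)) = \<rho> * h t"
    and litter: "bs \<in> set_pmf (\<kappa> t) ==> 2 \<le> length bs" "bs \<in> set_pmf (\<kappa> t) ==> length bs \<le> m"
begin

lemma prod_list_le_power:
  fixes f :: "'t => real"
  assumes "!!t. 0 \<le> f t" "!!t. f t \<le> q" "q \<le> 1" "k \<le> length bs"
  shows "prod_list (map f bs) \<le> q ^ k"
proof -
  have q: "0 \<le> q" using assms(1,2) order_trans by blast
  have "prod_list (map f bs) \<le> prod_list (map (%_. q) bs)" using prod_list_mono[of f "%_. q"] assms by blast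
  also have "... = q ^ length bs" by (induction bs) simp_all
  also have "... \<le> q ^ k" using assms q by (intro power_decreasing) auto
  finally show ?thesis .
qed

lemma F_square:
  fixes f :: "'t => real"
  assumes "!!t. 0 \<le> f t" "!!t. f t \<le> q" "q \<le> 1"
  shows "F f t \<le> q\<^sup>2"
proof -
  have "F f t \<le> \<E> (\<kappa> t) (%_. q\<^sup>2)" unfolding F_def by (rule expectation_mono_pmf[OF finite_kappa]) (rule prod_list_le_power[OF assms litter(1)])
  then show ?thesis by (simp add: measure_pmf.prob_space)
qed

text \<open>Each litter has at least two members, so every application of \<open>F\<close> squares
  the bound. This doubly exponential decay is what rules out a vanishing limit.\<close>

lemma funpow_F_le:
  assumes "!!t. 0 \<le> f t" "!!t. f t \<le> q" "q \<le> 1"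
  shows "0 \<le> (F ^^ n) f t \<and> (F ^^ n) f t \<le> q ^ (2 ^ n)"
proof (induction n arbitrary: t)
  case (Suc n)
  have q: "0 \<le> q" using assms(1,2) order_trans by blast
  have "F ((F ^^ n) f) t \<le> (q ^ (2 ^ n))\<^sup>2" by (rule F_square) (use Suc q assms(3) in \<open>auto intro: power_le_one\<close>)
  then show ?case using F_mono[of "(F ^^ n) f" "(F ^^ n) f" t] Suc by (simp add: power_mult[symmetric] mult.commute)
qed (use assms in simp)

text \<open>Second order expansion of a product with remainder. The lower bound is carried along
  because the upper one needs it in the induction step.\<close>

lemma prod_one_minus_le:
  fixes x :: "'t => real"
  assumes "!!t. 0 \<le> x t \<and> x t \<le> 1"
  shows "0 \<le> prod_list (map (%t. 1 - x t) bs) \<and> 0 \<le> sum_list (map x bs) \<and>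
    1 - sum_list (map x bs) \<le> prod_list (map (%t. 1 - x t) bs) \<and>
    prod_list (map (%t. 1 - x t) bs) \<le> 1 - sum_list (map x bs) + (sum_list (map x bs))\<^sup>2 / 2"
proof (induction bs)
  case (Cons t bs)
  let ?P = "prod_list (map (%t. 1 - x t) bs)" and ?S = "sum_list (map x bs)"
  have x: "0 \<le> x t" "x t \<le> 1" using assms by auto
  have IH: "0 \<le> ?P" "0 \<le> ?S" "1 - ?S \<le> ?P" "?P \<le> 1 - ?S + ?S\<^sup>2 / 2" using Cons.IH by blast+
  have P1: "?P \<le> 1" using prod_list_mono[of "%t. 1 - x t" "%_. 1" bs] assms by (auto simp: o_def map_replicate_const)
  have "x t * ?P \<le> x t" using mult_left_mono[OF P1 x(1)] by simp
  moreover have "x t * (1 - ?S) \<le> x t * ?P" using mult_left_mono[OF IH(3) x(1)] .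
  moreover have "0 \<le> (x t)\<^sup>2" by simp
  moreover have "(1 - x t) * ?P = ?P - x t * ?P" "x t * (1 - ?S) = x t - x t * ?S"
    "(x t + ?S)\<^sup>2 / 2 = (x t)\<^sup>2 / 2 + x t * ?S + ?S\<^sup>2 / 2" by (simp_all add: algebra_simps power2_eq_square)
  ultimately have "(1 - x t) * ?P \<le> 1 - (x t + ?S) + (x t + ?S)\<^sup>2 / 2" "1 - (x t + ?S) \<le> (1 - x t) * ?P" using IH by linarith+
  then show ?case using x IH(1,2) by simp
qed simp

text \<open>The functions \<open>\<psi> t\<close>, equal to 1 - t h + K t^2 h, are supersolutions:
  they dominate the exponential of - t h, and \<open>F\<close> maps the one for t / \<rho> below the
  one for t. Hence the transforms at the scaled arguments stay below the function at
  \<open>t\<^sub>0\<close>, uniformly in \<open>n\<close>.\<close>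

lemma laplace_bound:
  obtains t\<^sub>0 q where "0 < t\<^sub>0" "0 \<le> q" "q < 1" "!!n t. (F ^^ n) (%s. exp (- (t\<^sub>0 / \<rho> ^ n * h s))) t \<le> q"
proof -
  define H where "H = Max (range h)"
  define H' where "H' = Min (range h)"
  have H: "h s \<le> H" "H' \<le> h s" for s by (simp_all add: H_def H'_def)
  have H': "0 < H'" unfolding H'_def using h_pos by simp
  have Hp: "0 < H" using h_pos H(1) by (meson less_le_trans)
  \<comment> \<open>K \<ge> H absorbs the quadratic error of the exponential, and K H' \<ge> m^2 H^2
    that of a product over at most \<open>m\<close> children.\<close>
  define K where "K = m\<^sup>2 * H\<^sup>2 / H' + H"
  have K: "0 < K" "H \<le> K" "m\<^sup>2 * H\<^sup>2 \<le> K * H'" using H' Hp by (auto simp: K_def field_simps intro!: add_pos_nonneg)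
  define \<psi> where "\<psi> = (%t s. 1 - (t * h s - K * t\<^sup>2 * h s))"
  \<comment> \<open>This keeps \<open>t * h s\<close> at most 1/2 and makes the quadratic term half
    of the linear one at \<open>t\<^sub>0\<close>.\<close>
  define t\<^sub>0 where "t\<^sub>0 = 1 / (2 * K)"
  have t0: "0 < t\<^sub>0" "K * t\<^sub>0 = 1 / 2" "t\<^sub>0 * H \<le> 1 / 2" using K Hp by (auto simp: t\<^sub>0_def field_simps)
  have shrink: "0 < t / \<rho>" "t / \<rho> \<le> t\<^sub>0" if "0 < t" "t \<le> t\<^sub>0" for t using that rho divide_left_mono[of 1 \<rho> t] by auto
  have range: "0 \<le> t * h s - K * t\<^sup>2 * h s" "t * h s - K * t\<^sup>2 * h s \<le> t * h s" "t * h s \<le> 1 / 2" if "0 < t" "t \<le> t\<^sub>0" for t s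
  proof -
    have "K * t \<le> 1 / 2" using mult_left_mono[OF that(2), of K] K t0 by simp
    then have "K * t * (t * h s) \<le> 1 * (t * h s)" using that h_pos[of s] by (intro mult_right_mono) auto
    then show "0 \<le> t * h s - K * t\<^sup>2 * h s" by (simp add: power2_eq_square algebra_simps)
    show "t * h s - K * t\<^sup>2 * h s \<le> t * h s" using K h_pos[of s] by simp
    have "t * h s \<le> t\<^sub>0 * H" using that H h_pos[of s] by (intro mult_mono) auto
    then show "t * h s \<le> 1 / 2" using t0 by simp
  qed
  have start: "exp (- (t * h s)) \<le> \<psi> t s" if "0 < t" "t \<le> t\<^sub>0" for t s
  proof -
    have th: "0 \<le> t * h s" using that h_pos[of s] by simp
    have "exp (- (t * h s)) \<le> 1 / (1 + t * h s)" using exp_ge_add_one_self[of "t * h s"] th by (simp add: exp_minus field_simps)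
    also have "... \<le> 1 - t * h s + (t * h s)\<^sup>2"
    proof -
      have "(1 - t * h s + (t * h s)\<^sup>2) * (1 + t * h s) = 1 + (t * h s) ^ 3" by (simp add: algebra_simps power2_eq_square power3_eq_cube)
      then have "1 \<le> (1 - t * h s + (t * h s)\<^sup>2) * (1 + t * h s)" using th by simp
      then show ?thesis using th by (simp add: divide_le_eq)
    qed
    also have "(t * h s)\<^sup>2 \<le> K * t\<^sup>2 * h s"
    proof -
      have "t\<^sup>2 * h s * h s \<le> t\<^sup>2 * h s * K" using H(1)[of s] K h_pos[of s] by (intro mult_left_mono) auto
      then show ?thesis by (simp add: power2_eq_square algebra_simps)
    qed
    finally show ?thesis by (simp add: \<psi>_def)
  qed
  \<comment> \<open>The linear term is reproduced by \<open>mean_h\<close>. The quadratic one is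
    divided by \<rho> \<ge> 2, which leaves room for the second order error of the product.\<close>
  have step: "F (\<psi> (t / \<rho>)) s \<le> \<psi> t s" if t: "0 < t" "t \<le> t\<^sub>0" for t s
  proof -
    let ?t = "t / \<rho>"
    let ?x = "%s. ?t * h s - K * ?t\<^sup>2 * h s"
    note tr = shrink[OF t]
    have x: "0 \<le> ?x s \<and> ?x s \<le> 1" for s using range[OF tr, of s] by linarith
    have "prod_list (map (\<psi> ?t) bs) \<le> 1 - sum_list (map ?x bs) + (m * (?t * H))\<^sup>2 / 2" if bs: "bs \<in> set_pmf (\<kappa> s)" for bs
    proof -
      have "sum_list (map ?x bs) \<le> sum_list (map (%_. ?t * H) bs)"
      proof (rule sum_list_mono)
        fix s show "?x s \<le> ?t * H" using range(2)[OF tr, of s] mult_left_mono[OF H(1)[of s], of ?t] tr by linarith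
      qed
      also have "... = length bs * (?t * H)" by (simp add: map_replicate_const sum_list_replicate)
      also have "... \<le> m * (?t * H)" using litter(2)[OF bs] t rho Hp by (intro mult_right_mono) auto
      finally have "(sum_list (map ?x bs))\<^sup>2 \<le> (m * (?t * H))\<^sup>2" using prod_one_minus_le[of ?x bs, OF x] by (intro power_mono) auto
      then show ?thesis using prod_one_minus_le[of ?x bs, OF x] unfolding \<psi>_def by linarith
    qed
    then have "F (\<psi> ?t) s \<le> \<E> (\<kappa> s) (%bs. 1 - sum_list (map ?x bs) + (m * (?t * H))\<^sup>2 / 2)" unfolding F_def by (rule expectation_mono_pmf[OF finite_kappa])
    also have "... = 1 - \<E> (\<kappa> s) (%bs. sum_list (map ?x bs)) + (m * (?t * H))\<^sup>2 / 2" by (simp add: Bochner_Integration.integral_add Bochner_Integration.integral_diff int_k measure_pmf.prob_space)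
    also have "\<E> (\<kappa> s) (%bs. sum_list (map ?x bs)) = (?t - K * ?t\<^sup>2) * (\<rho> * h s)"
    proof -
      have "sum_list (map ?x bs) = (?t - K * ?t\<^sup>2) * sum_list (map h bs)" for bs by (induction bs) (simp_all add: algebra_simps)
      then show ?thesis using mean_h[of s] by simp
    qed
    also have "1 - (?t - K * ?t\<^sup>2) * (\<rho> * h s) + (m * (?t * H))\<^sup>2 / 2 \<le> \<psi> t s"
    proof -
      have e: "(?t - K * ?t\<^sup>2) * (\<rho> * h s) = t * h s - K * t\<^sup>2 * h s / \<rho>" using rho by (simp add: field_simps power2_eq_square)
      have "(m * (?t * H))\<^sup>2 / 2 = (m\<^sup>2 * H\<^sup>2) * t\<^sup>2 / (2 * \<rho>\<^sup>2)" by (simp add: power_mult_distrib power_divide mult_ac)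
      also have "... \<le> (K * h s) * t\<^sup>2 / (2 * \<rho>\<^sup>2)"
      proof -
        have "m\<^sup>2 * H\<^sup>2 \<le> K * h s" using K(3) mult_left_mono[OF H(2)[of s], of K] K(1) by linarith
        then show ?thesis by (intro divide_right_mono mult_right_mono) auto
      qed
      also have "... \<le> (K * h s) * t\<^sup>2 * (1 / 2)"
      proof -
        have "1 / (2 * \<rho>\<^sup>2) \<le> 1 / 2" using rho power_mono[of 1 \<rho> 2] by (simp add: divide_le_eq)
        then have "(K * h s) * t\<^sup>2 * (1 / (2 * \<rho>\<^sup>2)) \<le> (K * h s) * t\<^sup>2 * (1 / 2)" using K h_pos[of s] by (intro mult_left_mono) auto
        then show ?thesis by simp
      qed
      finally have a: "(m * (?t * H))\<^sup>2 / 2 \<le> (K * h s) * t\<^sup>2 * (1 / 2)" .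
      have "1 / \<rho> \<le> 1 / 2" using rho by (simp add: field_simps)
      then have "(K * h s) * t\<^sup>2 * (1 / \<rho>) \<le> (K * h s) * t\<^sup>2 * (1 / 2)" using K h_pos[of s] by (intro mult_left_mono) auto
      then have "K * t\<^sup>2 * h s / \<rho> \<le> (K * h s) * t\<^sup>2 * (1 / 2)" by (simp add: algebra_simps)
      moreover have "(K * h s) * t\<^sup>2 * (1 / 2) + (K * h s) * t\<^sup>2 * (1 / 2) = K * t\<^sup>2 * h s" by simp
      ultimately show ?thesis unfolding e \<psi>_def using a by linarith
    qed
    finally show ?thesis .
  qed
  have \<psi>0: "0 \<le> \<psi> t s" if "0 < t" "t \<le> t\<^sub>0" for t s using range[OF that, of s] by (simp add: \<psi>_def)
  have it: "0 < t ==> t \<le> t\<^sub>0 ==> (F ^^ n) (%s. exp (- (t / \<rho> ^ n * h s))) s \<le> \<psi> t s" for n t s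
  proof (induction n arbitrary: t s)
    case 0
    then show ?case using start by simp
  next
    case (Suc n)
    note tr = shrink[OF Suc.prems]
    have "(F ^^ Suc n) (%s. exp (- (t / \<rho> ^ Suc n * h s))) s = F ((F ^^ n) (%s. exp (- (t / \<rho> / \<rho> ^ n * h s)))) s" by simp
    also have "... \<le> F (\<psi> (t / \<rho>)) s" using F_mono[of "(F ^^ n) (%s. exp (- (t / \<rho> / \<rho> ^ n * h s)))" "\<psi> (t / \<rho>)" s] Suc.IH[OF tr]
        funpow_F_mono[of "%s. exp (- (t / \<rho> / \<rho> ^ n * h s))" "%s. exp (- (t / \<rho> / \<rho> ^ n * h s))" n] by simp
    also have "... \<le> \<psi> t s" by (rule step[OF Suc.prems])
    finally show ?case .
  qed
  have "\<psi> t\<^sub>0 s \<le> 1 - t\<^sub>0 * H' / 2" for s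
  proof -
    have "K * t\<^sub>0\<^sup>2 * h s = (K * t\<^sub>0) * (t\<^sub>0 * h s)" by (simp add: power2_eq_square)
    then have "K * t\<^sub>0\<^sup>2 * h s = t\<^sub>0 * h s / 2" unfolding t0(2) by simp
    then have "\<psi> t\<^sub>0 s = 1 - t\<^sub>0 * h s / 2" unfolding \<psi>_def by linarith
    then show ?thesis using mult_left_mono[OF H(2)[of s], of t\<^sub>0] t0 by simp
  qed
  then have le: "\<psi> t\<^sub>0 s \<le> 1 - t\<^sub>0 * H' / 2" for s .
  show ?thesis
  proof (rule that[of t\<^sub>0 "1 - t\<^sub>0 * H' / 2"])
    show "0 \<le> 1 - t\<^sub>0 * H' / 2" using order_trans[OF \<psi>0[OF t0(1) order_refl] le] by blast
    show "1 - t\<^sub>0 * H' / 2 < 1" using t0(1) H' by simp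
    show "(F ^^ n) (%s. exp (- (t\<^sub>0 / \<rho> ^ n * h s))) t \<le> 1 - t\<^sub>0 * H' / 2" for n t by (rule order_trans[OF it[OF t0(1) order_refl] le])
  qed (rule t0(1))
qed

end


section \<open>Almost sure limits of branching processes\<close>

lemma convergent_of_summable_increments:
  fixes a :: "nat => real"
  assumes "summable (%n. \<bar>a (Suc n) - a n\<bar>)"
  shows "convergent a"
proof -
  have "summable (%n. a (Suc n) - a n)" by (rule summable_rabs_cancel[OF assms])
  then have "convergent (%n. \<Sum>k<n. a (Suc k) - a k)" by (simp add: summable_iff_convergent)
  then have "convergent (%n. a n - a 0 + a 0)" unfolding sum_lessThan_telescope by (intro convergent_add convergent_const)
  then show ?thesis by simp
qed

text \<open>The partial sums s of the absolute values satisfy s \<le> C + \<bar>q\<bar> s with a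
  fixed constant C. They are therefore bounded, and the terms tend to zero.\<close>

lemma contraction_tendsto_zero:
  fixes a :: "nat => real"
  assumes q: "\<bar>q\<bar> < 1" and s: "summable (%n. \<bar>a (Suc n) - q * a n\<bar>)"
  shows "a \<longlonglongrightarrow> 0"
proof -
  let ?e = "%n. \<bar>a (Suc n) - q * a n\<bar>"
  have "(\<Sum>k<n. \<bar>a k\<bar>) \<le> (\<bar>a 0\<bar> + suminf ?e) / (1 - \<bar>q\<bar>)" for n
  proof -
    have "(\<Sum>k<n. \<bar>a k\<bar>) \<le> (\<Sum>k<Suc n. \<bar>a k\<bar>)" by simp
    also have "... = \<bar>a 0\<bar> + (\<Sum>k<n. \<bar>a (Suc k)\<bar>)" by (rule sum.lessThan_Suc_shift)
    also have "(\<Sum>k<n. \<bar>a (Suc k)\<bar>) \<le> (\<Sum>k<n. \<bar>q\<bar> * \<bar>a k\<bar> + ?e k)"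
    proof (rule sum_mono)
      fix k show "\<bar>a (Suc k)\<bar> \<le> \<bar>q\<bar> * \<bar>a k\<bar> + ?e k" using abs_triangle_ineq[of "q * a k" "a (Suc k) - q * a k"] by (simp add: abs_mult)
    qed
    also have "... = \<bar>q\<bar> * (\<Sum>k<n. \<bar>a k\<bar>) + (\<Sum>k<n. ?e k)" by (simp add: sum.distrib sum_distrib_left)
    also have "(\<Sum>k<n. ?e k) \<le> suminf ?e" by (rule sum_le_suminf[OF s]) auto
    finally have "(\<Sum>k<n. \<bar>a k\<bar>) * (1 - \<bar>q\<bar>) \<le> \<bar>a 0\<bar> + suminf ?e" by (simp add: algebra_simps)
    then show ?thesis using q by (simp add: pos_le_divide_eq)
  qed
  then have "summable (%k. \<bar>a k\<bar>)" by (intro summableI_nonneg_bounded) auto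
  then show ?thesis using summable_LIMSEQ_zero tendsto_rabs_zero_iff by blast
qed

text \<open>The Markov property enters through the joint law of consecutive generations;
  expectations over longer times are obtained by iterating \<open>expectation_Suc\<close>.\<close>

locale branching = supercritical \<kappa> \<rho> h m + prob_space Pr
  for \<kappa> :: "'t::finite => 't list pmf" and \<rho> h m and Pr :: "'w measure" +
  fixes Z :: "nat => 'w => 't list" and law :: "nat => 't list pmf"
  assumes finite_law: "finite (set_pmf (law n))"
    and pair_measurable: "(%\<omega>. (Z n \<omega>, Z (Suc n) \<omega>)) \<in> Pr \<rightarrow>\<^sub>M count_space UNIV"
    and pair_law: "distr Pr (count_space UNIV) (%\<omega>. (Z n \<omega>, Z (Suc n) \<omega>)) =
      measure_pmf (bind_pmf (law n) (%z. map_pmf (Pair z) (brood \<kappa> z)))"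
begin

lemma Z_measurable: "Z n \<in> Pr \<rightarrow>\<^sub>M count_space UNIV" using measurable_compose[OF pair_measurable[of n], of fst "count_space UNIV"] by simp

lemma real_measurable:
  fixes f :: "'t list => real"
  shows "(%\<omega>. f (Z n \<omega>)) \<in> borel_measurable Pr" by (rule measurable_compose[OF Z_measurable]) simp

lemma expectation_pair:
  fixes f :: "'t list => 't list => real"
  shows "integrable Pr (%\<omega>. f (Z n \<omega>) (Z (Suc n) \<omega>))"
    "expectation (%\<omega>. f (Z n \<omega>) (Z (Suc n) \<omega>)) = \<E> (law n) (%z. \<E> (brood \<kappa> z) (f z))"
proof -
  let ?p = "bind_pmf (law n) (%z. map_pmf (Pair z) (brood \<kappa> z))"
  let ?f = "%(z, y). f z y"
  have fin: "finite (set_pmf ?p)" using finite_law finite_brood by simp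
  have "integrable ?p ?f" by (rule integrable_measure_pmf_finite[OF fin])
  then show "integrable Pr (%\<omega>. f (Z n \<omega>) (Z (Suc n) \<omega>))" using integrable_distr_eq[OF pair_measurable, of ?f n] by (simp add: pair_law)
  have "expectation (%\<omega>. f (Z n \<omega>) (Z (Suc n) \<omega>)) = \<E> ?p ?f" using integral_distr[OF pair_measurable, of ?f n] by (simp add: pair_law)
  also have "... = \<E> (law n) (%z. \<E> (brood \<kappa> z) (f z))" by (subst expectation_bind_finite) (simp_all add: finite_law finite_brood)
  finally show "expectation (%\<omega>. f (Z n \<omega>) (Z (Suc n) \<omega>)) = \<E> (law n) (%z. \<E> (brood \<kappa> z) (f z))" .
qed

lemma expectation_one:
  fixes f :: "'t list => real"
  shows "integrable Pr (%\<omega>. f (Z n \<omega>))" "expectation (%\<omega>. f (Z n \<omega>)) = \<E> (law n) f" using expectation_pair[of "%z y. f z" n] by (simp_all add: measure_pmf.prob_space)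

lemma expectation_Suc:
  fixes f :: "'t list => real"
  shows "expectation (%\<omega>. f (Z (Suc n) \<omega>)) = expectation (%\<omega>. \<E> (brood \<kappa> (Z n \<omega>)) f)"
  using expectation_pair(2)[of "%z y. f y" n] expectation_one(2)[of "%z. \<E> (brood \<kappa> z) f" n] by simp

abbreviation "S g n \<omega> \<equiv> sum_list (map g (Z n \<omega>))"

lemma expectation_growth: "expectation (S h n) = \<rho> ^ n * expectation (S h 0)"
proof (induction n)
  case (Suc n)
  have "expectation (S h (Suc n)) = \<rho> * expectation (S h n)" unfolding expectation_Suc[of "%y. sum_list (map h y)"] expectation_brood_sum[of h, OF mean_h] by simp
  then show ?case using Suc by simp
qed simp

lemma expectation_prod:
  fixes f :: "'t => real"
  shows "expectation (%\<omega>. prod_list (map f (Z n \<omega>))) = expectation (%\<omega>. prod_list (map ((F ^^ n) f) (Z 0 \<omega>)))"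
proof (induction n arbitrary: f)
  case (Suc n)
  have "expectation (%\<omega>. prod_list (map f (Z (Suc n) \<omega>))) = expectation (%\<omega>. prod_list (map (F f) (Z n \<omega>)))" unfolding expectation_Suc[of "%y. prod_list (map f y)"] expectation_brood_prod ..
  then show ?case unfolding Suc.IH by (simp add: funpow_swap1)
qed simp

text \<open>Stated for an eigenvector \<open>g\<close> of any eigenvalue \<theta>, but scaled by
  powers of \<rho>: given a generation, the variance of the increment is at most proportional to its
  size, whose mean grows like \<rho>^n. It serves both eigenvectors.\<close>

lemma summable_increments:
  fixes g :: "'t => real"
  assumes mg: "!!t. \<E> (\<kappa> t) (%bs. sum_list (map g bs)) = \<theta> * g t"
  shows "AE \<omega> in Pr. summable (%n. \<bar>S g (Suc n) \<omega> - \<theta> * S g n \<omega>\<bar> / \<rho> ^ n)"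
proof -
  define K where "K = (\<Sum>t\<in>UNIV. \<E> (\<kappa> t) (%bs. (sum_list (map g bs) - \<theta> * g t)\<^sup>2))"
  have K: "\<E> (\<kappa> t) (%bs. (sum_list (map g bs) - \<theta> * g t)\<^sup>2) \<le> K" for t unfolding K_def by (rule member_le_sum) (auto intro: Bochner_Integration.integral_nonneg)
  have K0: "0 \<le> K" unfolding K_def by (intro sum_nonneg Bochner_Integration.integral_nonneg) simp
  define H' where "H' = Min (range h)"
  have H': "0 < H'" "H' \<le> h s" for s unfolding H'_def using h_pos by simp_all
  let ?D = "%n \<omega>. S g (Suc n) \<omega> - \<theta> * S g n \<omega>"
  define A where "A = K / H' * expectation (S h 0)"
  have D2: "expectation (%\<omega>. (?D n \<omega>)\<^sup>2) \<le> A * \<rho> ^ n" for n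
  proof -
    have "expectation (%\<omega>. (?D n \<omega>)\<^sup>2) = \<E> (law n) (%z. \<E> (brood \<kappa> z) (%y. (sum_list (map g y) - \<theta> * sum_list (map g z))\<^sup>2))" by (rule expectation_pair(2))
    also have "... \<le> \<E> (law n) (%z. K / H' * sum_list (map h z))"
    proof (rule expectation_mono_pmf[OF finite_law])
      fix z :: "'t list"
      have "H' * length z = sum_list (map (%_. H') z)" by (simp add: map_replicate_const sum_list_replicate)
      also have "... \<le> sum_list (map h z)" by (rule sum_list_mono) (rule H')
      finally have "K / H' * (H' * length z) \<le> K / H' * sum_list (map h z)" using K0 H'(1) by (intro mult_left_mono) auto
      then have "K * length z \<le> K / H' * sum_list (map h z)" using H'(1) by simp
      then show "\<E> (brood \<kappa> z) (%y. (sum_list (map g y) - \<theta> * sum_list (map g z))\<^sup>2) \<le> K / H' * sum_list (map h z)" using variance_brood[OF mg K, of z] by linarith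
    qed
    also have "... = K / H' * expectation (S h n)" using expectation_one(2)[of "%z. sum_list (map h z)" n] by simp
    also have "... = A * \<rho> ^ n" unfolding expectation_growth[of n] A_def by simp
    finally show ?thesis .
  qed
  have int: "integrable Pr (%\<omega>. \<bar>?D n \<omega>\<bar> / \<rho> ^ n)" "integrable Pr (%\<omega>. (?D n \<omega>)\<^sup>2)" for n by (rule expectation_pair(1))+
  have D1: "expectation (%\<omega>. \<bar>?D n \<omega>\<bar> / \<rho> ^ n) \<le> A / 2 * (2 / 3) ^ n + 1 / 2 * (3 / 4) ^ n" for n
  proof -
    have rn: "0 < \<rho> ^ n" using rho by simp
    have id: "(A * x / y + y) / 2 / x = A / 2 * (1 / y) + 1 / 2 * (y / x)" if "0 < x" "0 < y" for x y :: real using that by (simp add: field_simps)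
    \<comment> \<open>A weight for the inequality between arithmetic and geometric mean. Any base
      strictly between 1 and 2 makes both halves decay geometrically, the first one because the
      second moment grows at most like \<rho>^n.\<close>
    let ?c = "(3 / 2 :: real) ^ n"
    have c: "0 < ?c" by simp
    have "expectation (%\<omega>. \<bar>?D n \<omega>\<bar> / \<rho> ^ n) \<le> expectation (%\<omega>. ((?D n \<omega>)\<^sup>2 / ?c + ?c) / 2 / \<rho> ^ n)"
    proof (rule integral_mono)
      fix \<omega>
      have "0 \<le> (\<bar>?D n \<omega>\<bar> - ?c)\<^sup>2" by simp
      then have "2 * \<bar>?D n \<omega>\<bar> * ?c \<le> (?D n \<omega>)\<^sup>2 + ?c\<^sup>2" by (simp add: power2_diff)
      then have "2 * \<bar>?D n \<omega>\<bar> \<le> ((?D n \<omega>)\<^sup>2 + ?c\<^sup>2) / ?c" using c by (simp only: pos_le_divide_eq)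
      also have "... = (?D n \<omega>)\<^sup>2 / ?c + ?c" by (simp add: add_divide_distrib power2_eq_square)
      finally show "\<bar>?D n \<omega>\<bar> / \<rho> ^ n \<le> ((?D n \<omega>)\<^sup>2 / ?c + ?c) / 2 / \<rho> ^ n" using rn by (intro divide_right_mono) auto
    qed (use int in auto)
    also have "... = (expectation (%\<omega>. (?D n \<omega>)\<^sup>2) / ?c + ?c) / 2 / \<rho> ^ n" using int(2)[of n] by (simp add: prob_space)
    also have "... \<le> (A * \<rho> ^ n / ?c + ?c) / 2 / \<rho> ^ n" using D2[of n] rn c by (intro divide_right_mono add_right_mono) auto
    also have "... = A / 2 * (1 / ?c) + 1 / 2 * (?c / \<rho> ^ n)" by (rule id[OF rn c])
    also have "?c / \<rho> ^ n = (3 / 2 / \<rho>) ^ n" by (simp add: power_divide)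
    also have "... \<le> (3 / 4) ^ n" using rho by (intro power_mono) (auto simp: field_simps)
    finally show ?thesis by (simp add: power_divide)
  qed
  have sm: "summable (%n. A / 2 * (2 / 3) ^ n + 1 / 2 * (3 / 4 :: real) ^ n)" by (intro summable_add summable_mult summable_geometric) auto
  have nn: "0 \<le> expectation (%\<omega>. \<bar>?D n \<omega>\<bar> / \<rho> ^ n)" for n using rho by (intro Bochner_Integration.integral_nonneg) auto
  have m: "(%\<omega>. ennreal (\<bar>?D n \<omega>\<bar> / \<rho> ^ n)) \<in> borel_measurable Pr" for n using int(1)[of n] by measurable
  have "(\<integral>\<^sup>+ \<omega>. (\<Sum>n. ennreal (\<bar>?D n \<omega>\<bar> / \<rho> ^ n)) \<partial>Pr) = (\<Sum>n. \<integral>\<^sup>+ \<omega>. ennreal (\<bar>?D n \<omega>\<bar> / \<rho> ^ n) \<partial>Pr)"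
    by (rule nn_integral_suminf[OF m])
  also have "... = (\<Sum>n. ennreal (expectation (%\<omega>. \<bar>?D n \<omega>\<bar> / \<rho> ^ n)))" using rho by (intro suminf_cong nn_integral_eq_integral int) auto
  also have "... ~= \<infinity>"
  proof -
    have "summable (%n. expectation (%\<omega>. \<bar>?D n \<omega>\<bar> / \<rho> ^ n))"
    proof (rule summable_comparison_test'[OF sm, of 0])
      show "norm (expectation (%\<omega>. \<bar>?D n \<omega>\<bar> / \<rho> ^ n)) \<le> A / 2 * (2 / 3) ^ n + 1 / 2 * (3 / 4) ^ n" for n unfolding real_norm_def abs_of_nonneg[OF nn] by (rule D1)
    qed
    then show ?thesis using nn by (simp add: suminf_ennreal2)
  qed
  finally have "AE \<omega> in Pr. (\<Sum>n. ennreal (\<bar>?D n \<omega>\<bar> / \<rho> ^ n)) ~= \<infinity>" by (intro nn_integral_noteq_infinite borel_measurable_suminf_order m) auto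
  then show ?thesis by eventually_elim (use rho in \<open>auto intro!: summable_suminf_not_top\<close>)
qed

lemma converges: "AE \<omega> in Pr. convergent (%n. S h n \<omega> / \<rho> ^ n)" using summable_increments[of h, OF mean_h]
proof eventually_elim
  case (elim \<omega>)
  have "\<bar>S h (Suc n) \<omega> / \<rho> ^ Suc n - S h n \<omega> / \<rho> ^ n\<bar> = 1 / \<rho> * (\<bar>S h (Suc n) \<omega> - \<rho> * S h n \<omega>\<bar> / \<rho> ^ n)" for n
  proof -
    have "S h (Suc n) \<omega> / \<rho> ^ Suc n - S h n \<omega> / \<rho> ^ n = (S h (Suc n) \<omega> - \<rho> * S h n \<omega>) / (\<rho> * \<rho> ^ n)" using rho by (simp add: diff_divide_distrib)
    then show ?thesis using rho by (simp add: abs_divide abs_mult)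
  qed
  then show ?case using summable_mult[OF elim, of "1 / \<rho>"] by (intro convergent_of_summable_increments) (simp only:)
qed

text \<open>After division by \<rho>^n the sums obey a recursion with factor \<theta> / \<rho> up to
  summable errors, and this factor is less than 1 in absolute value.\<close>

lemma subdominant:
  fixes g :: "'t => real"
  assumes mg: "!!t. \<E> (\<kappa> t) (%bs. sum_list (map g bs)) = \<theta> * g t" and th: "\<bar>\<theta>\<bar> < \<rho>"
  shows "AE \<omega> in Pr. (%n. S g n \<omega> / \<rho> ^ n) \<longlonglongrightarrow> 0" using summable_increments[OF mg]
proof eventually_elim
  case (elim \<omega>)
  have "\<bar>S g (Suc n) \<omega> / \<rho> ^ Suc n - \<theta> / \<rho> * (S g n \<omega> / \<rho> ^ n)\<bar> = 1 / \<rho> * (\<bar>S g (Suc n) \<omega> - \<theta> * S g n \<omega>\<bar> / \<rho> ^ n)" for n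
  proof -
    have "S g (Suc n) \<omega> / \<rho> ^ Suc n - \<theta> / \<rho> * (S g n \<omega> / \<rho> ^ n) = (S g (Suc n) \<omega> - \<theta> * S g n \<omega>) / (\<rho> * \<rho> ^ n)" using rho by (simp add: field_simps)
    then show ?thesis using rho by (simp add: abs_divide abs_mult)
  qed
  then have s: "summable (%n. \<bar>S g (Suc n) \<omega> / \<rho> ^ Suc n - \<theta> / \<rho> * (S g n \<omega> / \<rho> ^ n)\<bar>)" using summable_mult[OF elim, of "1 / \<rho>"] by (simp only:)
  have "\<bar>\<theta> / \<rho>\<bar> < 1" using th rho by (simp add: abs_divide)
  then show ?case by (rule contraction_tendsto_zero[OF _ s])
qed

lemma extinct: "AE \<omega> in Pr. Z 0 \<omega> = [] --> (\<forall>n. Z n \<omega> = [])"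
proof -
  have "AE \<omega> in Pr. Z n \<omega> = [] --> Z (Suc n) \<omega> = []" for n
  proof -
    have "AE p in distr Pr (count_space UNIV) (%\<omega>. (Z n \<omega>, Z (Suc n) \<omega>)). fst p = [] --> snd p = []" unfolding pair_law by (auto simp: AE_measure_pmf_iff)
    then show ?thesis by (subst (asm) AE_distr_iff[OF pair_measurable]) auto
  qed
  then have "AE \<omega> in Pr. \<forall>n. Z n \<omega> = [] --> Z (Suc n) \<omega> = []" by (simp add: AE_all_countable)
  then show ?thesis
  proof eventually_elim
    case (elim \<omega>)
    then have "Z n \<omega> = []" if "Z 0 \<omega> = []" for n using that by (induction n) auto
    then show ?case by blast
  qed
qed

text \<open>Where the limit W vanishes, the exponential of - s W equals 1 for every s. For s equal
  to \<open>t\<^sub>0\<close> times \<rho>^k its mean is at most the probability of an empty start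
  plus q^(2^k): \<open>laplace_bound\<close> gives q, and k further applications of \<open>F\<close>
  square it k times. Letting k grow, W vanishes with no more probability than an empty start
  has.\<close>

lemma limit_positive: "AE \<omega> in Pr. Z 0 \<omega> ~= [] --> 0 < lim (%n. S h n \<omega> / \<rho> ^ n)"
proof -
  define W where "W = (%\<omega>. lim (%n. S h n \<omega> / \<rho> ^ n))"
  have W_m[measurable]: "W \<in> borel_measurable Pr" unfolding W_def by (rule borel_measurable_lim_metric) (rule real_measurable)
  have Z_m[measurable]: "Z 0 \<in> Pr \<rightarrow>\<^sub>M count_space UNIV" by (rule Z_measurable)
  have conv: "AE \<omega> in Pr. (%n. S h n \<omega> / \<rho> ^ n) \<longlonglongrightarrow> W \<omega>" using converges by eventually_elim (simp add: W_def convergent_LIMSEQ_iff)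
  have S0: "0 \<le> S h n \<omega>" for n \<omega> using h_pos by (intro sum_list_nonneg) (auto intro: less_imp_le)
  obtain t\<^sub>0 q where t0: "0 < t\<^sub>0" and q: "0 \<le> q" "q < 1"
    and lap: "!!n t. (F ^^ n) (%s. exp (- (t\<^sub>0 / \<rho> ^ n * h s))) t \<le> q" using laplace_bound by blast
  let ?none = "{\<omega> \<in> space Pr. Z 0 \<omega> = []}"
  let ?zero = "{\<omega> \<in> space Pr. W \<omega> = 0}"
  have bound: "prob ?zero \<le> prob ?none + q ^ (2 ^ k)" for k
  proof -
    let ?X = "%n \<omega>. exp (- (t\<^sub>0 * \<rho> ^ k * (S h n \<omega> / \<rho> ^ n)))"
    let ?X' = "%\<omega>. exp (- (t\<^sub>0 * \<rho> ^ k * W \<omega>))"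
    have X1: "norm (?X n \<omega>) \<le> 1" for n \<omega> using S0[of n \<omega>] t0 rho by simp
    have Xm: "?X n \<in> borel_measurable Pr" for n by (rule real_measurable)
    have lim: "AE \<omega> in Pr. (%n. ?X n \<omega>) \<longlonglongrightarrow> ?X' \<omega>" using conv by eventually_elim (intro tendsto_intros)
    have X'm: "?X' \<in> borel_measurable Pr" by measurable
    have X'i: "integrable Pr ?X'" by (rule integrable_dominated_convergence[OF X'm Xm _ lim, of "%_. 1"]) (use X1 in auto)
    have "(%n. expectation (?X n)) \<longlonglongrightarrow> expectation ?X'" by (rule integral_dominated_convergence[OF X'm Xm _ lim, of "%_. 1"]) (use X1 in auto)
    then have lm: "(%n. expectation (?X (n + k))) \<longlonglongrightarrow> expectation ?X'" by (rule LIMSEQ_ignore_initial_segment)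
    have "expectation (?X (n + k)) \<le> prob ?none + q ^ (2 ^ k)" for n
    proof -
      let ?f = "%s. exp (- (t\<^sub>0 / \<rho> ^ n * h s))"
      have f: "0 \<le> (F ^^ n) ?f s" "(F ^^ n) ?f s \<le> q" for s using lap[of n s] funpow_F_mono[of ?f ?f n s] by auto
      have Fk: "0 \<le> (F ^^ (n + k)) ?f s" "(F ^^ (n + k)) ?f s \<le> q ^ (2 ^ k)" for s using funpow_F_le[of "(F ^^ n) ?f" q k s] f q unfolding add.commute[of n k] funpow_add by auto
      have X: "?X (n + k) = (%\<omega>. prod_list (map ?f (Z (n + k) \<omega>)))"
      proof -
        have "prod_list (map ?f z) = exp (- (t\<^sub>0 / \<rho> ^ n * sum_list (map h z)))" for z by (induction z) (simp_all add: exp_add[symmetric] algebra_simps)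
        moreover have "t\<^sub>0 * \<rho> ^ k * (x / \<rho> ^ (n + k)) = t\<^sub>0 / \<rho> ^ n * x" for x using rho by (simp add: power_add)
        ultimately show ?thesis by simp
      qed
      have "expectation (?X (n + k)) = expectation (%\<omega>. prod_list (map ((F ^^ (n + k)) ?f) (Z 0 \<omega>)))" unfolding X by (rule expectation_prod)
      \<comment> \<open>A nonempty initial generation contributes at least one factor bounded by
        q^(2^k), and all other factors are at most 1.\<close>
      also have "... \<le> expectation (%\<omega>. indicator ?none \<omega> + q ^ (2 ^ k))"
      proof (rule integral_mono)
        fix \<omega> assume "\<omega> \<in> space Pr"
        then show "prod_list (map ((F ^^ (n + k)) ?f) (Z 0 \<omega>)) \<le> indicator ?none \<omega> + q ^ (2 ^ k)" using prod_list_le_power[OF Fk, of 1 "Z 0 \<omega>"] q power_le_one[of q "2 ^ k"]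
          by (cases "Z 0 \<omega>") (auto simp: indicator_def)
      qed (auto intro!: expectation_one(1) integrable_real_indicator simp: emeasure_eq_measure)
      also have "... = prob ?none + q ^ (2 ^ k)" by (subst Bochner_Integration.integral_add) (auto simp: prob_space emeasure_eq_measure intro!: integrable_real_indicator)
      finally show ?thesis .
    qed
    then have "expectation ?X' \<le> prob ?none + q ^ (2 ^ k)" by (intro LIMSEQ_le_const2[OF lm]) auto
    moreover have "prob ?zero \<le> expectation ?X'"
    proof -
      have "prob ?zero = expectation (indicator ?zero)" by simp
      also have "... \<le> expectation ?X'" by (rule integral_mono) (use X'i in \<open>auto simp: indicator_def emeasure_eq_measure intro!: integrable_real_indicator\<close>)
      finally show ?thesis .
    qed
    ultimately show ?thesis by linarith
  qed
  have "(%k. q ^ (2 ^ k)) \<longlonglongrightarrow> 0"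
  proof (rule tendsto_sandwich[OF _ _ tendsto_const])
    show "(%k. q ^ k) \<longlonglongrightarrow> 0" using q by (intro LIMSEQ_power_zero) auto
    show "\<forall>\<^sub>F k in sequentially. q ^ (2 ^ k) \<le> q ^ k" using q by (intro always_eventually allI power_decreasing) (auto intro: less_imp_le less_exp)
  qed (use q in auto)
  then have "(%k. prob ?none + q ^ (2 ^ k)) \<longlonglongrightarrow> prob ?none + 0" by (intro tendsto_intros)
  then have le: "prob ?zero \<le> prob ?none" using bound by (intro LIMSEQ_le_const[of _ "prob ?none"]) auto
  \<comment> \<open>An empty start entails a vanishing limit almost surely. Together with the
    inequality between the probabilities, the two events agree up to a null set.\<close>
  have "AE \<omega> in Pr. Z 0 \<omega> = [] --> W \<omega> = 0" using extinct conv
  proof eventually_elim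
    case (elim \<omega>)
    show ?case
    proof
      assume "Z 0 \<omega> = []"
      then have z: "Z n \<omega> = []" for n using elim(1) by blast
      have "(%n. 0) \<longlonglongrightarrow> W \<omega>" using elim(2) unfolding z by simp
      then show "W \<omega> = 0" by (rule LIMSEQ_unique[OF _ tendsto_const])
    qed
  qed
  then have sub: "AE \<omega> in Pr. \<omega> \<in> ?none --> \<omega> \<in> ?zero" by eventually_elim auto
  have "prob (?zero - ?none) = prob ?zero - prob (?zero \<inter> ?none)" by (rule finite_measure_Diff') measurable
  also have "prob (?zero \<inter> ?none) = prob ?none" by (rule finite_measure_eq_AE) (use sub in \<open>auto, measurable\<close>)
  finally have "prob (?zero - ?none) = 0" using le measure_nonneg[of Pr "?zero - ?none"] by linarith
  then have "AE \<omega> in Pr. \<omega> \<notin> ?zero - ?none" by (subst (asm) prob_eq_0) measurable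
  then show ?thesis using conv AE_space
  proof eventually_elim
    case (elim \<omega>)
    have "0 \<le> W \<omega>" using elim(2) S0 rho by (intro LIMSEQ_le_const[OF elim(2)]) auto
    moreover have "W \<omega> = lim (%n. S h n \<omega> / \<rho> ^ n)" by (simp add: W_def)
    ultimately show ?case using elim(1,3) by auto
  qed
qed

end


section \<open>Uniform convergence along a line of descent\<close>

lemma tri_half:
  assumes "c \<in> cells S (Suc N)"
  shows "tri (Suc N) c \<subseteq> tri N (half c)"
proof -
  obtain b i where b: "c = b + b + delta i" using assms unfolding cells_Suc by blast
  have h: "half c = b" unfolding b using half_sub_cell by blast
  have "pt (Suc N) (c + delta j) \<in> tri N b" for j
  proof -
    have "c + delta j = (b + delta i) + (b + delta j)" unfolding b by (simp add: ac_simps)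
    then have e: "pt (Suc N) (c + delta j) = (1 - 1/2) *\<^sub>R pt N (b + delta i) + (1/2) *\<^sub>R pt N (b + delta j)" by (simp add: complex_eq_iff Re_pt Im_pt field_simps)
    have "convex (tri N b)" unfolding tri_def by simp
    then show ?thesis unfolding e by (rule convexD_alt) (simp_all add: tri_corner)
  qed
  moreover have "convex (tri N b)" unfolding tri_def by simp
  ultimately show ?thesis unfolding h tri_def[of "Suc N"] by (intro hull_minimal) blast+
qed

lemma half_cells: "c \<in> cells S (Suc N) ==> half c \<in> cells S N" by simp

lemma tri_funpow_half: "c \<in> cells S (N + n) ==> tri (N + n) c \<subseteq> tri N ((half ^^ n) c)"
proof (induction n arbitrary: c)
  case (Suc n)
  have c: "c \<in> cells S (Suc (N + n))" using Suc.prems by (simp only: add_Suc_right)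
  have "tri (Suc (N + n)) c \<subseteq> tri (N + n) (half c)" by (rule tri_half[OF c])
  also have "... \<subseteq> tri N ((half ^^ n) (half c))" by (rule Suc.IH[OF half_cells[OF c]])
  finally show ?case by (simp add: funpow_swap1)
qed simp

definition len :: "cell list => nat" where "len cs = sum_list (map cell_len cs)"

lemma len_simps [simp]: "len [] = 0" "len (C # cs) = cell_len C + len cs" "len (cs @ ds) = len cs + len ds" by (simp_all add: len_def)

lemma cum_take: "i \<le> length cs ==> cum cs i = len (take i cs)" by (induction i) (simp_all add: take_Suc_conv_app_nth)

lemma locate_cell:
  fixes t :: real
  shows "0 \<le> t ==> t < len cs ==> \<exists>i<length cs. len (take i cs) \<le> t \<and> t < len (take (Suc i) cs)"
proof (induction cs arbitrary: t)
  case (Cons C cs)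
  show ?case
  proof (cases "t < cell_len C")
    case True
    then show ?thesis using Cons.prems by (intro exI[of _ 0]) simp
  next
    case False
    then obtain i where "i < length cs" "len (take i cs) \<le> t - cell_len C" "t - cell_len C < len (take (Suc i) cs)" using Cons.IH[of "t - cell_len C"] Cons.prems by auto
    then show ?thesis by (intro exI[of _ "Suc i"]) simp
  qed
qed simp

text \<open>Both scales are recorded: the fine cell serves to locate the walk, and the block serves
  to compare \<open>t\<close> with the boundaries between coarse cells.\<close>

lemma locate_block:
  fixes t :: real
  shows "0 \<le> t ==> t < len (concat Rs) ==> \<exists>k i. k < length Rs \<and> i < length (concat Rs) \<and> concat Rs ! i \<in> set (Rs ! k) \<and>
    len (take i (concat Rs)) \<le> t \<and> t < len (take (Suc i) (concat Rs)) \<and>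
    (\<Sum>j<k. len (Rs ! j)) \<le> t \<and> t < (\<Sum>j<Suc k. len (Rs ! j))"
proof (induction Rs arbitrary: t)
  case (Cons R Rs)
  show ?case
  proof (cases "t < len R")
    case True
    then obtain i where i: "i < length R" "len (take i R) \<le> t" "t < len (take (Suc i) R)" using locate_cell[OF Cons.prems(1)] by blast
    then show ?thesis using True Cons.prems(1) by (intro exI[of _ "0::nat"] exI[of _ i]) (simp add: nth_append)
  next
    case False
    then obtain k i where ki: "k < length Rs" "i < length (concat Rs)" "concat Rs ! i \<in> set (Rs ! k)"
      "len (take i (concat Rs)) \<le> t - len R" "t - len R < len (take (Suc i) (concat Rs))"
      "(\<Sum>j<k. len (Rs ! j)) \<le> t - len R" "t - len R < (\<Sum>j<Suc k. len (Rs ! j))" using Cons.IH[of "t - len R"] Cons.prems by auto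
    have s: "(\<Sum>j<Suc m. len ((R # Rs) ! j)) = len R + (\<Sum>j<m. len (Rs ! j))" for m by (subst sum.lessThan_Suc_shift) simp
    show ?thesis by (rule exI[of _ "Suc k"], rule exI[of _ "length R + i"])
        (use ki in \<open>simp add: s nth_append del: sum.lessThan_Suc\<close>)
  qed
qed simp

lemma interpolate_in_cell:
  fixes t :: real
  assumes ch: "chain N cs" and i: "i < length cs" and t: "cum cs i \<le> t" "t < cum cs (Suc i)"
  shows "interpolate (path_of N cs) t \<in> tri N (fst (cs ! i))"
proof -
  let ?w = "path_of N cs"
  define j where "j = nat \<lfloor>t\<rfloor>"
  have t0: "0 \<le> t" using t(1) by (meson of_nat_0_le_iff order_trans)
  have j: "real j \<le> t" "t < real j + 1" using t0 unfolding j_def by linarith+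
  have "real (cum cs i) < real j + 1" "real j < real (cum cs (Suc i))" using t j by linarith+
  then have ji: "cum cs i \<le> j" "j < cum cs (Suc i)" by linarith+
  have "cum cs (Suc i) \<le> cum cs (length cs)" using cum_strict[of "Suc i" "length cs" cs] i by (cases "Suc i = length cs") auto
  then have "t < steps ?w" using t(2) unfolding steps_path_of[OF ch] by linarith
  then have e: "interpolate ?w t = (1 - (t - j)) *\<^sub>R ?w ! j + (t - j) *\<^sub>R ?w ! Suc j" unfolding interpolate_def Let_def j_def[symmetric] by (simp add: algebra_simps)
  have v: "?w ! (cum cs i + k) \<in> tri N (fst (cs ! i))" if "k \<le> cell_len (cs ! i)" for k
  proof -
    have "k < length (cell_path N (cs ! i))" using that by (auto simp: cell_path_def cell_len_def split: if_splits)
    then have "cell_path N (cs ! i) ! k \<in> set (cell_path N (cs ! i))" by (rule nth_mem)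
    moreover have "set (cell_path N (cs ! i)) \<subseteq> tri N (fst (cs ! i))" by (simp add: cell_path_def cell_pt_tri)
    ultimately show ?thesis unfolding path_of_nth[OF ch i that] by blast
  qed
  have "?w ! j \<in> tri N (fst (cs ! i))" "?w ! Suc j \<in> tri N (fst (cs ! i))" using v[of "j - cum cs i"] v[of "Suc j - cum cs i"] ji by auto
  moreover have "convex (tri N (fst (cs ! i)))" unfolding tri_def by simp
  ultimately show ?thesis unfolding e using j by (intro convexD_alt) auto
qed

lemma interpolate_end:
  fixes t :: real
  assumes ch: "chain N cs" and l: "last (path_of N cs) = pt_a" and t: "len cs \<le> t"
  shows "interpolate (path_of N cs) t \<in> tri N (fst (cs ! (length cs - 1)))"
proof -
  let ?i = "length cs - 1"
  have ne: "cs ~= []" using ch by (simp add: chain_def)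
  then have i: "?i < length cs" "Suc ?i = length cs" by simp_all
  have "\<not> t < steps (path_of N cs)" using t unfolding steps_path_of[OF ch] by (simp add: cum_take)
  then have "interpolate (path_of N cs) t = pt_a" by (simp add: interpolate_def)
  also have "pt_a = path_of N cs ! cum cs (length cs)" unfolding l[symmetric] steps_path_of[OF ch, symmetric] steps_def using lattice_path_of[OF ch] by (intro last_conv_nth) (simp add: lattice_path_def)
  also have "cum cs (length cs) = cum cs ?i + cell_len (cs ! ?i)" using i(2) by (metis cum.simps(2))
  also have "path_of N cs ! ... = cell_path N (cs ! ?i) ! cell_len (cs ! ?i)" by (rule path_of_nth[OF ch i(1)]) simp
  also have "... = cell_pt N (cs ! ?i) C1" by (simp add: cell_path_def cell_len_def)
  finally show ?thesis by (simp add: cell_pt_tri)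
qed

text \<open>Regroups the children of all blocks by the ancestors of the blocks, which is the
  induction step for descendants over several generations.\<close>

lemma list_all2_concat_compose:
  "list_all2 P cs Rs ==> list_all2 R (concat Rs) Ts ==>
    \<exists>Us. concat Us = concat Ts \<and> list_all2 (%C U. \<exists>X Y. P C X \<and> list_all2 R X Y \<and> U = concat Y) cs Us"
proof (induction arbitrary: Ts rule: list_all2_induct)
  case (Cons C cs X Rs)
  then obtain T1 T2 where T: "Ts = T1 @ T2" "list_all2 R X T1" "list_all2 R (concat Rs) T2" by (auto simp: list_all2_append1)
  obtain Us where "concat Us = concat T2" "list_all2 (%C U. \<exists>X Y. P C X \<and> list_all2 R X Y \<and> U = concat Y) cs Us" using Cons.IH[OF T(3)] by blast
  then show ?case using Cons.hyps T by (intro exI[of _ "concat T1 # Us"]) auto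
qed auto

text \<open>Blocks of distinct parents are recovered by filtering. The time spent in a cell thereby
  depends on its base only and not on its position in the list.\<close>

lemma filter_block:
  assumes "list_all2 (%C R. \<forall>D\<in>set R. f D = g C) cs Rs" "distinct (map g cs)" "k < length cs"
  shows "filter (%D. f D = g (cs ! k)) (concat Rs) = Rs ! k" using assms
proof (induction arbitrary: k rule: list_all2_induct)
  case (Cons C cs R Rs)
  have rest: "f D \<in> g ` set cs" if D: "D \<in> set (concat Rs)" for D
  proof -
    obtain R where "R \<in> set Rs" "D \<in> set R" using D by auto
    then obtain j where "j < length Rs" "D \<in> set (Rs ! j)" by (metis in_set_conv_nth)
    then show ?thesis using Cons.hyps(2) unfolding list_all2_conv_all_nth by auto
  qed
  show ?case
  proof (cases k)
    case 0
    have "f D ~= g C" if "D \<in> set (concat Rs)" for D using rest[OF that] Cons.prems(1) by auto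
    then have "filter (%D. f D = g C) (concat Rs) = []" unfolding filter_empty_conv by blast
    moreover have "filter (%D. f D = g C) R = R" using Cons.hyps(1) by (simp add: filter_id_conv)
    ultimately show ?thesis using 0 by simp
  next
    case (Suc k')
    then have "g (cs ! k') \<in> g ` set cs" using Cons.prems(2) by auto
    then have "filter (%D. f D = g (cs ! k')) R = []" using Cons.hyps(1) Cons.prems(1) by (auto simp: filter_empty_conv)
    then show ?thesis using Suc Cons.IH[of k'] Cons.prems by simp
  qed
qed simp

text \<open>The deterministic part of the argument, for a single outcome at which all almost sure
  statements hold.\<close>

locale lineage =
  fixes Cs :: "nat => cell list" and \<rho> :: real
  assumes chain_Cs: "chain N (Cs N)"
    and refine_Cs: "\<exists>bss. length bss = length (Cs N) \<and> set bss \<subseteq> codes \<and> Cs (Suc N) = refine_all (Cs N) bss"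
    and root: "Cs 0 = [root_cell]"
    and last_Cs: "last (path_of N (Cs N)) = pt_a"
    and rho_pos: "0 < \<rho>"
    and growing: "k < length (Cs M) ==>
      \<exists>l>0. (%n. len (filter (%D. (half ^^ n) (fst D) = fst (Cs M ! k)) (Cs (M + n))) / \<rho> ^ n) \<longlonglongrightarrow> l"
begin

lemma children: "\<exists>Rs. concat Rs = Cs (Suc N) \<and> list_all2 (%C R. R ~= [] \<and> distinct (map fst R) \<and> (\<forall>D\<in>set R. half (fst D) = fst C)) (Cs N) Rs"
proof -
  obtain bss where b: "length bss = length (Cs N)" "set bss \<subseteq> codes" "Cs (Suc N) = refine_all (Cs N) bss" using refine_Cs by blast
  have "refine (Cs N ! i) (bss ! i) ~= [] \<and> distinct (map fst (refine (Cs N ! i) (bss ! i))) \<and> (\<forall>D\<in>set (refine (Cs N ! i) (bss ! i)). half (fst D) = fst (Cs N ! i))"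
    if i: "i < length (Cs N)" for i
  proof -
    have bc: "bss ! i \<in> codes" using b(1,2) i by (metis nth_mem subsetD)
    note c = chain_nth[OF chain_Cs i]
    show ?thesis using refine_props(1,4,5)[OF bc conjunct2[OF c] conjunct1[OF c]] unfolding chain_def by blast
  qed
  then show ?thesis using b by (intro exI[of _ "map2 refine (Cs N) bss"]) (simp add: refine_all_def list_all2_conv_all_nth)
qed

lemma distinct_blocks:
  "list_all2 (%C R. R ~= [] \<and> distinct (map fst R) \<and> (\<forall>D\<in>set R. half (fst D) = fst C)) cs Rs ==> distinct (map fst cs) ==>
    distinct (map fst (concat Rs)) \<and> (\<forall>D\<in>set (concat Rs). half (fst D) \<in> fst ` set cs)"
proof (induction rule: list_all2_induct)
  case (Cons C cs R Rs)
  then have IH: "distinct (map fst (concat Rs))" "\<forall>D\<in>set (concat Rs). half (fst D) \<in> fst ` set cs" by simp_all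
  have C: "fst C \<notin> fst ` set cs" using Cons.prems by simp
  have "fst ` set R \<inter> fst ` set (concat Rs) = {}"
  proof (rule equals0I)
    fix x assume "x \<in> fst ` set R \<inter> fst ` set (concat Rs)"
    then obtain D D' where D: "D \<in> set R" "x = fst D" "D' \<in> set (concat Rs)" "x = fst D'" by blast
    have "half x = fst C" unfolding D(2) using Cons.hyps(1) D(1) by blast
    moreover have "half x \<in> fst ` set cs" unfolding D(4) by (rule bspec[OF IH(2) D(3)])
    ultimately show False using C by simp
  qed
  then show ?case using Cons.hyps(1) IH by auto
qed simp

text \<open>Children of different cells have different parents, so distinctness is inherited. A
  triangle is thus crossed once, during one interval of time.\<close>

lemma distinct_Cs: "distinct (map fst (Cs N))"
proof (induction N)
  case (Suc N)
  obtain Rs where Rs: "concat Rs = Cs (Suc N)"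
    "list_all2 (%C R. R ~= [] \<and> distinct (map fst R) \<and> (\<forall>D\<in>set R. half (fst D) = fst C)) (Cs N) Rs" using children by blast
  then show ?case using conjunct1[OF distinct_blocks[OF Rs(2) Suc]] by simp
qed (simp add: root)

lemma descendants: "\<exists>Rs. concat Rs = Cs (M + n) \<and> list_all2 (%C R. R ~= [] \<and> (\<forall>D\<in>set R. (half ^^ n) (fst D) = fst C)) (Cs M) Rs"
proof (induction n)
  case 0
  then show ?case by (intro exI[of _ "map (%C. [C]) (Cs M)"]) (simp add: list_all2_conv_all_nth concat_map_singleton)
next
  case (Suc n)
  obtain Rs where Rs: "concat Rs = Cs (M + n)" "list_all2 (%C R. R ~= [] \<and> (\<forall>D\<in>set R. (half ^^ n) (fst D) = fst C)) (Cs M) Rs" using Suc.IH by blast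
  obtain Ts where Ts: "concat Ts = Cs (Suc (M + n))" "list_all2 (%C R. R ~= [] \<and> distinct (map fst R) \<and> (\<forall>D\<in>set R. half (fst D) = fst C)) (concat Rs) Ts" using children[of "M + n"] unfolding Rs(1) by blast
  from list_all2_concat_compose[OF Rs(2) Ts(2)]
  obtain Us where Us0: "concat Us = concat Ts \<and> list_all2 (%C U. \<exists>(X :: cell list) (Y :: cell list list). (X ~= [] \<and> (\<forall>D\<in>set X. (half ^^ n) (fst D) = fst C)) \<and>
      list_all2 (%C R. R ~= [] \<and> distinct (map fst R) \<and> (\<forall>D\<in>set R. half (fst D) = fst C)) X Y \<and> U = concat Y) (Cs M) Us" by (elim exE) (rule that)
  note Us = conjunct1[OF Us0] conjunct2[OF Us0]
  have desc: "(half ^^ Suc n) (fst D) = fst C" if X: "\<forall>D\<in>set X. (half ^^ n) (fst D) = fst C"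
    "list_all2 (%C R. R ~= [] \<and> distinct (map fst R) \<and> (\<forall>D\<in>set R. half (fst D) = fst C)) X Y" and D: "D \<in> set (concat Y)" for C :: cell and D :: cell and X :: "cell list" and Y :: "cell list list"
  proof -
    obtain R where "R \<in> set Y" "D \<in> set R" using D by auto
    then obtain j where j: "j < length Y" "D \<in> set (Y ! j)" by (metis in_set_conv_nth)
    then have "half (fst D) = fst (X ! j)" "X ! j \<in> set X" using X(2) unfolding list_all2_conv_all_nth by auto
    then show ?thesis using X(1) by (simp add: funpow_swap1)
  qed
  have nonempty: "concat Y ~= []" if "X ~= []"
    "list_all2 (%C R. R ~= [] \<and> distinct (map fst R) \<and> (\<forall>D\<in>set R. half (fst D) = fst C)) X Y" for X :: "cell list" and Y :: "cell list list" using that by (cases X; cases Y) auto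
  have "list_all2 (%C R. R ~= [] \<and> (\<forall>D\<in>set R. (half ^^ Suc n) (fst D) = fst C)) (Cs M) Us"
  proof (rule list_all2_mono[OF Us(2)])
    fix C :: cell and U :: "cell list"
    assume "\<exists>(X :: cell list) (Y :: cell list list). (X ~= [] \<and> (\<forall>D\<in>set X. (half ^^ n) (fst D) = fst C)) \<and>
      list_all2 (%C R. R ~= [] \<and> distinct (map fst R) \<and> (\<forall>D\<in>set R. half (fst D) = fst C)) X Y \<and> U = concat Y"
    then obtain X :: "cell list" and Y :: "cell list list" where XY: "X ~= []" "\<forall>D\<in>set X. (half ^^ n) (fst D) = fst C"
      "list_all2 (%C R. R ~= [] \<and> distinct (map fst R) \<and> (\<forall>D\<in>set R. half (fst D) = fst C)) X Y" "U = concat Y" by (elim exE conjE) (rule that)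
    show "U ~= [] \<and> (\<forall>D\<in>set U. (half ^^ Suc n) (fst D) = fst C)" unfolding XY(4) using nonempty[OF XY(1,3)] desc[OF XY(2,3)] by (intro conjI ballI)
  qed
  then show ?case using Us(1) Ts(1) by (intro exI[of _ Us]) (simp only: add_Suc_right simp_thms)
qed

abbreviation "walk N t \<equiv> interpolate (path_of N (Cs N)) t"

text \<open>The number of steps that the walk of level \<open>M + n\<close> makes inside the cell
  with number \<open>k\<close> of level \<open>M\<close>.\<close>

definition L :: "nat => nat => nat => nat" where
  "L M n k = len (filter (%D. (half ^^ n) (fst D) = fst (Cs M ! k)) (Cs (M + n)))"

text \<open>After its end the walk rests at \<open>pt_a\<close> in the last cell, which is why the
  upper bound on \<open>t\<close> is waived for that cell.\<close>

lemma position: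
  fixes t :: real
  assumes "0 \<le> t"
  shows "\<exists>k<length (Cs M). walk (M + n) t \<in> tri M (fst (Cs M ! k)) \<and> (\<Sum>j<k. L M n j) \<le> t \<and>
    (t < (\<Sum>j<Suc k. L M n j) \<or> Suc k = length (Cs M))"
proof -
  let ?C = "Cs (M + n)"
  obtain Rs where Rs: "concat Rs = ?C" "list_all2 (%C R. R ~= [] \<and> (\<forall>D\<in>set R. (half ^^ n) (fst D) = fst C)) (Cs M) Rs" using descendants by blast
  have Rs2: "list_all2 (%C R. \<forall>D\<in>set R. (half ^^ n) (fst D) = fst C) (Cs M) Rs" using Rs(2) by (rule list_all2_mono) simp
  have lR: "length Rs = length (Cs M)" using Rs(2) by (simp add: list_all2_lengthD)
  have R: "Rs ! k = filter (%D. (half ^^ n) (fst D) = fst (Cs M ! k)) ?C" if "k < length (Cs M)" for k using filter_block[OF Rs2 distinct_Cs that] Rs(1) by simp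
  have lenR: "len (Rs ! k) = L M n k" if "k < length (Cs M)" for k using R[OF that] by (simp add: L_def)
  have inside: "tri (M + n) (fst D) \<subseteq> tri M (fst (Cs M ! k))" if "k < length (Cs M)" "D \<in> set (Rs ! k)" for k D
  proof -
    have D: "D \<in> set ?C" "(half ^^ n) (fst D) = fst (Cs M ! k)" using R[OF that(1)] that(2) by auto
    have "fst D \<in> cells three_cells (M + n)" using chain_Cs[of "M + n"] D(1) unfolding chain_def by blast
    then show ?thesis using tri_funpow_half D(2) by metis
  qed
  show ?thesis
  proof (cases "t < len ?C")
    case True
    then obtain k i where ki: "k < length Rs" "i < length ?C" "?C ! i \<in> set (Rs ! k)"
      "len (take i ?C) \<le> t" "t < len (take (Suc i) ?C)" "(\<Sum>j<k. len (Rs ! j)) \<le> t" "t < (\<Sum>j<Suc k. len (Rs ! j))" using locate_block[OF assms, of Rs] unfolding Rs(1) by blast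
    have k: "k < length (Cs M)" using ki(1) lR by simp
    have "walk (M + n) t \<in> tri (M + n) (fst (?C ! i))" by (rule interpolate_in_cell[OF chain_Cs ki(2)]) (use ki in \<open>simp_all add: cum_take del: cum.simps\<close>)
    moreover have "(\<Sum>j<k. len (Rs ! j)) = (\<Sum>j<k. L M n j)" "(\<Sum>j<Suc k. len (Rs ! j)) = (\<Sum>j<Suc k. L M n j)" using k by (auto intro!: sum.cong lenR simp del: sum.lessThan_Suc)
    ultimately show ?thesis using inside[OF k ki(3)] ki(6,7) k by (intro exI[of _ k]) auto
  next
    case False
    let ?k = "length (Cs M) - 1"
    have ne: "Cs M ~= []" "?C ~= []" using chain_Cs by (auto simp: chain_def)
    then have k: "?k < length (Cs M)" "Suc ?k = length (Cs M)" by simp_all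
    have tot: "len (concat Xs) = (\<Sum>j<length Xs. len (Xs ! j))" for Xs by (induction Xs) (simp_all add: sum.lessThan_Suc_shift del: sum.lessThan_Suc)
    have "len ?C = (\<Sum>j<length (Cs M). L M n j)" using tot[of Rs] lenR unfolding Rs(1) lR by simp
    then have "len ?C = (\<Sum>j<?k. L M n j) + L M n ?k" using k(2) by (metis sum.lessThan_Suc)
    then have le: "(\<Sum>j<?k. L M n j) \<le> t" using False by linarith
    have tw: "walk (M + n) t \<in> tri (M + n) (fst (?C ! (length ?C - 1)))" by (rule interpolate_end[OF chain_Cs last_Cs]) (use False in simp)
    have "Rs ~= []" using lR k(1) by auto
    then have Rk: "Rs ~= []" "last Rs = Rs ! ?k" using last_conv_nth[OF \<open>Rs ~= []\<close>] unfolding lR by simp_all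
    have "Rs ! ?k ~= []" using Rs(2) k(1) unfolding list_all2_conv_all_nth by blast
    then have "last (concat Rs) = last (Rs ! ?k)" using Rk by (metis append_butlast_last_id concat.simps concat_append append_Nil2 last_appendR)
    then have "?C ! (length ?C - 1) = last (Rs ! ?k)" unfolding Rs(1) last_conv_nth[OF ne(2), symmetric] .
    then have mem: "?C ! (length ?C - 1) \<in> set (Rs ! ?k)" using last_in_set[OF \<open>Rs ! ?k ~= []\<close>] by (simp only:)
    have "walk (M + n) t \<in> tri M (fst (Cs M ! ?k))" by (rule subsetD[OF inside[OF k(1) mem] tw])
    then show ?thesis using k le by (intro exI[of _ ?k] conjI disjI2)
  qed
qed

lemma uniformly_Cauchy: "uniformly_Cauchy_on {0..} (%N t. walk N (\<rho> ^ N * t))"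
proof (rule uniformly_Cauchy_onI)
  fix e :: real assume e: "0 < e"
  \<comment> \<open>Two consecutive triangles of level \<open>M\<close> share a vertex and have
    diameter at most 2^-M each.\<close>
  obtain M :: nat where M: "2 / 2 ^ M < e"
  proof -
    obtain M where "(1 / 2 :: real) ^ M < e / 2" using real_arch_pow_inv[of "e / 2" "1 / 2"] e by auto
    then show thesis using that[of M] by (simp add: power_divide field_simps)
  qed
  let ?K = "length (Cs M)"
  define B where "B = (%n i. (\<Sum>k<i. real (L M n k) / \<rho> ^ n))"
  have rp: "0 < \<rho> ^ n" for n using rho_pos by simp
  have Bs: "B n i = (\<Sum>k<i. L M n k) / \<rho> ^ n" for n i unfolding B_def by (simp add: sum_divide_distrib)
  have "\<forall>k. \<exists>l. k < ?K --> 0 < l \<and> (%n. real (L M n k) / \<rho> ^ n) \<longlonglongrightarrow> l" using growing unfolding L_def by blast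
  then obtain l where l: "!!k. k < ?K ==> 0 < l k" "!!k. k < ?K ==> (%n. real (L M n k) / \<rho> ^ n) \<longlonglongrightarrow> l k" by metis
  define \<beta> where "\<beta> = (%i. \<Sum>k<i. l k)"
  have lim: "(%n. B n i) \<longlonglongrightarrow> \<beta> i" if "i \<le> ?K" for i unfolding B_def \<beta>_def by (rule tendsto_sum) (use l(2) that in auto)
  \<comment> \<open>Separators between consecutive limit times. For large \<open>n\<close> the
    boundary \<open>B n i\<close> lies to the left of \<open>\<mu> i\<close> and
    \<open>B n (Suc i)\<close> to its right, so at a common time two walks are at most one triangle
    apart.\<close>
  define \<mu> where "\<mu> = (%i. (\<beta> i + \<beta> (Suc i)) / 2)"
  have \<beta>: "\<beta> i < \<mu> i" "\<mu> i < \<beta> (Suc i)" if "i < ?K" for i using l(1)[OF that] by (simp_all add: \<mu>_def \<beta>_def)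
  have \<mu>_mono: "\<mu> i \<le> \<mu> j" if "i \<le> j" "j < ?K" for i j using that
  proof (induction j rule: dec_induct)
    case (step j)
    then show ?case using \<beta>(2)[of j] \<beta>(1)[of "Suc j"] by linarith
  qed simp
  have "\<forall>\<^sub>F n in sequentially. \<forall>i\<in>{..<?K}. B n i < \<mu> i \<and> \<mu> i < B n (Suc i)"
  proof (intro eventually_ball_finite ballI)
    fix i assume "i \<in> {..<?K}"
    then have i: "i < ?K" by simp
    show "\<forall>\<^sub>F n in sequentially. B n i < \<mu> i \<and> \<mu> i < B n (Suc i)" using order_tendstoD(2)[OF lim[of i] \<beta>(1)[OF i]] order_tendstoD(1)[OF lim[of "Suc i"] \<beta>(2)[OF i]] i
      by (auto intro: eventually_conj)
  qed simp
  then obtain n\<^sub>0 where n0: "!!n i. n\<^sub>0 \<le> n ==> i < ?K ==> B n i < \<mu> i \<and> \<mu> i < B n (Suc i)" unfolding eventually_sequentially by auto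
  have pos: "\<exists>k<?K. walk (M + n) (\<rho> ^ (M + n) * t) \<in> tri M (fst (Cs M ! k)) \<and> B n k \<le> \<rho> ^ M * t \<and>
      (\<rho> ^ M * t < B n (Suc k) \<or> Suc k = ?K)" if t: "0 \<le> t" for n t
  proof -
    have "0 \<le> \<rho> ^ (M + n) * t" using t rho_pos by simp
    from position[OF this, of M n] obtain k where k: "k < ?K" "walk (M + n) (\<rho> ^ (M + n) * t) \<in> tri M (fst (Cs M ! k))"
      "(\<Sum>j<k. L M n j) \<le> \<rho> ^ (M + n) * t" "\<rho> ^ (M + n) * t < (\<Sum>j<Suc k. L M n j) \<or> Suc k = ?K" by blast
    have e: "\<rho> ^ (M + n) * t = (\<rho> ^ M * t) * \<rho> ^ n" by (simp add: power_add)
    show ?thesis using k(1,2) k(3,4)[unfolded e] unfolding Bs pos_divide_le_eq[OF rp] pos_less_divide_eq[OF rp] e by blast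
  qed
  have order: "k \<le> Suc k'" if "n\<^sub>0 \<le> n" "n\<^sub>0 \<le> n'" "k < ?K" "k' < ?K" "B n k \<le> s" "s < B n' (Suc k') \<or> Suc k' = ?K" for n n' k k' s
  proof (rule ccontr)
    assume *: "\<not> k \<le> Suc k'"
    then have "s < B n' (Suc k')" using that by auto
    also have "... < \<mu> (Suc k')" using n0[OF that(2), of "Suc k'"] * that by auto
    also have "... \<le> \<mu> (k - 1)" by (rule \<mu>_mono) (use * that in auto)
    also have "... < B n k" using n0[OF that(1), of "k - 1"] * that by auto
    finally show False using that by simp
  qed
  have near: "dist x y \<le> 2 / 2 ^ M" if k: "k \<le> k'" "k' \<le> Suc k" "k' < ?K" and x: "x \<in> tri M (fst (Cs M ! k))" and y: "y \<in> tri M (fst (Cs M ! k'))" for k k' x y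
  proof -
    obtain z where z: "z \<in> tri M (fst (Cs M ! k))" "z \<in> tri M (fst (Cs M ! k'))"
    proof (cases "k' = k")
      case True
      then show thesis using that x by simp
    next
      case False
      then have "k' = Suc k" using k by simp
      then show thesis using that[of "cell_pt M (Cs M ! k) C1"] chain_link[OF chain_Cs, of k M] cell_pt_tri k(3) by metis
    qed
    have "dist x y \<le> dist x z + dist z y" by (rule dist_triangle)
    then show ?thesis using tri_diameter[OF x z(1)] tri_diameter[OF z(2) y] by simp
  qed
  have main: "dist (walk (M + n) (\<rho> ^ (M + n) * t)) (walk (M + n') (\<rho> ^ (M + n') * t)) < e"
    if n: "n\<^sub>0 \<le> n" "n\<^sub>0 \<le> n'" and t: "0 \<le> t" for n n' t
  proof -
    obtain k where k: "k < ?K" "walk (M + n) (\<rho> ^ (M + n) * t) \<in> tri M (fst (Cs M ! k))" "B n k \<le> \<rho> ^ M * t"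
      "\<rho> ^ M * t < B n (Suc k) \<or> Suc k = ?K" using pos[OF t, of n] by blast
    obtain k' where k': "k' < ?K" "walk (M + n') (\<rho> ^ (M + n') * t) \<in> tri M (fst (Cs M ! k'))" "B n' k' \<le> \<rho> ^ M * t"
      "\<rho> ^ M * t < B n' (Suc k') \<or> Suc k' = ?K" using pos[OF t, of n'] by blast
    have "k \<le> Suc k'" "k' \<le> Suc k" using order[OF n k(1) k'(1) k(3) k'(4)] order[OF n(2,1) k'(1) k(1) k'(3) k(4)] by auto
    then have "dist (walk (M + n) (\<rho> ^ (M + n) * t)) (walk (M + n') (\<rho> ^ (M + n') * t)) \<le> 2 / 2 ^ M" using near[of k k', OF _ _ k'(1) k(2) k'(2)] near[of k' k, OF _ _ k(1) k'(2) k(2)]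
      by (cases "k \<le> k'") (auto simp: dist_commute)
    then show ?thesis using M by simp
  qed
  show "\<exists>N0. \<forall>t\<in>{0..}. \<forall>N\<ge>N0. \<forall>N'\<ge>N0. dist (walk N (\<rho> ^ N * t)) (walk N' (\<rho> ^ N' * t)) < e"
  proof (intro exI[of _ "M + n\<^sub>0"] ballI allI impI)
    fix t :: real and N N' assume "t \<in> {0..}" "M + n\<^sub>0 \<le> N" "M + n\<^sub>0 \<le> N'"
    then show "dist (walk N (\<rho> ^ N * t)) (walk N' (\<rho> ^ N' * t)) < e" using main[of "N - M" "N' - M" t] by simp
  qed
qed

end


section \<open>The erased walks as a branching process\<close>

definition types :: "(int \<times> int => bool) => cell list => bool list" where
  "types P cs = map (%D. snd (snd D)) (filter (%D. P (fst D)) cs)"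

lemma types_append: "types P (cs @ ds) = types P cs @ types P ds" by (simp add: types_def)

lemma len_types: "real (len (filter (%D. P (fst D)) cs)) = sum_list (map (%s. if s then 2 else 1) (types P cs))" by (induction cs) (auto simp: types_def cell_len_def)

text \<open>Selecting children by a property of their parents selects whole litters. The descendants
  of one triangle therefore form a branching process of their own.\<close>

lemma brood_types:
  assumes t: "total_mass_one u" and cs: "\<forall>C\<in>set cs. fst C \<in> cells three_cells N \<and> inj (fst (snd C))"
  shows "map_pmf (%bss. types (%c. P (half c)) (refine_all cs bss)) (codes_pmf u cs) = brood (code_pmf u) (types P cs)" using cs
proof (induction cs)
  case Nil
  then show ?case by (simp add: refine_all_def types_def)
next
  case (Cons C cs)
  have C: "inj (fst (snd C))" "fst C \<in> cells three_cells N" using Cons.prems by (simp_all del: cells.simps)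
  have IH: "map_pmf (%bss. types (%c. P (half c)) (refine_all cs bss)) (codes_pmf u cs) = brood (code_pmf u) (types P cs)" by (rule Cons.IH) (use Cons.prems in \<open>simp del: cells.simps\<close>)
  have split: "types Q (refine_all (C # cs) (bs # bss)) = types Q (refine C bs) @ types Q (refine_all cs bss)" for Q bs bss by (simp add: refine_all_def types_append)
  have ty: "types (%c. P (half c)) (refine C bs) = (if P (fst C) then bs else [])" if "bs \<in> codes" for bs
  proof -
    note rp = refine_props(4,6)[OF that C]
    have "filter (%D. P (half (fst D))) (refine C bs) = (if P (fst C) then refine C bs else [])" using rp(1) by (auto simp: filter_id_conv filter_empty_conv simp del: split_paired_All)
    then show ?thesis using rp(2) by (simp add: types_def)
  qed
  have "map_pmf (%bss. types (%c. P (half c)) (refine_all (C # cs) bss)) (codes_pmf u (C # cs)) =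
    bind_pmf (code_pmf u (snd (snd C))) (%bs. map_pmf (%bss. types (%c. P (half c)) (refine C bs) @ types (%c. P (half c)) (refine_all cs bss)) (codes_pmf u cs))" by (simp add: map_bind_pmf map_pmf_comp split)
  also have "... = bind_pmf (code_pmf u (snd (snd C))) (%bs. map_pmf ((@) (if P (fst C) then bs else [])) (brood (code_pmf u) (types P cs)))"
  proof (rule bind_pmf_cong[OF refl])
    fix bs assume "bs \<in> set_pmf (code_pmf u (snd (snd C)))"
    then have "bs \<in> codes" using set_code_pmf[OF t] by blast
    show "map_pmf (%bss. types (%c. P (half c)) (refine C bs) @ types (%c. P (half c)) (refine_all cs bss)) (codes_pmf u cs) =
        map_pmf ((@) (if P (fst C) then bs else [])) (brood (code_pmf u) (types P cs))" unfolding ty[OF \<open>bs \<in> codes\<close>] IH[symmetric] map_pmf_comp ..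
  qed
  also have "... = brood (code_pmf u) (types P (C # cs))"
  proof -
    have "map_pmf ((@) []) p = p" for p :: "bool list pmf" by (rule pmf.map_ident_strong) simp
    then show ?thesis by (cases "P (fst C)") (simp_all add: types_def)
  qed
  finally show ?case .
qed

lemma set_codes_pmf:
  assumes "total_mass_one u"
  shows "bss \<in> set_pmf (codes_pmf u cs) ==> length bss = length cs \<and> set bss \<subseteq> codes"
proof (induction cs arbitrary: bss)
  case (Cons C cs)
  then obtain bs bss' where "bss = bs # bss'" "bs \<in> set_pmf (code_pmf u (snd (snd C)))" "bss' \<in> set_pmf (codes_pmf u cs)" by auto
  then show ?case using Cons.IH[of bss'] set_code_pmf[OF assms] by auto
qed simp

lemma finite_codes_pmf: "total_mass_one u ==> finite (set_pmf (codes_pmf u cs))" by (induction cs) (auto intro: finite_subset[OF set_code_pmf finite_codes])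

lemma cells_pmf_Suc:
  assumes "total_mass_one u"
  shows "cells_pmf u (Suc N) = bind_pmf (cells_pmf u N) (%cs. map_pmf (refine_all cs) (codes_pmf u cs))"
proof -
  have "cells_pmf u (Suc N) = map_pmf snd (map_pmf (%w. (decode N (Qhat N w), decode (Suc N) (Qhat (Suc N) w))) (W_pmf u (Suc N)))" unfolding cells_pmf_def map_pmf_comp by simp
  then show ?thesis unfolding W_pmf_step[OF assms] by (simp add: map_bind_pmf map_pmf_comp)
qed

lemma cells_pmf_0: "cells_pmf u 0 = return_pmf [root_cell]"
proof -
  have "Qhat 0 [0, pt_a] = path_of 0 [root_cell]" using Q_lattice_path[OF lattice_path_of[OF chain_root(1)]] chain_root(2) by (simp add: Qhat_def)
  then show ?thesis using decode_path_of[OF chain_root(1)] by (simp add: cells_pmf_def)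
qed

lemma finite_cells_pmf: "total_mass_one u ==> finite (set_pmf (cells_pmf u N))" by (induction N) (simp_all add: cells_pmf_0 cells_pmf_Suc finite_codes_pmf)

lemma chain_cells_pmf:
  assumes t: "total_mass_one u" and cs: "cs \<in> set_pmf (cells_pmf u N)"
  shows "chain N cs"
proof -
  obtain v where v: "v \<in> set_pmf (W_pmf u N)" "cs = decode N (Qhat N v)" using cs by (auto simp: cells_pmf_def)
  then show ?thesis using W_pmf_chain[OF t v(1) order_refl] decode_path_of by metis
qed

text \<open>For finitely many values the probabilities of single points determine the law on all
  subsets, which allows passing from the product sigma-algebra to discrete laws.\<close>

lemma finite_range_law:
  assumes P: "prob_space Pr" and F: "finite F" and Z: "!!\<omega>. \<omega> \<in> space Pr ==> Z \<omega> \<in> F"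
    and m: "!!p. {\<omega> \<in> space Pr. Z \<omega> = p} \<in> sets Pr" and e: "!!p. emeasure Pr {\<omega> \<in> space Pr. Z \<omega> = p} = ennreal (pmf q p)"
  shows "Z \<in> Pr \<rightarrow>\<^sub>M count_space UNIV" "distr Pr (count_space UNIV) Z = measure_pmf q"
proof -
  interpret prob_space Pr by (rule P)
  have pre: "Z -` A \<inter> space Pr = (\<Union>p\<in>A \<inter> F. {\<omega> \<in> space Pr. Z \<omega> = p})" for A using Z by auto
  have sets: "Z -` A \<inter> space Pr \<in> sets Pr" for A unfolding pre by (rule sets.finite_UN) (use F m in auto)
  then show M: "Z \<in> Pr \<rightarrow>\<^sub>M count_space UNIV" by (intro measurableI) auto
  have em: "emeasure Pr (Z -` A \<inter> space Pr) = emeasure q (A \<inter> F)" for A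
  proof -
    have "emeasure Pr (Z -` A \<inter> space Pr) = (\<Sum>p\<in>A \<inter> F. emeasure Pr {\<omega> \<in> space Pr. Z \<omega> = p})"
      unfolding pre by (rule sum_emeasure[symmetric]) (use F m in \<open>auto simp: disjoint_family_on_def\<close>)
    then show ?thesis using F by (simp add: e emeasure_measure_pmf_finite)
  qed
  have "emeasure q F = 1" using em[of UNIV] emeasure_space_1 by simp
  then have "measure q F = 1" by (simp add: measure_pmf.emeasure_eq_measure)
  then have F1: "AE x in q. x \<in> F" by (intro measure_pmf.AE_prob_1)
  show "distr Pr (count_space UNIV) Z = measure_pmf q"
  proof (rule measure_eqI)
    fix A
    have "emeasure q (A \<inter> F) = emeasure q A" by (rule emeasure_eq_AE) (use F1 in auto)
    then show "emeasure (distr Pr (count_space UNIV) Z) A = emeasure q A" using em[of A] emeasure_distr[OF M, of A] by simp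
  qed simp
qed

section \<open>Branching structure of the given walks\<close>

locale erased_walks =
  fixes u :: real and Pr :: "'w measure" and Y :: "nat => 'w => path"
  assumes u0: "0 \<le> u" and walks: "loop_erased_walks u Pr Y"
begin

lemma Pr: "prob_space Pr" using walks by (simp add: loop_erased_walks_def)

lemma Y_Gamma: "Y N \<in> Pr \<rightarrow>\<^sub>M count_space (Gamma N)" using walks by (simp add: loop_erased_walks_def)

lemma Y_measurable: "Y N \<in> Pr \<rightarrow>\<^sub>M count_space UNIV" by (rule measurable_compose[OF Y_Gamma, of "%x. x"]) simp

lemma Y_mem: "\<omega> \<in> space Pr ==> Y N \<omega> \<in> Gamma N" using measurable_space[OF Y_Gamma] by simp

lemma joint_law:
  assumes A: "A \<in> sets (\<Pi>\<^sub>M k\<in>{..N}. count_space UNIV)"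
  shows "emeasure Pr {\<omega> \<in> space Pr. (\<lambda>k\<in>{..N}. Y k \<omega>) \<in> A} = emeasure (W_law u N) {v \<in> W N. (\<lambda>k\<in>{..N}. Qhat k v) \<in> A}"
proof -
  let ?M = "\<Pi>\<^sub>M k\<in>{..N}. count_space (UNIV :: path set)"
  have mY: "(%\<omega>. \<lambda>k\<in>{..N}. Y k \<omega>) \<in> Pr \<rightarrow>\<^sub>M ?M" by (intro measurable_restrict Y_measurable)
  have sp: "space (W_law u N) = W N" "sets (W_law u N) = Pow (W N)" by (simp_all add: W_law_def space_point_measure sets_point_measure)
  have "Qhat k \<in> W_law u N \<rightarrow>\<^sub>M count_space UNIV" for k by (intro measurableI) (auto simp: sp)
  then have mQ: "(%v. \<lambda>k\<in>{..N}. Qhat k v) \<in> W_law u N \<rightarrow>\<^sub>M ?M" by (intro measurable_restrict)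
  have eq: "distr Pr ?M (%\<omega>. \<lambda>k\<in>{..N}. Y k \<omega>) = distr (W_law u N) ?M (%v. \<lambda>k\<in>{..N}. Qhat k v)" using walks by (simp add: loop_erased_walks_def)
  have "emeasure Pr ((%\<omega>. \<lambda>k\<in>{..N}. Y k \<omega>) -` A \<inter> space Pr) = emeasure (W_law u N) ((%v. \<lambda>k\<in>{..N}. Qhat k v) -` A \<inter> space (W_law u N))"
    using emeasure_distr[OF mY A] emeasure_distr[OF mQ A] eq by simp
  moreover have "(%\<omega>. \<lambda>k\<in>{..N}. Y k \<omega>) -` A \<inter> space Pr = {\<omega> \<in> space Pr. (\<lambda>k\<in>{..N}. Y k \<omega>) \<in> A}"
    "(%v. \<lambda>k\<in>{..N}. Qhat k v) -` A \<inter> space (W_law u N) = {v \<in> W N. (\<lambda>k\<in>{..N}. Qhat k v) \<in> A}" unfolding sp by blast+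
  ultimately show ?thesis by (simp only:)
qed

text \<open>The law of the walks is a probability measure and an image of the path measure, which
  therefore has the same total mass.\<close>

lemma total_mass: "total_mass_one u" unfolding total_mass_one_def
proof
  fix N :: nat
  interpret prob_space Pr by (rule Pr)
  let ?M = "\<Pi>\<^sub>M k\<in>{..N}. count_space (UNIV :: path set)"
  have s: "(\<lambda>k\<in>{..N}. f k) \<in> space ?M" for f :: "nat => path" by (simp add: space_PiM)
  have "emeasure (W_law u N) (W N) = 1" using joint_law[OF sets.top, of N] s emeasure_space_1 by simp
  moreover have "emeasure (W_law u N) (W N) = (\<integral>\<^sup>+ w. ennreal (W_mass u N w) * indicator (W N) w \<partial>count_space (W N))" unfolding W_law_def point_measure_def by (rule emeasure_density) auto
  moreover have "... = (\<integral>\<^sup>+ w. ennreal (W_mass u N w) \<partial>count_space (W N))" by (rule nn_integral_cong) simp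
  ultimately show "(\<integral>\<^sup>+ w. ennreal (W_mass u N w) \<partial>count_space (W N)) = 1" by simp
qed

definition paths :: "nat => (path \<times> path) pmf" where
  "paths N = map_pmf (%v. (Qhat N v, Qhat (Suc N) v)) (W_pmf u (Suc N))"

lemma Y_pair:
  "(%\<omega>. (Y N \<omega>, Y (Suc N) \<omega>)) \<in> Pr \<rightarrow>\<^sub>M count_space UNIV"
  "distr Pr (count_space UNIV) (%\<omega>. (Y N \<omega>, Y (Suc N) \<omega>)) = measure_pmf (paths N)"
proof -
  let ?M = "\<Pi>\<^sub>M k\<in>{..Suc N}. count_space (UNIV :: path set)"
  let ?Z = "%\<omega>. (Y N \<omega>, Y (Suc N) \<omega>)"
  have single: "{\<omega> \<in> space Pr. Y k \<omega> = \<gamma>} \<in> sets Pr" for k \<gamma> using measurable_sets[OF Y_measurable[of k], of "{\<gamma>}"] by (simp add: vimage_def Int_def conj_commute)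
  have m: "{\<omega> \<in> space Pr. ?Z \<omega> = p} \<in> sets Pr" for p
  proof -
    have "{\<omega> \<in> space Pr. ?Z \<omega> = p} = {\<omega> \<in> space Pr. Y N \<omega> = fst p} \<inter> {\<omega> \<in> space Pr. Y (Suc N) \<omega> = snd p}" by (cases p) auto
    then show ?thesis using single by auto
  qed
  have e: "emeasure Pr {\<omega> \<in> space Pr. ?Z \<omega> = p} = ennreal (pmf (paths N) p)" for p
  proof -
    let ?A = "((%y. y N) -` {fst p} \<inter> space ?M) \<inter> ((%y. y (Suc N)) -` {snd p} \<inter> space ?M)"
    have A: "?A \<in> sets ?M" by (intro sets.Int measurable_sets[OF measurable_component_singleton]) auto
    have s: "(\<lambda>k\<in>{..Suc N}. f k) \<in> space ?M" for f by (simp add: space_PiM)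
    have mem: "(\<lambda>k\<in>{..Suc N}. f k) \<in> ?A \<longleftrightarrow> (f N, f (Suc N)) = p" for f using s[of f] by (cases p) auto
    have "emeasure Pr {\<omega> \<in> space Pr. ?Z \<omega> = p} = emeasure (W_law u (Suc N)) {v \<in> W (Suc N). (Qhat N v, Qhat (Suc N) v) = p}" using joint_law[OF A] unfolding mem .
    also have "... = emeasure (W_pmf u (Suc N)) {v. (Qhat N v, Qhat (Suc N) v) = p}" by (rule W_law_pmf[OF total_mass])
    also have "... = ennreal (pmf (paths N) p)" unfolding paths_def pmf_map by (simp add: measure_pmf.emeasure_eq_measure vimage_def)
    finally show ?thesis .
  qed
  have F: "finite (Gamma N \<times> Gamma (Suc N))" by (simp add: finite_Gamma)
  have Z: "?Z \<omega> \<in> Gamma N \<times> Gamma (Suc N)" if "\<omega> \<in> space Pr" for \<omega> using Y_mem[OF that] by blast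
  note law = finite_range_law[OF Pr F Z m e]
  show "?Z \<in> Pr \<rightarrow>\<^sub>M count_space UNIV" by (rule law(1))
  show "distr Pr (count_space UNIV) ?Z = measure_pmf (paths N)" by (rule law(2))
qed

text \<open>Meaningful on the almost sure event that \<open>Y N \<omega>\<close> is the path of a
  chain, see \<open>AE_chain\<close>.\<close>

definition C :: "nat => 'w => cell list" where "C N \<omega> = decode N (Y N \<omega>)"

lemma C_pair:
  "(%\<omega>. (C N \<omega>, C (Suc N) \<omega>)) \<in> Pr \<rightarrow>\<^sub>M count_space UNIV"
  "distr Pr (count_space UNIV) (%\<omega>. (C N \<omega>, C (Suc N) \<omega>)) =
    measure_pmf (bind_pmf (cells_pmf u N) (%cs. map_pmf (%bss. (cs, refine_all cs bss)) (codes_pmf u cs)))"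
proof -
  let ?g = "%p. (decode N (fst p), decode (Suc N) (snd p))"
  have g: "?g \<in> count_space UNIV \<rightarrow>\<^sub>M count_space UNIV" by simp
  show "(%\<omega>. (C N \<omega>, C (Suc N) \<omega>)) \<in> Pr \<rightarrow>\<^sub>M count_space UNIV" using measurable_compose[OF Y_pair(1) g] by (simp add: C_def)
  have "distr Pr (count_space UNIV) (%\<omega>. (C N \<omega>, C (Suc N) \<omega>)) = distr (distr Pr (count_space UNIV) (%\<omega>. (Y N \<omega>, Y (Suc N) \<omega>))) (count_space UNIV) ?g"
    by (subst distr_distr[OF g Y_pair(1)]) (simp add: C_def comp_def)
  also have "... = measure_pmf (map_pmf ?g (paths N))" unfolding Y_pair(2) map_pmf_rep_eq ..
  also have "map_pmf ?g (paths N) = bind_pmf (cells_pmf u N) (%cs. map_pmf (%bss. (cs, refine_all cs bss)) (codes_pmf u cs))" unfolding paths_def map_pmf_comp fst_conv snd_conv by (rule W_pmf_step[OF total_mass])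
  finally show "distr Pr (count_space UNIV) (%\<omega>. (C N \<omega>, C (Suc N) \<omega>)) =
    measure_pmf (bind_pmf (cells_pmf u N) (%cs. map_pmf (%bss. (cs, refine_all cs bss)) (codes_pmf u cs)))" .
qed

lemma AE_pairI:
  assumes "Z \<in> Pr \<rightarrow>\<^sub>M count_space UNIV" "distr Pr (count_space UNIV) Z = measure_pmf q" "!!p. p \<in> set_pmf q ==> P p"
  shows "AE \<omega> in Pr. P (Z \<omega>)"
proof -
  have "AE p in distr Pr (count_space UNIV) Z. P p" unfolding assms(2) using assms(3) by (simp add: AE_measure_pmf_iff)
  then show ?thesis by (subst (asm) AE_distr_iff[OF assms(1)]) auto
qed

lemma AE_chain: "AE \<omega> in Pr. chain N (C N \<omega>) \<and> path_of N (C N \<omega>) = Y N \<omega>"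
proof -
  have "chain N (decode N (fst p)) \<and> path_of N (decode N (fst p)) = fst p" if p: "p \<in> set_pmf (paths N)" for p
  proof -
    obtain v where v: "v \<in> set_pmf (W_pmf u (Suc N))" "p = (Qhat N v, Qhat (Suc N) v)" using p by (auto simp: paths_def)
    obtain cs where cs: "chain N cs" "Qhat N v = path_of N cs" using W_pmf_chain[OF total_mass v(1), of N] by auto
    show ?thesis unfolding v(2) fst_conv cs(2) decode_path_of[OF cs(1)] using cs(1) by simp
  qed
  from AE_pairI[where P = "%p. chain N (decode N (fst p)) \<and> path_of N (decode N (fst p)) = fst p", OF Y_pair(1)[of N] Y_pair(2)[of N] this] show ?thesis by (simp add: C_def)
qed

lemma AE_refine: "AE \<omega> in Pr. \<exists>bss. length bss = length (C N \<omega>) \<and> set bss \<subseteq> codes \<and> C (Suc N) \<omega> = refine_all (C N \<omega>) bss"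
proof -
  have "\<exists>bss. length bss = length (fst p) \<and> set bss \<subseteq> codes \<and> snd p = refine_all (fst p) bss"
    if "p \<in> set_pmf (bind_pmf (cells_pmf u N) (%cs. map_pmf (%bss. (cs, refine_all cs bss)) (codes_pmf u cs)))" for p using that set_codes_pmf[OF total_mass] by fastforce
  from AE_pairI[where P = "%p. \<exists>bss. length bss = length (fst p) \<and> set bss \<subseteq> codes \<and> snd p = refine_all (fst p) bss", OF C_pair(1)[of N] C_pair(2)[of N] this] show ?thesis by simp
qed

lemma AE_root: "AE \<omega> in Pr. C 0 \<omega> = [root_cell]"
proof -
  have "fst p = [root_cell]" if "p \<in> set_pmf (bind_pmf (cells_pmf u 0) (%cs. map_pmf (%bss. (cs, refine_all cs bss)) (codes_pmf u cs)))" for p using that by (auto simp: cells_pmf_0)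
  from AE_pairI[where P = "%p. fst p = [root_cell]", OF C_pair(1)[of 0] C_pair(2)[of 0] this] show ?thesis by simp
qed

lemma last_Y: "\<omega> \<in> space Pr ==> Y N \<omega> ~= [] \<and> last (Y N \<omega>) = pt_a" using Y_mem[of \<omega> N] by (auto simp: Gamma_def W_def V_def nn_path_def split: if_splits)

text \<open>Stated for a fixed base \<open>d\<close> rather than for a cell of the random skeleton,
  so that countably many null sets suffice. The number of steps combines the functionals of both
  eigenvectors, of which only the dominant one survives the scaling.\<close>

lemma AE_growing:
  "AE \<omega> in Pr. types (%c. c = d) (C M \<omega>) ~= [] -->
    (\<exists>l>0. (%n. len (filter (%D. (half ^^ n) (fst D) = d) (C (M + n) \<omega>)) / lam u ^ n) \<longlonglongrightarrow> l)"
proof (rule growth[OF total_mass u0])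
  note t = total_mass
  fix \<theta> :: real and h g :: "bool => real" and \<alpha> \<beta> :: real
  assume gr: "2 \<le> lam u" "\<bar>\<theta>\<bar> < lam u" "!!s. 0 < h s"
    "!!r. measure_pmf.expectation (code_pmf u r) (%bs. sum_list (map h bs)) = lam u * h r"
    "!!r. measure_pmf.expectation (code_pmf u r) (%bs. sum_list (map g bs)) = \<theta> * g r"
    "!!s. (if s then 2 else 1) = \<alpha> * h s + \<beta> * g s"
  interpret prob_space Pr by (rule Pr)
  \<comment> \<open>Generation \<open>n\<close> consists of the types of those cells of level
    \<open>M + n\<close> that descend from the cell with base \<open>d\<close>.\<close>
  define Z where "Z = (%n \<omega>. types (%c. (half ^^ n) c = d) (C (M + n) \<omega>))"
  define law where "law = (%n. map_pmf (types (%c. (half ^^ n) c = d)) (cells_pmf u (M + n)))"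
  interpret branching "code_pmf u" "lam u" h 3 Pr Z law
  proof unfold_locales
    show "finite (set_pmf (code_pmf u r))" for r by (rule finite_subset[OF set_code_pmf[OF t] finite_codes])
    show "2 \<le> length bs" "length bs \<le> 3" if "bs \<in> set_pmf (code_pmf u r)" for bs r using that set_code_pmf[OF t] code_counts(3,4) by blast+
    show "finite (set_pmf (law n))" for n by (simp add: law_def finite_cells_pmf[OF t])
    fix n
    let ?g = "%p. (types (%c. (half ^^ n) c = d) (fst p), types (%c. (half ^^ Suc n) c = d) (snd p))"
    let ?q = "bind_pmf (cells_pmf u (M + n)) (%cs. map_pmf (%bss. (cs, refine_all cs bss)) (codes_pmf u cs))"
    have g: "?g \<in> count_space UNIV \<rightarrow>\<^sub>M count_space UNIV" by simp
    have Zg: "(%\<omega>. (Z n \<omega>, Z (Suc n) \<omega>)) = (%\<omega>. ?g (C (M + n) \<omega>, C (Suc (M + n)) \<omega>))" by (simp add: Z_def)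
    show "(%\<omega>. (Z n \<omega>, Z (Suc n) \<omega>)) \<in> Pr \<rightarrow>\<^sub>M count_space UNIV" unfolding Zg by (rule measurable_compose[OF C_pair(1) g])
    have "distr Pr (count_space UNIV) (%\<omega>. (Z n \<omega>, Z (Suc n) \<omega>)) =
        distr (distr Pr (count_space UNIV) (%\<omega>. (C (M + n) \<omega>, C (Suc (M + n)) \<omega>))) (count_space UNIV) ?g" unfolding Zg by (subst distr_distr[OF g C_pair(1)]) (simp add: comp_def)
    also have "... = measure_pmf (map_pmf ?g ?q)" unfolding C_pair(2) map_pmf_rep_eq ..
    also have "map_pmf ?g ?q = bind_pmf (cells_pmf u (M + n)) (%cs. map_pmf (Pair (types (%c. (half ^^ n) c = d) cs))
        (brood (code_pmf u) (types (%c. (half ^^ n) c = d) cs)))" unfolding map_bind_pmf map_pmf_comp fst_conv snd_conv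
    proof (rule bind_pmf_cong[OF refl])
      fix cs assume "cs \<in> set_pmf (cells_pmf u (M + n))"
      then have "chain (M + n) cs" by (rule chain_cells_pmf[OF t])
      then have cs: "\<forall>C\<in>set cs. fst C \<in> cells three_cells (M + n) \<and> inj (fst (snd C))" unfolding chain_def by blast
      show "map_pmf (%bss. (types (%c. (half ^^ n) c = d) cs, types (%c. (half ^^ Suc n) c = d) (refine_all cs bss))) (codes_pmf u cs) =
          map_pmf (Pair (types (%c. (half ^^ n) c = d) cs)) (brood (code_pmf u) (types (%c. (half ^^ n) c = d) cs))" unfolding brood_types[OF t cs, symmetric] map_pmf_comp funpow_Suc_right comp_def ..
    qed
    also have "... = bind_pmf (law n) (%z. map_pmf (Pair z) (brood (code_pmf u) z))" unfolding law_def bind_map_pmf ..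
    finally show "distr Pr (count_space UNIV) (%\<omega>. (Z n \<omega>, Z (Suc n) \<omega>)) =
        measure_pmf (bind_pmf (law n) (%z. map_pmf (Pair z) (brood (code_pmf u) z)))" .
  qed (use gr in auto)
  define H where "H = max (h False) (h True)"
  have H: "h s \<le> H" "0 < H" for s using gr(3)[of True] by (cases s; simp add: H_def; linarith)+
  show ?thesis using converges subdominant[OF gr(5,2)] limit_positive
  proof eventually_elim
    case (elim \<omega>)
    let ?W = "lim (%n. sum_list (map h (Z n \<omega>)) / lam u ^ n)"
    have W: "(%n. sum_list (map h (Z n \<omega>)) / lam u ^ n) \<longlonglongrightarrow> ?W" using elim(1) by (simp add: convergent_LIMSEQ_iff)
    have len: "real (len (filter (%D. (half ^^ n) (fst D) = d) (C (M + n) \<omega>))) = sum_list (map (%s. if s then 2 else 1) (Z n \<omega>))" for n unfolding Z_def by (rule len_types)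
    have comb: "sum_list (map (%s. if s then 2 else 1) z) = \<alpha> * sum_list (map h z) + \<beta> * sum_list (map g z)" for z unfolding gr(6) by (induction z) (simp_all add: algebra_simps)
    have "(%n. \<alpha> * (sum_list (map h (Z n \<omega>)) / lam u ^ n) + \<beta> * (sum_list (map g (Z n \<omega>)) / lam u ^ n)) \<longlonglongrightarrow> \<alpha> * ?W + \<beta> * 0" by (intro tendsto_intros W elim(2))
    then have lim: "(%n. len (filter (%D. (half ^^ n) (fst D) = d) (C (M + n) \<omega>)) / lam u ^ n) \<longlonglongrightarrow> \<alpha> * ?W" unfolding len comb by (simp add: add_divide_distrib)
    \<comment> \<open>Bounding the \<open>h\<close>-sum by the number of steps shows that the limit
      \<alpha> \<open>?W\<close> is positive whenever \<open>?W\<close> is, without computing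
      \<alpha>.\<close>
    have "sum_list (map h z) \<le> H * sum_list (map (%s. if s then 2 else 1) z)" for z
    proof (induction z)
      case (Cons s z)
      have "h s \<le> H * (if s then 2 else 1)" using H(1)[of s] H(2) by (cases s) auto
      then show ?case using Cons by (simp add: distrib_left)
    qed simp
    then have "sum_list (map h (Z n \<omega>)) / lam u ^ n \<le> H * (len (filter (%D. (half ^^ n) (fst D) = d) (C (M + n) \<omega>)) / lam u ^ n)" for n unfolding len using gr(1) by (simp add: divide_right_mono)
    then have "?W \<le> H * (\<alpha> * ?W)" by (intro LIMSEQ_le[OF W tendsto_mult_left[OF lim]]) blast
    show ?case
    proof
      assume "types (%c. c = d) (C M \<omega>) ~= []"
      then have "0 < ?W" using elim(3) by (simp add: Z_def)
      then have "0 < H * (\<alpha> * ?W)" using \<open>?W \<le> H * (\<alpha> * ?W)\<close> by linarith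
      then have "0 < \<alpha> * ?W" using H(2) by (simp add: zero_less_mult_iff)
      then show "\<exists>l>0. (%n. len (filter (%D. (half ^^ n) (fst D) = d) (C (M + n) \<omega>)) / lam u ^ n) \<longlonglongrightarrow> l" using lim by blast
    qed
  qed
qed

lemma AE_Cauchy: "AE \<omega> in Pr. uniformly_Cauchy_on {0..} (%N t. scaled_walk u Y N t \<omega>)"
proof -
  have lam_pos: "0 < lam u" by (rule growth[OF total_mass u0]) linarith
  have "AE \<omega> in Pr. \<forall>M d. types (%c. c = d) (C M \<omega>) ~= [] -->
      (\<exists>l>0. (%n. len (filter (%D. (half ^^ n) (fst D) = d) (C (M + n) \<omega>)) / lam u ^ n) \<longlonglongrightarrow> l)" unfolding AE_all_countable using AE_growing by blast
  moreover have "AE \<omega> in Pr. \<forall>N. chain N (C N \<omega>) \<and> path_of N (C N \<omega>) = Y N \<omega>" unfolding AE_all_countable using AE_chain by blast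
  moreover have "AE \<omega> in Pr. \<forall>N. \<exists>bss. length bss = length (C N \<omega>) \<and> set bss \<subseteq> codes \<and> C (Suc N) \<omega> = refine_all (C N \<omega>) bss"
    unfolding AE_all_countable using AE_refine by blast
  ultimately show ?thesis using AE_root AE_space
  proof eventually_elim
    case (elim \<omega>)
    interpret lineage "%N. C N \<omega>" "lam u"
    proof
      fix k M assume k: "k < length (C M \<omega>)"
      have "C M \<omega> ! k \<in> set (C M \<omega>)" using k by simp
      then have "types (%c. c = fst (C M \<omega> ! k)) (C M \<omega>) ~= []" unfolding types_def by (auto simp: filter_empty_conv)
      then show "\<exists>l>0. (%n. len (filter (%D. (half ^^ n) (fst D) = fst (C M \<omega> ! k)) (C (M + n) \<omega>)) / lam u ^ n) \<longlonglongrightarrow> l" using elim(1) by blast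
    qed (use elim last_Y lam_pos in auto)
    show ?case using uniformly_Cauchy elim(2) by (simp add: scaled_walk_def)
  qed
qed

end

section \<open>Continuity of the paths and the limit process\<close>

lemma interpolate_sum:
  assumes w: "w ~= []" "last w = pt_a" and t: "0 \<le> t"
  shows "interpolate w t = w ! 0 + (\<Sum>i<steps w. max 0 (min 1 (t - real i)) *\<^sub>R (w ! Suc i - w ! i))"
proof -
  let ?f = "%i. max 0 (min 1 (t - real i)) *\<^sub>R (w ! Suc i - w ! i)"
  show ?thesis
  proof (cases "t < steps w")
    case True
    define i where "i = nat \<lfloor>t\<rfloor>"
    have i: "real i \<le> t" "t < real i + 1" using t unfolding i_def by linarith+
    then have less: "i < steps w" using True by linarith
    have "sum ?f {..<steps w} = sum ?f {..<Suc i} + sum ?f {Suc i..<steps w}" unfolding lessThan_atLeast0 by (rule sum.atLeastLessThan_concat[symmetric]) (use less in auto)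
    also have "sum ?f {Suc i..<steps w} = 0" by (rule sum.neutral) (use i in auto)
    also have "sum ?f {..<Suc i} = sum ?f {..<i} + ?f i" by simp
    also have "sum ?f {..<i} = (\<Sum>k<i. w ! Suc k - w ! k)" by (rule sum.cong) (use i in auto)
    also have "... = w ! i - w ! 0" by (rule sum_lessThan_telescope)
    finally show ?thesis using True i by (simp add: interpolate_def i_def[symmetric] Let_def)
  next
    case False
    then have "sum ?f {..<steps w} = (\<Sum>k<steps w. w ! Suc k - w ! k)" by (intro sum.cong) auto
    also have "... = w ! steps w - w ! 0" by (rule sum_lessThan_telescope)
    also have "w ! steps w = pt_a" using w by (simp add: steps_def last_conv_nth)
    finally show ?thesis using False by (simp add: interpolate_def)
  qed
qed

text \<open>The representation as a sum of clamped ramps, one for each step, holds also after the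
  end of the path and avoids gluing at integer times.\<close>

lemma continuous_interpolate:
  assumes "w ~= []" "last w = pt_a"
  shows "continuous_on {0..} (interpolate w)"
proof -
  have "continuous_on {0..} (%t. w ! 0 + (\<Sum>i<steps w. max 0 (min 1 (t - real i)) *\<^sub>R (w ! Suc i - w ! i)))" by (intro continuous_intros)
  then show ?thesis by (rule continuous_on_cong[THEN iffD1, rotated 2]) (simp_all add: interpolate_sum[OF assms])
qed

theorem theorem7:
  fixes u :: real and Pr :: "'w measure" and Y :: "nat \<Rightarrow> 'w \<Rightarrow> path"
  assumes "0 \<le> u" and "u \<le> 1"
    and "loop_erased_walks u Pr Y"
  shows "\<exists>X. continuous_process Pr X \<and>
           (AE \<omega> in Pr. uniform_limit {0..} (\<lambda>N t. scaled_walk u Y N t \<omega>) (\<lambda>t. X t \<omega>) sequentially)"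
proof -
  interpret erased_walks u Pr Y by unfold_locales (rule assms)+
  have lam0: "0 \<le> lam u" by (rule growth[OF total_mass u0]) linarith
  obtain B where B: "{\<omega> \<in> space Pr. \<not> uniformly_Cauchy_on {0..} (%N t. scaled_walk u Y N t \<omega>)} \<subseteq> B" "emeasure Pr B = 0" "B \<in> sets Pr" using AE_Cauchy by (rule AE_E)
  \<comment> \<open>Set to 0 on a null set containing the exceptional outcomes, so that the limit
    exists and is continuous for every outcome, as \<open>continuous_process\<close>
    demands.\<close>
  define f where "f = (%N t \<omega>. if \<omega> \<in> B then 0 else scaled_walk u Y N t \<omega>)"
  define X where "X = (%t \<omega>. lim (%N. f N t \<omega>))"
  have "f N t \<in> borel_measurable Pr" for N t
  proof -
    have "scaled_walk u Y N t \<in> borel_measurable Pr" unfolding scaled_walk_def by (rule measurable_compose[OF Y_measurable, of "%w. interpolate w (lam u ^ N * t)"]) simp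
    then show ?thesis unfolding f_def using B(3) sets.Int_space_eq2[OF B(3)] by (intro measurable_If_set) auto
  qed
  then have Xm: "X t \<in> borel_measurable Pr" for t unfolding X_def by (rule borel_measurable_lim_metric)
  have lim: "uniform_limit {0..} (%N t. f N t \<omega>) (%t. X t \<omega>) sequentially" if "\<omega> \<in> space Pr" for \<omega>
  proof -
    have "uniformly_Cauchy_on {0..} (%N t. f N t \<omega>)"
    proof (cases "\<omega> \<in> B")
      case True
      then show ?thesis by (intro uniformly_Cauchy_onI) (simp add: f_def)
    next
      case False
      then show ?thesis using B(1) that by (auto simp: f_def)
    qed
    then have "uniformly_convergent_on {0..} (%N t. f N t \<omega>)" by (rule Cauchy_uniformly_convergent)
    then show ?thesis unfolding X_def by (simp add: uniformly_convergent_uniform_limit_iff)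
  qed
  have cont: "continuous_on {0..} (%t. X t \<omega>)" if \<omega>: "\<omega> \<in> space Pr" for \<omega>
  proof (rule uniform_limit_theorem[OF _ lim[OF \<omega>]])
    have "continuous_on {0..} (%t. interpolate (Y N \<omega>) (lam u ^ N * t))" for N by (rule continuous_on_compose2[OF continuous_interpolate]) (use last_Y[OF \<omega>] lam0 in \<open>auto intro!: continuous_intros\<close>)
    then have "continuous_on {0..} (%t. f N t \<omega>)" for N by (cases "\<omega> \<in> B") (simp_all add: f_def scaled_walk_def)
    then show "\<forall>\<^sub>F N in sequentially. continuous_on {0..} (%t. f N t \<omega>)" by simp
  qed simp
  have "AE \<omega> in Pr. \<omega> \<notin> B" using B(2,3) by (intro AE_not_in) auto
  then have "AE \<omega> in Pr. uniform_limit {0..} (%N t. scaled_walk u Y N t \<omega>) (%t. X t \<omega>) sequentially" using AE_space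
  proof eventually_elim
    case (elim \<omega>)
    then show ?case using lim[OF elim(2)] by (simp add: f_def)
  qed
  then show ?thesis using Xm cont unfolding continuous_process_def by blast
qed

end
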